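(* Let $f$ and $\phi$ satisfy the standing assumptions in the context, with associated measures $\nu$ and $\mu$. Then there exists $\theta>0$ such that $\mathcal L_\phi$ is quasi-compact and has a spectral gap in the space $V_\theta$. Moreover, $\mu$ has exponential decay of correlations in $V_\theta$: there exist $C>0$ and $\xi\in(0,1)$ such that for every $n\ge 1$, every $\Phi\in V_\theta$ and every $\Psi\in L^1(\nu)$, $$\Big|\int \Phi\,(\Psi\circ f^n)\,d\mu-\int\Phi\,d\mu\int\Psi\,d\mu\Big|\le C\,\xi^n\,\|\Phi\|_\theta\,\|\Psi\|_{L^1(\nu)},$$ and the density $d\mu/d\nu$ belongs to $V_\theta$.
   Context: Setting. $M$ is a compact Riemannian manifold, $m=\dim M$, $f:M\to M$ is a $C^1$ local diffeomorphism, every point of $M$ has the same number $\deg(f)$ of preimages, and $\phi:M\to\mathbb R$ is $\alpha$-Hölder continuous. Standing assumptions: (A1) There are $p\ge 1$, $q\ge 0$ and a family $\mathcal Q=\{Q_1,\dots,Q_q,Q_{q+1},\dots,Q_{q+p}\}$ of pairwise disjoint open sets whose closures cover $M$ and have finite inner diameter (any two points of the closure can be joined by a curve inside it of length less than some constant), such that: every $f|_{\bar Q_i}$ is a homeomorphism onto its image; if $f(Q_i)\cap Q_j\ne\emptyset$ then $f(Q_i)\supset Q_j$ (hence $f(\bar Q_i)\supset\bar Q_j$); there is $N\ge1$ with $f^N(Q_i)=M$ for every $i$. (A2) There are $\sigma>1$ and $L>1$ such that $\|Df(x)^{-1}\|\le\sigma^{-1}$ for $x\in Q_{q+1}\cup\dots\cup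 Q_{q+p}$ and $\|Df(x)^{-1}\|\le L$ for $x\in Q_1\cup\dots\cup Q_q$. (A3) $\sup\phi-\inf\phi<\log\deg(f)-\log q$ (convention $\log 0=-\infty$). (A4) $\sup\phi-\inf\phi<\tfrac12(c\tau-\log L)\alpha$, with $c,\tau$ as below. Constants. Fix $\varepsilon_0>0$ with $\sup\phi-\inf\phi<\log\deg(f)-\log q-\varepsilon_0$. For $n\ge1$, $\mathcal Q^{(n)}=\bigvee_{j=0}^{n-1}f^{-j}\mathcal Q$ denotes the family of $n$-cylinders (nonempty intersections $\bigcap_{j=0}^{n-1}f^{-j}(Q_{i_j})$). For $\gamma\in(0,1)$ let $B(n)=B(n,\gamma)$ be the set of $Q_n\in\mathcal Q^{(n)}$ with $\#\{0\le j\le n-1: f^j(Q_n)\subset Q_1\cup\dots\cup Q_q\}>\gamma n$. Here $\gamma\in(0,1)$ is fixed such that $\#B(n)\le \exp((\log q+\varepsilon_0)n)$ for all large $n$ and the $\nu$-measure of the union of $B(n)$ decays exponentially in $n$ ($\nu$ below). The constant $c>0$ satisfies $\sigma^{-(1-\gamma)}<e^{-2c}<1$ and $\log q+c\alpha+\varepsilon_0<\log\deg(f)$, and $L$ is close enough to $1$ that $(\log L)^2\le 2c^2$, $\sigma^{-(1-\gamma)}L^\gamma<e^{-2c}<1$ and $\sup\phi-\inf\phi<\log\deg(f)-\log q-m\log L$. An integer $n$ is a hyperbolic time for $x$ if $\prod_{j=n-k}^{n-1}\|Df(f^j(x))^{-1}\|<e^{-ck}$ for all $1\le k\le n$; $Q_n\in\mathcal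 Q^{(n)}$ is a hyperbolic cylinder if $n$ is a hyperbolic time for every point of $Q_n$. The constant $\tau\in(0,1)$ is such that for all $n\ge1$ and all $x$ not in the union of $B(n)$ there are $l>\tau n$ and integers $1\le n_1<\dots<n_l\le n$ such that $x$ lies in the closure of a hyperbolic cylinder of order $n_i$ for each $i$. Operator and measures. $\mathcal L_\phi g(x)=\sum_{f(y)=x}e^{\phi(y)}g(y)$. By a theorem of Oliveira and Viana there is a probability measure $\nu$ with $\mathcal L_\phi^*\nu=\lambda\nu$, where $\lambda$ is the spectral radius of $\mathcal L_\phi$ on $C(M)$, which is expanding ($\nu$-a.e. point lies in the closures of infinitely many hyperbolic cylinders), and there is a unique equilibrium state $\mu$ of $f$ for $\phi$ (invariant probability maximizing $h_\eta(f)+\int\phi\,d\eta$), with $\mu\ll\nu$. These $\nu,\mu$ are fixed. Spaces. $S_n\phi=\sum_{j=0}^{n-1}\phi\circ f^j$; for a set $E$, $S_n\phi(E)=\sup_{x\in E}S_n\phi(x)$. For $g\in L^\infty(\nu)$, $\overline{\mathrm{osc}}(g,E)$ is the $\nu$-essential supremum of $|g(x)-g(y)|$ over $x,y\in E$. For $\theta>0$, $\mathrm{var}_\theta(g)=\sum_{n\ge1}\theta^n\sum_{Q_n\in\mathcal Q^{(n)}}e^{S_n\phi(Q_n)}\,\overline{\mathrm{osc}}(g,Q_n)$, $\|g\|_\theta=\|g\|_\infty+\mathrm{var}_\theta(g)$, and $V_\theta=\{g\in L^\infty(\nu):\|g\|_\theta<\infty\}$, a Banach space. A bounded operator $T$ on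 a Banach space $B$ is quasi-compact if there is a $T$-invariant decomposition $B=B_0\oplus B_1$ with $B_0$ finite dimensional, the spectrum of $T|_{B_0}$ consisting of finitely many eigenvalues of absolute value $r(T)$ (the spectral radius), and $r(T|_{B_1})<r(T)$; it has a spectral gap if moreover $\dim B_0=1$. *)

theory Defs
  imports "HOL-Probability.Probability"
begin

section \<open>Riemannian manifolds\<close>

text \<open>
  The manifold is the whole type \<open>'a\<close>, modelled on the Euclidean space \<open>'e\<close> and without boundary.
  A chart is a pair \<open>(U, u)\<close> of a domain and a coordinate map. A Riemannian metric is given in
  coordinates: \<open>R c x v w\<close> is the inner product at the point \<open>x\<close> of the tangent vectors that have
  the coordinates \<open>v\<close>, \<open>w\<close> in the chart \<open>c\<close>.
\<close>

type_synonym ('a, 'e) chart = "'a set \<times> ('a \<Rightarrow> 'e)"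
type_synonym ('a, 'e) metric_tensor = "('a, 'e) chart \<Rightarrow> 'a \<Rightarrow> 'e \<Rightarrow> 'e \<Rightarrow> real"

abbreviation chart_inv :: "('a, 'e) chart \<Rightarrow> 'e \<Rightarrow> 'a" where
  "chart_inv c \<equiv> inv_into (fst c) (snd c)"

text \<open>\<open>k\<close> times continuously differentiable; only meant for open \<open>S\<close>.\<close>

primrec Ck_on :: "nat \<Rightarrow> 'e::euclidean_space set \<Rightarrow> ('e \<Rightarrow> 'b::real_normed_vector) \<Rightarrow> bool" where
  "Ck_on 0 S h \<longleftrightarrow> continuous_on S h"
| "Ck_on (Suc k) S h \<longleftrightarrow> (\<forall>x\<in>S. h differentiable (at x)) \<and>
     (\<forall>v. Ck_on k S (\<lambda>x. frechet_derivative h (at x) v))"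

definition smooth_atlas :: "('a::topological_space, 'e::euclidean_space) chart set \<Rightarrow> bool" where
  "smooth_atlas A \<longleftrightarrow>
     (\<Union>c\<in>A. fst c) = UNIV \<and>
     (\<forall>c\<in>A. open (fst c) \<and> open (snd c ` fst c) \<and>
        homeomorphism (fst c) (snd c ` fst c) (snd c) (chart_inv c)) \<and>
     (\<forall>c\<in>A. \<forall>d\<in>A. \<forall>k. Ck_on k (snd c ` (fst c \<inter> fst d)) (snd d \<circ> chart_inv c))"

definition riemannian_metric ::
    "('a::topological_space, 'e::euclidean_space) chart set \<Rightarrow> ('a, 'e) metric_tensor \<Rightarrow> bool" where
  "riemannian_metric A R \<longleftrightarrow>
     (\<forall>c\<in>A. \<forall>x\<in>fst c. bilinear (R c x) \<and> (\<forall>v w. R c x v w = R c x w v) \<and>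
        (\<forall>v. v \<noteq> 0 \<longrightarrow> R c x v v > 0)) \<and>
     (\<forall>c\<in>A. \<forall>v w k. Ck_on k (snd c ` fst c) (\<lambda>z. R c (chart_inv c z) v w)) \<and>
     (\<forall>c\<in>A. \<forall>d\<in>A. \<forall>x\<in>fst c \<inter> fst d. \<forall>v w.
        R c x v w = R d x (frechet_derivative (snd d \<circ> chart_inv c) (at (snd c x)) v)
                          (frechet_derivative (snd d \<circ> chart_inv c) (at (snd c x)) w))"

text \<open>
  The tangent space at \<open>x\<close> is identified with \<open>'e\<close> by means of the chosen chart \<open>chart_at A x\<close>.
  By the compatibility of \<open>R\<close> with coordinate changes the lengths and operator norms below do not
  depend on this choice.
\<close>

definition chart_at :: "('a, 'e) chart set \<Rightarrow> 'a \<Rightarrow> ('a, 'e) chart" where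
  "chart_at A x = (SOME c. c \<in> A \<and> x \<in> fst c)"

definition tnorm :: "('a, 'e) chart set \<Rightarrow> ('a, 'e) metric_tensor \<Rightarrow> 'a \<Rightarrow> 'e \<Rightarrow> real" where
  "tnorm A R x v = sqrt (R (chart_at A x) x v v)"

definition pw_C1_curve ::
    "('a::topological_space, 'e::euclidean_space) chart set \<Rightarrow> (real \<Rightarrow> 'a) \<Rightarrow> bool" where
  "pw_C1_curve A \<gamma> \<longleftrightarrow> path \<gamma> \<and>
     (\<forall>c\<in>A. (snd c \<circ> \<gamma>) piecewise_C1_differentiable_on {t \<in> {0..1}. \<gamma> t \<in> fst c})"

definition curve_length ::
    "('a, 'e::euclidean_space) chart set \<Rightarrow> ('a, 'e) metric_tensor \<Rightarrow> (real \<Rightarrow> 'a) \<Rightarrow> ennreal" where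
  "curve_length A R \<gamma> = (\<integral>\<^sup>+ t\<in>{0..1}.
     ennreal (tnorm A R (\<gamma> t) (vector_derivative (snd (chart_at A (\<gamma> t)) \<circ> \<gamma>) (at t))) \<partial>lborel)"

definition riem_dist ::
    "('a::topological_space, 'e::euclidean_space) chart set \<Rightarrow> ('a, 'e) metric_tensor \<Rightarrow> 'a \<Rightarrow> 'a \<Rightarrow> ennreal" where
  "riem_dist A R x y =
     (INF \<gamma>\<in>{\<gamma>. pw_C1_curve A \<gamma> \<and> pathstart \<gamma> = x \<and> pathfinish \<gamma> = y}. curve_length A R \<gamma>)"

text \<open>
  The distance of the type is the Riemannian distance. This makes the manifold connected (any two
  points are at finite distance) and entails no other restriction, because the Riemannian distance
  of a connected manifold induces its topology.
\<close>

definition riemannian_manifold ::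
    "('a::metric_space, 'e::euclidean_space) chart set \<Rightarrow> ('a, 'e) metric_tensor \<Rightarrow> bool" where
  "riemannian_manifold A R \<longleftrightarrow> smooth_atlas A \<and> riemannian_metric A R \<and>
     (\<forall>x y. riem_dist A R x y = ennreal (dist x y))"

definition C1_map_on ::
    "('a::topological_space, 'e::euclidean_space) chart set \<Rightarrow> 'a set \<Rightarrow> ('a \<Rightarrow> 'a) \<Rightarrow> bool" where
  "C1_map_on A U h \<longleftrightarrow> continuous_on U h \<and>
     (\<forall>c\<in>A. \<forall>d\<in>A. Ck_on 1 (snd c ` (U \<inter> fst c \<inter> h -` fst d)) (snd d \<circ> h \<circ> chart_inv c))"

definition C1_local_diffeo ::
    "('a::topological_space, 'e::euclidean_space) chart set \<Rightarrow> ('a \<Rightarrow> 'a) \<Rightarrow> bool" where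
  "C1_local_diffeo A f \<longleftrightarrow> (\<forall>x. \<exists>U g. open U \<and> x \<in> U \<and> open (f ` U) \<and>
     C1_map_on A U f \<and> C1_map_on A (f ` U) g \<and> (\<forall>y\<in>U. g (f y) = y))"

definition tangent_map ::
    "('a, 'e::euclidean_space) chart set \<Rightarrow> ('a \<Rightarrow> 'a) \<Rightarrow> 'a \<Rightarrow> 'e \<Rightarrow> 'e" where
  "tangent_map A f x =
     frechet_derivative (snd (chart_at A (f x)) \<circ> f \<circ> chart_inv (chart_at A x)) (at (snd (chart_at A x) x))"

definition inv_deriv_norm ::
    "('a, 'e::euclidean_space) chart set \<Rightarrow> ('a, 'e) metric_tensor \<Rightarrow> ('a \<Rightarrow> 'a) \<Rightarrow> 'a \<Rightarrow> real" where
  "inv_deriv_norm A R f x =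
     (SUP w\<in>{w. tnorm A R (f x) w = 1}. tnorm A R x (inv (tangent_map A f x) w))"

definition holder_continuous :: "real \<Rightarrow> ('a::metric_space \<Rightarrow> real) \<Rightarrow> bool" where
  "holder_continuous \<alpha> \<phi> \<longleftrightarrow> (\<exists>K. \<forall>x y. \<bar>\<phi> x - \<phi> y\<bar> \<le> K * dist x y powr \<alpha>)"

section \<open>Cylinders and hyperbolic times\<close>

definition cylinders :: "('a \<Rightarrow> 'a) \<Rightarrow> 'a set set \<Rightarrow> nat \<Rightarrow> 'a set set" where
  "cylinders f P n = {C. C \<noteq> {} \<and> (\<exists>D. (\<forall>j<n. D j \<in> P) \<and> C = (\<Inter>j<n. (f ^^ j) -` D j))}"

definition frequent_cylinders ::
    "('a \<Rightarrow> 'a) \<Rightarrow> 'a set set \<Rightarrow> 'a set \<Rightarrow> real \<Rightarrow> nat \<Rightarrow> 'a set set" where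
  "frequent_cylinders f P W \<gamma> n =
     {C \<in> cylinders f P n. real (card {j. j < n \<and> (f ^^ j) ` C \<subseteq> W}) > \<gamma> * real n}"

text \<open>Index \<open>i\<close> runs over \<open>{1..q + p}\<close>; the first \<open>q\<close> sets are those without uniform expansion.\<close>

definition markov_family ::
    "('a::metric_space, 'e::euclidean_space) chart set \<Rightarrow> ('a, 'e) metric_tensor \<Rightarrow> ('a \<Rightarrow> 'a) \<Rightarrow>
     nat \<Rightarrow> nat \<Rightarrow> (nat \<Rightarrow> 'a set) \<Rightarrow> bool" where
  "markov_family A R f p q Q \<longleftrightarrow> p \<ge> 1 \<and>
     (\<forall>i\<in>{1..q+p}. open (Q i)) \<and>
     disjoint_family_on Q {1..q+p} \<and>
     (\<Union>i\<in>{1..q+p}. closure (Q i)) = UNIV \<and>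
     (\<exists>D::real. \<forall>i\<in>{1..q+p}. \<forall>x\<in>closure (Q i). \<forall>y\<in>closure (Q i). \<exists>\<gamma>.
        pw_C1_curve A \<gamma> \<and> path_image \<gamma> \<subseteq> closure (Q i) \<and> pathstart \<gamma> = x \<and> pathfinish \<gamma> = y \<and>
        curve_length A R \<gamma> < ennreal D) \<and>
     (\<forall>i\<in>{1..q+p}. \<exists>g. homeomorphism (closure (Q i)) (f ` closure (Q i)) f g) \<and>
     (\<forall>i\<in>{1..q+p}. \<forall>j\<in>{1..q+p}. f ` Q i \<inter> Q j \<noteq> {} \<longrightarrow> Q j \<subseteq> f ` Q i) \<and>
     (\<exists>N\<ge>1. \<forall>i\<in>{1..q+p}. (f ^^ N) ` Q i = UNIV)"

definition hyperbolic_time ::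
    "('a, 'e::euclidean_space) chart set \<Rightarrow> ('a, 'e) metric_tensor \<Rightarrow> ('a \<Rightarrow> 'a) \<Rightarrow> real \<Rightarrow> nat \<Rightarrow> 'a \<Rightarrow> bool" where
  "hyperbolic_time A R f c n x \<longleftrightarrow>
     (\<forall>k\<in>{1..n}. (\<Prod>j=n-k..<n. inv_deriv_norm A R f ((f ^^ j) x)) < exp (- c * real k))"

definition hyperbolic_cylinders ::
    "('a, 'e::euclidean_space) chart set \<Rightarrow> ('a, 'e) metric_tensor \<Rightarrow> ('a \<Rightarrow> 'a) \<Rightarrow> 'a set set \<Rightarrow>
     real \<Rightarrow> nat \<Rightarrow> 'a set set" where
  "hyperbolic_cylinders A R f P c n =
     {C \<in> cylinders f P n. \<forall>x\<in>C. hyperbolic_time A R f c n x}"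

definition expanding_measure ::
    "('a::metric_space, 'e::euclidean_space) chart set \<Rightarrow> ('a, 'e) metric_tensor \<Rightarrow> ('a \<Rightarrow> 'a) \<Rightarrow>
     'a set set \<Rightarrow> real \<Rightarrow> 'a measure \<Rightarrow> bool" where
  "expanding_measure A R f P c \<nu> \<longleftrightarrow>
     (AE x in \<nu>. infinite {(n, C). n \<ge> 1 \<and> C \<in> hyperbolic_cylinders A R f P c n \<and> x \<in> closure C})"

section \<open>Entropy and equilibrium states\<close>

text \<open>The logarithm of a natural number, with the convention \<open>log 0 = -\<infinity>\<close>.\<close>

definition log_nat :: "nat \<Rightarrow> ereal" where
  "log_nat n = (if n = 0 then - \<infinity> else ereal (ln (real n)))"

definition invariant_prob :: "('a::topological_space \<Rightarrow> 'a) \<Rightarrow> 'a measure \<Rightarrow> bool" where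
  "invariant_prob f \<eta> \<longleftrightarrow> prob_space \<eta> \<and> sets \<eta> = sets borel \<and> distr \<eta> borel f = \<eta>"

definition partition_entropy :: "'a measure \<Rightarrow> 'a set set \<Rightarrow> real" where
  "partition_entropy \<eta> P = - (\<Sum>C\<in>P. measure \<eta> C * ln (measure \<eta> C))"

definition measure_entropy :: "('a::topological_space \<Rightarrow> 'a) \<Rightarrow> 'a measure \<Rightarrow> ereal" where
  "measure_entropy f \<eta> =
     (SUP P\<in>{P. finite P \<and> P \<subseteq> sets borel \<and> disjoint P \<and> \<Union>P = UNIV}.
        ereal (lim (\<lambda>n. partition_entropy \<eta> (cylinders f P n) / real n)))"

definition equilibrium_state ::
    "('a::topological_space \<Rightarrow> 'a) \<Rightarrow> ('a \<Rightarrow> real) \<Rightarrow> 'a measure \<Rightarrow> bool" where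
  "equilibrium_state f \<phi> \<mu> \<longleftrightarrow> invariant_prob f \<mu> \<and>
     (\<forall>\<eta>. invariant_prob f \<eta> \<longrightarrow>
        measure_entropy f \<eta> + ereal (\<integral>x. \<phi> x \<partial>\<eta>) \<le> measure_entropy f \<mu> + ereal (\<integral>x. \<phi> x \<partial>\<mu>))"

section \<open>Operators on seminormed spaces of functions\<close>

text \<open>
  A complex Banach space such as \<open>L\<^sup>\<infinity>(\<nu>)\<close> is represented by a complex vector space \<open>V\<close> of functions
  with a seminorm \<open>N\<close>: its elements are the functions in \<open>V\<close>, and \<open>g\<close>, \<open>h\<close> denote the same element
  iff \<open>N (g - h) = 0\<close>. All notions below are those of the quotient space; in particular linearity
  and inverses are understood up to functions of seminorm zero.
\<close>

definition complete_seminormed :: "('a \<Rightarrow> complex) set \<Rightarrow> (('a \<Rightarrow> complex) \<Rightarrow> real) \<Rightarrow> bool" where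
  "complete_seminormed V N \<longleftrightarrow>
     (\<forall>g::nat \<Rightarrow> 'a \<Rightarrow> complex. (\<forall>i. g i \<in> V) \<and>
        (\<forall>e>0. \<exists>M. \<forall>i\<ge>M. \<forall>j\<ge>M. N (\<lambda>x. g i x - g j x) < e) \<longrightarrow>
        (\<exists>h\<in>V. (\<lambda>i. N (\<lambda>x. g i x - h x)) \<longlonglongrightarrow> 0))"

definition bounded_operator ::
    "('a \<Rightarrow> complex) set \<Rightarrow> (('a \<Rightarrow> complex) \<Rightarrow> real) \<Rightarrow> (('a \<Rightarrow> complex) \<Rightarrow> ('a \<Rightarrow> complex)) \<Rightarrow> bool" where
  "bounded_operator V N T \<longleftrightarrow>
     (\<forall>g\<in>V. T g \<in> V) \<and>
     (\<forall>g\<in>V. \<forall>h\<in>V. \<forall>a b.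
        N (\<lambda>x. T (\<lambda>y. a * g y + b * h y) x - (a * T g x + b * T h x)) = 0) \<and>
     (\<exists>K. \<forall>g\<in>V. N (T g) \<le> K * N g)"

definition op_spectrum ::
    "('a \<Rightarrow> complex) set \<Rightarrow> (('a \<Rightarrow> complex) \<Rightarrow> real) \<Rightarrow> (('a \<Rightarrow> complex) \<Rightarrow> ('a \<Rightarrow> complex)) \<Rightarrow> complex set" where
  "op_spectrum V N T = {z. \<not> (\<exists>S. bounded_operator V N S \<and>
     (\<forall>g\<in>V. N (\<lambda>x. S (\<lambda>y. T g y - z * g y) x - g x) = 0 \<and>
             N (\<lambda>x. (T (S g) x - z * S g x) - g x) = 0))}"

definition op_eigenvalue ::
    "('a \<Rightarrow> complex) set \<Rightarrow> (('a \<Rightarrow> complex) \<Rightarrow> real) \<Rightarrow> (('a \<Rightarrow> complex) \<Rightarrow> ('a \<Rightarrow> complex)) \<Rightarrow> complex \<Rightarrow> bool" where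
  "op_eigenvalue V N T z \<longleftrightarrow> (\<exists>g\<in>V. N g \<noteq> 0 \<and> N (\<lambda>x. T g x - z * g x) = 0)"

text \<open>The spectrum is empty only on the zero space, whose spectral radius is \<open>0\<close>.\<close>

definition op_spectral_radius ::
    "('a \<Rightarrow> complex) set \<Rightarrow> (('a \<Rightarrow> complex) \<Rightarrow> real) \<Rightarrow> (('a \<Rightarrow> complex) \<Rightarrow> ('a \<Rightarrow> complex)) \<Rightarrow> real" where
  "op_spectral_radius V N T = Sup (insert 0 (cmod ` op_spectrum V N T))"

definition closed_subspace ::
    "('a \<Rightarrow> complex) set \<Rightarrow> (('a \<Rightarrow> complex) \<Rightarrow> real) \<Rightarrow> ('a \<Rightarrow> complex) set \<Rightarrow> bool" where
  "closed_subspace V N W \<longleftrightarrow> W \<subseteq> V \<and> (\<lambda>_. 0) \<in> W \<and>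
     (\<forall>g\<in>W. \<forall>h\<in>W. \<forall>a b. (\<lambda>x. a * g x + b * h x) \<in> W) \<and>
     (\<forall>g\<in>V. (\<forall>e>0. \<exists>h\<in>W. N (\<lambda>x. g x - h x) < e) \<longrightarrow> g \<in> W)"

definition has_dimension ::
    "('a \<Rightarrow> complex) set \<Rightarrow> (('a \<Rightarrow> complex) \<Rightarrow> real) \<Rightarrow> nat \<Rightarrow> bool" where
  "has_dimension W N n \<longleftrightarrow> (\<exists>b::nat \<Rightarrow> 'a \<Rightarrow> complex.
     (\<forall>i<n. b i \<in> W) \<and>
     (\<forall>g\<in>W. \<exists>a. N (\<lambda>x. g x - (\<Sum>i<n. a i * b i x)) = 0) \<and>
     (\<forall>a. N (\<lambda>x. \<Sum>i<n. a i * b i x) = 0 \<longrightarrow> (\<forall>i<n. a i = 0)))"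

definition quasi_compact_decomposition ::
    "('a \<Rightarrow> complex) set \<Rightarrow> (('a \<Rightarrow> complex) \<Rightarrow> real) \<Rightarrow> (('a \<Rightarrow> complex) \<Rightarrow> ('a \<Rightarrow> complex)) \<Rightarrow>
     ('a \<Rightarrow> complex) set \<Rightarrow> ('a \<Rightarrow> complex) set \<Rightarrow> bool" where
  "quasi_compact_decomposition V N T B0 B1 \<longleftrightarrow>
     closed_subspace V N B0 \<and> closed_subspace V N B1 \<and>
     (\<forall>g\<in>V. \<exists>g0\<in>B0. \<exists>g1\<in>B1. N (\<lambda>x. g x - (g0 x + g1 x)) = 0) \<and>
     (\<forall>g\<in>B0 \<inter> B1. N g = 0) \<and>
     T ` B0 \<subseteq> B0 \<and> T ` B1 \<subseteq> B1 \<and>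
     (\<exists>n. has_dimension B0 N n) \<and>
     finite (op_spectrum B0 N T) \<and>
     (\<forall>z\<in>op_spectrum B0 N T. op_eigenvalue B0 N T z \<and> cmod z = op_spectral_radius V N T) \<and>
     op_spectral_radius B1 N T < op_spectral_radius V N T"

definition quasi_compact ::
    "('a \<Rightarrow> complex) set \<Rightarrow> (('a \<Rightarrow> complex) \<Rightarrow> real) \<Rightarrow> (('a \<Rightarrow> complex) \<Rightarrow> ('a \<Rightarrow> complex)) \<Rightarrow> bool" where
  "quasi_compact V N T \<longleftrightarrow> complete_seminormed V N \<and> bounded_operator V N T \<and>
     (\<exists>B0 B1. quasi_compact_decomposition V N T B0 B1)"

definition has_spectral_gap ::
    "('a \<Rightarrow> complex) set \<Rightarrow> (('a \<Rightarrow> complex) \<Rightarrow> real) \<Rightarrow> (('a \<Rightarrow> complex) \<Rightarrow> ('a \<Rightarrow> complex)) \<Rightarrow> bool" where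
  "has_spectral_gap V N T \<longleftrightarrow> complete_seminormed V N \<and> bounded_operator V N T \<and>
     (\<exists>B0 B1. quasi_compact_decomposition V N T B0 B1 \<and> has_dimension B0 N 1)"

section \<open>The transfer operator and the spaces of functions of bounded variation\<close>

definition transfer_op ::
    "('a \<Rightarrow> 'a) \<Rightarrow> ('a \<Rightarrow> real) \<Rightarrow> ('a \<Rightarrow> complex) \<Rightarrow> 'a \<Rightarrow> complex" where
  "transfer_op f \<phi> g x = (\<Sum>y\<in>f -` {x}. complex_of_real (exp (\<phi> y)) * g y)"

definition continuous_functions :: "('a::topological_space \<Rightarrow> complex) set" where
  "continuous_functions = {g. continuous_on UNIV g}"

definition sup_norm :: "('a \<Rightarrow> complex) \<Rightarrow> real" where
  "sup_norm g = (SUP x. cmod (g x))"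

definition conformal_measure ::
    "('a::topological_space \<Rightarrow> 'a) \<Rightarrow> ('a \<Rightarrow> real) \<Rightarrow> real \<Rightarrow> 'a measure \<Rightarrow> bool" where
  "conformal_measure f \<phi> lam \<nu> \<longleftrightarrow> prob_space \<nu> \<and> sets \<nu> = sets borel \<and>
     (\<forall>g\<in>continuous_functions. (\<integral>x. transfer_op f \<phi> g x \<partial>\<nu>) = complex_of_real lam * (\<integral>x. g x \<partial>\<nu>))"

definition birkhoff_sum :: "('a \<Rightarrow> 'a) \<Rightarrow> ('a \<Rightarrow> real) \<Rightarrow> nat \<Rightarrow> 'a \<Rightarrow> real" where
  "birkhoff_sum f \<phi> n x = (\<Sum>j<n. \<phi> ((f ^^ j) x))"

definition ess_osc :: "'a measure \<Rightarrow> ('a \<Rightarrow> complex) \<Rightarrow> 'a set \<Rightarrow> ennreal" where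
  "ess_osc \<nu> g E = esssup (restrict_space (\<nu> \<Otimes>\<^sub>M \<nu>) (E \<times> E)) (\<lambda>(x, y). ennreal (cmod (g x - g y)))"

definition var_theta ::
    "('a \<Rightarrow> 'a) \<Rightarrow> ('a \<Rightarrow> real) \<Rightarrow> 'a set set \<Rightarrow> 'a measure \<Rightarrow> real \<Rightarrow> ('a \<Rightarrow> complex) \<Rightarrow> ennreal" where
  "var_theta f \<phi> P \<nu> \<theta> g = (\<Sum>k. let n = Suc k in
     ennreal (\<theta> ^ n) *
     (\<Sum>C\<in>cylinders f P n. ennreal (exp (SUP x\<in>C. birkhoff_sum f \<phi> n x)) * ess_osc \<nu> g C))"

definition enorm_theta ::
    "('a \<Rightarrow> 'a) \<Rightarrow> ('a \<Rightarrow> real) \<Rightarrow> 'a set set \<Rightarrow> 'a measure \<Rightarrow> real \<Rightarrow> ('a \<Rightarrow> complex) \<Rightarrow> ennreal" where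
  "enorm_theta f \<phi> P \<nu> \<theta> g = esssup \<nu> (\<lambda>x. ennreal (cmod (g x))) + var_theta f \<phi> P \<nu> \<theta> g"

definition norm_theta ::
    "('a \<Rightarrow> 'a) \<Rightarrow> ('a \<Rightarrow> real) \<Rightarrow> 'a set set \<Rightarrow> 'a measure \<Rightarrow> real \<Rightarrow> ('a \<Rightarrow> complex) \<Rightarrow> real" where
  "norm_theta f \<phi> P \<nu> \<theta> g = enn2real (enorm_theta f \<phi> P \<nu> \<theta> g)"

definition V_theta ::
    "('a \<Rightarrow> 'a) \<Rightarrow> ('a \<Rightarrow> real) \<Rightarrow> 'a set set \<Rightarrow> 'a measure \<Rightarrow> real \<Rightarrow> ('a \<Rightarrow> complex) set" where
  "V_theta f \<phi> P \<nu> \<theta> = {g \<in> borel_measurable \<nu>. enorm_theta f \<phi> P \<nu> \<theta> g < \<infinity>}"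

end

theory Submission
  imports Defs
begin

text \<open>
  The family \<open>B n\<close> of cylinders with too many visits to the non-expanding region has at most
  \<open>(q exp \<epsilon>\<^sub>0)\<^sup>n\<close> elements, so its weight \<open>\<Sum> exp (S\<^sub>n \<phi>)\<close> is at most a constant times \<open>(\<lambda> \<rho>)\<^sup>n\<close> with
  \<open>\<rho> = exp (osc \<phi> - c \<alpha>)\<close>, and every other cylinder lies in a hyperbolic one. Decomposing a cylinder at its
  last hyperbolic time and using bounded distortion gives \<open>\<Sum> exp (S\<^sub>n \<phi>) \<le> K \<lambda>\<^sup>n\<close> over all \<open>n\<close>-cylinders, and the
  oscillation of a \<open>\<alpha>\<close>-Hoelder function contributes a further factor of order \<open>n \<rho>\<^sup>n\<close>.
  Since \<open>2 osc \<phi> < c \<alpha>\<close>, one can take \<open>\<theta> = exp (c \<alpha> / 2) / \<lambda>\<close>, for which \<open>exp (osc \<phi>) < \<theta> \<lambda>\<close> and \<open>\<theta> \<lambda> \<rho> < 1\<close>.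
  The first inequality makes the variation contract under \<open>\<lambda>\<^sup>-\<^sup>1 \<L>\<close>, the second makes the error terms summable:
  this is a Lasota-Yorke inequality with the \<open>L\<^sup>1\<close> norm as weak norm.

  No compactness of the embedding into \<open>L\<^sup>1\<close> is needed. A nonnegative density whose norm is controlled by its
  integral is bounded below on some cylinder of fixed order, and mixing spreads this lower bound over \<open>M\<close>; hence
  \<open>\<lambda>\<^sup>-\<^sup>1 \<L>\<close> contracts the \<open>L\<^sup>1\<close> norm of functions of mean zero whose norm is controlled by their \<open>L\<^sup>1\<close> norm, and
  together with the Lasota-Yorke inequality it contracts the mean zero subspace exponentially. The fixed density is
  unique in \<open>L\<^sup>1\<close> because Hoelder functions belong to the space and are dense in \<open>L\<^sup>1\<close>; so it is \<open>d\<mu>/d\<nu>\<close>.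
\<close>

section \<open>Resolvents and the spectral gap\<close>

text \<open>The distance is an infimum of lengths of piecewise C1 curves, but a curve pulled back by
  an inverse branch on the closure of a partition element is only known to be continuous. No length
  of the lift is formed: increments of the lift are compared in charts with the length of the
  original curve, locally and up to an arbitrarily small error, and the local bounds are glued by
  bisection. Afterwards the geometry is seen only through exponential contraction on hyperbolic
  cylinders. Two facts have to be proved before any estimate in the space: conformality, given for
  continuous functions, is extended to Borel functions, and the boundary of the partition is shown
  to be \<nu>-null; otherwise the n-cylinders would not cover almost everything, and variation and
  \<open>L1\<close> norm together would not control the sup norm. The choice of \<theta> is a
  midpoint: for \<theta> \<lambda> = exp t the two requirements read osc < t and t < c \<alpha> -
  osc, an interval that is nonempty exactly when 2 osc < c \<alpha> and has the centre c \<alpha> /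
  2.\<close>

locale seminormed_functions =
  fixes V :: "('a \<Rightarrow> complex) set" and N :: "('a \<Rightarrow> complex) \<Rightarrow> real"
  assumes V_zero: "(\<lambda>_. 0) \<in> V"
    and V_lin: "\<And>g h a b. g \<in> V \<Longrightarrow> h \<in> V \<Longrightarrow> (\<lambda>x. a * g x + b * h x) \<in> V"
    and N_nonneg: "\<And>g. N g \<ge> 0"
    and N_add: "\<And>g h. g \<in> V \<Longrightarrow> h \<in> V \<Longrightarrow> N (\<lambda>x. g x + h x) \<le> N g + N h"
    and N_scale: "\<And>g a. g \<in> V \<Longrightarrow> N (\<lambda>x. a * g x) = cmod a * N g"
begin

lemma V_add: "g \<in> V \<Longrightarrow> h \<in> V \<Longrightarrow> (\<lambda>x. g x + h x) \<in> V"
  using V_lin[of g h 1 1] by simp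

lemma V_diff: "g \<in> V \<Longrightarrow> h \<in> V \<Longrightarrow> (\<lambda>x. g x - h x) \<in> V"
  using V_lin[of g h 1 "-1"] by simp

lemma V_scale: "g \<in> V \<Longrightarrow> (\<lambda>x. a * g x) \<in> V"
  using V_lin[of g g a 0] by simp

lemma V_uminus: "g \<in> V \<Longrightarrow> (\<lambda>x. - g x) \<in> V"
  using V_scale[of g "-1"] by simp

lemma N_zero: "N (\<lambda>_. 0) = 0"
  using N_scale[OF V_zero, of 0] by simp

lemma N_uminus: "g \<in> V \<Longrightarrow> N (\<lambda>x. - g x) = N g"
  using N_scale[of g "-1"] by simp

lemma N_minus_commute: "g \<in> V \<Longrightarrow> h \<in> V \<Longrightarrow> N (\<lambda>x. g x - h x) = N (\<lambda>x. h x - g x)"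
  using N_uminus[OF V_diff, of g h] by simp

lemma N_diff: "g \<in> V \<Longrightarrow> h \<in> V \<Longrightarrow> N (\<lambda>x. g x - h x) \<le> N g + N h"
  using N_add[OF _ V_uminus, of g h] N_uminus[of h] by simp

lemma N_triangle:
  "g \<in> V \<Longrightarrow> h \<in> V \<Longrightarrow> k \<in> V \<Longrightarrow> N (\<lambda>x. g x - k x) \<le> N (\<lambda>x. g x - h x) + N (\<lambda>x. h x - k x)"
  using N_add[OF V_diff V_diff, of g h h k] by simp

lemma N_le_diff: "g \<in> V \<Longrightarrow> h \<in> V \<Longrightarrow> N g \<le> N h + N (\<lambda>x. g x - h x)"
  using N_add[OF _ V_diff, of h g h] by simp

lemma V_sum: "(\<And>i. i \<in> I \<Longrightarrow> g i \<in> V) \<Longrightarrow> (\<lambda>x. \<Sum>i\<in>I. g i x) \<in> V"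
  by (induction I rule: infinite_finite_induct) (auto intro: V_zero V_add)

lemma N_sum: "(\<And>i. i \<in> I \<Longrightarrow> g i \<in> V) \<Longrightarrow> N (\<lambda>x. \<Sum>i\<in>I. g i x) \<le> (\<Sum>i\<in>I. N (g i))"
proof (induction I rule: infinite_finite_induct)
  case (insert i I)
  have "N (\<lambda>x. g i x + (\<Sum>i\<in>I. g i x)) \<le> N (g i) + N (\<lambda>x. \<Sum>i\<in>I. g i x)"
    by (intro N_add V_sum) (auto intro: insert.prems)
  with insert show ?case by fastforce
qed (simp_all add: N_zero)

lemma N_cong: "g \<in> V \<Longrightarrow> h \<in> V \<Longrightarrow> N (\<lambda>x. g x - h x) = 0 \<Longrightarrow> N g = N h"
  using N_le_diff[of g h] N_le_diff[of h g] N_minus_commute[of g h] by simp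

text \<open>A seminorm does not separate points, so a limit is determined only up to functions of
  seminorm zero. The resolvent below is a chosen limit; its linearity and its inverse property are
  obtained by exhibiting two limits of one sequence.\<close>

lemma limit_unique:
  assumes "\<And>n. s n \<in> V" "g \<in> V" "h \<in> V"
    and "(\<lambda>n. N (\<lambda>x. s n x - g x)) \<longlonglongrightarrow> 0" "(\<lambda>n. N (\<lambda>x. s n x - h x)) \<longlonglongrightarrow> 0"
  shows "N (\<lambda>x. g x - h x) = 0"
proof -
  have "(\<lambda>n. N (\<lambda>x. s n x - g x) + N (\<lambda>x. s n x - h x)) \<longlonglongrightarrow> 0"
    using tendsto_add[OF assms(4,5)] by simp
  moreover have "N (\<lambda>x. g x - h x) \<le> N (\<lambda>x. s n x - g x) + N (\<lambda>x. s n x - h x)" for n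
    using N_triangle[OF assms(2) assms(1)[of n] assms(3)] N_minus_commute[OF assms(2) assms(1)[of n]]
    by simp
  ultimately have "N (\<lambda>x. g x - h x) \<le> 0"
    by (intro LIMSEQ_le_const) auto
  then show ?thesis using N_nonneg[of "\<lambda>x. g x - h x"] by simp
qed

end

text \<open>Linearity is demanded as an equality of functions, not only modulo seminorm zero as in
  \<open>bounded_operator\<close>: the transfer operator is a finite sum over fibres and satisfies
  it pointwise, and powers and finite sums can then be rewritten as functions.\<close>

locale linear_operator = seminormed_functions +
  fixes T :: "('a \<Rightarrow> complex) \<Rightarrow> ('a \<Rightarrow> complex)"
  assumes T_V: "g \<in> V \<Longrightarrow> T g \<in> V"
    and T_lin: "g \<in> V \<Longrightarrow> h \<in> V \<Longrightarrow> T (\<lambda>x. a * g x + b * h x) = (\<lambda>x. a * T g x + b * T h x)"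
    and T_bounded: "\<exists>K. \<forall>g\<in>V. N (T g) \<le> K * N g"
begin

lemma T_scale: "g \<in> V \<Longrightarrow> T (\<lambda>x. a * g x) = (\<lambda>x. a * T g x)"
  using T_lin[of g g a 0] by simp

lemma T_diff: "g \<in> V \<Longrightarrow> h \<in> V \<Longrightarrow> T (\<lambda>x. g x - h x) = (\<lambda>x. T g x - T h x)"
  using T_lin[of g h 1 "-1"] by simp

lemma T_zero: "T (\<lambda>_. 0) = (\<lambda>_. 0)"
  using T_scale[OF V_zero, of 0] by simp

lemma T_sum: "(\<And>i. i \<in> I \<Longrightarrow> g i \<in> V) \<Longrightarrow> T (\<lambda>x. \<Sum>i\<in>I. g i x) = (\<lambda>x. \<Sum>i\<in>I. T (g i) x)"
proof (induction I rule: infinite_finite_induct)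
  case (insert i I)
  have "T (\<lambda>x. g i x + (\<Sum>i\<in>I. g i x)) = (\<lambda>x. T (g i) x + T (\<lambda>x. \<Sum>i\<in>I. g i x) x)"
    using T_lin[OF _ V_sum, of "g i" I g 1 1] insert.prems by simp
  with insert show ?case by simp
qed (simp_all add: T_zero)

lemma Tpow_V: "g \<in> V \<Longrightarrow> (T ^^ n) g \<in> V"
  by (induction n) (auto intro: T_V)

lemma Tpow_lin:
  "g \<in> V \<Longrightarrow> h \<in> V \<Longrightarrow> (T ^^ n) (\<lambda>x. a * g x + b * h x) = (\<lambda>x. a * (T ^^ n) g x + b * (T ^^ n) h x)"
  by (induction n) (simp_all add: T_lin Tpow_V)

lemma bounded_operator_T: "bounded_operator V N T"
  unfolding bounded_operator_def using T_V T_lin T_bounded by (simp add: N_zero)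

lemma bounded_operator_N_cong:
  assumes S: "bounded_operator V N S" and "g \<in> V" "N g = 0"
  shows "N (S g) = 0"
proof -
  obtain K where "N (S g) \<le> K * N g" using S \<open>g \<in> V\<close> unfolding bounded_operator_def by blast
  then show ?thesis using N_nonneg[of "S g"] \<open>N g = 0\<close> by simp
qed

text \<open>A bounded left inverse of \<open>T - z\<close> would send the image of an eigenfunction,
  which has seminorm zero, to a function of seminorm zero; but that function agrees with the
  eigenfunction up to seminorm zero.\<close>

lemma eigenvalue_in_spectrum:
  assumes "op_eigenvalue V N T z"
  shows "z \<in> op_spectrum V N T"
proof (rule ccontr)
  assume "z \<notin> op_spectrum V N T"
  then obtain S where S: "bounded_operator V N S"
    and inv: "\<And>g. g \<in> V \<Longrightarrow> N (\<lambda>x. S (\<lambda>y. T g y - z * g y) x - g x) = 0"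
    unfolding op_spectrum_def by blast
  obtain g where g: "g \<in> V" "N g \<noteq> 0" "N (\<lambda>x. T g x - z * g x) = 0"
    using assms unfolding op_eigenvalue_def by blast
  have u: "(\<lambda>x. T g x - z * g x) \<in> V" using g T_V V_diff V_scale by blast
  have "N (S (\<lambda>x. T g x - z * g x)) = 0"
    using bounded_operator_N_cong[OF S u] g by blast
  moreover have "S (\<lambda>x. T g x - z * g x) \<in> V" using S u unfolding bounded_operator_def by blast
  ultimately show False using N_cong[OF _ _ inv] g by metis
qed

lemma null_seq_le:
  assumes "\<And>n. a n \<le> b n" "\<And>n. (a n :: real) \<ge> 0" "b \<longlonglongrightarrow> 0"
  shows "a \<longlonglongrightarrow> 0"
  by (rule Lim_null_comparison[OF _ assms(3)]) (use assms in auto)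

lemma neumann_tail:
  assumes "\<And>n. a n \<le> C * r ^ n" "\<And>n. (a n::real) \<ge> 0" "0 \<le> r" "r < t"
  shows "(\<lambda>n. a n / t ^ n) \<longlonglongrightarrow> 0"
proof -
  have "(\<lambda>n. C * (r / t) ^ n) \<longlonglongrightarrow> C * 0"
    by (intro tendsto_intros LIMSEQ_power_zero) (use assms(3,4) in auto)
  moreover have "a n / t ^ n \<le> C * (r / t) ^ n" for n
  proof -
    have "a n / t ^ n \<le> C * r ^ n / t ^ n" using assms by (intro divide_right_mono) auto
    then show ?thesis by (simp add: power_divide)
  qed
  ultimately show ?thesis
    using assms by (intro null_seq_le[of "\<lambda>n. a n / t ^ n" "\<lambda>n. C * (r / t) ^ n"]) auto
qed

text \<open>The Neumann series with terms \<open>- z^(-k-1) T^k\<close> is dominated by a geometric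
  series of ratio \<open>r / cmod z\<close>, so completeness yields a limit. The growth of the
  powers enters, not the norm of \<open>T\<close>, and the radius obtained is therefore the growth
  rate.\<close>

lemma resolvent:
  assumes complete: "complete_seminormed V N"
    and growth: "\<And>n g. g \<in> V \<Longrightarrow> N ((T ^^ n) g) \<le> C * r ^ n * N g"
    and r: "0 \<le> r" "r < cmod z"
  shows "z \<notin> op_spectrum V N T"
proof -
  have z: "z \<noteq> 0" "cmod z > 0" using r by auto
  define s where "s n g = (\<lambda>x. \<Sum>k<n. - (1 / z ^ Suc k) * (T ^^ k) g x)" for n g
  have term_V: "(\<lambda>x. - (1 / z ^ Suc k) * (T ^^ k) g x) \<in> V" if "g \<in> V" for k g
    by (intro V_scale Tpow_V that)
  have s_V: "s n g \<in> V" if "g \<in> V" for n g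
    unfolding s_def by (intro V_sum term_V that)
  have term_le: "N (\<lambda>x. - (1 / z ^ Suc k) * (T ^^ k) g x) \<le> C * N g / cmod z * (r / cmod z) ^ k"
    if "g \<in> V" for k g
  proof -
    have "N (\<lambda>x. - (1 / z ^ Suc k) * (T ^^ k) g x) = 1 / cmod z ^ Suc k * N ((T ^^ k) g)"
      by (subst N_scale[OF Tpow_V[OF that]]) (simp add: norm_divide norm_mult norm_power)
    also have "\<dots> \<le> 1 / cmod z ^ Suc k * (C * r ^ k * N g)"
      by (intro mult_left_mono growth that) auto
    finally show ?thesis by (simp add: power_divide field_simps)
  qed
  have q: "0 \<le> r / cmod z" "r / cmod z < 1" using r z by auto
  have C_pos: "0 \<le> C * N g" if "g \<in> V" for g
    using growth[OF that, of 0] N_nonneg[of g] by simp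
  have geo: "(\<Sum>k\<in>{m..<n}. (r / cmod z) ^ k) \<le> (r / cmod z) ^ m / (1 - r / cmod z)" for m n
  proof -
    have "(\<Sum>k\<in>{m..<n}. (r / cmod z) ^ k) \<le> (\<Sum>k. (r / cmod z) ^ (k + m))"
    proof (cases "m \<le> n")
      case True
      have "(\<Sum>k\<in>{m..<n}. (r / cmod z) ^ k) = (\<Sum>k\<in>{0..<n-m}. (r / cmod z) ^ (k + m))"
        using True by (subst sum.shift_bounds_nat_ivl[symmetric]) simp
      also have "\<dots> \<le> (\<Sum>k. (r / cmod z) ^ (k + m))"
        by (intro sum_le_suminf summable_ignore_initial_segment summable_geometric) (use q in auto)
      finally show ?thesis .
    next
      case False
      then show ?thesis using q
        by (auto intro!: suminf_nonneg summable_ignore_initial_segment summable_geometric)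
    qed
    also have "\<dots> = (r / cmod z) ^ m / (1 - r / cmod z)"
      using q by (simp add: power_add suminf_mult2[symmetric] suminf_geometric summable_geometric)
    finally show ?thesis .
  qed
  have s_diff: "N (\<lambda>x. s n g x - s m g x) \<le> C * N g / cmod z * ((r / cmod z) ^ m / (1 - r / cmod z))"
    if "g \<in> V" "m \<le> n" for g n m
  proof -
    have "s n g x - s m g x = (\<Sum>k\<in>{m..<n}. - (1 / z ^ Suc k) * (T ^^ k) g x)" for x
      unfolding s_def lessThan_atLeast0 using that(2) by (subst sum_diff_nat_ivl) auto
    then have "N (\<lambda>x. s n g x - s m g x) = N (\<lambda>x. \<Sum>k\<in>{m..<n}. - (1 / z ^ Suc k) * (T ^^ k) g x)"
      by presburger
    also have "\<dots> \<le> (\<Sum>k\<in>{m..<n}. N (\<lambda>x. - (1 / z ^ Suc k) * (T ^^ k) g x))"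
      by (intro N_sum term_V that)
    also have "\<dots> \<le> (\<Sum>k\<in>{m..<n}. C * N g / cmod z * (r / cmod z) ^ k)"
      by (intro sum_mono term_le that)
    also have "\<dots> = C * N g / cmod z * (\<Sum>k\<in>{m..<n}. (r / cmod z) ^ k)"
      by (simp add: sum_distrib_left)
    also have "\<dots> \<le> C * N g / cmod z * ((r / cmod z) ^ m / (1 - r / cmod z))"
      by (intro mult_left_mono geo) (use C_pos[OF that(1)] z in auto)
    finally show ?thesis .
  qed
  have ex: "\<exists>h\<in>V. (\<lambda>n. N (\<lambda>x. s n g x - h x)) \<longlonglongrightarrow> 0" if g: "g \<in> V" for g
  proof -
    have lim: "(\<lambda>m. C * N g / cmod z * ((r / cmod z) ^ m / (1 - r / cmod z))) \<longlonglongrightarrow> C * N g / cmod z * (0 / (1 - r / cmod z))"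
      by (intro tendsto_intros LIMSEQ_power_zero) (use q in auto)
    have "\<exists>M. \<forall>i\<ge>M. \<forall>j\<ge>M. N (\<lambda>x. s i g x - s j g x) < e" if "e > 0" for e
    proof -
      obtain M where M: "\<And>m. m \<ge> M \<Longrightarrow> C * N g / cmod z * ((r / cmod z) ^ m / (1 - r / cmod z)) < e"
        using order_tendstoD(2)[OF lim, of e] \<open>e > 0\<close> by (auto simp: eventually_sequentially)
      have "N (\<lambda>x. s i g x - s j g x) < e" if "i \<ge> M" "j \<ge> M" for i j
      proof (cases "j \<le> i")
        case True
        then show ?thesis using s_diff[OF g True] M[OF that(2)] by linarith
      next
        case False
        then show ?thesis using s_diff[OF g, of i j] M[OF that(1)] N_minus_commute[OF s_V[OF g] s_V[OF g], of i j]
          by linarith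
      qed
      then show ?thesis by blast
    qed
    then show ?thesis
      using complete[unfolded complete_seminormed_def, rule_format, of "\<lambda>n. s n g"] s_V[OF g] by simp
  qed
  \<comment> \<open>The limit is picked by choice among functions that differ by seminorm zero,
    which is why the linearity of \<open>S\<close> holds only modulo such functions.\<close>
  define S where "S g = (SOME h. h \<in> V \<and> (\<lambda>n. N (\<lambda>x. s n g x - h x)) \<longlonglongrightarrow> 0)" for g
  have S: "S g \<in> V" "(\<lambda>n. N (\<lambda>x. s n g x - S g x)) \<longlonglongrightarrow> 0" if "g \<in> V" for g
    using someI_ex[of "\<lambda>h. h \<in> V \<and> (\<lambda>n. N (\<lambda>x. s n g x - h x)) \<longlonglongrightarrow> 0"] ex[OF that]
    unfolding S_def by blast+
  have tail: "(\<lambda>n. N ((T ^^ n) g) / cmod z ^ n) \<longlonglongrightarrow> 0" if "g \<in> V" for g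
    by (rule neumann_tail[of _ "C * N g" r]) (use growth[OF that] N_nonneg r in \<open>auto simp: mult_ac\<close>)
  \<comment> \<open>Applying \<open>T - z\<close> to a partial sum telescopes: what is left besides
    \<open>g\<close> is the remainder \<open>T^n g / z^n\<close>, which vanishes in the limit
    because \<open>r < cmod z\<close>.\<close>
  have telescope: "(\<Sum>k<n. - (1 / z ^ Suc k) * (T ^^ Suc k) g x) - z * (\<Sum>k<n. - (1 / z ^ Suc k) * (T ^^ k) g x)
      = g x - (T ^^ n) g x / z ^ n" for n g x
  proof (induction n)
    case (Suc n)
    then show ?case using z(1) by (simp add: algebra_simps del: funpow.simps)
  qed simp
  have Sbound: "N (S g) \<le> (C / cmod z / (1 - r / cmod z)) * N g" if g: "g \<in> V" for g
  proof -
    have "N (S g) \<le> C * N g / cmod z * (1 / (1 - r / cmod z)) + N (\<lambda>x. s n g x - S g x)" for n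
    proof -
      have "N (s n g) \<le> C * N g / cmod z * (1 / (1 - r / cmod z))"
        using s_diff[OF g, of 0 n] by (simp add: s_def[of 0])
      then show ?thesis
        using N_le_diff[OF S(1)[OF g] s_V[OF g, of n]] N_minus_commute[OF S(1)[OF g] s_V[OF g, of n]]
        by linarith
    qed
    then have "N (S g) \<le> C * N g / cmod z * (1 / (1 - r / cmod z)) + 0"
      by (intro LIMSEQ_le_const[OF tendsto_add[OF tendsto_const S(2)[OF g]]]) auto
    then show ?thesis by simp
  qed
  have Slin: "N (\<lambda>x. S (\<lambda>y. a * g y + b * h y) x - (a * S g x + b * S h x)) = 0"
    if g: "g \<in> V" and h: "h \<in> V" for g h a b
  proof (rule limit_unique[of "\<lambda>n. s n (\<lambda>y. a * g y + b * h y)"])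
    have gh: "(\<lambda>y. a * g y + b * h y) \<in> V" using V_lin g h by blast
    show "s n (\<lambda>y. a * g y + b * h y) \<in> V" for n by (rule s_V[OF gh])
    show "S (\<lambda>y. a * g y + b * h y) \<in> V"
      "(\<lambda>n. N (\<lambda>x. s n (\<lambda>y. a * g y + b * h y) x - S (\<lambda>y. a * g y + b * h y) x)) \<longlonglongrightarrow> 0"
      using S[OF gh] by auto
    show abS: "(\<lambda>x. a * S g x + b * S h x) \<in> V" using V_lin S g h by blast
    have eq: "s n (\<lambda>y. a * g y + b * h y) x = a * s n g x + b * s n h x" for n x
      unfolding s_def Tpow_lin[OF g h] sum_distrib_left sum.distrib[symmetric]
      by (intro sum.cong) (auto simp: algebra_simps)
    have le: "N (\<lambda>x. s n (\<lambda>y. a * g y + b * h y) x - (a * S g x + b * S h x))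
        \<le> cmod a * N (\<lambda>x. s n g x - S g x) + cmod b * N (\<lambda>x. s n h x - S h x)" for n
    proof -
      have V1: "(\<lambda>x. s n g x - S g x) \<in> V" "(\<lambda>x. s n h x - S h x) \<in> V"
        using V_diff s_V S g h by blast+
      have "(\<lambda>x. s n (\<lambda>y. a * g y + b * h y) x - (a * S g x + b * S h x))
        = (\<lambda>x. a * (s n g x - S g x) + b * (s n h x - S h x))"
        by (auto simp: eq algebra_simps)
      then show ?thesis
        using N_add[OF V_scale[OF V1(1), of a] V_scale[OF V1(2), of b]] N_scale[OF V1(1), of a] N_scale[OF V1(2), of b]
        by simp
    qed
    have "(\<lambda>n. cmod a * N (\<lambda>x. s n g x - S g x) + cmod b * N (\<lambda>x. s n h x - S h x)) \<longlonglongrightarrow> cmod a * 0 + cmod b * 0"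
      by (intro tendsto_intros S g h)
    then show "(\<lambda>n. N (\<lambda>x. s n (\<lambda>y. a * g y + b * h y) x - (a * S g x + b * S h x))) \<longlonglongrightarrow> 0"
      using null_seq_le[OF le N_nonneg] by simp
  qed
  have bS: "bounded_operator V N S"
    unfolding bounded_operator_def using S(1) Slin Sbound by blast
  have inv1: "N (\<lambda>x. S (\<lambda>y. T g y - z * g y) x - g x) = 0" if g: "g \<in> V" for g
  proof (rule limit_unique[of "\<lambda>n. s n (\<lambda>y. T g y - z * g y)"])
    have u: "(\<lambda>y. T g y - z * g y) \<in> V" using T_V V_diff V_scale g by blast
    show "s n (\<lambda>y. T g y - z * g y) \<in> V" for n by (rule s_V[OF u])
    show "S (\<lambda>y. T g y - z * g y) \<in> V"
      "(\<lambda>n. N (\<lambda>x. s n (\<lambda>y. T g y - z * g y) x - S (\<lambda>y. T g y - z * g y) x)) \<longlonglongrightarrow> 0"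
      using S[OF u] by auto
    have pw: "(T ^^ k) (\<lambda>y. T g y - z * g y) = (\<lambda>x. (T ^^ Suc k) g x - z * (T ^^ k) g x)" for k
      using Tpow_lin[OF T_V[OF g] g, of k 1 "-z"] by (simp add: funpow_Suc_right del: funpow.simps)
    have eq: "s n (\<lambda>y. T g y - z * g y) x - g x = - (1 / z ^ n) * (T ^^ n) g x" for n x
    proof -
      have "s n (\<lambda>y. T g y - z * g y) x = (\<Sum>k<n. - (1 / z ^ Suc k) * (T ^^ Suc k) g x) - z * (\<Sum>k<n. - (1 / z ^ Suc k) * (T ^^ k) g x)"
        unfolding s_def pw sum_distrib_left sum_subtractf[symmetric]
        by (intro sum.cong) (auto simp: algebra_simps)
      then show ?thesis unfolding telescope by simp
    qed
    have "N (\<lambda>x. s n (\<lambda>y. T g y - z * g y) x - g x) = N ((T ^^ n) g) / cmod z ^ n" for n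
      unfolding eq by (subst N_scale[OF Tpow_V[OF g]]) (simp add: norm_divide norm_power)
    then show "(\<lambda>n. N (\<lambda>x. s n (\<lambda>y. T g y - z * g y) x - g x)) \<longlonglongrightarrow> 0"
      using tail[OF g] by simp
  qed (rule g)
  obtain K where K: "\<And>g. g \<in> V \<Longrightarrow> N (T g) \<le> K * N g" using T_bounded by blast
  have inv2: "N (\<lambda>x. (T (S g) x - z * S g x) - g x) = 0" if g: "g \<in> V" for g
  proof (rule limit_unique[of "\<lambda>n x. T (s n g) x - z * s n g x"])
    show "(\<lambda>x. T (s n g) x - z * s n g x) \<in> V" for n
      using T_V V_diff V_scale s_V g by blast
    show "(\<lambda>x. T (S g) x - z * S g x) \<in> V" using T_V V_diff V_scale S g by blast
    have bd: "N (\<lambda>x. (T (s n g) x - z * s n g x) - (T (S g) x - z * S g x)) \<le> (\<bar>K\<bar> + cmod z) * N (\<lambda>x. s n g x - S g x)" for n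
    proof -
      define w where "w = (\<lambda>x. s n g x - S g x)"
      have w: "w \<in> V" unfolding w_def using V_diff s_V S g by blast
      have "(\<lambda>x. (T (s n g) x - z * s n g x) - (T (S g) x - z * S g x)) = (\<lambda>x. T w x - z * w x)"
        unfolding w_def T_diff[OF s_V[OF g] S(1)[OF g]] by (auto simp: algebra_simps)
      moreover have "N (\<lambda>x. T w x - z * w x) \<le> K * N w + cmod z * N w"
        using N_diff[OF T_V[OF w] V_scale[OF w, of z]] K[OF w] N_scale[OF w, of z] by linarith
      moreover have "K * N w \<le> \<bar>K\<bar> * N w" by (intro mult_right_mono N_nonneg) auto
      ultimately show ?thesis unfolding w_def by (simp add: algebra_simps)
    qed
    have lm: "(\<lambda>n. (\<bar>K\<bar> + cmod z) * N (\<lambda>x. s n g x - S g x)) \<longlonglongrightarrow> (\<bar>K\<bar> + cmod z) * 0"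
      by (intro tendsto_intros S g)
    show "(\<lambda>n. N (\<lambda>x. (T (s n g) x - z * s n g x) - (T (S g) x - z * S g x))) \<longlonglongrightarrow> 0"
      by (rule null_seq_le[OF bd N_nonneg]) (use lm in simp)
    have "T (s n g) = (\<lambda>x. \<Sum>k<n. - (1 / z ^ Suc k) * (T ^^ Suc k) g x)" for n
    proof -
      have "T (s n g) = (\<lambda>x. \<Sum>k<n. T (\<lambda>x. - (1 / z ^ Suc k) * (T ^^ k) g x) x)"
        unfolding s_def by (rule T_sum[OF term_V[OF g]])
      then show ?thesis by (subst (asm) T_scale[OF Tpow_V[OF g]]) simp
    qed
    then have eq: "T (s n g) x - z * s n g x - g x = - (1 / z ^ n) * (T ^^ n) g x" for n x
      using telescope[where n=n and g=g and x=x] unfolding s_def by simp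
    have "N (\<lambda>x. (T (s n g) x - z * s n g x) - g x) = N ((T ^^ n) g) / cmod z ^ n" for n
      unfolding eq by (subst N_scale[OF Tpow_V[OF g]]) (simp add: norm_divide norm_power)
    then show "(\<lambda>n. N (\<lambda>x. (T (s n g) x - z * s n g x) - g x)) \<longlonglongrightarrow> 0"
      using tail[OF g] by simp
  qed (rule g)
  show ?thesis unfolding op_spectrum_def using bS inv1 inv2 by blast
qed

lemma restrict:
  assumes "closed_subspace V N W" "T ` W \<subseteq> W"
  shows "linear_operator W N T"
proof -
  have W: "W \<subseteq> V" using assms unfolding closed_subspace_def by blast
  obtain K where "\<And>g. g \<in> V \<Longrightarrow> N (T g) \<le> K * N g" using T_bounded by blast
  then have bnd: "\<exists>K. \<forall>g\<in>W. N (T g) \<le> K * N g" using W by blast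
  have lin: "(\<lambda>x. a * g x + b * h x) \<in> W" if "g \<in> W" "h \<in> W" for g h a b
    using assms(1) that unfolding closed_subspace_def by blast
  have zero: "(\<lambda>_. 0) \<in> W" using assms(1) unfolding closed_subspace_def by blast
  show ?thesis
  proof
    fix g h a b assume "g \<in> W" "h \<in> W"
    then have gh: "g \<in> V" "h \<in> V" using W by auto
    show "N (\<lambda>x. g x + h x) \<le> N g + N h" by (rule N_add[OF gh])
    show "N (\<lambda>x. a * g x) = cmod a * N g" by (rule N_scale[OF gh(1)])
    show "T (\<lambda>x. a * g x + b * h x) = (\<lambda>x. a * T g x + b * T h x)" by (rule T_lin[OF gh])
    show "T g \<in> W" using assms(2) \<open>g \<in> W\<close> by blast
  qed (use bnd lin zero N_nonneg in auto)
qed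

lemma complete_subspace:
  assumes "closed_subspace V N W" "complete_seminormed V N"
  shows "complete_seminormed W N"
  unfolding complete_seminormed_def
proof (intro allI impI)
  fix g :: "nat \<Rightarrow> 'a \<Rightarrow> complex"
  assume g: "(\<forall>i. g i \<in> W) \<and> (\<forall>e>0. \<exists>M. \<forall>i\<ge>M. \<forall>j\<ge>M. N (\<lambda>x. g i x - g j x) < e)"
  have W: "W \<subseteq> V" using assms unfolding closed_subspace_def by blast
  then have "\<forall>i. g i \<in> V" using g by blast
  then obtain h where h: "h \<in> V" "(\<lambda>i. N (\<lambda>x. g i x - h x)) \<longlonglongrightarrow> 0"
    using assms(2)[unfolded complete_seminormed_def, THEN spec, of g] g by metis
  have "\<exists>k\<in>W. N (\<lambda>x. h x - k x) < e" if "e > 0" for e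
  proof -
    obtain i where "N (\<lambda>x. g i x - h x) < e"
      using order_tendstoD(2)[OF h(2) \<open>e > 0\<close>] by (auto simp: eventually_sequentially)
    moreover have "g i \<in> W" "g i \<in> V" using g W by auto
    ultimately show ?thesis using h(1) N_minus_commute[of "g i" h] by (intro bexI[of _ "g i"]) auto
  qed
  then have "h \<in> W" using assms(1) h unfolding closed_subspace_def by blast
  then show "\<exists>h\<in>W. (\<lambda>i. N (\<lambda>x. g i x - h x)) \<longlonglongrightarrow> 0" using h by blast
qed

text \<open>With \<open>J\<close> a bounded functional satisfying \<open>J T = l J\<close>, the
  direction of \<open>h\<close> and the kernel of \<open>J\<close> are complementary and invariant.
  The eigenvalue \<open>l\<close> together with the growth bound pins the spectral radius to
  \<open>l\<close>, and the decay on the kernel confines its spectrum to the disc of radius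
  \<open>l * \<xi>\<close>.\<close>

lemma spectral_gap:
  fixes J :: "('a \<Rightarrow> complex) \<Rightarrow> complex"
  assumes complete: "complete_seminormed V N"
    and J_lin: "\<And>g k a b. g \<in> V \<Longrightarrow> k \<in> V \<Longrightarrow> J (\<lambda>x. a * g x + b * k x) = a * J g + b * J k"
    and J_le: "\<And>g. g \<in> V \<Longrightarrow> cmod (J g) \<le> N g"
    and J_T: "\<And>g. g \<in> V \<Longrightarrow> J (T g) = of_real l * J g"
    and l: "0 < l" and \<xi>: "0 < \<xi>" "\<xi> < 1"
    and h: "h \<in> V" "N (\<lambda>x. T h x - of_real l * h x) = 0" "J h = 1"
    and decay: "\<And>n g. g \<in> V \<Longrightarrow> J g = 0 \<Longrightarrow> N ((T ^^ n) g) \<le> C * (l * \<xi>) ^ n * N g"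
    and growth: "\<And>n g. g \<in> V \<Longrightarrow> N ((T ^^ n) g) \<le> C * l ^ n * N g"
  shows "\<exists>B0 B1. quasi_compact_decomposition V N T B0 B1 \<and> has_dimension B0 N 1"
proof -
  \<comment> \<open>The line through \<open>h\<close> is saturated by functions of seminorm zero,
    since a closed subspace contains everything at seminorm distance zero from it; the span of
    \<open>h\<close> alone need not be closed in this sense.\<close>
  define B0 where "B0 = {g \<in> V. N (\<lambda>x. g x - J g * h x) = 0}"
  define B1 where "B1 = {g \<in> V. J g = 0}"
  have J_diff: "J (\<lambda>x. g x - k x) = J g - J k" if "g \<in> V" "k \<in> V" for g k
    using J_lin[OF that, of 1 "-1"] by simp
  have J_scale: "J (\<lambda>x. a * g x) = a * J g" if "g \<in> V" for g a
    using J_lin[OF that that, of a 0] by simp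
  have J_zero: "J (\<lambda>_. 0) = 0" using J_scale[OF V_zero, of 0] by simp
  have Nh: "N h > 0" using J_le[OF h(1)] h(3) by (simp add: order.strict_trans2[OF zero_less_one])
  have B0: "closed_subspace V N B0"
    unfolding closed_subspace_def
  proof (intro conjI ballI allI impI)
    show "B0 \<subseteq> V" by (auto simp: B0_def)
    show "(\<lambda>_. 0) \<in> B0" by (simp add: B0_def V_zero J_zero N_zero)
    fix g assume g: "g \<in> V" "\<forall>e>0. \<exists>k\<in>B0. N (\<lambda>x. g x - k x) < e"
    have "N (\<lambda>x. g x - J g * h x) \<le> 0"
    proof (rule field_le_epsilon)
      fix e :: real assume e: "e > 0"
      obtain k where k: "k \<in> B0" "N (\<lambda>x. g x - k x) < e / (1 + N h)"
        using g(2) e Nh by (metis add_pos_pos divide_pos_pos zero_less_one)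
      have kV: "k \<in> V" "N (\<lambda>x. k x - J k * h x) = 0" using k by (auto simp: B0_def)
      have V: "(\<lambda>x. J k * h x) \<in> V" "(\<lambda>x. J g * h x) \<in> V" using V_scale h by auto
      have "N (\<lambda>x. g x - J g * h x) \<le> N (\<lambda>x. g x - k x) + N (\<lambda>x. k x - J g * h x)"
        by (rule N_triangle) (use g kV V in auto)
      also have "N (\<lambda>x. k x - J g * h x) \<le> N (\<lambda>x. k x - J k * h x) + N (\<lambda>x. J k * h x - J g * h x)"
        by (rule N_triangle) (use g kV V in auto)
      also have "(\<lambda>x. J k * h x - J g * h x) = (\<lambda>x. (J k - J g) * h x)" by (auto simp: algebra_simps)
      also have "N (\<lambda>x. (J k - J g) * h x) = cmod (J k - J g) * N h" by (rule N_scale[OF h(1)])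
      also have "cmod (J k - J g) \<le> N (\<lambda>x. g x - k x)"
        using J_le[OF V_diff[OF g(1) kV(1)]] by (simp add: J_diff g kV norm_minus_commute)
      finally have "N (\<lambda>x. g x - J g * h x) \<le> N (\<lambda>x. g x - k x) + N (\<lambda>x. g x - k x) * N h"
        using kV Nh by (simp add: mult_right_mono)
      also have "\<dots> = N (\<lambda>x. g x - k x) * (1 + N h)" by (simp add: algebra_simps)
      also have "\<dots> \<le> e" using k(2) Nh by (simp add: field_simps)
      finally show "N (\<lambda>x. g x - J g * h x) \<le> 0 + e" by simp
    qed
    then show "g \<in> B0" using g N_nonneg[of "\<lambda>x. g x - J g * h x"] by (simp add: B0_def)
  next
    fix g k a b assume g: "g \<in> B0" and k: "k \<in> B0"
    have V: "g \<in> V" "k \<in> V" "(\<lambda>x. g x - J g * h x) \<in> V" "(\<lambda>x. k x - J k * h x) \<in> V"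
      using g k by (auto simp: B0_def intro!: V_diff V_scale h)
    have "(\<lambda>x. a * g x + b * k x - (a * J g + b * J k) * h x)
       = (\<lambda>x. a * (g x - J g * h x) + b * (k x - J k * h x))" by (auto simp: algebra_simps)
    moreover have "N \<dots> \<le> cmod a * N (\<lambda>x. g x - J g * h x) + cmod b * N (\<lambda>x. k x - J k * h x)"
      using N_add[OF V_scale[OF V(3), of a] V_scale[OF V(4), of b]] N_scale[OF V(3), of a] N_scale[OF V(4), of b] by simp
    ultimately have "N (\<lambda>x. a * g x + b * k x - (a * J g + b * J k) * h x) \<le> 0"
      using g k by (simp add: B0_def)
    then show "(\<lambda>x. a * g x + b * k x) \<in> B0"
      using V N_nonneg[of "\<lambda>x. a * g x + b * k x - (a * J g + b * J k) * h x"]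
      by (simp add: B0_def V_lin J_lin)
  qed
  have B1: "closed_subspace V N B1"
    unfolding closed_subspace_def
  proof (intro conjI ballI allI impI)
    show "B1 \<subseteq> V" by (auto simp: B1_def)
    show "(\<lambda>_. 0) \<in> B1" by (simp add: B1_def V_zero J_zero)
    fix g k a b assume "g \<in> B1" "k \<in> B1"
    then show "(\<lambda>x. a * g x + b * k x) \<in> B1" by (simp add: B1_def V_lin J_lin)
  next
    fix g assume g: "g \<in> V" "\<forall>e>0. \<exists>k\<in>B1. N (\<lambda>x. g x - k x) < e"
    have "cmod (J g) \<le> 0"
    proof (rule field_le_epsilon)
      fix e :: real assume "e > 0"
      then obtain k where "k \<in> B1" "N (\<lambda>x. g x - k x) < e" using g(2) by blast
      then show "cmod (J g) \<le> 0 + e" using J_le[OF V_diff[of g k]] g J_diff[of g k] by (force simp: B1_def)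
    qed
    then show "g \<in> B1" using g by (simp add: B1_def)
  qed
  have TB1: "T ` B1 \<subseteq> B1" by (auto simp: B1_def T_V J_T)
  have TB0: "T ` B0 \<subseteq> B0"
  proof safe
    fix g assume g: "g \<in> B0"
    obtain K where K: "\<And>g. g \<in> V \<Longrightarrow> N (T g) \<le> K * N g" using T_bounded by blast
    have V: "g \<in> V" "(\<lambda>x. J g * h x) \<in> V" using g V_scale h by (auto simp: B0_def)
    have "N (T (\<lambda>x. g x - J g * h x)) \<le> 0" using K[OF V_diff[OF V]] g by (simp add: B0_def)
    then have 1: "N (\<lambda>x. T g x - J g * T h x) \<le> 0" by (simp add: T_diff V T_scale h)
    have "(\<lambda>x. J g * T h x - of_real l * J g * h x) = (\<lambda>x. J g * (T h x - of_real l * h x))"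
      by (auto simp: algebra_simps)
    then have 2: "N (\<lambda>x. J g * T h x - of_real l * J g * h x) = 0"
      using N_scale[OF V_diff[OF T_V[OF h(1)] V_scale[OF h(1)]], of "J g" "of_real l"] h by simp
    have "N (\<lambda>x. T g x - of_real l * J g * h x) \<le> N (\<lambda>x. T g x - J g * T h x) + N (\<lambda>x. J g * T h x - of_real l * J g * h x)"
      by (rule N_triangle) (use V T_V V_scale h in auto)
    then show "T g \<in> B0" using 1 2 N_nonneg[of "\<lambda>x. T g x - of_real l * J g * h x"] V
      by (simp add: B0_def T_V J_T)
  qed
  have dim: "has_dimension B0 N 1"
    unfolding has_dimension_def
  proof (intro exI[of _ "\<lambda>_. h"] conjI allI impI ballI)
    show "h \<in> B0" using h by (simp add: B0_def N_zero)
    show "\<exists>a. N (\<lambda>x. g x - (\<Sum>i<(1::nat). a i * h x)) = 0" if "g \<in> B0" for g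
      using that by (intro exI[of _ "\<lambda>_. J g"]) (simp add: B0_def lessThan_Suc)
    show "a i = 0" if "N (\<lambda>x. \<Sum>i<1. a i * h x) = 0" "i < 1" for a :: "nat \<Rightarrow> complex" and i :: nat
      using that Nh N_scale[OF h(1), of "a 0"] by simp
  qed
  have eigV: "op_eigenvalue V N T (of_real l)" and eig0: "op_eigenvalue B0 N T (of_real l)"
  proof -
    have "h \<in> B0" using h by (simp add: B0_def N_zero)
    then show "op_eigenvalue V N T (of_real l)" "op_eigenvalue B0 N T (of_real l)"
      unfolding op_eigenvalue_def using h Nh by (metis less_irrefl)+
  qed
  interpret T0: linear_operator B0 N T by (rule restrict[OF B0 TB0])
  interpret T1: linear_operator B1 N T by (rule restrict[OF B1 TB1])
  have spec0: "op_spectrum B0 N T = {of_real l}"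
  proof
    show "{of_real l} \<subseteq> op_spectrum B0 N T" using T0.eigenvalue_in_spectrum[OF eig0] by simp
    show "op_spectrum B0 N T \<subseteq> {of_real l}"
    proof (rule subsetI, rule ccontr)
      fix z assume z: "z \<in> op_spectrum B0 N T" "z \<notin> {of_real l}"
      \<comment> \<open>On \<open>B0\<close> the operator acts as multiplication by \<open>l\<close>
        modulo seminorm zero, so multiplication by \<open>w\<close> inverts
        \<open>T - z\<close>.\<close>
      define w where "w = 1 / (of_real l - z)"
      define S where "S g = (\<lambda>x. w * g x)" for g :: "'a \<Rightarrow> complex"
      have "bounded_operator B0 N S"
        unfolding bounded_operator_def S_def
      proof (intro conjI ballI allI exI[of _ "cmod w"])
        fix g assume g: "g \<in> B0"
        show "(\<lambda>x. w * g x) \<in> B0" by (rule T0.V_scale[OF g])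
        show "N (\<lambda>x. w * g x) \<le> cmod w * N g" using T0.N_scale[OF g] by simp
        fix h a b
        show "N (\<lambda>x. w * (a * g x + b * h x) - (a * (w * g x) + b * (w * h x))) = 0"
          by (simp add: algebra_simps N_zero)
      qed
      moreover have "N (\<lambda>x. S (\<lambda>y. T g y - z * g y) x - g x) = 0"
        "N (\<lambda>x. (T (S g) x - z * S g x) - g x) = 0" if g: "g \<in> B0" for g
      proof -
        have gV: "g \<in> V" and g0: "N (\<lambda>x. g x - J g * h x) = 0" using g by (auto simp: B0_def)
        have "N (\<lambda>x. T g x - of_real l * J g * h x) = 0" using TB0 g by (auto simp: B0_def J_T)
        moreover have "N (\<lambda>x. of_real l * J g * h x - of_real l * g x) = 0"
        proof -
          have "(\<lambda>x. of_real l * J g * h x - of_real l * g x) = (\<lambda>x. (- of_real l) * (g x - J g * h x))"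
            by (auto simp: algebra_simps)
          then show ?thesis using N_scale[OF V_diff[OF gV V_scale[OF h(1)]], of "- of_real l" "J g"] g0 by simp
        qed
        moreover have "N (\<lambda>x. T g x - of_real l * g x) \<le> N (\<lambda>x. T g x - of_real l * J g * h x) + N (\<lambda>x. of_real l * J g * h x - of_real l * g x)"
          by (rule N_triangle) (use gV T_V V_scale h in auto)
        ultimately have e: "N (\<lambda>x. T g x - of_real l * g x) = 0"
          using N_nonneg[of "\<lambda>x. T g x - of_real l * g x"] by simp
        have wz: "w * (of_real l - z) = 1" using z by (simp add: w_def)
        have "S (\<lambda>y. T g y - z * g y) x - g x = w * (T g x - of_real l * g x)" for x
        proof -
          have "w * (T g x - z * g x) - g x = w * (T g x - z * g x) - w * (of_real l - z) * g x" unfolding wz by simp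
          then show ?thesis unfolding S_def by (simp add: algebra_simps)
        qed
        moreover have "(T (S g) x - z * S g x) - g x = w * (T g x - of_real l * g x)" for x
        proof -
          have "w * T g x - z * (w * g x) - g x = w * (T g x - z * g x) - w * (of_real l - z) * g x"
            unfolding wz by (simp add: algebra_simps)
          then show ?thesis unfolding S_def T_scale[OF gV] by (simp add: algebra_simps)
        qed
        moreover have "N (\<lambda>x. w * (T g x - of_real l * g x)) = 0"
          using N_scale[OF V_diff[OF T_V[OF gV] V_scale[OF gV]], of w "of_real l"] e by simp
        ultimately show "N (\<lambda>x. S (\<lambda>y. T g y - z * g y) x - g x) = 0"
          "N (\<lambda>x. (T (S g) x - z * S g x) - g x) = 0" by simp_all
      qed
      ultimately show False using z(1) unfolding op_spectrum_def by blast
    qed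
  qed
  have radV: "op_spectral_radius V N T = l"
    unfolding op_spectral_radius_def
  proof (rule cSup_eq_maximum)
    show "l \<in> insert 0 (cmod ` op_spectrum V N T)"
      using eigenvalue_in_spectrum[OF eigV] l by (force intro!: image_eqI[of _ _ "of_real l"])
    show "y \<le> l" if "y \<in> insert 0 (cmod ` op_spectrum V N T)" for y
      using that resolvent[OF complete growth] l by force
  qed
  have "op_spectral_radius B1 N T \<le> l * \<xi>"
    unfolding op_spectral_radius_def
  proof (rule cSup_least)
    have dec1: "N ((T ^^ n) g) \<le> C * (l * \<xi>) ^ n * N g" if "g \<in> B1" for n g
      using that by (intro decay) (auto simp: B1_def)
    show "y \<le> l * \<xi>" if "y \<in> insert 0 (cmod ` op_spectrum B1 N T)" for y
      using that T1.resolvent[OF complete_subspace[OF B1 complete] dec1] l \<xi> by force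
  qed simp
  also have "l * \<xi> < l" using l \<xi> by simp
  finally have rad1: "op_spectral_radius B1 N T < l" .
  have split: "\<exists>g0\<in>B0. \<exists>g1\<in>B1. N (\<lambda>x. g x - (g0 x + g1 x)) = 0" if g: "g \<in> V" for g
  proof -
    have "(\<lambda>x. J g * h x) \<in> B0" using h by (simp add: B0_def V_scale J_scale N_zero)
    moreover have "(\<lambda>x. g x - J g * h x) \<in> B1"
      using h g by (simp add: B1_def V_scale J_scale V_diff J_diff)
    moreover have "N (\<lambda>x. g x - (J g * h x + (g x - J g * h x))) = 0" by (simp add: N_zero)
    ultimately show ?thesis
      by (intro bexI[where x = "\<lambda>x. J g * h x"] bexI[where x = "\<lambda>x. g x - J g * h x"])
  qed
  have int: "N g = 0" if "g \<in> B0 \<inter> B1" for g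
    using that by (auto simp: B0_def B1_def)
  have "quasi_compact_decomposition V N T B0 B1"
    unfolding quasi_compact_decomposition_def
    using B0 B1 split int TB0 TB1 dim rad1 l by (auto simp: radV spec0 eig0)
  then show ?thesis using dim by blast
qed

end

section \<open>Calculus\<close>

text \<open>No measurability is assumed of the integrand: the speed of a curve is expressed through
  charts and derivatives picked by choice. The integral is a supremum over simple functions below,
  and a simple function for \<open>A\<close> plus one for \<open>B\<close> is admissible for
  \<open>C\<close>, which gives this one inequality.\<close>

lemma nn_integral_superadditive:
  fixes f :: "'a \<Rightarrow> ennreal"
  assumes "A \<inter> B = {}" "A \<union> B \<subseteq> C"
  shows "(\<integral>\<^sup>+x\<in>A. f x \<partial>M) + (\<integral>\<^sup>+x\<in>B. f x \<partial>M) \<le> (\<integral>\<^sup>+x\<in>C. f x \<partial>M)"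
proof -
  let ?S = "\<lambda>E. {g. simple_function M g \<and> g \<le> (\<lambda>x. f x * indicator E x)}"
  have ne: "(\<lambda>_. 0) \<in> ?S E" for E by (auto simp: le_fun_def)
  have "(\<integral>\<^sup>+x\<in>A. f x \<partial>M) + (\<integral>\<^sup>+x\<in>B. f x \<partial>M)
      = (SUP g\<in>?S A. SUP h\<in>?S B. integral\<^sup>S M g + integral\<^sup>S M h)"
  proof -
    have n: "?S A \<noteq> {}" "?S B \<noteq> {}" using ne by blast+
    show ?thesis
      unfolding nn_integral_def ennreal_SUP_add_left[OF n(1), symmetric]
      using n(2) by (simp add: ennreal_SUP_add_right image_image)
  qed
  also have "\<dots> \<le> (\<integral>\<^sup>+x\<in>C. f x \<partial>M)"
  proof (intro SUP_least)
    fix g h assume g: "g \<in> ?S A" and h: "h \<in> ?S B"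
    have "integral\<^sup>S M g + integral\<^sup>S M h = integral\<^sup>S M (\<lambda>x. g x + h x)"
      using g h by (simp add: simple_integral_add)
    also have "\<dots> \<le> (\<integral>\<^sup>+x\<in>C. f x \<partial>M)"
      unfolding nn_integral_def
    proof (rule SUP_upper, safe)
      show "simple_function M (\<lambda>x. g x + h x)" using g h by auto
      show "(\<lambda>x. g x + h x) \<le> (\<lambda>x. f x * indicator C x)"
      proof (rule le_funI)
        fix x
        have "g x \<le> f x * indicator A x" "h x \<le> f x * indicator B x"
          using g h by (auto simp: le_fun_def)
        then show "g x + h x \<le> f x * indicator C x"
          using assms by (cases "x \<in> A"; cases "x \<in> B") (auto simp: indicator_def)
      qed
    qed
    finally show "integral\<^sup>S M g + integral\<^sup>S M h \<le> (\<integral>\<^sup>+x\<in>C. f x \<partial>M)" .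
  qed
  finally show ?thesis .
qed

text \<open>A signed integral is at most the integral of the positive part, and
  \<open>ennreal\<close> truncates at zero. Continuity off the finite set \<open>F\<close> supplies
  the measurability; the points of \<open>F\<close> and the end points are spiked away.\<close>

lemma has_integral_le_nn_integral:
  fixes \<psi> :: "real \<Rightarrow> real"
  assumes int: "(\<psi> has_integral I) {a..b}" and F: "finite F"
    and cont: "continuous_on ({a<..<b} - F) \<psi>"
  shows "ennreal I \<le> (\<integral>\<^sup>+t\<in>{a<..<b} - F. ennreal (\<psi> t) \<partial>lborel)"
proof (cases "(\<integral>\<^sup>+t\<in>{a<..<b} - F. ennreal (\<psi> t) \<partial>lborel) = \<infinity>")
  case False
  define g where "g t = indicator ({a<..<b} - F) t *\<^sub>R max 0 (\<psi> t)" for t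
  have op: "{a<..<b} - F \<in> sets borel"
    using F by (intro borel_open open_Diff finite_imp_closed) auto
  have g_meas: "g \<in> borel_measurable borel"
    unfolding g_def by (intro borel_measurable_continuous_on_indicator op continuous_intros cont)
  have g_nn: "(\<integral>\<^sup>+t. ennreal (g t) \<partial>lborel) = (\<integral>\<^sup>+t\<in>{a<..<b} - F. ennreal (\<psi> t) \<partial>lborel)"
    by (intro nn_integral_cong) (auto simp: g_def indicator_def max_def ennreal_neg)
  have "g t \<ge> 0" for t by (simp add: g_def)
  then have g_int: "integrable lborel g"
    using g_meas False by (intro integrableI_nonneg) (auto simp: g_nn less_top)
  have "((\<lambda>t. if t \<in> {a..b} then \<psi> t else 0) has_integral I) UNIV"
    by (subst has_integral_restrict_UNIV) (rule int)
  then have "((\<lambda>t. if t \<in> {a<..<b} - F then \<psi> t else 0) has_integral I) UNIV"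
    by (rule has_integral_spike_finite[of "F \<union> {a, b}", rotated 2]) (use F in auto)
  moreover have "(g has_integral integral\<^sup>L lborel g) UNIV"
    by (rule has_integral_integral_lborel[OF g_int])
  ultimately have "I \<le> integral\<^sup>L lborel g"
    by (rule has_integral_le) (auto simp: g_def)
  then have "ennreal I \<le> (\<integral>\<^sup>+t. ennreal (g t) \<partial>lborel)"
    by (subst nn_integral_eq_integral[OF g_int]) (auto simp: g_def ennreal_leI)
  then show ?thesis by (simp add: g_nn)
qed simp

lemma linear_norm_le_Basis:
  fixes h :: "'e::euclidean_space \<Rightarrow> 'b::real_normed_vector"
  assumes "linear h"
  shows "norm (h v) \<le> (\<Sum>i\<in>Basis. norm (h i)) * norm v"
proof -
  have "h v = h (\<Sum>i\<in>Basis. (v \<bullet> i) *\<^sub>R i)" by (simp add: euclidean_representation)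
  also have "\<dots> = (\<Sum>i\<in>Basis. (v \<bullet> i) *\<^sub>R h i)"
    by (simp add: linear_sum[OF assms] linear_cmul[OF assms] o_def)
  also have "norm \<dots> \<le> (\<Sum>i\<in>Basis. norm v * norm (h i))"
    by (intro sum_norm_le) (auto simp: Basis_le_norm mult_right_mono)
  finally show ?thesis by (simp add: sum_distrib_left mult.commute)
qed

text \<open>Continuous differentiability makes the linearisation at \<open>z0\<close> uniform over
  pairs of nearby points, neither of which has to be \<open>z0\<close>. Continuity of the derivative
  is known only for each fixed vector; summing over \<open>Basis\<close> turns it into a bound on
  the operator norm.\<close>

lemma strictly_differentiable:
  fixes H :: "'e::euclidean_space \<Rightarrow> 'e"
  assumes Uo: "open U" "z0 \<in> U"
    and diff: "\<And>z. z \<in> U \<Longrightarrow> H differentiable (at z)"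
    and cont: "\<And>v. continuous_on U (\<lambda>z. frechet_derivative H (at z) v)"
    and "\<eta> > 0"
  obtains r where "r > 0" "ball z0 r \<subseteq> U"
    "\<And>y z. y \<in> ball z0 r \<Longrightarrow> z \<in> ball z0 r \<Longrightarrow>
       norm (H y - H z - frechet_derivative H (at z0) (y - z)) \<le> \<eta> * norm (y - z)"
proof -
  let ?D = "\<lambda>z. frechet_derivative H (at z)"
  have lin: "linear (?D z)" if "z \<in> U" for z
    using diff[OF that] by (rule linear_frechet_derivative)
  have "((\<lambda>z. \<Sum>i\<in>Basis. norm (?D z i - ?D z0 i)) \<longlongrightarrow> (\<Sum>i\<in>(Basis::'e set). norm (?D z0 i - ?D z0 i))) (at z0)"
    using cont Uo by (intro tendsto_intros) (auto simp: continuous_on_eq_continuous_at isCont_def)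
  then have "\<forall>\<^sub>F z in at z0. (\<Sum>i\<in>Basis. norm (?D z i - ?D z0 i)) < \<eta>"
    by (rule order_tendstoD) (use \<open>\<eta> > 0\<close> in simp)
  then have "\<forall>\<^sub>F z in nhds z0. (\<Sum>i\<in>Basis. norm (?D z i - ?D z0 i)) < \<eta>"
    by (simp add: eventually_nhds_conv_at \<open>\<eta> > 0\<close>)
  then obtain r1 where r1: "r1 > 0" "\<And>z. dist z z0 < r1 \<Longrightarrow> (\<Sum>i\<in>Basis. norm (?D z i - ?D z0 i)) < \<eta>"
    by (auto simp: eventually_nhds_metric)
  obtain r2 where r2: "r2 > 0" "ball z0 r2 \<subseteq> U" using Uo openE by blast
  define r where "r = min r1 r2"
  have "norm (H y - H z - ?D z0 (y - z)) \<le> \<eta> * norm (y - z)" if "y \<in> ball z0 r" "z \<in> ball z0 r" for y z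
  proof -
    have sub: "ball z0 r \<subseteq> U" using r2 by (auto simp: r_def)
    have "norm (H y - H z - ?D z0 (y - z)) \<le> norm (y - z) * \<eta>"
    proof (rule differentiable_bound_linearization[of z y "ball z0 r" H ?D z0 \<eta>])
      show "z + t *\<^sub>R (y - z) \<in> ball z0 r" if "t \<in> {0..1}" for t
      proof -
        have "z + t *\<^sub>R (y - z) = (1 - t) *\<^sub>R z + t *\<^sub>R y" by (simp add: algebra_simps)
        then show ?thesis using convex_ball[of z0 r] \<open>y \<in> _\<close> \<open>z \<in> _\<close> that unfolding convex_alt by auto
      qed
      show "(H has_derivative ?D x) (at x within ball z0 r)" if "x \<in> ball z0 r" for x
        using that sub diff frechet_derivative_works has_derivative_at_withinI by blast
      show "z0 \<in> ball z0 r" using r1 r2 by (simp add: r_def)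
      show "onorm (?D x - ?D z0) \<le> \<eta>" if x: "x \<in> ball z0 r" for x
      proof (rule onorm_bound)
        show "0 \<le> \<eta>" using \<open>\<eta> > 0\<close> by simp
        have l: "linear (\<lambda>v. ?D x v - ?D z0 v)"
          by (intro linear_compose_sub lin) (use x sub Uo in auto)
        fix v
        have "norm ((?D x - ?D z0) v) \<le> (\<Sum>i\<in>Basis. norm (?D x i - ?D z0 i)) * norm v"
          using linear_norm_le_Basis[OF l, of v] by simp
        also have "\<dots> \<le> \<eta> * norm v"
          using r1(2)[of x] x by (intro mult_right_mono) (auto simp: r_def dist_commute less_imp_le)
        finally show "norm ((?D x - ?D z0) v) \<le> \<eta> * norm v" .
      qed
    qed
    then show ?thesis by (simp add: mult.commute)
  qed
  moreover have "r > 0" "ball z0 r \<subseteq> U" using r1 r2 by (auto simp: r_def)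
  ultimately show ?thesis using that by blast
qed

text \<open>Bisection: the bound is local at every point and survives concatenation, by the triangle
  inequality on the left and superadditivity on the right. Half-open intervals keep the two domains
  of integration disjoint.\<close>

lemma Bolzano_metric_bound:
  fixes \<Gamma> :: "real \<Rightarrow> 'a::metric_space" and l :: "real \<Rightarrow> ennreal"
  assumes "\<And>t0. t0 \<in> {0..1} \<Longrightarrow> \<exists>\<delta>>0. \<forall>s\<in>{0..1}. \<forall>t\<in>{0..1}. \<bar>s - t0\<bar> < \<delta> \<longrightarrow> \<bar>t - t0\<bar> < \<delta> \<longrightarrow> s \<le> t \<longrightarrow>
      ennreal (dist (\<Gamma> s) (\<Gamma> t)) \<le> M * (\<integral>\<^sup>+\<tau>\<in>{s<..t}. l \<tau> \<partial>lborel)"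
  shows "ennreal (dist (\<Gamma> 0) (\<Gamma> 1)) \<le> M * (\<integral>\<^sup>+\<tau>\<in>{0<..1}. l \<tau> \<partial>lborel)"
proof -
  let ?L = "\<lambda>s t. \<integral>\<^sup>+\<tau>\<in>{s<..t}. l \<tau> \<partial>lborel"
  have "0 \<le> (0::real) \<and> (1::real) \<le> 1 \<longrightarrow> ennreal (dist (\<Gamma> 0) (\<Gamma> 1)) \<le> M * ?L 0 1"
  proof (rule Bolzano[of "0::real" 1 "\<lambda>s t. 0 \<le> s \<and> t \<le> 1 \<longrightarrow> ennreal (dist (\<Gamma> s) (\<Gamma> t)) \<le> M * ?L s t"])
    fix a b c :: real
    assume trans: "0 \<le> a \<and> b \<le> 1 \<longrightarrow> ennreal (dist (\<Gamma> a) (\<Gamma> b)) \<le> M * ?L a b"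
      "0 \<le> b \<and> c \<le> 1 \<longrightarrow> ennreal (dist (\<Gamma> b) (\<Gamma> c)) \<le> M * ?L b c" "a \<le> b" "b \<le> c"
    show "0 \<le> a \<and> c \<le> 1 \<longrightarrow> ennreal (dist (\<Gamma> a) (\<Gamma> c)) \<le> M * ?L a c"
    proof
      assume "0 \<le> a \<and> c \<le> 1"
      then have 1: "ennreal (dist (\<Gamma> a) (\<Gamma> b)) \<le> M * ?L a b" "ennreal (dist (\<Gamma> b) (\<Gamma> c)) \<le> M * ?L b c"
        using trans by auto
      have "ennreal (dist (\<Gamma> a) (\<Gamma> c)) \<le> ennreal (dist (\<Gamma> a) (\<Gamma> b)) + ennreal (dist (\<Gamma> b) (\<Gamma> c))"
        by (simp add: dist_triangle flip: ennreal_plus)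
      also have "\<dots> \<le> M * (?L a b + ?L b c)"
        using add_mono[OF 1] by (simp add: distrib_left)
      also have "\<dots> \<le> M * ?L a c"
        by (intro mult_left_mono nn_integral_superadditive) (use trans in auto)
      finally show "ennreal (dist (\<Gamma> a) (\<Gamma> c)) \<le> M * ?L a c" .
    qed
  next
    fix x :: real assume "0 \<le> x" "x \<le> 1"
    then obtain \<delta> where \<delta>: "\<delta> > 0" "\<forall>s\<in>{0..1}. \<forall>t\<in>{0..1}. \<bar>s - x\<bar> < \<delta> \<longrightarrow> \<bar>t - x\<bar> < \<delta> \<longrightarrow> s \<le> t \<longrightarrow>
      ennreal (dist (\<Gamma> s) (\<Gamma> t)) \<le> M * ?L s t"
      using assms[of x] by auto
    show "\<exists>d>0. \<forall>a b. a \<le> x \<and> x \<le> b \<and> b - a < d \<longrightarrow> 0 \<le> a \<and> b \<le> 1 \<longrightarrow>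
        ennreal (dist (\<Gamma> a) (\<Gamma> b)) \<le> M * ?L a b"
      by (rule exI[of _ \<delta>]) (use \<delta> in auto)
  qed simp
  then show ?thesis by simp
qed

lemma min_one_divide:
  fixes e k :: real
  assumes "e > 0" "k > 0"
  shows "min 1 (e / k) > 0" "min 1 (e / k) \<le> 1" "min 1 (e / k) * k \<le> e"
  using assms by (auto simp: min_def field_simps)

section \<open>Riemannian geometry\<close>

locale riemannian =
  fixes A :: "('a::metric_space, 'e::euclidean_space) chart set" and R :: "('a, 'e) metric_tensor"
  assumes riem: "riemannian_manifold A R"
begin

text \<open>The tangent norm read in an arbitrary chart \<open>c\<close>, whereas
  \<open>tnorm\<close> is bound to the chart chosen at the point; \<open>nrm_transition\<close>
  links the two.\<close>

definition nrm :: "('a, 'e) chart \<Rightarrow> 'a \<Rightarrow> 'e \<Rightarrow> real" where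
  "nrm c x v = sqrt (R c x v v)"

definition transition :: "('a, 'e) chart \<Rightarrow> ('a, 'e) chart \<Rightarrow> 'a \<Rightarrow> 'e \<Rightarrow> 'e" where
  "transition c d x = frechet_derivative (snd d \<circ> chart_inv c) (at (snd c x))"

lemma atlas: "smooth_atlas A" and metric: "riemannian_metric A R"
  and dist_eq: "riem_dist A R x y = ennreal (dist x y)"
  using riem unfolding riemannian_manifold_def by auto

lemma chart_at: "chart_at A x \<in> A" "x \<in> fst (chart_at A x)"
proof -
  have "\<exists>c. c \<in> A \<and> x \<in> fst c" using atlas unfolding smooth_atlas_def by blast
  from someI_ex[OF this] show "chart_at A x \<in> A" "x \<in> fst (chart_at A x)"
    unfolding chart_at_def by auto
qed

lemma chart:
  assumes "c \<in> A"
  shows "open (fst c)" "open (snd c ` fst c)" "continuous_on (fst c) (snd c)"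
    "continuous_on (snd c ` fst c) (chart_inv c)" "homeomorphism (fst c) (snd c ` fst c) (snd c) (chart_inv c)"
  using assms atlas unfolding smooth_atlas_def homeomorphism_def by blast+

lemma chart_inv: "c \<in> A \<Longrightarrow> x \<in> fst c \<Longrightarrow> chart_inv c (snd c x) = x"
  using chart(5)[of c] unfolding homeomorphism_def by blast

lemma chart_inv2: "c \<in> A \<Longrightarrow> z \<in> snd c ` fst c \<Longrightarrow> snd c (chart_inv c z) = z \<and> chart_inv c z \<in> fst c"
  using chart(5)[of c] unfolding homeomorphism_def by (metis image_eqI)

lemma chart_isCont: "c \<in> A \<Longrightarrow> x \<in> fst c \<Longrightarrow> isCont (snd c) x"
  using chart(1,3)[of c] continuous_on_eq_continuous_at by blast

lemma chart_image_open:
  assumes "c \<in> A" "open S" "S \<subseteq> fst c"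
  shows "open (snd c ` S)"
proof -
  have "openin (top_of_set (snd c ` fst c)) (snd c ` S)"
    using homeomorphism_imp_open_map[OF chart(5)[OF assms(1)]] assms(2,3)
    by (simp add: openin_open_eq chart(1)[OF assms(1)])
  then show ?thesis using chart(2)[OF assms(1)] openin_open_eq by blast
qed

lemma transition_deriv:
  assumes "c \<in> A" "d \<in> A" "x \<in> fst c" "x \<in> fst d"
  shows "((snd d \<circ> chart_inv c) has_derivative transition c d x) (at (snd c x))"
proof -
  have "Ck_on (Suc 0) (snd c ` (fst c \<inter> fst d)) (snd d \<circ> chart_inv c)"
    using atlas assms(1,2) unfolding smooth_atlas_def by blast
  then show ?thesis
    using assms(3,4) unfolding transition_def by (auto simp: frechet_derivative_works)
qed

lemma transition_cont:
  assumes "c \<in> A" "d \<in> A"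
  shows "continuous_on (snd c ` (fst c \<inter> fst d)) (\<lambda>z. frechet_derivative (snd d \<circ> chart_inv c) (at z) v)"
proof -
  have "Ck_on (Suc 0) (snd c ` (fst c \<inter> fst d)) (snd d \<circ> chart_inv c)"
    using atlas assms(1,2) unfolding smooth_atlas_def by blast
  then show ?thesis by simp
qed

lemma tensor:
  assumes "c \<in> A" "x \<in> fst c"
  shows "bilinear (R c x)" "R c x v w = R c x w v" "v \<noteq> 0 \<Longrightarrow> R c x v v > 0"
  using metric assms unfolding riemannian_metric_def by blast+

lemma tensor_linear:
  assumes "c \<in> A" "x \<in> fst c"
  shows "linear (R c x v)" "linear (\<lambda>v. R c x v w)"
  using tensor(1)[OF assms] unfolding bilinear_def by auto

lemma tensor_diff:
  assumes "c \<in> A" "x \<in> fst c"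
  shows "R c x (v - w) u = R c x v u - R c x w u" "R c x u (v - w) = R c x u v - R c x u w"
    "R c x (v + w) u = R c x v u + R c x w u" "R c x u (v + w) = R c x u v + R c x u w"
    "R c x (a *\<^sub>R v) u = a * R c x v u" "R c x u (a *\<^sub>R v) = a * R c x u v"
  using linear_diff[OF tensor_linear(1)[OF assms]] linear_diff[OF tensor_linear(2)[OF assms]]
    linear_add[OF tensor_linear(1)[OF assms]] linear_add[OF tensor_linear(2)[OF assms]]
    linear_cmul[OF tensor_linear(1)[OF assms]] linear_cmul[OF tensor_linear(2)[OF assms]]
  by auto

lemma tensor_bounded: "c \<in> A \<Longrightarrow> x \<in> fst c \<Longrightarrow> bounded_bilinear (R c x)"
  using tensor(1) by (simp add: bilinear_conv_bounded_bilinear)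

lemma tensor_cont:
  assumes c: "c \<in> A" "x \<in> fst c"
  shows "isCont (\<lambda>y. R c y v w) x"
proof -
  have "Ck_on 0 (snd c ` fst c) (\<lambda>z. R c (chart_inv c z) v w)"
    using metric c unfolding riemannian_metric_def by blast
  then have "continuous_on (fst c) (\<lambda>y. R c (chart_inv c (snd c y)) v w)"
    using continuous_on_compose2[OF _ chart(3)[OF c(1)]] by fastforce
  then have "continuous_on (fst c) (\<lambda>y. R c y v w)"
    by (rule continuous_on_eq) (simp add: chart_inv c)
  then show ?thesis using chart(1)[OF c(1)] c(2) continuous_on_eq_continuous_at by blast
qed

lemma nrm_transition:
  assumes "c \<in> A" "d \<in> A" "x \<in> fst c" "x \<in> fst d"
  shows "nrm d x (transition c d x v) = nrm c x v"
proof -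
  have "\<forall>c\<in>A. \<forall>d\<in>A. \<forall>x\<in>fst c \<inter> fst d. \<forall>v w.
        R c x v w = R d x (frechet_derivative (snd d \<circ> chart_inv c) (at (snd c x)) v)
                          (frechet_derivative (snd d \<circ> chart_inv c) (at (snd c x)) w)"
    using metric unfolding riemannian_metric_def by (elim conjE)
  then have "R c x v v = R d x (transition c d x v) (transition c d x v)"
    using assms unfolding transition_def by (meson IntI)
  then show ?thesis by (simp add: nrm_def)
qed

lemma tnorm_eq: "tnorm A R x = nrm (chart_at A x) x"
  unfolding tnorm_def nrm_def by auto

lemma R_nonneg: "c \<in> A \<Longrightarrow> x \<in> fst c \<Longrightarrow> R c x v v \<ge> 0"
  using tensor(3)[of c x v] linear_0[OF tensor_linear(1), of c x 0] by (cases "v = 0") (auto simp: less_imp_le)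

lemma nrm_nonneg: "c \<in> A \<Longrightarrow> x \<in> fst c \<Longrightarrow> nrm c x v \<ge> 0"
  unfolding nrm_def using R_nonneg by simp

lemma nrm_pos: "c \<in> A \<Longrightarrow> x \<in> fst c \<Longrightarrow> v \<noteq> 0 \<Longrightarrow> nrm c x v > 0"
  unfolding nrm_def using tensor(3) by simp

lemma nrm_power2: "c \<in> A \<Longrightarrow> x \<in> fst c \<Longrightarrow> (nrm c x v)\<^sup>2 = R c x v v"
  unfolding nrm_def using R_nonneg by simp

lemma nrm_scale: "c \<in> A \<Longrightarrow> x \<in> fst c \<Longrightarrow> nrm c x (a *\<^sub>R v) = \<bar>a\<bar> * nrm c x v"
  unfolding nrm_def using linear_cmul[OF tensor_linear(1)] linear_cmul[OF tensor_linear(2)]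
  by (simp add: real_sqrt_mult flip: mult.assoc power2_eq_square)

lemma nrm_zero: "c \<in> A \<Longrightarrow> x \<in> fst c \<Longrightarrow> nrm c x 0 = 0"
  using nrm_scale[of c x 0 0] by simp

lemma Cauchy_Schwarz:
  assumes c: "c \<in> A" "x \<in> fst c"
  shows "R c x v w \<le> nrm c x v * nrm c x w"
proof (cases "w = 0")
  case True
  then show ?thesis using linear_0[OF tensor_linear(1)[OF c]] nrm_zero[OF c] by simp
next
  case False
  define t where "t = R c x v w / R c x w w"
  have pos: "R c x w w > 0" using tensor(3)[OF c False] .
  have "0 \<le> R c x (v - t *\<^sub>R w) (v - t *\<^sub>R w)" by (rule R_nonneg[OF c])
  also have "\<dots> = R c x v v - 2 * t * R c x v w + t * t * R c x w w"
    using tensor(2)[OF c, of w v] by (simp add: tensor_diff[OF c] algebra_simps)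
  also have "\<dots> = R c x v v - (R c x v w)\<^sup>2 / R c x w w"
    using pos by (simp add: t_def power2_eq_square field_simps)
  finally have "(R c x v w)\<^sup>2 \<le> (nrm c x v * nrm c x w)\<^sup>2"
    using pos by (simp add: power_mult_distrib nrm_power2[OF c] field_simps)
  then show ?thesis
    by (rule power2_le_imp_le) (intro mult_nonneg_nonneg nrm_nonneg[OF c])
qed

lemma nrm_triangle:
  assumes c: "c \<in> A" "x \<in> fst c"
  shows "nrm c x (v + w) \<le> nrm c x v + nrm c x w"
proof (rule power2_le_imp_le)
  have "(nrm c x (v + w))\<^sup>2 = R c x v v + 2 * R c x v w + R c x w w"
    using tensor(2)[OF c, of w v] by (simp add: nrm_power2[OF c] tensor_diff[OF c])
  also have "\<dots> \<le> (nrm c x v + nrm c x w)\<^sup>2"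
    using Cauchy_Schwarz[OF c, of v w] by (simp add: power2_sum nrm_power2[OF c])
  finally show "(nrm c x (v + w))\<^sup>2 \<le> (nrm c x v + nrm c x w)\<^sup>2" .
qed (use nrm_nonneg[OF c] in auto)

lemma nrm_le_norm:
  assumes c: "c \<in> A" "x \<in> fst c"
  obtains K where "K > 0" "\<And>v. nrm c x v \<le> K * norm v"
proof -
  obtain K where K: "\<And>v w. norm (R c x v w) \<le> norm v * norm w * K" "K > 0"
    using bounded_bilinear.pos_bounded[OF tensor_bounded[OF c]] by blast
  have "nrm c x v \<le> sqrt K * norm v" for v
  proof (rule power2_le_imp_le)
    show "(nrm c x v)\<^sup>2 \<le> (sqrt K * norm v)\<^sup>2"
      unfolding nrm_power2[OF c] power_mult_distrib
      using K(1)[of v v] K(2) by (simp add: power2_eq_square mult_ac)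
  qed (use K in auto)
  then show ?thesis using that[of "sqrt K"] K(2) by simp
qed

lemma norm_le_nrm:
  assumes c: "c \<in> A" "x \<in> fst c"
  obtains m where "m > 0" "\<And>v. m * norm v \<le> nrm c x v"
proof -
  obtain i :: 'e where i: "i \<in> Basis" by (metis ex_in_conv nonempty_Basis)
  have "\<exists>v\<in>sphere (0::'e) 1. \<forall>w\<in>sphere 0 1. nrm c x v \<le> nrm c x w"
  proof (rule continuous_attains_inf)
    show "sphere (0::'e) 1 \<noteq> {}" using i by (metis empty_iff mem_sphere_0 norm_Basis)
    show "continuous_on (sphere 0 1) (nrm c x)" unfolding nrm_def
      by (intro continuous_intros bounded_bilinear.continuous_on[OF tensor_bounded[OF c]])
  qed simp
  then obtain v0 where v0: "norm v0 = 1" "\<And>w. norm w = 1 \<Longrightarrow> nrm c x v0 \<le> nrm c x w" by auto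
  have "nrm c x v0 * norm v \<le> nrm c x v" for v
  proof (cases "v = 0")
    case False
    have "nrm c x v0 \<le> nrm c x ((1 / norm v) *\<^sub>R v)" by (rule v0) (use False in simp)
    then show ?thesis using False by (simp add: nrm_scale[OF c] field_simps)
  qed (simp add: nrm_nonneg[OF c])
  moreover have "nrm c x v0 > 0" using v0 by (intro nrm_pos c) auto
  ultimately show ?thesis using that by blast
qed

lemma tensor_diag_diff:
  assumes c: "c \<in> A" "x \<in> fst c" "y \<in> fst c"
  shows "\<bar>R c y v v - R c x v v\<bar> \<le> (\<Sum>i\<in>Basis. \<Sum>j\<in>Basis. \<bar>R c y i j - R c x i j\<bar>) * (norm v)\<^sup>2"
proof -
  have ex: "R c z v v = (\<Sum>i\<in>Basis. \<Sum>j\<in>Basis. (v \<bullet> i) * (v \<bullet> j) * R c z i j)" if "z \<in> fst c" for z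
  proof -
    have "R c z v v = R c z (\<Sum>i\<in>Basis. (v \<bullet> i) *\<^sub>R i) (\<Sum>j\<in>Basis. (v \<bullet> j) *\<^sub>R j)"
      by (simp add: euclidean_representation)
    also have "\<dots> = (\<Sum>i\<in>Basis. \<Sum>j\<in>Basis. (v \<bullet> i) * (v \<bullet> j) * R c z i j)"
      unfolding linear_sum[OF tensor_linear(2)[OF c(1) that]] linear_sum[OF tensor_linear(1)[OF c(1) that]]
      by (simp add: tensor_diff[OF c(1) that] mult.assoc)
        (intro sum.cong refl, subst tensor(2)[OF c(1) that], simp)
    finally show ?thesis .
  qed
  have "R c y v v - R c x v v = (\<Sum>i\<in>Basis. \<Sum>j\<in>Basis. (v \<bullet> i) * (v \<bullet> j) * (R c y i j - R c x i j))"
    unfolding ex[OF c(3)] ex[OF c(2)] sum_subtractf[symmetric] by (simp add: algebra_simps)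
  also have "\<bar>\<dots>\<bar> \<le> (\<Sum>i\<in>Basis. \<Sum>j\<in>Basis. \<bar>R c y i j - R c x i j\<bar> * (norm v)\<^sup>2)"
  proof (intro order.trans[OF sum_abs] sum_mono)
    fix i j :: 'e assume "i \<in> Basis" "j \<in> Basis"
    then have "\<bar>v \<bullet> i\<bar> * \<bar>v \<bullet> j\<bar> \<le> norm v * norm v" by (intro mult_mono Basis_le_norm) auto
    then have "\<bar>v \<bullet> i\<bar> * \<bar>v \<bullet> j\<bar> * \<bar>R c y i j - R c x i j\<bar> \<le> norm v * norm v * \<bar>R c y i j - R c x i j\<bar>"
      by (rule mult_right_mono) simp
    then show "\<bar>(v \<bullet> i) * (v \<bullet> j) * (R c y i j - R c x i j)\<bar> \<le> \<bar>R c y i j - R c x i j\<bar> * (norm v)\<^sup>2"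
      by (simp add: abs_mult power2_eq_square mult.commute)
  qed
  finally show ?thesis by (simp add: sum_distrib_right)
qed

text \<open>Only single entries of the metric tensor are known to vary continuously. Uniformity in
  \<open>v\<close> comes from comparing the sum of the entry changes with \<open>e * m^2\<close>,
  where \<open>m\<close> bounds the norm at \<open>x\<close> from below by the Euclidean one; roots
  are then taken with \<open>(1 - e)^2 \<le> 1 - e\<close> and
  \<open>1 + e \<le> (1 + e)^2\<close>.\<close>

lemma nrm_locally_uniform:
  assumes c: "c \<in> A" "x \<in> fst c" and e: "e > 0" "e < 1"
  shows "\<forall>\<^sub>F y in nhds x. y \<in> fst c \<and>
    (\<forall>v. (1 - e) * nrm c x v \<le> nrm c y v \<and> nrm c y v \<le> (1 + e) * nrm c x v)"
proof -
  obtain m where m: "m > 0" "\<And>v. m * norm v \<le> nrm c x v" using norm_le_nrm[OF c] by blast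
  have "((\<lambda>y. \<Sum>i\<in>Basis. \<Sum>j\<in>Basis. \<bar>R c y i j - R c x i j\<bar>) \<longlongrightarrow> (\<Sum>i\<in>Basis. \<Sum>j\<in>Basis. \<bar>R c x i j - R c x i j\<bar>)) (nhds x)"
    using tensor_cont[OF c] tendsto_at_iff_tendsto_nhds[of "\<lambda>y. R c y v w" x for v w]
    by (intro tendsto_intros) (auto simp: isCont_def)
  then have "\<forall>\<^sub>F y in nhds x. (\<Sum>i\<in>Basis. \<Sum>j\<in>Basis. \<bar>R c y i j - R c x i j\<bar>) < e * m\<^sup>2"
    by (rule order_tendstoD) (use e m in auto)
  moreover have "\<forall>\<^sub>F y in nhds x. y \<in> fst c"
    using chart(1)[OF c(1)] c(2) by (simp add: eventually_nhds_in_open)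
  ultimately show ?thesis
  proof eventually_elim
    case (elim y)
    have "\<bar>R c y v v - R c x v v\<bar> \<le> e * R c x v v" for v
    proof -
      have "\<bar>R c y v v - R c x v v\<bar> \<le> (e * m\<^sup>2) * (norm v)\<^sup>2"
        by (rule order.trans[OF tensor_diag_diff[OF c elim(2)] mult_right_mono]) (use elim(1) in auto)
      also have "\<dots> = e * (m * norm v)\<^sup>2" by (simp add: power_mult_distrib)
      also have "\<dots> \<le> e * (nrm c x v)\<^sup>2"
        using m e by (intro mult_left_mono power_mono) auto
      finally show ?thesis by (simp add: nrm_power2[OF c])
    qed note 1 = this
    have "(1 - e) * nrm c x v \<le> nrm c y v" for v
    proof (rule power2_le_imp_le)
      have "((1 - e) * nrm c x v)\<^sup>2 = (1 - e) * ((1 - e) * R c x v v)"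
        unfolding power_mult_distrib nrm_power2[OF c] by (simp add: power2_eq_square)
      also have "\<dots> \<le> 1 * ((1 - e) * R c x v v)"
        using e R_nonneg[OF c] by (intro mult_right_mono) auto
      also have "\<dots> \<le> R c y v v" using 1[of v] by (simp add: abs_le_iff algebra_simps)
      finally show "((1 - e) * nrm c x v)\<^sup>2 \<le> (nrm c y v)\<^sup>2" using nrm_power2[OF c(1) elim(2)] by simp
    qed (rule nrm_nonneg[OF c(1) elim(2)])
    moreover have "nrm c y v \<le> (1 + e) * nrm c x v" for v
    proof (rule power2_le_imp_le)
      have "R c y v v \<le> 1 * ((1 + e) * R c x v v)" using 1[of v] by (simp add: abs_le_iff algebra_simps)
      also have "\<dots> \<le> (1 + e) * ((1 + e) * R c x v v)"
        using e R_nonneg[OF c] by (intro mult_right_mono) auto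
      also have "\<dots> = ((1 + e) * nrm c x v)\<^sup>2"
        unfolding power_mult_distrib nrm_power2[OF c] by (simp add: power2_eq_square)
      finally show "(nrm c y v)\<^sup>2 \<le> ((1 + e) * nrm c x v)\<^sup>2" using nrm_power2[OF c(1) elim(2)] by simp
    qed (use e nrm_nonneg[OF c] in simp)
    ultimately show ?case using elim(2) by blast
  qed
qed

text \<open>The straight segment in the chart is an admissible curve, and near \<open>x\<close> its
  speed is almost its norm at \<open>x\<close>; its length bounds the Riemannian distance, which is
  the distance of the type.\<close>

lemma dist_le_nrm:
  assumes c: "c \<in> A" "x \<in> fst c" and e: "e > 0"
  shows "\<exists>\<delta>>0. \<forall>y z. dist y x < \<delta> \<longrightarrow> dist z x < \<delta> \<longrightarrow> dist y z \<le> (1 + e) * nrm c x (snd c z - snd c y)"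
proof -
  \<comment> \<open>The local comparison of norms asks for an error below 1.\<close>
  define e' where "e' = min e (1/2)"
  have e': "e' > 0" "e' < 1" "e' \<le> e" using e by (auto simp: e'_def)
  have "isCont (chart_inv c) (snd c x)"
    using chart(2,4)[OF c(1)] c(2) continuous_on_eq_continuous_at by blast
  then have "((chart_inv c) \<longlongrightarrow> chart_inv c (snd c x)) (nhds (snd c x))"
    unfolding isCont_def tendsto_at_iff_tendsto_nhds .
  then have lim: "filterlim (chart_inv c) (nhds x) (nhds (snd c x))"
    by (simp only: chart_inv[OF c])
  have "\<forall>\<^sub>F z in nhds (snd c x). z \<in> snd c ` fst c"
    using chart(2)[OF c(1)] c(2) by (simp add: eventually_nhds_in_open)
  with eventually_compose_filterlim[OF nrm_locally_uniform[OF c e'(1,2)] lim]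
  have "\<forall>\<^sub>F z in nhds (snd c x). z \<in> snd c ` fst c \<and> (\<forall>v. nrm c (chart_inv c z) v \<le> (1 + e') * nrm c x v)"
    by eventually_elim auto
  then obtain r where r: "r > 0" "\<And>z. dist z (snd c x) < r \<Longrightarrow> z \<in> snd c ` fst c"
    "\<And>z v. dist z (snd c x) < r \<Longrightarrow> nrm c (chart_inv c z) v \<le> (1 + e') * nrm c x v"
    by (auto simp: eventually_nhds_metric)
  have "\<forall>\<^sub>F y in nhds x. y \<in> fst c \<and> dist (snd c y) (snd c x) < r"
  proof (rule eventually_conj)
    show "\<forall>\<^sub>F y in nhds x. y \<in> fst c" using chart(1)[OF c(1)] c(2) by (simp add: eventually_nhds_in_open)
    show "\<forall>\<^sub>F y in nhds x. dist (snd c y) (snd c x) < r"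
      using chart_isCont[OF c, unfolded isCont_def tendsto_at_iff_tendsto_nhds] r(1) by (rule tendstoD)
  qed
  then obtain \<delta> where \<delta>: "\<delta> > 0" "\<And>y. dist y x < \<delta> \<Longrightarrow> y \<in> fst c \<and> dist (snd c y) (snd c x) < r"
    by (auto simp: eventually_nhds_metric)
  have "dist y z \<le> (1 + e) * nrm c x (snd c z - snd c y)" if y: "dist y x < \<delta>" and z: "dist z x < \<delta>" for y z
  proof -
    define w where "w = snd c z - snd c y"
    define l where "l t = snd c y + t *\<^sub>R w" for t
    define \<gamma> where "\<gamma> = chart_inv c \<circ> l"
    have yz: "y \<in> fst c" "z \<in> fst c" using \<delta>(2) y z by auto
    have l_ball: "dist (l t) (snd c x) < r" if "t \<in> {0..1}" for t
    proof -
      have "l t = (1 - t) *\<^sub>R snd c y + t *\<^sub>R snd c z" by (simp add: l_def w_def algebra_simps)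
      moreover have "snd c y \<in> ball (snd c x) r" "snd c z \<in> ball (snd c x) r"
        using \<delta>(2)[OF y] \<delta>(2)[OF z] by (auto simp: dist_commute)
      ultimately have "l t \<in> ball (snd c x) r"
        using convex_ball[of "snd c x" r] that unfolding convex_alt by auto
      then show ?thesis by (simp add: dist_commute)
    qed
    have l_in: "l t \<in> snd c ` fst c" if "t \<in> {0..1}" for t using r(2) l_ball that by blast
    have l_\<gamma>: "snd c (\<gamma> t) = l t" "\<gamma> t \<in> fst c" if "t \<in> {0..1}" for t
      using chart_inv2[OF c(1) l_in[OF that]] by (auto simp: \<gamma>_def)
    have l_deriv: "(l has_vector_derivative w) (at t)" for t
      unfolding l_def by (auto intro!: derivative_eq_intros)
    have l_cont: "continuous_on S l" for S unfolding l_def by (intro continuous_intros)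
    have deriv: "((snd d \<circ> \<gamma>) has_vector_derivative frechet_derivative (snd d \<circ> chart_inv c) (at (l t)) w) (at t)"
      if "d \<in> A" "t \<in> {0..1}" "\<gamma> t \<in> fst d" for d t
    proof -
      have "((snd d \<circ> chart_inv c) has_derivative transition c d (\<gamma> t)) (at (l t))"
        using transition_deriv[OF c(1) that(1) l_\<gamma>(2)[OF that(2)] that(3)] l_\<gamma>(1)[OF that(2)] by simp
      then have "((snd d \<circ> chart_inv c) \<circ> l has_vector_derivative transition c d (\<gamma> t) w) (at t)"
        by (rule vector_derivative_diff_chain_within[OF l_deriv has_derivative_at_withinI])
      then show ?thesis
        unfolding transition_def \<gamma>_def using l_\<gamma>(1)[OF that(2)] by (simp add: o_assoc \<gamma>_def)
    qed
    \<comment> \<open>Admissibility is tested in every chart of the atlas, so the segment is pushed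
      through all coordinate changes.\<close>
    have curve: "pw_C1_curve A \<gamma>"
      unfolding pw_C1_curve_def
    proof (intro conjI ballI)
      show "path \<gamma>" unfolding path_def \<gamma>_def
        by (rule continuous_on_compose[OF l_cont continuous_on_subset[OF chart(4)[OF c(1)]]]) (use l_in in auto)
      fix d assume d: "d \<in> A"
      have "(snd d \<circ> \<gamma>) C1_differentiable_on {t \<in> {0..1}. \<gamma> t \<in> fst d}"
        unfolding C1_differentiable_on_def
      proof (intro exI conjI ballI)
        show "((snd d \<circ> \<gamma>) has_vector_derivative frechet_derivative (snd d \<circ> chart_inv c) (at (l t)) w) (at t)"
          if "t \<in> {t \<in> {0..1}. \<gamma> t \<in> fst d}" for t using deriv[OF d] that by auto
        show "continuous_on {t \<in> {0..1}. \<gamma> t \<in> fst d} (\<lambda>t. frechet_derivative (snd d \<circ> chart_inv c) (at (l t)) w)"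
        proof (rule continuous_on_compose2[OF transition_cont[OF c(1) d] l_cont])
          show "l ` {t \<in> {0..1}. \<gamma> t \<in> fst d} \<subseteq> snd c ` (fst c \<inter> fst d)"
            using l_\<gamma> by force
        qed
      qed
      then show "(snd d \<circ> \<gamma>) piecewise_C1_differentiable_on {t \<in> {0..1}. \<gamma> t \<in> fst d}"
        by (rule C1_differentiable_imp_piecewise)
    qed
    have ends: "pathstart \<gamma> = y" "pathfinish \<gamma> = z"
      using chart_inv[OF c(1)] yz by (auto simp: pathstart_def pathfinish_def \<gamma>_def l_def w_def)
    have "curve_length A R \<gamma> \<le> (\<integral>\<^sup>+t\<in>{0..1::real}. ennreal ((1 + e) * nrm c x w) \<partial>lborel)"
      unfolding curve_length_def
    proof (intro nn_integral_mono)
      fix t :: real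
      show "ennreal (tnorm A R (\<gamma> t) (vector_derivative (snd (chart_at A (\<gamma> t)) \<circ> \<gamma>) (at t))) * indicator {0..1} t
        \<le> ennreal ((1 + e) * nrm c x w) * indicator {0..1} t"
      proof (cases "t \<in> {0..1}")
        case t: True
        define d where "d = chart_at A (\<gamma> t)"
        have d: "d \<in> A" "\<gamma> t \<in> fst d" using chart_at by (auto simp: d_def)
        have "vector_derivative (snd d \<circ> \<gamma>) (at t) = transition c d (\<gamma> t) w"
          using vector_derivative_at[OF deriv[OF d(1) t d(2)]] l_\<gamma>[OF t] by (simp add: transition_def)
        then have "tnorm A R (\<gamma> t) (vector_derivative (snd d \<circ> \<gamma>) (at t)) = nrm c (\<gamma> t) w"
          unfolding tnorm_eq using nrm_transition[OF c(1) d(1) l_\<gamma>(2)[OF t] d(2)] by (simp add: d_def)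
        also have "\<dots> \<le> (1 + e') * nrm c x w"
          using r(3)[OF l_ball[OF t]] by (simp add: \<gamma>_def)
        also have "\<dots> \<le> (1 + e) * nrm c x w"
          using e' nrm_nonneg[OF c] by (intro mult_right_mono) auto
        finally show ?thesis unfolding d_def by (intro mult_right_mono ennreal_leI) auto
      qed simp
    qed
    also have "\<dots> = ennreal ((1 + e) * nrm c x w)"
      by (subst nn_integral_cmult_indicator) auto
    finally have "riem_dist A R y z \<le> ennreal ((1 + e) * nrm c x w)"
      unfolding riem_dist_def using curve ends by (intro INF_lower2[of \<gamma>]) auto
    then show ?thesis
      unfolding dist_eq w_def using nrm_nonneg[OF c] e by (simp add: ennreal_le_iff)
  qed
  then show ?thesis using \<delta>(1) by blast
qed

section \<open>Lengths of curves and displacements in charts\<close>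

abbreviation cdist :: "'a \<Rightarrow> 'a \<Rightarrow> 'a \<Rightarrow> real" where
  "cdist x y z \<equiv> nrm (chart_at A x) x (snd (chart_at A x) y - snd (chart_at A x) z)"

definition speed :: "(real \<Rightarrow> 'a) \<Rightarrow> real \<Rightarrow> ennreal" where
  "speed \<gamma> \<tau> = ennreal (tnorm A R (\<gamma> \<tau>) (vector_derivative (snd (chart_at A (\<gamma> \<tau>)) \<circ> \<gamma>) (at \<tau>)))"

abbreviation len :: "(real \<Rightarrow> 'a) \<Rightarrow> real \<Rightarrow> real \<Rightarrow> ennreal" where
  "len \<gamma> s t \<equiv> (\<integral>\<^sup>+\<tau>\<in>{s<..t}. speed \<gamma> \<tau> \<partial>lborel)"

text \<open>A short piece of a curve is nearly as long as its chord or longer. The chord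
  \<open>w\<close> is paired with the derivative in the inner product frozen at
  \<open>\<gamma> t0\<close>: the integral is the squared norm of \<open>w\<close> by the
  fundamental theorem, and Cauchy-Schwarz bounds the integrand by the norm of \<open>w\<close> times
  that of the derivative.\<close>

lemma curve_chart_le:
  assumes curve: "pw_C1_curve A \<gamma>" and t0: "t0 \<in> {0..1}" and c: "c \<in> A" "\<gamma> t0 \<in> fst c"
    and e: "e > 0" "e < 1"
  shows "\<exists>\<delta>>0. \<forall>s\<in>{0..1}. \<forall>t\<in>{0..1}. \<bar>s - t0\<bar> < \<delta> \<longrightarrow> \<bar>t - t0\<bar> < \<delta> \<longrightarrow> s \<le> t \<longrightarrow>
    ennreal ((1 - e) * nrm c (\<gamma> t0) (snd c (\<gamma> t) - snd c (\<gamma> s))) \<le> len \<gamma> s t"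
proof -
  define x where "x = \<gamma> t0"
  have cx: "c \<in> A" "x \<in> fst c" using c by (auto simp: x_def)
  have \<gamma>_cont: "continuous_on {0..1} \<gamma>" using curve by (simp add: pw_C1_curve_def path_def)
  have "\<forall>\<^sub>F y in nhds x. y \<in> fst c \<and> (\<forall>v. (1 - e) * nrm c x v \<le> nrm c y v)"
    using nrm_locally_uniform[OF cx e] by eventually_elim auto
  moreover have "filterlim \<gamma> (nhds x) (at t0 within {0..1})"
    using \<gamma>_cont t0 unfolding continuous_on_def x_def by blast
  ultimately have "\<forall>\<^sub>F \<tau> in at t0 within {0..1}. \<gamma> \<tau> \<in> fst c \<and> (\<forall>v. (1 - e) * nrm c x v \<le> nrm c (\<gamma> \<tau>) v)"
    by (rule eventually_compose_filterlim)
  then obtain \<delta> where \<delta>: "\<delta> > 0" and \<delta>1: "\<And>\<tau>. \<tau> \<in> {0..1} \<Longrightarrow> \<tau> \<noteq> t0 \<Longrightarrow> dist \<tau> t0 < \<delta> \<Longrightarrow>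
      \<gamma> \<tau> \<in> fst c \<and> (\<forall>v. (1 - e) * nrm c x v \<le> nrm c (\<gamma> \<tau>) v)"
    unfolding eventually_at by blast
  have near: "\<gamma> \<tau> \<in> fst c" "(1 - e) * nrm c x v \<le> nrm c (\<gamma> \<tau>) v" if "\<tau> \<in> {0..1}" "\<bar>\<tau> - t0\<bar> < \<delta>" for \<tau> v
  proof -
    have "(1 - e) * nrm c x v \<le> 1 * nrm c x v"
      using e nrm_nonneg[OF cx] by (intro mult_right_mono) auto
    then show "\<gamma> \<tau> \<in> fst c" "(1 - e) * nrm c x v \<le> nrm c (\<gamma> \<tau>) v"
      using \<delta>1[of \<tau>] that cx by (cases "\<tau> = t0"; auto simp: dist_real_def x_def)+
  qed
  let ?T = "{\<tau> \<in> {0..1}. \<gamma> \<tau> \<in> fst c}"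
  have "(snd c \<circ> \<gamma>) piecewise_C1_differentiable_on ?T"
    using curve c unfolding pw_C1_curve_def by blast
  then obtain F D where F: "finite F" and D: "\<And>\<tau>. \<tau> \<in> ?T - F \<Longrightarrow> ((snd c \<circ> \<gamma>) has_vector_derivative D \<tau>) (at \<tau>)"
    and D_cont: "continuous_on (?T - F) D" and u_cont: "continuous_on ?T (snd c \<circ> \<gamma>)"
    unfolding piecewise_C1_differentiable_on_def C1_differentiable_on_def by blast
  \<comment> \<open>The speed is measured in the chart chosen at \<open>\<gamma> \<tau>\<close>, the
    derivative \<open>D\<close> in \<open>c\<close>; the coordinate change relates the two without
    changing the norm.\<close>
  have speed: "speed \<gamma> \<tau> = ennreal (nrm c (\<gamma> \<tau>) (D \<tau>))" if \<tau>: "\<tau> \<in> {0<..<1}" "\<bar>\<tau> - t0\<bar> < \<delta>" "\<tau> \<notin> F" for \<tau>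
  proof -
    define d where "d = chart_at A (\<gamma> \<tau>)"
    have d: "d \<in> A" "\<gamma> \<tau> \<in> fst d" using chart_at by (auto simp: d_def)
    have in_c: "\<gamma> \<tau> \<in> fst c" using near(1) \<tau> by auto
    have u': "((snd c \<circ> \<gamma>) has_vector_derivative D \<tau>) (at \<tau>)" by (rule D) (use in_c \<tau> in auto)
    have "((snd d \<circ> chart_inv c) has_derivative transition c d (\<gamma> \<tau>)) (at ((snd c \<circ> \<gamma>) \<tau>))"
      using transition_deriv[OF c(1) d(1) in_c d(2)] by simp
    then have chain: "((snd d \<circ> chart_inv c) \<circ> (snd c \<circ> \<gamma>) has_vector_derivative transition c d (\<gamma> \<tau>) (D \<tau>)) (at \<tau>)"
      by (rule vector_derivative_diff_chain_within[OF u' has_derivative_at_withinI])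
    have eq: "((snd d \<circ> chart_inv c) \<circ> (snd c \<circ> \<gamma>)) \<tau>' = (snd d \<circ> \<gamma>) \<tau>'"
      if "\<tau>' \<in> {0<..<1} \<inter> ball t0 \<delta>" for \<tau>'
    proof -
      have "\<gamma> \<tau>' \<in> fst c" using near(1)[of \<tau>'] that by (auto simp: dist_real_def)
      then show ?thesis using chart_inv[OF c(1)] by simp
    qed
    have "((snd d \<circ> \<gamma>) has_vector_derivative transition c d (\<gamma> \<tau>) (D \<tau>)) (at \<tau>)"
      by (rule has_vector_derivative_transform_within_open[OF chain open_Int[OF open_greaterThanLessThan open_ball] _ eq])
        (use \<tau> in \<open>auto simp: dist_real_def\<close>)
    then show ?thesis
      using nrm_transition[OF c(1) d(1) in_c d(2)]
      by (simp add: speed_def vector_derivative_at tnorm_eq flip: d_def)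
  qed
  have "ennreal ((1 - e) * nrm c x (snd c (\<gamma> t) - snd c (\<gamma> s))) \<le> len \<gamma> s t"
    if st: "s \<in> {0..1}" "t \<in> {0..1}" "\<bar>s - t0\<bar> < \<delta>" "\<bar>t - t0\<bar> < \<delta>" "s \<le> t" for s t
  proof -
    define w where "w = snd c (\<gamma> t) - snd c (\<gamma> s)"
    define \<psi> where "\<psi> \<tau> = R c x w (D \<tau>)" for \<tau>
    show ?thesis
    proof (cases "w = 0")
      case True
      then show ?thesis using nrm_zero[OF cx] by (simp flip: w_def)
    next
      case False
      have w_pos: "nrm c x w > 0" using nrm_pos[OF cx False] .
      have in_T: "\<tau> \<in> ?T" if "\<tau> \<in> {s..t}" for \<tau> using near(1)[of \<tau>] st that by auto
      have bl: "bounded_linear (R c x w)"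
        using bounded_bilinear.bounded_linear_right[OF tensor_bounded[OF cx]] .
      have "(\<psi> has_integral (R c x w ((snd c \<circ> \<gamma>) t) - R c x w ((snd c \<circ> \<gamma>) s))) {s..t}"
      proof (rule fundamental_theorem_of_calculus_interior_strong[OF F \<open>s \<le> t\<close>])
        show "((\<lambda>\<tau>. R c x w ((snd c \<circ> \<gamma>) \<tau>)) has_vector_derivative \<psi> \<tau>) (at \<tau>)" if "\<tau> \<in> {s<..<t} - F" for \<tau>
          unfolding \<psi>_def by (rule bounded_linear.has_vector_derivative[OF bl D]) (use that in_T in auto)
        show "continuous_on {s..t} (\<lambda>\<tau>. R c x w ((snd c \<circ> \<gamma>) \<tau>))"
          by (rule bounded_linear.continuous_on[OF bl continuous_on_subset[OF u_cont]]) (use in_T in auto)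
      qed
      then have int: "(\<psi> has_integral (nrm c x w)\<^sup>2) {s..t}"
        by (simp add: tensor_diff[OF cx, symmetric] nrm_power2[OF cx] w_def)
      have "continuous_on ({s<..<t} - F) \<psi>"
        unfolding \<psi>_def
        by (rule bounded_linear.continuous_on[OF bl continuous_on_subset[OF D_cont]]) (use in_T in auto)
      from has_integral_le_nn_integral[OF int F this]
      have "ennreal ((1 - e) / nrm c x w) * ennreal ((nrm c x w)\<^sup>2)
          \<le> ennreal ((1 - e) / nrm c x w) * (\<integral>\<^sup>+\<tau>\<in>{s<..<t} - F. ennreal (\<psi> \<tau>) \<partial>lborel)"
        by (rule mult_left_mono) simp
      also have "\<dots> = (\<integral>\<^sup>+\<tau>. ennreal ((1 - e) / nrm c x w) * (ennreal (\<psi> \<tau>) * indicator ({s<..<t} - F) \<tau>) \<partial>lborel)"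
      proof (rule nn_integral_cmult[symmetric])
        have op: "{s<..<t} - F \<in> sets borel"
          using F by (intro borel_open open_Diff finite_imp_closed) auto
        have "(\<lambda>\<tau>. indicator ({s<..<t} - F) \<tau> *\<^sub>R \<psi> \<tau>) \<in> borel_measurable borel"
          by (rule borel_measurable_continuous_on_indicator[OF op \<open>continuous_on ({s<..<t} - F) \<psi>\<close>])
        then have "(\<lambda>\<tau>. ennreal (indicator ({s<..<t} - F) \<tau> *\<^sub>R \<psi> \<tau>)) \<in> borel_measurable lborel" by simp
        also have "(\<lambda>\<tau>. ennreal (indicator ({s<..<t} - F) \<tau> *\<^sub>R \<psi> \<tau>)) = (\<lambda>\<tau>. ennreal (\<psi> \<tau>) * indicator ({s<..<t} - F) \<tau>)"
          by (auto simp: indicator_def)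
        finally show "(\<lambda>\<tau>. ennreal (\<psi> \<tau>) * indicator ({s<..<t} - F) \<tau>) \<in> borel_measurable lborel" .
      qed
      also have "\<dots> \<le> len \<gamma> s t"
      proof (intro nn_integral_mono)
        fix \<tau> :: real
        show "ennreal ((1 - e) / nrm c x w) * (ennreal (\<psi> \<tau>) * indicator ({s<..<t} - F) \<tau>) \<le> speed \<gamma> \<tau> * indicator {s<..t} \<tau>"
        proof (cases "\<tau> \<in> {s<..<t} - F")
          case True
          have \<tau>: "\<tau> \<in> {0<..<1}" "\<bar>\<tau> - t0\<bar> < \<delta>" "\<tau> \<notin> F" using True st by auto
          have "(1 - e) / nrm c x w * \<psi> \<tau> \<le> (1 - e) / nrm c x w * (nrm c x w * nrm c x (D \<tau>))"
            unfolding \<psi>_def using e w_pos by (intro mult_left_mono Cauchy_Schwarz cx) auto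
          also have "\<dots> = (1 - e) * nrm c x (D \<tau>)" using w_pos by simp
          also have "\<dots> \<le> nrm c (\<gamma> \<tau>) (D \<tau>)" using near(2) \<tau> by simp
          finally show ?thesis
            using True e w_pos by (simp add: speed[OF \<tau>] ennreal_leI flip: ennreal_mult')
        qed simp
      qed
      finally show ?thesis
        using w_pos e by (simp add: power2_eq_square flip: w_def ennreal_mult')
    qed
  qed
  then show ?thesis using \<delta> unfolding x_def by blast
qed

end

section \<open>The inverse derivative of a local diffeomorphism and lifts of curves\<close>

locale riemannian_local_diffeo = riemannian A R
  for A :: "('a::metric_space, 'e::euclidean_space) chart set" and R :: "('a, 'e) metric_tensor" +
  fixes f :: "'a \<Rightarrow> 'a"
  assumes local_diffeo: "C1_local_diffeo A f"
begin

definition tder :: "('a, 'e) chart \<Rightarrow> ('a, 'e) chart \<Rightarrow> 'a \<Rightarrow> 'e \<Rightarrow> 'e" where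
  "tder c d x = frechet_derivative (snd d \<circ> f \<circ> chart_inv c) (at (snd c x))"

abbreviation a :: "'a \<Rightarrow> real" where
  "a \<equiv> inv_deriv_norm A R f"

lemma f_continuous: "continuous_on S f"
proof -
  have "isCont f x" for x
  proof -
    obtain U where "open U" "x \<in> U" "C1_map_on A U f"
      using local_diffeo unfolding C1_local_diffeo_def by meson
    then show ?thesis
      unfolding C1_map_on_def using continuous_on_eq_continuous_at by blast
  qed
  then show ?thesis by (simp add: continuous_at_imp_continuous_on)
qed

lemma f_isCont: "isCont f x"
  using f_continuous[of UNIV] continuous_on_eq_continuous_at[of UNIV f] by auto

lemma chart_nbhd:
  assumes c: "c \<in> A" "x \<in> fst c" and d: "d \<in> A" "f x \<in> fst d"
  obtains S g where "open S" "x \<in> S" "S \<subseteq> fst c" "f ` S \<subseteq> fst d"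
    "\<And>y. y \<in> S \<Longrightarrow> ((snd d \<circ> f \<circ> chart_inv c) has_derivative tder c d y) (at (snd c y))"
    "\<And>v. continuous_on (snd c ` S) (\<lambda>z. frechet_derivative (snd d \<circ> f \<circ> chart_inv c) (at z) v)"
    "\<And>y. y \<in> S \<Longrightarrow> g (f y) = y"
    "\<And>y. y \<in> S \<Longrightarrow> (snd c \<circ> g \<circ> chart_inv d) differentiable (at (snd d (f y)))"
proof -
  obtain U g where U: "open U" "x \<in> U" "C1_map_on A U f" "C1_map_on A (f ` U) g" "\<forall>y\<in>U. g (f y) = y"
    using local_diffeo unfolding C1_local_diffeo_def by meson
  define S where "S = U \<inter> fst c \<inter> f -` fst d"
  have "open (f -` fst d)" using continuous_on_open_vimage[OF open_UNIV, of f] f_continuous chart(1)[OF d(1)] by auto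
  then have "open S" using U chart(1)[OF c(1)] by (auto simp: S_def)
  moreover have 1: "Ck_on 1 (snd c ` S) (snd d \<circ> f \<circ> chart_inv c)"
    using U(3) c d unfolding C1_map_on_def S_def by blast
  have 2: "Ck_on 1 (snd d ` (f ` U \<inter> fst d \<inter> g -` fst c)) (snd c \<circ> g \<circ> chart_inv d)"
    using U(4) c d unfolding C1_map_on_def by blast
  have "(snd c \<circ> g \<circ> chart_inv d) differentiable (at (snd d (f y)))" if "y \<in> S" for y
  proof -
    have "snd d (f y) \<in> snd d ` (f ` U \<inter> fst d \<inter> g -` fst c)"
      using that U(5) by (intro imageI) (auto simp: S_def)
    then show ?thesis using 2 unfolding One_nat_def Ck_on.simps by blast
  qed
  moreover have "((snd d \<circ> f \<circ> chart_inv c) has_derivative tder c d y) (at (snd c y))" if "y \<in> S" for y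
    using 1 that unfolding tder_def by (auto simp: frechet_derivative_works)
  moreover have "continuous_on (snd c ` S) (\<lambda>z. frechet_derivative (snd d \<circ> f \<circ> chart_inv c) (at z) v)" for v
    using 1 by simp
  ultimately show ?thesis
    by (intro that[of S g]) (use U c d in \<open>auto simp: S_def\<close>)
qed

lemma tder_deriv:
  assumes "c \<in> A" "x \<in> fst c" "d \<in> A" "f x \<in> fst d"
  shows "((snd d \<circ> f \<circ> chart_inv c) has_derivative tder c d x) (at (snd c x))"
  using chart_nbhd[OF assms] by metis

lemma tder_linear:
  assumes "c \<in> A" "x \<in> fst c" "d \<in> A" "f x \<in> fst d"
  shows "linear (tder c d x)"
  using has_derivative_linear[OF tder_deriv[OF assms]] .

text \<open>The chain rule for the local inverse composed with \<open>f\<close>. The composition is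
  the identity on the chart image of \<open>S\<close>, which is open and contains the point.\<close>

lemma tder_left_inverse:
  assumes c: "c \<in> A" "x \<in> fst c" and d: "d \<in> A" "f x \<in> fst d"
  obtains D where "linear D" "\<And>v. D (tder c d x v) = v"
proof -
  obtain S g where S: "open S" "x \<in> S" "S \<subseteq> fst c" "f ` S \<subseteq> fst d"
    and g: "\<And>y. y \<in> S \<Longrightarrow> g (f y) = y"
      "\<And>y. y \<in> S \<Longrightarrow> (snd c \<circ> g \<circ> chart_inv d) differentiable (at (snd d (f y)))"
    using chart_nbhd[OF c d] by metis
  let ?H = "snd d \<circ> f \<circ> chart_inv c" and ?G = "snd c \<circ> g \<circ> chart_inv d"
  obtain D where D: "(?G has_derivative D) (at (snd d (f x)))"
    using g(2)[OF S(2)] unfolding differentiable_def by blast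
  have "?H (snd c x) = snd d (f x)" using chart_inv[OF c] by simp
  then have "(?G \<circ> ?H has_derivative D \<circ> tder c d x) (at (snd c x))"
    using diff_chain_at[OF tder_deriv[OF c d]] D by simp
  then have "((\<lambda>z. z) has_derivative D \<circ> tder c d x) (at (snd c x))"
  proof (rule has_derivative_transform_within_open)
    show "open (snd c ` S)" using chart_image_open[OF c(1) S(1,3)] .
    show "(?G \<circ> ?H) z = z" if z: "z \<in> snd c ` S" for z
    proof -
      obtain y where y: "y \<in> S" "z = snd c y" using z by blast
      then have "chart_inv c z = y" "chart_inv d (snd d (f y)) = f y"
        using S chart_inv[OF c(1)] chart_inv[OF d(1)] by auto
      then show ?thesis using y g(1) by simp
    qed
  qed (use S in auto)
  then have "D \<circ> tder c d x = (\<lambda>v. v)"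
    using has_derivative_unique[OF _ has_derivative_ident] by blast
  then show ?thesis using that has_derivative_linear[OF D] by (metis comp_apply)
qed

text \<open>Both sides are derivatives of the one map that expresses \<open>f\<close> in the charts
  \<open>c\<close> and \<open>d'\<close>.\<close>

lemma tder_change:
  assumes c: "c \<in> A" "x \<in> fst c" and d: "d \<in> A" "f x \<in> fst d"
    and c': "c' \<in> A" "x \<in> fst c'" and d': "d' \<in> A" "f x \<in> fst d'"
  shows "transition d d' (f x) (tder c d x v) = tder c' d' x (transition c c' x v)"
proof -
  obtain S where S: "open S" "x \<in> S" "S \<subseteq> fst c" "f ` S \<subseteq> fst d"
    using chart_nbhd[OF c d] by metis
  define S' where "S' = S \<inter> fst c'"
  have S': "open S'" "x \<in> S'" "S' \<subseteq> fst c"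
    using S c' open_Int[OF S(1) chart(1)[OF c'(1)]] by (auto simp: S'_def)
  let ?K = "snd d' \<circ> f \<circ> chart_inv c"
  have "(snd d \<circ> f \<circ> chart_inv c) (snd c x) = snd d (f x)" using chart_inv[OF c] by simp
  then have "((snd d' \<circ> chart_inv d) \<circ> (snd d \<circ> f \<circ> chart_inv c) has_derivative transition d d' (f x) \<circ> tder c d x) (at (snd c x))"
    using diff_chain_at[OF tder_deriv[OF c d]] transition_deriv[OF d(1) d'(1) d(2) d'(2)] by simp
  then have 1: "(?K has_derivative transition d d' (f x) \<circ> tder c d x) (at (snd c x))"
  proof (rule has_derivative_transform_within_open)
    show "open (snd c ` S')" using chart_image_open[OF c(1) S'(1,3)] .
    show "((snd d' \<circ> chart_inv d) \<circ> (snd d \<circ> f \<circ> chart_inv c)) z = ?K z" if z: "z \<in> snd c ` S'" for z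
    proof -
      obtain y where y: "y \<in> S'" "z = snd c y" using z by blast
      then have "chart_inv c z = y" "chart_inv d (snd d (f y)) = f y"
        using S S' chart_inv[OF c(1)] chart_inv[OF d(1)] by (auto simp: S'_def)
      then show ?thesis by simp
    qed
  qed (use S' in auto)
  have "(snd c' \<circ> chart_inv c) (snd c x) = snd c' x" using chart_inv[OF c] by simp
  then have "((snd d' \<circ> f \<circ> chart_inv c') \<circ> (snd c' \<circ> chart_inv c) has_derivative tder c' d' x \<circ> transition c c' x) (at (snd c x))"
    using diff_chain_at[OF transition_deriv[OF c(1) c'(1) c(2) c'(2)]] tder_deriv[OF c' d'] by simp
  then have 2: "(?K has_derivative tder c' d' x \<circ> transition c c' x) (at (snd c x))"
  proof (rule has_derivative_transform_within_open)
    show "open (snd c ` S')" using chart_image_open[OF c(1) S'(1,3)] .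
    show "((snd d' \<circ> f \<circ> chart_inv c') \<circ> (snd c' \<circ> chart_inv c)) z = ?K z" if z: "z \<in> snd c ` S'" for z
    proof -
      obtain y where y: "y \<in> S'" "z = snd c y" using z by blast
      then have "chart_inv c z = y" "chart_inv c' (snd c' y) = y"
        using S S' chart_inv[OF c(1)] chart_inv[OF c'(1)] by (auto simp: S'_def)
      then show ?thesis by simp
    qed
  qed (use S' in auto)
  show ?thesis using has_derivative_unique[OF 1 2] by (metis comp_apply)
qed

lemma nrm_tder_pos:
  assumes "c \<in> A" "x \<in> fst c" "d \<in> A" "f x \<in> fst d" "v \<noteq> 0"
  shows "nrm d (f x) (tder c d x v) > 0"
proof -
  obtain D where "linear D" "\<And>v. D (tder c d x v) = v" using tder_left_inverse[OF assms(1-4)] by blast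
  then have "tder c d x v \<noteq> 0" using assms(5) by (metis linear_0)
  then show ?thesis using nrm_pos assms by blast
qed

text \<open>\<open>a x\<close> is the least \<open>b\<close> with
  \<open>nrm v \<le> b * nrm (T v)\<close>, and this form is used from here on: it involves no
  inverse and no unit sphere. The supremum is meaningful because a left inverse of \<open>T\<close>
  is bounded on the unit sphere at \<open>f x\<close>.\<close>

lemma inv_deriv_norm_chart_at:
  fixes x :: 'a
  defines "T \<equiv> tangent_map A f x"
  shows "nrm (chart_at A x) x v \<le> a x * nrm (chart_at A (f x)) (f x) (T v)"
    and "(\<And>v. nrm (chart_at A x) x v \<le> b * nrm (chart_at A (f x)) (f x) (T v)) \<Longrightarrow> a x \<le> b"
proof -
  let ?c = "chart_at A x" and ?d = "chart_at A (f x)"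
  have T: "T = tder ?c ?d x" unfolding T_def tangent_map_def tder_def ..
  note cd = chart_at[of x] chart_at[of "f x"]
  obtain D where D: "linear D" "\<And>v. D (T v) = v" using tder_left_inverse[OF cd] unfolding T by metis
  have T_lin: "linear T" unfolding T by (rule tder_linear[OF cd])
  have inj: "inj T" using D(2) by (metis injI)
  have invT: "inv T (T v) = v" for v using inj by simp
  have surj: "surj T" by (rule linear_injective_imp_surjective[OF T_lin inj refl])
  have a_eq: "a x = (SUP w\<in>{w. nrm ?d (f x) w = 1}. nrm ?c x (inv T w))"
    unfolding inv_deriv_norm_def tnorm_eq T_def ..
  obtain m where m: "m > 0" "\<And>v. m * norm v \<le> nrm ?d (f x) v" using norm_le_nrm[OF cd(3,4)] by blast
  obtain K where K: "K > 0" "\<And>v. nrm ?c x v \<le> K * norm v" using nrm_le_norm[OF cd(1,2)] by blast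
  let ?k = "\<Sum>i\<in>Basis. norm (D i)"
  have bdd: "bdd_above ((\<lambda>w. nrm ?c x (inv T w)) ` {w. nrm ?d (f x) w = 1})"
  proof (rule bdd_aboveI2)
    fix w assume "w \<in> {w. nrm ?d (f x) w = 1}"
    then have w: "norm w \<le> 1 / m" using m(2)[of w] m(1) by (simp add: field_simps)
    have "inv T w = D w" using D(2) surj by (metis surj_f_inv_f)
    then have "nrm ?c x (inv T w) \<le> K * norm (D w)" using K(2) by simp
    also have "\<dots> \<le> K * (?k * norm w)" using K(1) linear_norm_le_Basis[OF D(1)] by (intro mult_left_mono) auto
    also have "\<dots> \<le> K * (?k * (1 / m))" using K(1) w by (intro mult_left_mono) (auto intro: sum_nonneg)
    finally show "nrm ?c x (inv T w) \<le> K * (?k * (1 / m))" .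
  qed
  have T_pos: "nrm ?d (f x) (T v) > 0" if "v \<noteq> 0" for v
    unfolding T by (rule nrm_tder_pos[OF cd that])
  have unit: "nrm ?d (f x) ((1 / nrm ?d (f x) (T v)) *\<^sub>R T v) = 1" if "v \<noteq> 0" for v
    using T_pos[OF that] by (simp add: nrm_scale[OF cd(3,4)])
  have inv_unit: "nrm ?c x (inv T ((1 / nrm ?d (f x) (T v)) *\<^sub>R T v)) = nrm ?c x v / nrm ?d (f x) (T v)" if "v \<noteq> 0" for v
    using T_pos[OF that] invT[of "(1 / nrm ?d (f x) (T v)) *\<^sub>R v"]
    by (simp add: linear_cmul[OF T_lin] nrm_scale[OF cd(1,2)])
  show "nrm ?c x v \<le> a x * nrm ?d (f x) (T v)"
  proof (cases "v = 0")
    case True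
    then show ?thesis by (simp add: linear_0[OF T_lin] nrm_zero[OF cd(1,2)] nrm_zero[OF cd(3,4)])
  next
    case False
    have "nrm ?c x (inv T ((1 / nrm ?d (f x) (T v)) *\<^sub>R T v)) \<le> a x"
      unfolding a_eq by (rule cSUP_upper[OF _ bdd]) (use unit[OF False] in simp)
    then show ?thesis using T_pos[OF False] by (simp add: inv_unit[OF False] field_simps)
  qed
  show "a x \<le> b" if b: "\<And>v. nrm ?c x v \<le> b * nrm ?d (f x) (T v)"
    unfolding a_eq
  proof (rule cSUP_least)
    obtain i :: 'e where "i \<in> Basis" by (metis ex_in_conv nonempty_Basis)
    then have "i \<noteq> 0" by auto
    then show "{w. nrm ?d (f x) w = 1} \<noteq> {}" using unit[of i] by blast
    fix w assume w: "w \<in> {w. nrm ?d (f x) w = 1}"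
    show "nrm ?c x (inv T w) \<le> b" using b[of "inv T w"] w by (simp add: surj_f_inv_f[OF surj])
  qed
qed

lemma inv_deriv_norm:
  assumes c: "c \<in> A" "x \<in> fst c" and d: "d \<in> A" "f x \<in> fst d"
  shows "nrm c x v \<le> a x * nrm d (f x) (tder c d x v)"
    and "(\<And>v. nrm c x v \<le> b * nrm d (f x) (tder c d x v)) \<Longrightarrow> a x \<le> b"
proof -
  note cd = chart_at[of x] chart_at[of "f x"]
  let ?c = "chart_at A x" and ?d = "chart_at A (f x)"
  have T: "tangent_map A f x = tder ?c ?d x" unfolding tangent_map_def tder_def ..
  have "nrm ?c x (transition c ?c x v) \<le> a x * nrm ?d (f x) (tder ?c ?d x (transition c ?c x v))"
    using inv_deriv_norm_chart_at(1)[of x] unfolding T .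
  then show "nrm c x v \<le> a x * nrm d (f x) (tder c d x v)"
    by (simp add: tder_change[OF c d cd, symmetric] nrm_transition c d cd)
  assume b: "\<And>v. nrm c x v \<le> b * nrm d (f x) (tder c d x v)"
  show "a x \<le> b"
  proof (rule inv_deriv_norm_chart_at(2), unfold T)
    fix v
    show "nrm ?c x v \<le> b * nrm ?d (f x) (tder ?c ?d x v)"
      using b[of "transition ?c c x v"]
      by (simp add: tder_change[OF cd c d, symmetric] nrm_transition c d cd)
  qed
qed

lemma inv_deriv_norm_pos: "a x > 0"
proof -
  note cd = chart_at[of x] chart_at[of "f x"]
  obtain i :: 'e where "i \<in> Basis" by (metis ex_in_conv nonempty_Basis)
  then have i: "i \<noteq> 0" by auto
  have "0 < nrm (chart_at A x) x i" by (rule nrm_pos[OF cd(1,2) i])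
  also have "\<dots> \<le> a x * nrm (chart_at A (f x)) (f x) (tder (chart_at A x) (chart_at A (f x)) x i)"
    by (rule inv_deriv_norm(1)[OF cd])
  finally show ?thesis using nrm_tder_pos[OF cd i] by (simp add: zero_less_mult_iff)
qed

text \<open>A vector \<open>v\<close> witnessing that \<open>a x - e\<close> is too small at
  \<open>x\<close> still does so at nearby points, since both sides are continuous in the point for
  fixed \<open>v\<close>. Semicontinuity suffices to bound \<open>a\<close> below on the compact
  manifold and to carry upper bounds to closures.\<close>

lemma inv_deriv_norm_lsc:
  assumes e: "e > 0"
  shows "\<forall>\<^sub>F y in nhds x. a x - e < a y"
proof -
  note cd = chart_at[of x] chart_at[of "f x"]
  let ?c = "chart_at A x" and ?d = "chart_at A (f x)"
  obtain S where S: "open S" "x \<in> S" "S \<subseteq> fst ?c" "f ` S \<subseteq> fst ?d"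
    and cont: "\<And>v. continuous_on (snd ?c ` S) (\<lambda>z. frechet_derivative (snd ?d \<circ> f \<circ> chart_inv ?c) (at z) v)"
    using chart_nbhd[OF cd] by metis
  obtain v where v: "nrm ?c x v > (a x - e) * nrm ?d (f x) (tder ?c ?d x v)"
    using inv_deriv_norm(2)[OF cd, of "a x - e"] e by (meson diff_less_eq less_add_same_cancel1 not_le)
  have "continuous_on S (\<lambda>y. tder ?c ?d y v)"
    unfolding tder_def
    by (rule continuous_on_compose2[OF cont continuous_on_subset[OF chart(3)[OF cd(1)]]]) (use S in auto)
  then have tder_cont: "isCont (\<lambda>y. tder ?c ?d y v) x" using S continuous_on_eq_continuous_at by blast
  have R_lim: "((\<lambda>y. R ?d (f y) (w y) (w y)) \<longlongrightarrow> R ?d (f x) (w x) (w x)) (at x)" if w: "isCont w x" for w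
  proof -
    have ex: "R ?d (f y) (w y) (w y) = (\<Sum>i\<in>Basis. \<Sum>j\<in>Basis. (w y \<bullet> i) * (w y \<bullet> j) * R ?d (f y) i j)" if "y \<in> S" for y
    proof -
      have fy: "f y \<in> fst ?d" using S that by auto
      have "R ?d (f y) (w y) (w y) = R ?d (f y) (\<Sum>i\<in>Basis. (w y \<bullet> i) *\<^sub>R i) (\<Sum>j\<in>Basis. (w y \<bullet> j) *\<^sub>R j)"
        by (simp add: euclidean_representation)
      also have "\<dots> = (\<Sum>i\<in>Basis. \<Sum>j\<in>Basis. (w y \<bullet> i) * (w y \<bullet> j) * R ?d (f y) i j)"
        unfolding linear_sum[OF tensor_linear(2)[OF cd(3) fy]] linear_sum[OF tensor_linear(1)[OF cd(3) fy]]
        by (simp add: tensor_diff[OF cd(3) fy] mult.assoc)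
          (intro sum.cong refl, subst tensor(2)[OF cd(3) fy], simp)
      finally show ?thesis .
    qed
    have lim: "((\<lambda>y. \<Sum>i\<in>Basis. \<Sum>j\<in>Basis. (w y \<bullet> i) * (w y \<bullet> j) * R ?d (f y) i j) \<longlongrightarrow>
        (\<Sum>i\<in>Basis. \<Sum>j\<in>Basis. (w x \<bullet> i) * (w x \<bullet> j) * R ?d (f x) i j)) (at x)"
    proof (intro tendsto_intros)
      show "(w \<longlongrightarrow> w x) (at x)" "(w \<longlongrightarrow> w x) (at x)" using w by (auto simp: isCont_def)
      show "((\<lambda>y. R ?d (f y) i j) \<longlongrightarrow> R ?d (f x) i j) (at x)" for i j
        using isCont_o2[OF f_isCont tensor_cont[OF cd(3,4)]] by (simp add: isCont_def)
    qed
    have "\<forall>\<^sub>F y in at x. y \<in> S" using S eventually_at_in_open' by blast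
    then have "\<forall>\<^sub>F y in at x. (\<Sum>i\<in>Basis. \<Sum>j\<in>Basis. (w y \<bullet> i) * (w y \<bullet> j) * R ?d (f y) i j) = R ?d (f y) (w y) (w y)"
      by eventually_elim (simp add: ex)
    from Lim_transform_eventually[OF lim this] show ?thesis using ex[OF S(2)] by simp
  qed
  have "((\<lambda>y. nrm ?c y v - (a x - e) * nrm ?d (f y) (tder ?c ?d y v)) \<longlongrightarrow>
      nrm ?c x v - (a x - e) * nrm ?d (f x) (tder ?c ?d x v)) (at x)"
    unfolding nrm_def
    by (intro tendsto_intros R_lim tder_cont) (use tensor_cont[OF cd(1,2)] in \<open>simp add: isCont_def\<close>)
  then have "\<forall>\<^sub>F y in at x. nrm ?c y v - (a x - e) * nrm ?d (f y) (tder ?c ?d y v) > 0"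
    by (rule order_tendstoD) (use v in simp)
  then have "\<forall>\<^sub>F y in nhds x. nrm ?c y v - (a x - e) * nrm ?d (f y) (tder ?c ?d y v) > 0"
    using v by (simp add: eventually_nhds_conv_at)
  moreover have "\<forall>\<^sub>F y in nhds x. y \<in> S" using S by (simp add: eventually_nhds_in_open)
  ultimately show ?thesis
  proof eventually_elim
    case (elim y)
    have y: "y \<in> fst ?c" "f y \<in> fst ?d" using S elim by auto
    have "(a x - e) * nrm ?d (f y) (tder ?c ?d y v) < a y * nrm ?d (f y) (tder ?c ?d y v)"
      using elim(1) inv_deriv_norm(1)[OF cd(1) y(1) cd(3) y(2), of v] by linarith
    then show ?case using nrm_nonneg[OF cd(3) y(2)] by (metis mult_right_mono not_le)
  qed
qed

text \<open>The infinitesimal bound by \<open>a x\<close> becomes a bound for finite increments by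
  strict differentiability, the remainder being absorbed on the left.\<close>

lemma chart_distance_le:
  assumes c: "c \<in> A" "x \<in> fst c" and d: "d \<in> A" "f x \<in> fst d" and e: "e > 0"
  shows "\<exists>\<delta>>0. \<forall>y z. dist y x < \<delta> \<longrightarrow> dist z x < \<delta> \<longrightarrow>
    nrm c x (snd c y - snd c z) \<le> (a x + e) * nrm d (f x) (snd d (f y) - snd d (f z))"
proof -
  let ?H = "snd d \<circ> f \<circ> chart_inv c"
  obtain S where S: "open S" "x \<in> S" "S \<subseteq> fst c" "f ` S \<subseteq> fst d"
    and deriv: "\<And>y. y \<in> S \<Longrightarrow> (?H has_derivative tder c d y) (at (snd c y))"
    and cont: "\<And>v. continuous_on (snd c ` S) (\<lambda>z. frechet_derivative ?H (at z) v)"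
    by (rule chart_nbhd[OF c d]) blast
  obtain m where m: "m > 0" "\<And>v. m * norm v \<le> nrm c x v" using norm_le_nrm[OF c] by blast
  obtain K where K: "K > 0" "\<And>v. nrm d (f x) v \<le> K * norm v" using nrm_le_norm[OF d] by blast
  have a0: "a x > 0" by (rule inv_deriv_norm_pos)
  \<comment> \<open>Chosen such that the remainder contributes exactly the fraction
    \<open>e / (a x + e)\<close> of \<open>nrm c x v\<close>, which leaves the factor
    \<open>a x / (a x + e)\<close> on the left.\<close>
  define \<eta> where "\<eta> = e * m / ((a x + e) * (a x) * K)"
  have \<eta>: "\<eta> > 0" using e m K a0 by (simp add: \<eta>_def)
  have op: "open (snd c ` S)" using chart_image_open[OF c(1) S(1,3)] .
  obtain r where r: "r > 0" "ball (snd c x) r \<subseteq> snd c ` S"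
    "\<And>y z. y \<in> ball (snd c x) r \<Longrightarrow> z \<in> ball (snd c x) r \<Longrightarrow>
       norm (?H y - ?H z - frechet_derivative ?H (at (snd c x)) (y - z)) \<le> \<eta> * norm (y - z)"
  proof (rule strictly_differentiable[OF op _ _ cont \<eta>])
    show "snd c x \<in> snd c ` S" using S by blast
    show "?H differentiable at z" if "z \<in> snd c ` S" for z
      using that deriv unfolding differentiable_def by blast
  qed blast
  have "\<forall>\<^sub>F y in nhds x. y \<in> fst c \<and> dist (snd c y) (snd c x) < r"
  proof (rule eventually_conj)
    show "\<forall>\<^sub>F y in nhds x. y \<in> fst c" using chart(1)[OF c(1)] c(2) by (simp add: eventually_nhds_in_open)
    show "\<forall>\<^sub>F y in nhds x. dist (snd c y) (snd c x) < r"
      using chart_isCont[OF c, unfolded isCont_def tendsto_at_iff_tendsto_nhds] r(1) by (rule tendstoD)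
  qed
  then obtain \<delta> where \<delta>: "\<delta> > 0" "\<And>y. dist y x < \<delta> \<Longrightarrow> y \<in> fst c \<and> dist (snd c y) (snd c x) < r"
    by (auto simp: eventually_nhds_metric)
  have "nrm c x (snd c y - snd c z) \<le> (a x + e) * nrm d (f x) (snd d (f y) - snd d (f z))"
    if y: "dist y x < \<delta>" and z: "dist z x < \<delta>" for y z
  proof -
    define v where "v = snd c y - snd c z"
    define w where "w = snd d (f y) - snd d (f z)"
    have yz: "y \<in> fst c" "z \<in> fst c" "snd c y \<in> ball (snd c x) r" "snd c z \<in> ball (snd c x) r"
      using \<delta>(2)[OF y] \<delta>(2)[OF z] by (auto simp: dist_commute)
    have "norm (w - tder c d x v) \<le> \<eta> * norm v"
      using r(3)[OF yz(3,4)] chart_inv[OF c(1)] yz by (simp add: v_def w_def tder_def)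
    then have 1: "norm (tder c d x v - w) \<le> \<eta> * norm v" by (simp add: norm_minus_commute)
    have "nrm c x v \<le> a x * nrm d (f x) (w + (tder c d x v - w))"
      using inv_deriv_norm(1)[OF c d, of v] by simp
    also have "\<dots> \<le> a x * (nrm d (f x) w + nrm d (f x) (tder c d x v - w))"
      using a0 by (intro mult_left_mono nrm_triangle[OF d]) auto
    also have "nrm d (f x) (tder c d x v - w) \<le> K * norm (tder c d x v - w)" by (rule K)
    also have "\<dots> \<le> K * (\<eta> * norm v)" using K 1 by (intro mult_left_mono) auto
    also have "\<dots> \<le> K * (\<eta> * (nrm c x v / m))"
      using K \<eta> m(1) m(2)[of v] by (intro mult_left_mono) (auto simp: field_simps)
    finally have "nrm c x v \<le> a x * (nrm d (f x) w + K * (\<eta> * (nrm c x v / m)))"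
      using a0 by simp
    also have "\<dots> = a x * nrm d (f x) w + e / (a x + e) * nrm c x v"
    proof -
      have "u * (K * (e * m / (q * u * K) * (n / m))) = e / q * n" if "u > 0" "q > 0" for u q n :: real
        using K(1) m(1) that by (simp add: divide_simps)
      from this[OF a0, of "a x + e"] show ?thesis using a0 e by (simp add: \<eta>_def distrib_left)
    qed
    finally have "nrm c x v * (1 - e / (a x + e)) \<le> a x * nrm d (f x) w" by (simp add: algebra_simps)
    also have "1 - e / (a x + e) = a x / (a x + e)" using a0 e by (simp add: field_simps)
    finally have "a x * nrm c x v \<le> a x * ((a x + e) * nrm d (f x) w)"
      using a0 e by (simp add: field_simps)
    then have "nrm c x v \<le> (a x + e) * nrm d (f x) w" using a0 by simp
    then show ?thesis by (simp add: v_def w_def)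
  qed
  then show ?thesis using \<delta>(1) by blast
qed

text \<open>The lift \<open>\<Gamma>\<close> is only continuous, so nothing is differentiated along
  it: the induction compares its increment with that of \<open>f \<circ> \<Gamma>\<close> in charts,
  gaining one factor of the product, until the curve \<open>\<gamma>\<close> itself is
  reached.\<close>

lemma lift_chart_le:
  assumes curve: "pw_C1_curve A \<gamma>" and t0: "t0 \<in> {0..1}"
    and "continuous_on {0..1} \<Gamma>" "\<And>t. t \<in> {0..1} \<Longrightarrow> \<gamma> t = (f ^^ m) (\<Gamma> t)" "e > 0"
  shows "\<exists>\<delta>>0. \<forall>s\<in>{0..1}. \<forall>t\<in>{0..1}. \<bar>s - t0\<bar> < \<delta> \<longrightarrow> \<bar>t - t0\<bar> < \<delta> \<longrightarrow> s \<le> t \<longrightarrow>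
    ennreal (cdist (\<Gamma> t0) (\<Gamma> t) (\<Gamma> s))
      \<le> ennreal ((\<Prod>j<m. a ((f ^^ j) (\<Gamma> t0))) + e) * len \<gamma> s t"
  using assms(3-)
proof (induction m arbitrary: \<Gamma> e)
  case 0
  have \<gamma>\<Gamma>: "\<gamma> t = \<Gamma> t" if "t \<in> {0..1}" for t using 0(2) that by simp
  let ?c = "chart_at A (\<gamma> t0)"
  define e' where "e' = e / (1 + e)"
  have e': "e' > 0" "e' < 1" "(1 + e) * (1 - e') = 1" using \<open>e > 0\<close> by (auto simp: e'_def field_simps)
  obtain \<delta> where \<delta>: "\<delta> > 0" "\<forall>s\<in>{0..1}. \<forall>t\<in>{0..1}. \<bar>s - t0\<bar> < \<delta> \<longrightarrow> \<bar>t - t0\<bar> < \<delta> \<longrightarrow> s \<le> t \<longrightarrow>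
    ennreal ((1 - e') * nrm ?c (\<gamma> t0) (snd ?c (\<gamma> t) - snd ?c (\<gamma> s))) \<le> len \<gamma> s t"
    using curve_chart_le[OF curve t0 chart_at e'(1,2)] by blast
  show ?case
  proof (intro exI[of _ \<delta>] conjI ballI impI)
    fix s t :: real assume st: "s \<in> {0..1}" "t \<in> {0..1}" "\<bar>s - t0\<bar> < \<delta>" "\<bar>t - t0\<bar> < \<delta>" "s \<le> t"
    let ?n = "nrm ?c (\<gamma> t0) (snd ?c (\<gamma> t) - snd ?c (\<gamma> s))"
    have "?n = (1 + e) * ((1 - e') * ?n)" using e'(3) by (simp flip: mult.assoc)
    then have "ennreal ?n = ennreal (1 + e) * ennreal ((1 - e') * ?n)"
      using \<open>e > 0\<close> by (metis ennreal_mult' add_nonneg_nonneg less_imp_le zero_le_one)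
    also have "\<dots> \<le> ennreal (1 + e) * len \<gamma> s t"
      using \<delta>(2) st by (intro mult_left_mono) auto
    finally show "ennreal (cdist (\<Gamma> t0) (\<Gamma> t) (\<Gamma> s))
      \<le> ennreal ((\<Prod>j<0. a ((f ^^ j) (\<Gamma> t0))) + e) * len \<gamma> s t"
      using \<gamma>\<Gamma> t0 st by simp
  qed (use \<delta> in auto)
next
  case (Suc m)
  define x where "x = \<Gamma> t0"
  define p where "p = (\<Prod>j<m. a ((f ^^ j) (f x)))"
  have p: "p \<ge> 0" unfolding p_def by (intro prod_nonneg) (simp add: inv_deriv_norm_pos less_imp_le)
  have a0: "a x > 0" by (rule inv_deriv_norm_pos)
  have prod_eq: "(\<Prod>j<Suc m. a ((f ^^ j) x)) = a x * p"
    unfolding p_def by (subst prod.lessThan_Suc_shift) (simp add: funpow_swap1)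
  \<comment> \<open>Small enough that \<open>(a x + e') * (p + e')\<close> exceeds
    \<open>a x * p\<close> by at most \<open>e\<close>.\<close>
  define e' where "e' = min 1 (e / (a x + p + 1))"
  have e': "e' > 0" "e' \<le> 1" "e' * (a x + p + 1) \<le> e"
    using min_one_divide[OF \<open>e > 0\<close>, of "a x + p + 1"] a0 p by (auto simp: e'_def)
  have f\<Gamma>: "continuous_on {0..1} (f \<circ> \<Gamma>)"
    using continuous_on_compose Suc.prems(1) f_continuous by blast
  have "\<gamma> t = (f ^^ m) ((f \<circ> \<Gamma>) t)" if "t \<in> {0..1}" for t
    using Suc.prems(2)[OF that] by (simp add: funpow_swap1)
  from Suc.IH[OF f\<Gamma> this e'(1)] obtain \<delta>1 where \<delta>1: "\<delta>1 > 0" "\<forall>s\<in>{0..1}. \<forall>t\<in>{0..1}. \<bar>s - t0\<bar> < \<delta>1 \<longrightarrow> \<bar>t - t0\<bar> < \<delta>1 \<longrightarrow> s \<le> t \<longrightarrow>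
    ennreal (cdist (f x) (f (\<Gamma> t)) (f (\<Gamma> s)))
      \<le> ennreal (p + e') * len \<gamma> s t"
    unfolding p_def x_def by auto
  obtain \<delta>2 where \<delta>2: "\<delta>2 > 0" "\<And>y z. dist y x < \<delta>2 \<Longrightarrow> dist z x < \<delta>2 \<Longrightarrow>
    cdist x y z
      \<le> (a x + e') * cdist (f x) (f y) (f z)"
    using chart_distance_le[OF chart_at chart_at e'(1)] by blast
  obtain \<delta>3 where \<delta>3: "\<delta>3 > 0" "\<And>t. t \<in> {0..1} \<Longrightarrow> dist t t0 < \<delta>3 \<Longrightarrow> dist (\<Gamma> t) x < \<delta>2"
    using Suc.prems(1) t0 \<delta>2(1) unfolding continuous_on_iff x_def by meson
  show ?case
  proof (intro exI[of _ "min \<delta>1 \<delta>3"] conjI ballI impI)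
    fix s t :: real assume st: "s \<in> {0..1}" "t \<in> {0..1}" "\<bar>s - t0\<bar> < min \<delta>1 \<delta>3" "\<bar>t - t0\<bar> < min \<delta>1 \<delta>3" "s \<le> t"
    let ?L = "\<integral>\<^sup>+\<tau>\<in>{s<..t}. speed \<gamma> \<tau> \<partial>lborel"
    let ?n = "cdist (f x) (f (\<Gamma> t)) (f (\<Gamma> s))"
    have "cdist x (\<Gamma> t) (\<Gamma> s) \<le> (a x + e') * ?n"
      by (intro \<delta>2(2) \<delta>3(2)) (use st in \<open>auto simp: dist_real_def\<close>)
    then have "ennreal (cdist x (\<Gamma> t) (\<Gamma> s)) \<le> ennreal (a x + e') * ennreal ?n"
      using a0 e' by (subst ennreal_mult'[symmetric]) (auto intro: ennreal_leI)
    also have "\<dots> \<le> ennreal (a x + e') * (ennreal (p + e') * ?L)"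
      using \<delta>1(2) st by (intro mult_left_mono) auto
    also have "\<dots> = ennreal ((a x + e') * (p + e')) * ?L"
      using a0 e' p by (simp add: ennreal_mult' mult.assoc)
    also have "(a x + e') * (p + e') \<le> a x * p + e"
    proof -
      have "(a x + e') * (p + e') = a x * p + e' * (a x + p + e')" by (simp add: algebra_simps)
      also have "e' * (a x + p + e') \<le> e' * (a x + p + 1)" using e' by (intro mult_left_mono) auto
      finally show ?thesis using e'(3) by simp
    qed
    finally show "ennreal (cdist (\<Gamma> t0) (\<Gamma> t) (\<Gamma> s))
      \<le> ennreal ((\<Prod>j<Suc m. a ((f ^^ j) (\<Gamma> t0))) + e) * ?L"
      unfolding prod_eq[unfolded x_def] unfolding x_def by (simp add: ennreal_leI mult_right_mono)
  qed (use \<delta>1 \<delta>3 in auto)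
qed

text \<open>Bounds on increments in charts become bounds on distances by \<open>dist_le_nrm\<close>
  and are glued over the unit interval. \<open>max 0 D\<close> appears because
  \<open>ennreal\<close> maps a negative \<open>D\<close> to zero.\<close>

lemma lift_dist_le:
  assumes curve: "pw_C1_curve A \<gamma>" and len: "curve_length A R \<gamma> \<le> ennreal D"
    and \<Gamma>: "continuous_on {0..1} \<Gamma>" "\<And>t. t \<in> {0..1} \<Longrightarrow> \<gamma> t = (f ^^ m) (\<Gamma> t)"
    and M: "\<And>t. t \<in> {0..1} \<Longrightarrow> (\<Prod>j<m. a ((f ^^ j) (\<Gamma> t))) \<le> M"
  shows "dist (\<Gamma> 0) (\<Gamma> 1) \<le> M * max 0 D"
proof (rule field_le_epsilon)
  fix e0 :: real assume "e0 > 0"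
  define e where "e = e0 / (max 0 D + 1)"
  have e: "e > 0" "e * max 0 D \<le> e0" using \<open>e0 > 0\<close> by (auto simp: e_def field_simps)
  have M0: "M \<ge> 0"
    using M[of 0] prod_nonneg[of "{..<m}" "\<lambda>j. a ((f ^^ j) (\<Gamma> 0))"] inv_deriv_norm_pos
    by (force simp: less_imp_le)
  have "ennreal (dist (\<Gamma> 0) (\<Gamma> 1)) \<le> ennreal (M + e) * len \<gamma> 0 1"
  proof (rule Bolzano_metric_bound)
    fix t0 :: real assume t0: "t0 \<in> {0..1}"
    define x where "x = \<Gamma> t0"
    define p where "p = (\<Prod>j<m. a ((f ^^ j) x))"
    have p: "0 \<le> p" "p \<le> M"
      unfolding p_def using M[OF t0] by (auto intro!: prod_nonneg simp: inv_deriv_norm_pos less_imp_le x_def)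
    define e' where "e' = min 1 (e / (p + 2))"
    have e': "e' > 0" "e' \<le> 1" "e' * (p + 2) \<le> e"
      using min_one_divide[OF e(1), of "p + 2"] p by (auto simp: e'_def)
    let ?c = "chart_at A x"
    obtain \<delta>1 where \<delta>1: "\<delta>1 > 0" "\<forall>s\<in>{0..1}. \<forall>t\<in>{0..1}. \<bar>s - t0\<bar> < \<delta>1 \<longrightarrow> \<bar>t - t0\<bar> < \<delta>1 \<longrightarrow> s \<le> t \<longrightarrow>
      ennreal (nrm ?c x (snd ?c (\<Gamma> t) - snd ?c (\<Gamma> s))) \<le> ennreal (p + e') * len \<gamma> s t"
      using lift_chart_le[OF curve t0 \<Gamma> e'(1)] unfolding x_def p_def by auto
    obtain \<delta>2 where \<delta>2: "\<delta>2 > 0" "\<And>y z. dist y x < \<delta>2 \<Longrightarrow> dist z x < \<delta>2 \<Longrightarrow>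
       dist y z \<le> (1 + e') * nrm ?c x (snd ?c z - snd ?c y)"
      using dist_le_nrm[OF chart_at e'(1)] by blast
    obtain \<delta>3 where \<delta>3: "\<delta>3 > 0" "\<And>t. t \<in> {0..1} \<Longrightarrow> dist t t0 < \<delta>3 \<Longrightarrow> dist (\<Gamma> t) x < \<delta>2"
      using \<Gamma>(1) t0 \<delta>2(1) unfolding continuous_on_iff x_def by meson
    show "\<exists>\<delta>>0. \<forall>s\<in>{0..1}. \<forall>t\<in>{0..1}. \<bar>s - t0\<bar> < \<delta> \<longrightarrow> \<bar>t - t0\<bar> < \<delta> \<longrightarrow> s \<le> t \<longrightarrow>
      ennreal (dist (\<Gamma> s) (\<Gamma> t)) \<le> ennreal (M + e) * len \<gamma> s t"
    proof (intro exI[of _ "min \<delta>1 \<delta>3"] conjI ballI impI)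
      fix s t :: real assume st: "s \<in> {0..1}" "t \<in> {0..1}" "\<bar>s - t0\<bar> < min \<delta>1 \<delta>3" "\<bar>t - t0\<bar> < min \<delta>1 \<delta>3" "s \<le> t"
      let ?L = "\<integral>\<^sup>+\<tau>\<in>{s<..t}. speed \<gamma> \<tau> \<partial>lborel"
      let ?n = "nrm ?c x (snd ?c (\<Gamma> t) - snd ?c (\<Gamma> s))"
      have "dist (\<Gamma> s) (\<Gamma> t) \<le> (1 + e') * ?n"
        by (intro \<delta>2(2) \<delta>3(2)) (use st in \<open>auto simp: dist_real_def\<close>)
      then have "ennreal (dist (\<Gamma> s) (\<Gamma> t)) \<le> ennreal (1 + e') * ennreal ?n"
        using e' by (subst ennreal_mult'[symmetric]) (auto intro: ennreal_leI)
      also have "\<dots> \<le> ennreal (1 + e') * (ennreal (p + e') * ?L)"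
        using \<delta>1(2) st by (intro mult_left_mono) auto
      also have "\<dots> = ennreal ((1 + e') * (p + e')) * ?L"
        using e' p by (simp add: ennreal_mult' mult.assoc)
      also have "(1 + e') * (p + e') \<le> M + e"
      proof -
        have "(1 + e') * (p + e') = p + e' * (p + 1 + e')" by (simp add: algebra_simps)
        also have "e' * (p + 1 + e') \<le> e' * (p + 2)" using e' by (intro mult_left_mono) auto
        finally show ?thesis using e'(3) p by simp
      qed
      finally show "ennreal (dist (\<Gamma> s) (\<Gamma> t)) \<le> ennreal (M + e) * ?L"
        by (simp add: ennreal_leI mult_right_mono)
    qed (use \<delta>1 \<delta>3 in auto)
  qed
  also have "\<dots> \<le> ennreal (M + e) * curve_length A R \<gamma>"
    unfolding curve_length_def speed_def[abs_def]
    by (intro mult_left_mono nn_integral_mono) (auto simp: indicator_def)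
  also have "\<dots> \<le> ennreal (M + e) * ennreal (max 0 D)"
    using len by (intro mult_left_mono) (auto simp: max_def ennreal_neg)
  also have "\<dots> = ennreal ((M + e) * max 0 D)"
    using M0 e by (simp add: ennreal_mult')
  finally have "dist (\<Gamma> 0) (\<Gamma> 1) \<le> (M + e) * max 0 D"
    using M0 e by (simp add: ennreal_le_iff)
  then show "dist (\<Gamma> 0) (\<Gamma> 1) \<le> M * max 0 D + e0"
    using e(2) by (simp add: algebra_simps)
qed

end

section \<open>Markov partitions\<close>

locale markov_map =
  fixes f :: "'a::metric_space \<Rightarrow> 'a" and P :: "'a set set" and N :: nat
  assumes compact_space: "compact (UNIV :: 'a set)"
    and f_cont: "continuous_on UNIV f"
    and finite_P: "finite P"
    and open_P: "E \<in> P \<Longrightarrow> open E"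
    and disjoint_P: "E \<in> P \<Longrightarrow> F \<in> P \<Longrightarrow> E \<noteq> F \<Longrightarrow> E \<inter> F = {}"
    and closure_P: "(\<Union>E\<in>P. closure E) = UNIV"
    and homeo_P: "E \<in> P \<Longrightarrow> \<exists>g. homeomorphism (closure E) (f ` closure E) f g"
    and markov: "E \<in> P \<Longrightarrow> F \<in> P \<Longrightarrow> f ` E \<inter> F \<noteq> {} \<Longrightarrow> F \<subseteq> f ` E"
    and N_pos: "N \<ge> 1"
    and mixing: "E \<in> P \<Longrightarrow> (f ^^ N) ` E = UNIV"
begin

abbreviation cyl :: "nat \<Rightarrow> 'a set set" where
  "cyl n \<equiv> cylinders f P n"

lemma P_ne: "E \<in> P \<Longrightarrow> E \<noteq> {}"
  using mixing by fastforce

lemma inj_P: "E \<in> P \<Longrightarrow> inj_on f (closure E)"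
  using homeo_P unfolding homeomorphism_def inj_on_def by metis

lemma fpow_cont: "continuous_on S (f ^^ n)"
proof -
  have "continuous_on UNIV (f ^^ n)"
  proof (induction n)
    case (Suc n)
    then show ?case using continuous_on_compose[OF Suc continuous_on_subset[OF f_cont]] by simp
  qed (simp add: continuous_on_id id_def)
  then show ?thesis using continuous_on_subset by blast
qed

lemma open_vimage_fpow: "open S \<Longrightarrow> open ((f ^^ n) -` S)"
  using continuous_on_open_vimage[OF open_UNIV, of "f ^^ n"] fpow_cont by auto

lemma cyl_0: "cyl 0 = {UNIV}"
  unfolding cylinders_def by auto

lemma cyl_SucE:
  assumes "C \<in> cyl (Suc n)"
  obtains E C' where "E \<in> P" "C' \<in> cyl n" "C = E \<inter> f -` C'"
proof -
  obtain D where D: "C \<noteq> {}" "\<And>j. j < Suc n \<Longrightarrow> D j \<in> P" "C = (\<Inter>j<Suc n. (f ^^ j) -` D j)"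
    using assms unfolding cylinders_def by blast
  have eq: "C = D 0 \<inter> f -` (\<Inter>j<n. (f ^^ j) -` D (Suc j))"
    unfolding D(3) lessThan_Suc_eq_insert_0 by (auto simp: funpow_swap1)
  moreover have "(\<Inter>j<n. (f ^^ j) -` D (Suc j)) \<in> cyl n"
  proof -
    have "(\<Inter>j<n. (f ^^ j) -` D (Suc j)) \<noteq> {}" using D(1) eq by auto
    moreover have "\<forall>j<n. D (Suc j) \<in> P" using D(2) by simp
    ultimately show ?thesis
      unfolding cylinders_def by (intro CollectI conjI exI[of _ "\<lambda>j. D (Suc j)"]) auto
  qed
  ultimately show ?thesis using that D(2) by blast
qed

lemma cyl_SucI:
  assumes "E \<in> P" "C' \<in> cyl n" "E \<inter> f -` C' \<noteq> {}"
  shows "E \<inter> f -` C' \<in> cyl (Suc n)"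
proof -
  obtain D where D: "\<And>j. j < n \<Longrightarrow> D j \<in> P" "C' = (\<Inter>j<n. (f ^^ j) -` D j)"
    using assms unfolding cylinders_def by blast
  have "E \<inter> f -` C' = (\<Inter>j<Suc n. (f ^^ j) -` (case_nat E D j))"
    unfolding D(2) lessThan_Suc_eq_insert_0 by (auto simp: funpow_swap1)
  moreover have "\<forall>j<Suc n. case_nat E D j \<in> P"
    using assms(1) D(1) by (auto split: nat.split)
  ultimately show ?thesis
    using assms(3) unfolding cylinders_def
    by (intro CollectI conjI exI[of _ "case_nat E D"]) auto
qed

lemma cyl_1: "cyl (Suc 0) = P"
proof
  show "cyl (Suc 0) \<subseteq> P" by (auto elim!: cyl_SucE simp: cyl_0)
  show "P \<subseteq> cyl (Suc 0)" using cyl_SucI[of _ UNIV 0] P_ne by (auto simp: cyl_0)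
qed

lemma cyl_ne: "C \<in> cyl n \<Longrightarrow> C \<noteq> {}"
  unfolding cylinders_def by blast

lemma finite_cyl: "finite (cyl n)"
proof (induction n)
  case (Suc n)
  have "cyl (Suc n) \<subseteq> (\<lambda>(E, C). E \<inter> f -` C) ` (P \<times> cyl n)"
    by (force elim!: cyl_SucE)
  then show ?case using Suc finite_P by (meson finite_SigmaI finite_imageI finite_subset)
qed (simp add: cyl_0)

lemma open_cyl: "C \<in> cyl n \<Longrightarrow> open C"
proof (induction n arbitrary: C)
  case (Suc n)
  then show ?case using open_P open_vimage_fpow[of _ 1] by (auto elim!: cyl_SucE)
qed (simp add: cyl_0)

lemma cyl_disjoint: "C \<in> cyl n \<Longrightarrow> D \<in> cyl n \<Longrightarrow> x \<in> C \<Longrightarrow> x \<in> D \<Longrightarrow> C = D"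
proof (induction n arbitrary: C D x)
  case (Suc n)
  obtain E C' where 1: "E \<in> P" "C' \<in> cyl n" "C = E \<inter> f -` C'" using Suc.prems(1) by (rule cyl_SucE)
  obtain F D' where 2: "F \<in> P" "D' \<in> cyl n" "D = F \<inter> f -` D'" using Suc.prems(2) by (rule cyl_SucE)
  have "E = F" using disjoint_P 1 2 Suc.prems by blast
  moreover have "C' = D'" using Suc.IH[OF 1(2) 2(2), of "f x"] 1 2 Suc.prems by simp
  ultimately show ?case using 1 2 by simp
qed (simp add: cyl_0)

lemma cyl_splitE:
  assumes "C \<in> cyl (n + k)"
  obtains C' C'' where "C' \<in> cyl n" "C'' \<in> cyl k" "C = C' \<inter> (f ^^ n) -` C''"
  using assms
proof (induction n arbitrary: C thesis)
  case 0
  then show ?case using 0(1)[of UNIV C] by (simp add: cyl_0)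
next
  case (Suc n)
  obtain E D where 1: "E \<in> P" "D \<in> cyl (n + k)" "C = E \<inter> f -` D"
    using Suc.prems(2) cyl_SucE[of C "n + k"] by auto
  obtain C' C'' where 2: "C' \<in> cyl n" "C'' \<in> cyl k" "D = C' \<inter> (f ^^ n) -` C''"
    using Suc.IH[OF _ 1(2)] by blast
  have "C = (E \<inter> f -` C') \<inter> (f ^^ Suc n) -` C''" using 1 2 by (auto simp: funpow_swap1)
  moreover have "E \<inter> f -` C' \<in> cyl (Suc n)"
    using cyl_SucI[OF 1(1) 2(1)] cyl_ne[OF Suc.prems(2)] calculation by blast
  ultimately show ?case using Suc.prems(1) 2 by blast
qed

lemma cyl_joinI:
  assumes "C' \<in> cyl n" "C'' \<in> cyl k" "C' \<inter> (f ^^ n) -` C'' \<noteq> {}"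
  shows "C' \<inter> (f ^^ n) -` C'' \<in> cyl (n + k)"
  using assms
proof (induction n arbitrary: C')
  case (Suc n)
  obtain E D where 1: "E \<in> P" "D \<in> cyl n" "C' = E \<inter> f -` D" using Suc.prems(1) by (rule cyl_SucE)
  have eq: "C' \<inter> (f ^^ Suc n) -` C'' = E \<inter> f -` (D \<inter> (f ^^ n) -` C'')"
    using 1 by (auto simp: funpow_swap1)
  then have "D \<inter> (f ^^ n) -` C'' \<in> cyl (n + k)" using Suc 1 by blast
  then show ?case using cyl_SucI[OF 1(1)] Suc.prems(3) unfolding eq add_Suc by blast
qed (simp add: cyl_0)

lemma cyl_subset:
  assumes "C \<in> cyl n" "D \<in> cyl k" "k \<le> n" "x \<in> C" "x \<in> D"
  shows "C \<subseteq> D"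
proof -
  have "C \<in> cyl (k + (n - k))" using assms(1,3) by simp
  then obtain C' C'' where "C' \<in> cyl k" "C = C' \<inter> (f ^^ k) -` C''" by (rule cyl_splitE)
  then show ?thesis using cyl_disjoint[of C' k D x] assms by blast
qed

lemma ex_cyl_of_le:
  assumes "C \<in> cyl n" "k \<le> n"
  obtains D where "D \<in> cyl k" "C \<subseteq> D"
proof -
  have "C \<in> cyl (k + (n - k))" using assms by simp
  then obtain C' C'' where "C' \<in> cyl k" "C = C' \<inter> (f ^^ k) -` C''" by (rule cyl_splitE)
  then show ?thesis using that by blast
qed

text \<open>For \<open>n \<ge> 1\<close> the cylinder \<open>C\<close> lies in one partition
  element, which the Markov property puts inside the image of \<open>E\<close>. At order 0 the claim
  would be that \<open>E\<close> covers the space in a single step.\<close>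

lemma image_branch:
  assumes "E \<in> P" "C \<in> cyl n" "n \<ge> 1" "E \<inter> f -` C \<noteq> {}"
  shows "f ` (E \<inter> f -` C) = C"
proof -
  obtain F where F: "F \<in> P" "C \<subseteq> F" using ex_cyl_of_le[OF assms(2), of 1] assms(3) by (auto simp: cyl_1)
  then have "F \<subseteq> f ` E" using markov[OF assms(1) F(1)] assms(4) by blast
  then show ?thesis using F by blast
qed

lemma image_cyl:
  assumes "C' \<in> cyl n" "C'' \<in> cyl k" "k \<ge> 1" "C' \<inter> (f ^^ n) -` C'' \<noteq> {}"
  shows "(f ^^ n) ` (C' \<inter> (f ^^ n) -` C'') = C''"
  using assms
proof (induction n arbitrary: C')
  case (Suc n)
  obtain E D where 1: "E \<in> P" "D \<in> cyl n" "C' = E \<inter> f -` D" using Suc.prems(1) by (rule cyl_SucE)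
  have eq: "C' \<inter> (f ^^ Suc n) -` C'' = E \<inter> f -` (D \<inter> (f ^^ n) -` C'')"
    using 1 by (auto simp: funpow_swap1)
  have ne: "D \<inter> (f ^^ n) -` C'' \<noteq> {}" using Suc.prems(4) unfolding eq by auto
  have "f ` (C' \<inter> (f ^^ Suc n) -` C'') = D \<inter> (f ^^ n) -` C''"
    unfolding eq
    by (rule image_branch[OF 1(1) cyl_joinI[OF 1(2) Suc.prems(2) ne]]) (use Suc.prems(3,4)[unfolded eq] in auto)
  then have "(f ^^ n) ` f ` (C' \<inter> (f ^^ Suc n) -` C'') = C''"
    using Suc.IH[OF 1(2) Suc.prems(2,3) ne] by simp
  then show ?case unfolding funpow_Suc_right image_comp .
qed (simp add: cyl_0)

text \<open>A cylinder of order n + 1 fixes the itinerary at the times 0 to n, so n steps bring it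
  onto an element of \<open>P\<close>; one step more gives the image of such an element.\<close>

lemma cyl_last:
  assumes "C \<in> cyl (Suc n)"
  obtains E where "E \<in> P" "(f ^^ n) ` C = E"
proof -
  have "C \<in> cyl (n + Suc 0)" using assms by simp
  then obtain C' E where "C' \<in> cyl n" "E \<in> cyl (Suc 0)" "C = C' \<inter> (f ^^ n) -` E" by (rule cyl_splitE)
  then show ?thesis using image_cyl[of C' n E "Suc 0"] cyl_ne[OF assms] that by (auto simp: cyl_1)
qed

text \<open>Closures are included because the boundary is not yet known to be a null set when this
  is first used.\<close>

lemma inj_cyl: "C \<in> cyl n \<Longrightarrow> inj_on (f ^^ n) (closure C)"
proof (induction n arbitrary: C)
  case (Suc n)
  obtain E D where 1: "E \<in> P" "D \<in> cyl n" "C = E \<inter> f -` D" using Suc.prems(1) by (rule cyl_SucE)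
  have "closed (f -` closure D)"
    using continuous_closed_vimage[of "closure D" f] f_cont continuous_on_eq_continuous_at by blast
  then have "closure C \<subseteq> closure E \<inter> f -` closure D"
    unfolding 1 using closure_subset[of E] closure_subset[of D] by (intro closure_minimal) auto
  moreover have "inj_on (f ^^ n) (f ` closure C)"
    using inj_on_subset[OF Suc.IH[OF 1(2)]] calculation by blast
  moreover have "inj_on f (closure C)" using inj_on_subset[OF inj_P[OF 1(1)]] calculation by blast
  ultimately have "inj_on ((f ^^ n) \<circ> f) (closure C)" using comp_inj_on by blast
  then show ?case unfolding funpow_Suc_right .
qed (simp add: cyl_0)

lemma closed_image: "closed S \<Longrightarrow> closed (f ` S)"
  using compact_continuous_image[OF continuous_on_subset[OF f_cont]] compact_space compact_imp_closed
  by (metis compact_Int_closed inf_top.left_neutral subset_UNIV)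

text \<open>A point \<open>x\<close> over a partition element cannot sit on the boundary: if
  \<open>x\<close> is in the closure of \<open>E\<close>, the Markov property provides a point of
  \<open>E\<close> with the same image, and injectivity on the closure identifies it with
  \<open>x\<close>. Thus \<open>f\<close> maps the boundary set into itself.\<close>

lemma vimage_P:
  assumes "f x \<in> F" "F \<in> P"
  obtains E where "E \<in> P" "x \<in> E"
proof -
  obtain E where E: "E \<in> P" "x \<in> closure E" using closure_P by blast
  have "open (f -` F)" using open_vimage_fpow[of F 1] open_P[OF assms(2)] by simp
  from open_Int_closure_eq_empty[OF this, of E] have "f -` F \<inter> E \<noteq> {}" using E(2) assms(1) by blast
  then have "F \<subseteq> f ` E" using markov[OF E(1) assms(2)] by blast
  then obtain y where y: "y \<in> E" "f y = f x" using assms(1) by (metis imageE subsetD)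
  then have "y = x" using inj_onD[OF inj_P[OF E(1)], of y x] E(2) closure_subset by blast
  then show ?thesis using that E y by blast
qed

text \<open>The inverse homeomorphisms are composed along the itinerary. The branch must exist on
  the whole closure of \<open>E\<close>, because the short curves given by the inner diameter run in
  the closure.\<close>

lemma inverse_branch:
  assumes "C \<in> cyl (Suc n)" "(f ^^ n) ` C = E"
  obtains G where "continuous_on (closure E) G" "G ` closure E \<subseteq> closure C"
    "\<And>z. z \<in> closure E \<Longrightarrow> (f ^^ n) (G z) = z" "\<And>x. x \<in> C \<Longrightarrow> G ((f ^^ n) x) = x"
  using assms
proof (induction n arbitrary: C thesis)
  case 0
  then show ?case using 0(1)[of "\<lambda>x. x"] by auto
next
  case (Suc n)
  obtain F D where FD: "F \<in> P" "D \<in> cyl (Suc n)" "C = F \<inter> f -` D" using Suc.prems(2) by (rule cyl_SucE)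
  have fC: "f ` C = D" using image_branch[OF FD(1,2)] FD(3) cyl_ne[OF Suc.prems(2)] by auto
  have "(f ^^ n) ` D = E"
    using Suc.prems(3) unfolding fC[symmetric] by (simp add: image_image funpow_swap1)
  then obtain G where G: "continuous_on (closure E) G" "G ` closure E \<subseteq> closure D"
    "\<And>z. z \<in> closure E \<Longrightarrow> (f ^^ n) (G z) = z" "\<And>x. x \<in> D \<Longrightarrow> G ((f ^^ n) x) = x"
    using Suc.IH[OF _ FD(2)] by blast
  obtain g where g: "homeomorphism (closure F) (f ` closure F) f g" using homeo_P FD(1) by blast
  have sub: "closure D \<subseteq> f ` closure F"
    using fC FD(3) closure_subset[of F] by (intro closure_minimal closed_image) auto
  have gf: "g (f x) = x" if "x \<in> closure F" for x by (rule homeomorphism_apply1[OF g that])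
  have fg: "f (g y) = y" if "y \<in> closure D" for y by (rule homeomorphism_apply2[OF g]) (use sub that in blast)
  have cont: "continuous_on (closure E) (g \<circ> G)"
    by (rule continuous_on_compose[OF G(1) continuous_on_subset[OF homeomorphism_cont2[OF g]]]) (use G(2) sub in blast)
  have 1: "(g \<circ> G) ((f ^^ Suc n) x) = x" if "x \<in> C" for x
  proof -
    have "G ((f ^^ n) (f x)) = f x" using G(4) that fC by blast
    moreover have "x \<in> closure F" using that FD(3) closure_subset[of F] by auto
    ultimately show ?thesis using gf by (simp add: funpow_swap1)
  qed
  have 2: "(f ^^ Suc n) ((g \<circ> G) z) = z" if "z \<in> closure E" for z
    using fg[of "G z"] G(2,3) that by (auto simp: funpow_swap1)
  have "(g \<circ> G) ` E \<subseteq> closure C"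
    using 1 Suc.prems(3) closure_subset[of C] by (metis (no_types, lifting) image_iff image_subset_iff subsetD)
  then have "(g \<circ> G) ` closure E \<subseteq> closure C"
    by (intro image_closure_subset cont) auto
  then show ?case using Suc.prems(1)[OF cont _ 2 1] by blast
qed

end

section \<open>Contraction on hyperbolic cylinders\<close>

text \<open>A window of length \<open>i\<close> ending at time \<open>n + k\<close> either stays
  after time \<open>n\<close> or splits there into a full window of length \<open>k\<close> and one
  of length \<open>i - k\<close> ending at \<open>n\<close>; the exponents of the two bounds add
  up.\<close>

lemma hyperbolic_time_add:
  assumes 1: "hyperbolic_time A R f c n x" and 2: "hyperbolic_time A R f c k ((f ^^ n) x)"
    and pos: "\<And>x. inv_deriv_norm A R f x > 0"
  shows "hyperbolic_time A R f c (n + k) x"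
  unfolding hyperbolic_time_def
proof
  let ?a = "\<lambda>x. inv_deriv_norm A R f x"
  fix i assume i: "i \<in> {1..n + k}"
  have shift: "(\<Prod>j=n+l..<n+k. ?a ((f ^^ j) x)) = (\<Prod>j=l..<k. ?a ((f ^^ j) ((f ^^ n) x)))" for l
  proof -
    have "(\<Prod>j=n+l..<n+k. ?a ((f ^^ j) x)) = (\<Prod>j=l..<k. ?a ((f ^^ (j + n)) x))"
      using prod.shift_bounds_nat_ivl[of "\<lambda>j. ?a ((f ^^ j) x)" l n k] by (simp add: add.commute)
    then show ?thesis by (simp add: funpow_add)
  qed
  show "(\<Prod>j=n+k-i..<n+k. ?a ((f ^^ j) x)) < exp (- c * real i)"
  proof (cases "i \<le> k")
    case True
    then have e: "n + k - i = n + (k - i)" by simp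
    show ?thesis using 2 i True unfolding hyperbolic_time_def e shift by simp
  next
    case False
    have "(\<Prod>j=n+k-i..<n+k. ?a ((f ^^ j) x)) = (\<Prod>j=n-(i-k)..<n. ?a ((f ^^ j) x)) * (\<Prod>j=n..<n+k. ?a ((f ^^ j) x))"
      using False i by (subst prod.atLeastLessThan_concat) (auto simp: algebra_simps)
    also have "(\<Prod>j=n..<n+k. ?a ((f ^^ j) x)) = (\<Prod>j=0..<k. ?a ((f ^^ j) ((f ^^ n) x)))"
      using shift[of 0] by simp
    also have "(\<Prod>j=n-(i-k)..<n. ?a ((f ^^ j) x)) * \<dots> < exp (- c * real (i - k)) * exp (- c * real k)"
    proof -
      have A: "(\<Prod>j=n-(i-k)..<n. ?a ((f ^^ j) x)) < exp (- c * real (i - k))"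
        by (rule bspec[OF 1[unfolded hyperbolic_time_def]]) (use False i in auto)
      have "(\<Prod>j=0..<k. ?a ((f ^^ j) ((f ^^ n) x))) \<le> exp (- c * real k)"
        using 2 unfolding hyperbolic_time_def by (cases "k = 0") (force dest: bspec[of _ _ k])+
      moreover have "0 < (\<Prod>j=0..<k. ?a ((f ^^ j) ((f ^^ n) x)))" by (intro prod_pos) (simp add: pos)
      moreover have "0 \<le> (\<Prod>j=n-(i-k)..<n. ?a ((f ^^ j) x))" by (intro prod_nonneg) (simp add: pos less_imp_le)
      ultimately show ?thesis using A by (intro mult_less_le_imp_less) auto
    qed
    also have "\<dots> = exp (- c * real i)" using False by (simp flip: exp_add) (simp add: algebra_simps of_nat_diff)
    finally show ?thesis .
  qed
qed

lemma hyperbolic_time_shift: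
  assumes "hyperbolic_time A R f c n x" "j \<le> n"
  shows "hyperbolic_time A R f c (n - j) ((f ^^ j) x)"
  unfolding hyperbolic_time_def
proof
  fix k assume k: "k \<in> {1..n - j}"
  have "(\<Prod>i=n-j-k..<n-j. inv_deriv_norm A R f ((f ^^ i) ((f ^^ j) x))) = (\<Prod>i=n-j-k..<n-j. inv_deriv_norm A R f ((f ^^ (i + j)) x))"
    by (simp add: funpow_add)
  also have "\<dots> = (\<Prod>i=n-j-k+j..<n-j+j. inv_deriv_norm A R f ((f ^^ i) x))"
    by (rule prod.shift_bounds_nat_ivl[symmetric])
  also have "n - j - k + j = n - k" using k assms(2) by auto
  also have "n - j + j = n" using assms(2) by auto
  also have "(\<Prod>i=n-k..<n. inv_deriv_norm A R f ((f ^^ i) x)) < exp (- c * real k)"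
    by (rule bspec[OF assms(1)[unfolded hyperbolic_time_def]]) (use k in auto)
  finally show "(\<Prod>i=n-j-k..<n-j. inv_deriv_norm A R f ((f ^^ i) ((f ^^ j) x))) < exp (- c * real k)" .
qed

locale riemannian_markov_map = riemannian_local_diffeo A R f + markov_map f P N
  for A :: "('a::metric_space, 'e::euclidean_space) chart set" and R :: "('a, 'e) metric_tensor"
    and f :: "'a \<Rightarrow> 'a" and P N +
  fixes D :: real
  assumes inner_diameter: "E \<in> P \<Longrightarrow> x \<in> closure E \<Longrightarrow> y \<in> closure E \<Longrightarrow>
    \<exists>\<gamma>. pw_C1_curve A \<gamma> \<and> path_image \<gamma> \<subseteq> closure E \<and> pathstart \<gamma> = x \<and> pathfinish \<gamma> = y \<and> curve_length A R \<gamma> < ennreal D"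
begin

abbreviation hyp :: "real \<Rightarrow> nat \<Rightarrow> 'a set set" where
  "hyp c n \<equiv> hyperbolic_cylinders A R f P c n"

text \<open>Lower semicontinuity and compactness: if the values along a sequence tended to zero,
  half the positive value at a limit point would still have to lie below them.\<close>

lemma inv_deriv_norm_bounded_below: "\<exists>a0>0. \<forall>x. a0 \<le> a x"
proof (rule ccontr)
  assume "\<not> ?thesis"
  then have *: "\<exists>x. a x < a0" if "a0 > 0" for a0 using that by (meson not_le)
  have "\<exists>x. a x < 1 / (real n + 1)" for n :: nat by (rule *) simp
  then obtain x :: "nat \<Rightarrow> 'a" where x: "\<And>n. a (x n) < 1 / (real n + 1)" by metis
  obtain l r where r: "strict_mono r" "(x \<circ> r) \<longlonglongrightarrow> l"
    using compact_space unfolding compact_def by (metis UNIV_I)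
  have "\<forall>\<^sub>F n in sequentially. a l - a l / 2 < a ((x \<circ> r) n)"
    using eventually_compose_filterlim[OF inv_deriv_norm_lsc r(2), of "a l / 2"] inv_deriv_norm_pos[of l] by simp
  moreover have "(\<lambda>n. 1 / (real (r n) + 1)) \<longlonglongrightarrow> 0"
    using LIMSEQ_subseq_LIMSEQ[OF LIMSEQ_inverse_real_of_nat r(1)] by (simp add: o_def inverse_eq_divide add.commute)
  then have "\<forall>\<^sub>F n in sequentially. 1 / (real (r n) + 1) < a l / 2"
    by (rule order_tendstoD) (simp add: inv_deriv_norm_pos)
  ultimately have "\<forall>\<^sub>F n::nat in sequentially. False"
  proof eventually_elim
    case (elim n)
    then show ?case using x[of "r n"] by simp
  qed
  then show False by simp
qed

text \<open>Sublevel sets of products of positive lower semicontinuous functions are closed. The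
  factor \<open>t < 1\<close> on each of the \<open>m\<close> terms makes room for the
  semicontinuity and is removed by letting \<open>t\<close> tend to 1.\<close>

lemma prod_closure_le:
  assumes M: "\<And>x. x \<in> S \<Longrightarrow> (\<Prod>j<m. a ((f ^^ j) x)) \<le> M" and z: "z \<in> closure S"
  shows "(\<Prod>j<m. a ((f ^^ j) z)) \<le> M"
proof -
  obtain x where x: "\<And>n. x n \<in> S" "x \<longlonglongrightarrow> z" using z by (auto simp: closure_sequential)
  have t: "t ^ m * (\<Prod>j<m. a ((f ^^ j) z)) \<le> M" if t: "0 < t" "t < 1" for t
  proof -
    have "\<forall>\<^sub>F n in sequentially. \<forall>j\<in>{..<m}. a ((f ^^ j) z) * t < a ((f ^^ j) (x n))"
    proof (rule eventually_ball_finite, simp, rule ballI)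
      fix j
      have "isCont (f ^^ j) z" using fpow_cont[of UNIV j] continuous_on_eq_continuous_at[of UNIV] by auto
      then have "(\<lambda>n. (f ^^ j) (x n)) \<longlonglongrightarrow> (f ^^ j) z" by (rule isCont_tendsto_compose[OF _ x(2)])
      from eventually_compose_filterlim[OF inv_deriv_norm_lsc this, of "(1 - t) * a ((f ^^ j) z)"]
      show "\<forall>\<^sub>F n in sequentially. a ((f ^^ j) z) * t < a ((f ^^ j) (x n))"
        using t inv_deriv_norm_pos[of "(f ^^ j) z"] by (simp add: algebra_simps)
    qed
    then obtain n where n: "\<forall>j\<in>{..<m}. a ((f ^^ j) z) * t < a ((f ^^ j) (x n))"
      using eventually_happens by fastforce
    have "t ^ m * (\<Prod>j<m. a ((f ^^ j) z)) = (\<Prod>j<m. a ((f ^^ j) z) * t)"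
      by (simp add: prod.distrib mult.commute)
    also have "\<dots> \<le> (\<Prod>j<m. a ((f ^^ j) (x n)))"
      using n t by (intro prod_mono) (auto simp: inv_deriv_norm_pos less_imp_le)
    also have "\<dots> \<le> M" using M x by blast
    finally show ?thesis .
  qed
  have "((\<lambda>t. t ^ m * (\<Prod>j<m. a ((f ^^ j) z))) \<longlongrightarrow> 1 ^ m * (\<Prod>j<m. a ((f ^^ j) z))) (at_left (1::real))"
    by (intro tendsto_intros)
  moreover have "\<forall>\<^sub>F t in at_left (1::real). t ^ m * (\<Prod>j<m. a ((f ^^ j) z)) \<le> M"
    using eventually_at_left_real[of 0 1] by (rule eventually_mono) (auto intro: t)
  ultimately show ?thesis
    using tendsto_upperbound[of _ _ "at_left (1::real)" M] by (simp add: trivial_limit_at_left_real)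
qed

lemma hyp_cyl: "C \<in> hyp c n \<Longrightarrow> C \<in> cyl n"
  unfolding hyperbolic_cylinders_def by blast

lemma hyp_0: "hyp c 0 = {UNIV}"
  unfolding hyperbolic_cylinders_def hyperbolic_time_def by (auto simp: cyl_0)

lemma hyp_join:
  assumes "C \<in> hyp c n" "C' \<in> hyp c k" "C \<inter> (f ^^ n) -` C' \<noteq> {}"
  shows "C \<inter> (f ^^ n) -` C' \<in> hyp c (n + k)"
  using assms cyl_joinI[of C n C' k] hyperbolic_time_add[OF _ _ inv_deriv_norm_pos]
  unfolding hyperbolic_cylinders_def by blast

text \<open>Points of the cylinder are compared after \<open>n - 1\<close> steps, when it has become
  a partition element: a short curve in the closure is lifted by the inverse branch. The product of
  the first \<open>n - 1\<close> factors is the full hyperbolic product divided by its last factor,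
  and that is at least \<open>a0\<close>.\<close>

lemma hyp_diameter: "\<exists>K\<ge>0. \<forall>n\<ge>1. \<forall>C\<in>hyp c n. \<forall>x\<in>C. \<forall>y\<in>C. dist x y \<le> K * exp (- c * real n)"
proof -
  obtain a0 where a0: "a0 > 0" "\<And>x. a0 \<le> a x" using inv_deriv_norm_bounded_below by blast
  have "dist x y \<le> (max 0 D / a0) * exp (- c * real n)"
    if n: "n \<ge> 1" and C: "C \<in> hyp c n" and xy: "x \<in> C" "y \<in> C" for n C x y
  proof -
    obtain m where m: "n = Suc m" using n by (cases n) auto
    have C': "C \<in> cyl (Suc m)" using hyp_cyl[OF C] m by simp
    then obtain E where E: "E \<in> P" "(f ^^ m) ` C = E" by (rule cyl_last)
    obtain G where G: "continuous_on (closure E) G" "G ` closure E \<subseteq> closure C"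
      "\<And>z. z \<in> closure E \<Longrightarrow> (f ^^ m) (G z) = z" "\<And>x. x \<in> C \<Longrightarrow> G ((f ^^ m) x) = x"
      by (rule inverse_branch[OF C' E(2)]) blast
    have "(f ^^ m) x \<in> closure E" "(f ^^ m) y \<in> closure E" using E xy closure_subset[of E] by auto
    then obtain \<gamma> where \<gamma>: "pw_C1_curve A \<gamma>" "path_image \<gamma> \<subseteq> closure E" "pathstart \<gamma> = (f ^^ m) x"
      "pathfinish \<gamma> = (f ^^ m) y" "curve_length A R \<gamma> < ennreal D"
      using inner_diameter[OF E(1)] by blast
    have \<gamma>E: "\<gamma> t \<in> closure E" if "t \<in> {0..1}" for t using \<gamma>(2) that unfolding path_image_def by blast
    have \<gamma>_cont: "continuous_on {0..1} \<gamma>" using \<gamma>(1) by (simp add: pw_C1_curve_def path_def)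
    have "dist ((G \<circ> \<gamma>) 0) ((G \<circ> \<gamma>) 1) \<le> exp (- c * real n) / a0 * max 0 D"
    proof (rule lift_dist_le[OF \<gamma>(1) less_imp_le[OF \<gamma>(5)], of _ m])
      show "continuous_on {0..1} (G \<circ> \<gamma>)"
        by (rule continuous_on_compose[OF \<gamma>_cont continuous_on_subset[OF G(1)]]) (use \<gamma>E in auto)
      show "\<gamma> t = (f ^^ m) ((G \<circ> \<gamma>) t)" if "t \<in> {0..1}" for t using G(3) \<gamma>E that by simp
      show "(\<Prod>j<m. a ((f ^^ j) ((G \<circ> \<gamma>) t))) \<le> exp (- c * real n) / a0" if "t \<in> {0..1}" for t
      proof (rule prod_closure_le)
        show "(G \<circ> \<gamma>) t \<in> closure C" using G(2) \<gamma>E that by auto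
        fix z assume "z \<in> C"
        then have "hyperbolic_time A R f c n z" using C unfolding hyperbolic_cylinders_def by blast
        then have "(\<Prod>j=n-n..<n. a ((f ^^ j) z)) < exp (- c * real n)"
          using n unfolding hyperbolic_time_def by (metis atLeastAtMost_iff order_refl)
        then have "(\<Prod>j<m. a ((f ^^ j) z)) * a ((f ^^ m) z) < exp (- c * real n)"
          by (simp add: m atLeast0LessThan)
        moreover have "(\<Prod>j<m. a ((f ^^ j) z)) * a0 \<le> (\<Prod>j<m. a ((f ^^ j) z)) * a ((f ^^ m) z)"
          by (intro mult_left_mono a0 prod_nonneg) (simp add: inv_deriv_norm_pos less_imp_le)
        ultimately show "(\<Prod>j<m. a ((f ^^ j) z)) \<le> exp (- c * real n) / a0"
          using a0(1) by (simp add: pos_le_divide_eq)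
      qed
    qed
    moreover have "(G \<circ> \<gamma>) 0 = x" "(G \<circ> \<gamma>) 1 = y"
      using \<gamma>(3,4) G(4) xy by (auto simp: pathstart_def pathfinish_def)
    ultimately show ?thesis by (simp add: mult.commute)
  qed
  then show ?thesis using a0 by (intro exI[of _ "max 0 D / a0"]) auto
qed

text \<open>The image of a hyperbolic cylinder of order \<open>n\<close> under \<open>f ^^ j\<close>
  is a hyperbolic cylinder of order \<open>n - j\<close>, so the diameter bound applies at every
  time.\<close>

lemma hyp_contraction:
  "\<exists>K\<ge>0. \<forall>n C x y j. C \<in> hyp c n \<longrightarrow> x \<in> C \<longrightarrow> y \<in> C \<longrightarrow> j < n \<longrightarrow>
     dist ((f ^^ j) x) ((f ^^ j) y) \<le> K * exp (- c * real (n - j))"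
proof -
  obtain K where K: "K \<ge> 0" "\<forall>n\<ge>1. \<forall>C\<in>hyp c n. \<forall>x\<in>C. \<forall>y\<in>C. dist x y \<le> K * exp (- c * real n)"
    using hyp_diameter[of c] by blast
  have "dist ((f ^^ j) x) ((f ^^ j) y) \<le> K * exp (- c * real (n - j))"
    if C: "C \<in> hyp c n" and xy: "x \<in> C" "y \<in> C" and j: "j < n" for n C x y j
  proof -
    have "C \<in> cyl (j + (n - j))" using hyp_cyl[OF C] j by simp
    then obtain C' C'' where CC: "C' \<in> cyl j" "C'' \<in> cyl (n - j)" "C = C' \<inter> (f ^^ j) -` C''" by (rule cyl_splitE)
    have "C' \<inter> (f ^^ j) -` C'' \<noteq> {}" using CC(3) xy by blast
    then have im: "(f ^^ j) ` C = C''" using image_cyl[OF CC(1,2)] CC(3) j by simp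
    have "hyperbolic_time A R f c (n - j) z" if z: "z \<in> C''" for z
    proof -
      obtain w where w: "w \<in> C" "z = (f ^^ j) w" using z im by blast
      then have "hyperbolic_time A R f c n w" using C unfolding hyperbolic_cylinders_def by blast
      then show ?thesis unfolding w(2) by (rule hyperbolic_time_shift) (use j in simp)
    qed
    then have "C'' \<in> hyp c (n - j)" using CC(2) unfolding hyperbolic_cylinders_def by blast
    moreover have "(f ^^ j) x \<in> C''" "(f ^^ j) y \<in> C''" using im xy by auto
    moreover have "n - j \<ge> 1" using j by simp
    ultimately show ?thesis using K(2) by blast
  qed
  then show ?thesis using K(1) by blast
qed

end

section \<open>Conformal measures\<close>

locale conformal_map = markov_map f P N
  for f :: "'a::{metric_space, second_countable_topology} \<Rightarrow> 'a" and P N +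
  fixes \<phi> :: "'a \<Rightarrow> real" and d :: nat and \<nu> :: "'a measure" and lam :: real
  assumes fibre: "finite (f -` {x}) \<and> card (f -` {x}) = d"
    and phi_cont: "continuous_on UNIV \<phi>"
    and conformal: "conformal_measure f \<phi> lam \<nu>"
begin

lemma nu_sets [measurable_cong]: "sets \<nu> = sets borel"
  and nu_prob: "prob_space \<nu>"
  using conformal unfolding conformal_measure_def by auto

lemma nu_space [simp]: "space \<nu> = UNIV"
  using sets_eq_imp_space_eq[OF nu_sets] by simp

sublocale prob_space \<nu> by (rule nu_prob)

lemma nu_UNIV: "emeasure \<nu> UNIV = 1"
  using emeasure_space_1 by simp

lemma prob_UNIV [simp]: "prob UNIV = 1"
  using prob_space by simp

lemma finite_fibre: "finite (f -` {x})" using fibre by blast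

lemma phi_meas [measurable]: "\<phi> \<in> borel_measurable borel"
  using phi_cont by (rule borel_measurable_continuous_onI)

lemma f_meas [measurable]: "f \<in> borel_measurable borel"
  using f_cont by (rule borel_measurable_continuous_onI)

lemma fpow_meas [measurable]: "(f ^^ n) \<in> borel_measurable borel"
  using fpow_cont by (rule borel_measurable_continuous_onI)

lemma phi_bounded: obtains M where "M \<ge> 0" "\<And>x. \<bar>\<phi> x\<bar> \<le> M"
proof -
  have "compact (\<phi> ` UNIV)" by (rule compact_continuous_image[OF phi_cont compact_space])
  then obtain M where M: "\<And>y. y \<in> range \<phi> \<Longrightarrow> norm y \<le> M" using compact_imp_bounded bounded_iff by metis
  have "\<bar>\<phi> x\<bar> \<le> max 0 M" for x using M[of "\<phi> x"] by simp
  then show ?thesis using that[of "max 0 M"] by simp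
qed

lemma P_nonempty: "P \<noteq> {}"
  using closure_P by fastforce

lemma f_surj: "\<exists>y. f y = x"
proof -
  obtain E where "E \<in> P" using P_nonempty by blast
  then have "x \<in> (f ^^ N) ` E" using mixing by simp
  moreover obtain k where "N = Suc k" using N_pos by (cases N) auto
  ultimately show ?thesis by auto
qed

lemma fibre_ne: "f -` {x} \<noteq> {}"
  using f_surj[of x] by auto

lemma d_pos: "d \<ge> 1"
  using fibre[of undefined] fibre_ne[of undefined] by (metis One_nat_def Suc_leI card_gt_0_iff)

text \<open>Closures of partition elements cover the space but may overlap, and their boundaries are
  not known to be null at this stage. Removing the earlier closures from each yields disjoint Borel
  pieces on which \<open>f\<close> has a Borel inverse, so sums over fibres become finite sums of
  Borel functions.\<close>

lemma measurable_branches: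
  obtains r :: nat and D :: "nat \<Rightarrow> 'a set" and g :: "nat \<Rightarrow> 'a \<Rightarrow> 'a" where
    "\<And>i. i < r \<Longrightarrow> D i \<in> sets borel" "disjoint_family_on D {..<r}" "(\<Union>i<r. D i) = UNIV"
    "\<And>i y. i < r \<Longrightarrow> y \<in> D i \<Longrightarrow> g i (f y) = y"
    "\<And>i. i < r \<Longrightarrow> g i \<in> borel_measurable borel" "\<And>i. i < r \<Longrightarrow> f ` D i \<in> sets borel"
proof -
  obtain xs where xs: "set xs = P" "distinct xs" using finite_distinct_list[OF finite_P] by blast
  define r where "r = length xs"
  define D where "D i = closure (xs ! i) - (\<Union>j<i. closure (xs ! j))" for i
  have xs_P: "xs ! i \<in> P" if "i < r" for i using xs that by (auto simp: r_def)
  have "\<exists>g. homeomorphism (closure (xs ! i)) (f ` closure (xs ! i)) f g" if "i < r" for i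
    using homeo_P[OF xs_P[OF that]] .
  then obtain h where h: "\<And>i. i < r \<Longrightarrow> homeomorphism (closure (xs ! i)) (f ` closure (xs ! i)) f (h i)" by metis
  \<comment> \<open>Extended by a constant off the closed image, to be Borel on the whole
    space.\<close>
  define g where "g i x = (if x \<in> f ` closure (xs ! i) then h i x else undefined)" for i x
  have D_meas: "D i \<in> sets borel" for i
    unfolding D_def by (intro sets.Diff sets.finite_UN borel_closed) auto
  have gf: "g i (f y) = y" if "i < r" "y \<in> closure (xs ! i)" for i y
    using homeomorphism_apply1[OF h[OF that(1)] that(2)] that(2) by (simp add: g_def)
  have cl: "closed (f ` closure (xs ! i))" for i by (rule closed_image) simp
  have g_meas: "g i \<in> borel_measurable borel" if "i < r" for i
    unfolding g_def
    by (subst measurable_If_restrict_space_iff)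
      (use cl[of i] homeomorphism_cont2[OF h[OF that]] in \<open>auto intro!: borel_closed borel_measurable_continuous_on_restrict\<close>)
  have "f ` D i = f ` closure (xs ! i) \<inter> g i -` D i" if "i < r" for i
    using gf[OF that] by (force simp: D_def)
  moreover have "f ` closure (xs ! i) \<inter> g i -` D i \<in> sets borel" if "i < r" for i
    using measurable_sets[OF g_meas[OF that] D_meas[of i]] borel_closed[OF cl[of i]] by auto
  ultimately have fD: "f ` D i \<in> sets borel" if "i < r" for i using that by simp
  have "disjoint_family_on D {..<r}"
    unfolding disjoint_family_on_def
  proof (intro ballI impI)
    fix i j :: nat assume "i \<noteq> j"
    then consider "i < j" | "j < i" by linarith
    then show "D i \<inter> D j = {}" by cases (auto simp: D_def)
  qed
  moreover have "(\<Union>i<r. D i) = UNIV"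
  proof -
    have "x \<in> (\<Union>i<r. D i)" for x
    proof -
      have ex: "\<exists>i. i < r \<and> x \<in> closure (xs ! i)"
        using closure_P xs(1) unfolding r_def by (metis (no_types, lifting) UNIV_I UN_iff in_set_conv_nth)
      define i where "i = (LEAST i. i < r \<and> x \<in> closure (xs ! i))"
      have i: "i < r" "x \<in> closure (xs ! i)" using LeastI_ex[OF ex] by (auto simp: i_def)
      have "x \<notin> closure (xs ! j)" if "j < i" for j
        using not_less_Least[of j "\<lambda>i. i < r \<and> x \<in> closure (xs ! i)"] that i(1) by (auto simp: i_def)
      then show ?thesis using i by (auto simp: D_def)
    qed
    then show ?thesis by blast
  qed
  ultimately show ?thesis
    using that[of r D g] D_meas g_meas fD gf by (auto simp: D_def)
qed

lemma fibre_sum_measurable: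
  fixes v :: "'a \<Rightarrow> 'b::{second_countable_topology, topological_comm_monoid_add}"
  assumes v: "v \<in> borel_measurable borel"
  shows "(\<lambda>x. \<Sum>y\<in>f -` {x}. v y) \<in> borel_measurable borel"
proof -
  obtain r :: nat and D g where
    D: "\<And>i. i < r \<Longrightarrow> D i \<in> sets borel" "disjoint_family_on D {..<r}" "(\<Union>i<r. D i) = UNIV"
    and g: "\<And>i y. i < r \<Longrightarrow> y \<in> D i \<Longrightarrow> g i (f y) = y"
    "\<And>i. i < r \<Longrightarrow> g i \<in> borel_measurable borel" "\<And>i. i < r \<Longrightarrow> f ` D i \<in> sets borel"
    by (rule measurable_branches) blast
  have "(\<Sum>y\<in>f -` {x}. v y) = (\<Sum>i<r. if x \<in> f ` D i then v (g i x) else 0)" for x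
  proof -
    have "f -` {x} = (\<Union>i<r. f -` {x} \<inter> D i)" using D(3) by blast
    then have "(\<Sum>y\<in>f -` {x}. v y) = (\<Sum>y\<in>(\<Union>i<r. f -` {x} \<inter> D i). v y)" by simp
    also have "\<dots> = (\<Sum>i<r. \<Sum>y\<in>f -` {x} \<inter> D i. v y)"
      by (rule sum.UNION_disjoint)
        (use D(2) finite_fibre in \<open>auto simp: disjoint_family_on_def\<close>)
    also have "\<dots> = (\<Sum>i<r. if x \<in> f ` D i then v (g i x) else 0)"
    proof (rule sum.cong[OF refl])
      fix i assume "i \<in> {..<r}"
      then have i: "i < r" by simp
      have "f -` {x} \<inter> D i = (if x \<in> f ` D i then {g i x} else {})" using g(1)[OF i] by force
      then show "(\<Sum>y\<in>f -` {x} \<inter> D i. v y) = (if x \<in> f ` D i then v (g i x) else 0)" by simp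
    qed
    finally show ?thesis .
  qed
  moreover have "(\<lambda>x. \<Sum>i<r. if x \<in> f ` D i then v (g i x) else 0) \<in> borel_measurable borel"
  proof (intro borel_measurable_sum measurable_If_set borel_measurable_const)
    fix i assume "i \<in> {..<r}"
    then have i: "i < r" by simp
    show "(\<lambda>x. v (g i x)) \<in> borel_measurable borel" by (rule measurable_compose[OF g(2)[OF i] v])
    show "f ` D i \<inter> space borel \<in> sets borel" using g(3)[OF i] by simp
  qed
  ultimately show ?thesis by simp
qed

lemma image_measurable:
  assumes A: "A \<in> sets borel"
  shows "f ` A \<in> sets borel"
proof -
  obtain r :: nat and D g where
    D: "\<And>i. i < r \<Longrightarrow> D i \<in> sets borel" "disjoint_family_on D {..<r}" "(\<Union>i<r. D i) = UNIV"
    and g: "\<And>i y. i < r \<Longrightarrow> y \<in> D i \<Longrightarrow> g i (f y) = y"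
    "\<And>i. i < r \<Longrightarrow> g i \<in> borel_measurable borel" "\<And>i. i < r \<Longrightarrow> f ` D i \<in> sets borel"
    by (rule measurable_branches) blast
  have "f ` A = (\<Union>i<r. f ` D i \<inter> (g i -` A))"
  proof safe
    fix y assume "y \<in> A"
    moreover obtain i where "i < r" "y \<in> D i" using D(3) by blast
    ultimately show "f y \<in> (\<Union>i<r. f ` D i \<inter> (g i -` A))" using g(1) by force
  next
    fix i y assume "i < r" "g i (f y) \<in> A" "y \<in> D i"
    then show "f y \<in> f ` A" using g(1) by fastforce
  qed
  moreover have "(\<Union>i<r. f ` D i \<inter> (g i -` A)) \<in> sets borel"
    using g(2,3) measurable_sets[OF g(2) A] by (intro sets.finite_UN) auto
  ultimately show ?thesis by simp
qed

lemma image_fpow_measurable: "A \<in> sets borel \<Longrightarrow> (f ^^ n) ` A \<in> sets borel"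
proof (induction n)
  case (Suc n)
  then show ?case using image_measurable[of "(f ^^ n) ` A"] by (simp add: image_image)
qed simp

section \<open>Conformality for nonnegative Borel functions\<close>

definition nntransfer :: "('a \<Rightarrow> ennreal) \<Rightarrow> 'a \<Rightarrow> ennreal" where
  "nntransfer u x = (\<Sum>y\<in>f -` {x}. ennreal (exp (\<phi> y)) * u y)"

lemma nntransfer_measurable [measurable]:
  assumes [measurable]: "u \<in> borel_measurable borel"
  shows "nntransfer u \<in> borel_measurable borel"
  unfolding nntransfer_def by (rule fibre_sum_measurable) measurable

lemma nntransfer_mono: "(\<And>y. u y \<le> v y) \<Longrightarrow> nntransfer u x \<le> nntransfer v x"
  unfolding nntransfer_def by (intro sum_mono mult_left_mono) auto

lemma nntransfer_add: "nntransfer (\<lambda>y. u y + v y) x = nntransfer u x + nntransfer v x"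
  unfolding nntransfer_def by (simp add: distrib_left sum.distrib)

lemma nntransfer_cmult: "nntransfer (\<lambda>y. a * u y) x = a * nntransfer u x"
  unfolding nntransfer_def by (simp add: sum_distrib_left mult_ac)

lemma nntransfer_LIMSEQ: "(\<And>y. (\<lambda>n. U n y) \<longlonglongrightarrow> u y) \<Longrightarrow> (\<lambda>n. nntransfer (U n) x) \<longlonglongrightarrow> nntransfer u x"
  unfolding nntransfer_def by (intro tendsto_sum ennreal_tendsto_cmult) auto

text \<open>The eigenmeasure equation for a single function. It is given for continuous functions;
  the class of functions that satisfy it is closed under sums and increasing limits, which leads to
  all nonnegative Borel functions.\<close>

definition conf :: "('a \<Rightarrow> ennreal) \<Rightarrow> bool" where
  "conf u \<longleftrightarrow> u \<in> borel_measurable borel \<and> (\<integral>\<^sup>+x. nntransfer u x \<partial>\<nu>) = ennreal lam * (\<integral>\<^sup>+x. u x \<partial>\<nu>)"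

text \<open>The transfer of the constant 1 is a sum of \<open>d\<close> weights at each point and
  has integral \<open>lam\<close>. This is how the degree bounds \<open>lam\<close> from below, and
  why families of much fewer than \<open>d ^ n\<close> cylinders have a small weight relative to
  \<open>lam ^ n\<close>.\<close>

lemma lam_ge:
  assumes "\<And>x. m \<le> \<phi> x"
  shows "real d * exp m \<le> lam"
proof -
  define T where "T x = (\<Sum>y\<in>f -` {x}. exp (\<phi> y))" for x
  have T: "transfer_op f \<phi> (\<lambda>_. 1) x = complex_of_real (T x)" for x
    unfolding transfer_op_def T_def by simp
  have T_meas [measurable]: "T \<in> borel_measurable borel"
    unfolding T_def by (rule fibre_sum_measurable) measurable
  obtain M where M: "\<And>x. \<bar>\<phi> x\<bar> \<le> M" using phi_bounded by blast
  have T_le: "T x \<le> real d * exp M" for x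
  proof -
    have "T x \<le> (\<Sum>y\<in>f -` {x}. exp M)" unfolding T_def using M by (intro sum_mono) (auto simp: abs_le_iff)
    then show ?thesis using fibre[of x] by simp
  qed
  have T_ge: "real d * exp m \<le> T x" for x
  proof -
    have "(\<Sum>y\<in>f -` {x}. exp m) \<le> T x" unfolding T_def using assms by (intro sum_mono) auto
    then show ?thesis using fibre[of x] by simp
  qed
  have T_nonneg: "T x \<ge> 0" for x unfolding T_def by (intro sum_nonneg) simp
  have int: "integrable \<nu> T"
    by (rule integrable_const_bound[of _ "real d * exp M"]) (use T_le T_nonneg in auto)
  have "(\<lambda>_. 1) \<in> continuous_functions" by (simp add: continuous_functions_def)
  then have "(\<integral>x. transfer_op f \<phi> (\<lambda>_. 1) x \<partial>\<nu>) = complex_of_real lam * (\<integral>x. 1 \<partial>\<nu>)"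
    using conformal unfolding conformal_measure_def by blast
  then have "complex_of_real (\<integral>x. T x \<partial>\<nu>) = complex_of_real lam"
    unfolding T by (simp add: prob_space)
  then have "(\<integral>x. T x \<partial>\<nu>) = lam" using of_real_eq_iff by blast
  moreover have "(\<integral>x. real d * exp m \<partial>\<nu>) \<le> (\<integral>x. T x \<partial>\<nu>)"
    using int T_ge by (intro integral_mono) auto
  ultimately show ?thesis by (simp add: prob_space)
qed

lemma lam_pos: "lam > 0"
proof -
  obtain M where M: "\<And>x. \<bar>\<phi> x\<bar> \<le> M" using phi_bounded by blast
  have "- M \<le> \<phi> x" for x using M[of x] by linarith
  from lam_ge[OF this] have "real d * exp (- M) \<le> lam" by simp
  moreover have "real d * exp (- M) > 0" using d_pos by simp
  ultimately show ?thesis by linarith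
qed

lemma conf_continuous:
  assumes g: "continuous_on UNIV g" "\<And>x. 0 \<le> g x" "\<And>x. g x \<le> (1::real)"
  shows "conf (\<lambda>x. ennreal (g x))"
proof -
  define T where "T x = (\<Sum>y\<in>f -` {x}. exp (\<phi> y) * g y)" for x
  have T: "transfer_op f \<phi> (\<lambda>y. complex_of_real (g y)) x = complex_of_real (T x)" for x
    unfolding transfer_op_def T_def by simp
  have g_meas [measurable]: "g \<in> borel_measurable borel" using g(1) by (rule borel_measurable_continuous_onI)
  have T_meas [measurable]: "T \<in> borel_measurable borel"
    unfolding T_def by (rule fibre_sum_measurable) measurable
  have T_nn: "nntransfer (\<lambda>x. ennreal (g x)) x = ennreal (T x)" for x
    unfolding nntransfer_def T_def using g(2)
    by (subst sum_ennreal[symmetric]) (auto simp: ennreal_mult')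
  have T_nonneg: "T x \<ge> 0" for x unfolding T_def using g(2) by (intro sum_nonneg) simp
  obtain M where M: "\<And>x. \<bar>\<phi> x\<bar> \<le> M" using phi_bounded by blast
  have T_le: "T x \<le> real d * exp M" for x
  proof -
    have "T x \<le> (\<Sum>y\<in>f -` {x}. exp M * 1)"
      unfolding T_def using M g by (intro sum_mono mult_mono) (auto simp: abs_le_iff)
    then show ?thesis using fibre[of x] by simp
  qed
  have int: "integrable \<nu> T"
    by (rule integrable_const_bound[of _ "real d * exp M"]) (use T_le T_nonneg in auto)
  have int_g: "integrable \<nu> g"
    by (rule integrable_const_bound[of _ 1]) (use g in auto)
  have "(\<lambda>y. complex_of_real (g y)) \<in> continuous_functions"
    unfolding continuous_functions_def using g(1) by (auto intro: continuous_intros)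
  then have "(\<integral>x. transfer_op f \<phi> (\<lambda>y. complex_of_real (g y)) x \<partial>\<nu>) = complex_of_real lam * (\<integral>x. complex_of_real (g x) \<partial>\<nu>)"
    using conformal unfolding conformal_measure_def by blast
  then have "complex_of_real (\<integral>x. T x \<partial>\<nu>) = complex_of_real (lam * (\<integral>x. g x \<partial>\<nu>))" unfolding T by simp
  then have "(\<integral>x. T x \<partial>\<nu>) = lam * (\<integral>x. g x \<partial>\<nu>)" using of_real_eq_iff by blast
  then show ?thesis
    unfolding conf_def T_nn using int int_g T_nonneg g(2) lam_pos
    by (simp add: nn_integral_eq_integral ennreal_mult')
qed

lemma conf_LIMSEQ:
  assumes U: "\<And>n. conf (U n)" and inc: "incseq U" and lim: "\<And>x. (\<lambda>n. U n x) \<longlonglongrightarrow> u x"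
  shows "conf u"
proof -
  have [measurable]: "U n \<in> borel_measurable borel" for n using U unfolding conf_def by blast
  have u_meas: "u \<in> borel_measurable borel"
    by (rule borel_measurable_LIMSEQ_order[OF lim]) simp
  have "(\<lambda>n. \<integral>\<^sup>+x. nntransfer (U n) x \<partial>\<nu>) \<longlonglongrightarrow> (\<integral>\<^sup>+x. nntransfer u x \<partial>\<nu>)"
  proof (rule nn_integral_LIMSEQ)
    show "incseq (\<lambda>n. nntransfer (U n))"
      using inc by (intro incseq_SucI le_funI nntransfer_mono) (auto simp: incseq_Suc_iff le_fun_def)
    show "(\<lambda>n. nntransfer (U n) x) \<longlonglongrightarrow> nntransfer u x" for x by (rule nntransfer_LIMSEQ[OF lim])
  qed simp
  moreover have "(\<lambda>n. \<integral>\<^sup>+x. U n x \<partial>\<nu>) \<longlonglongrightarrow> (\<integral>\<^sup>+x. u x \<partial>\<nu>)"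
    by (rule nn_integral_LIMSEQ[OF inc _ lim]) simp
  then have "(\<lambda>n. ennreal lam * (\<integral>\<^sup>+x. U n x \<partial>\<nu>)) \<longlonglongrightarrow> ennreal lam * (\<integral>\<^sup>+x. u x \<partial>\<nu>)"
    by (rule ennreal_tendsto_cmult[rotated]) simp
  moreover have "(\<integral>\<^sup>+x. nntransfer (U n) x \<partial>\<nu>) = ennreal lam * (\<integral>\<^sup>+x. U n x \<partial>\<nu>)" for n
    using U unfolding conf_def by blast
  ultimately show ?thesis unfolding conf_def using u_meas LIMSEQ_unique by auto
qed

lemma conf_add:
  assumes "conf u" "conf v"
  shows "conf (\<lambda>x. u x + v x)"
proof -
  have [measurable]: "u \<in> borel_measurable borel" "v \<in> borel_measurable borel"
    using assms unfolding conf_def by auto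
  show ?thesis
    using assms unfolding conf_def nntransfer_add
    by (simp add: nn_integral_add distrib_left)
qed

lemma conf_open:
  assumes "open S"
  shows "conf (indicator S)"
\<comment> \<open>The distance to the empty complement is 0 by convention, so the approximation used
  below would fail for the whole space.\<close>
proof (cases "S = UNIV")
  case True
  have "conf (\<lambda>x. ennreal 1)" by (rule conf_continuous) auto
  then show ?thesis using True by simp
next
  case False
  define U where "U n x = min 1 (real n * infdist x (- S))" for n x
  have lim: "(\<lambda>n. ennreal (U n x)) \<longlonglongrightarrow> indicator S x" for x
  proof (cases "x \<in> S")
    case True
    have pos: "infdist x (- S) > 0"
      using infdist_pos_not_in_closed[of "- S" x] assms False True by (auto simp: closed_def)
    obtain n0 :: nat where n0: "real n0 > 1 / infdist x (- S)" using reals_Archimedean2 by blast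
    have "U n x = 1" if "n \<ge> n0" for n
    proof -
      have "real n > 1 / infdist x (- S)" using n0 that by linarith
      then show ?thesis using pos by (simp add: U_def field_simps min_def)
    qed
    then have "\<forall>\<^sub>F n in sequentially. ennreal (U n x) = indicator S x"
      using True by (auto simp: eventually_sequentially intro!: exI[of _ n0])
    then show ?thesis by (rule tendsto_eventually)
  next
    case False
    then show ?thesis by (simp add: U_def)
  qed
  show ?thesis
  proof (rule conf_LIMSEQ[OF _ _ lim])
    show "conf (\<lambda>x. ennreal (U n x))" for n
      by (rule conf_continuous) (auto simp: U_def infdist_nonneg intro!: continuous_intros)
    show "incseq (\<lambda>n x. ennreal (U n x))"
      unfolding U_def
      by (intro incseq_SucI le_funI ennreal_leI min.mono mult_right_mono infdist_nonneg) auto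
  qed
qed

text \<open>Dynkin's argument over the open sets. For complements the equation for \<open>A\<close>
  is cancelled from that for the whole space, which is possible because \<nu> is finite.\<close>

lemma conf_indicator:
  assumes "A \<in> sets borel"
  shows "conf (indicator A)"
proof -
  have A: "A \<in> sigma_sets UNIV {S. open S}" using assms by (simp add: borel_def)
  have meas: "A \<in> sets borel" if "A \<in> sigma_sets UNIV {S. open S}" for A :: "'a set"
    using that by (simp add: borel_def)
  have "Int_stable {S :: 'a set. open S}" "{S :: 'a set. open S} \<subseteq> Pow UNIV" by (auto simp: Int_stable_def)
  then show ?thesis
    using A
  proof (induction rule: sigma_sets_induct_disjoint)
    case (basic A)
    then show ?case using conf_open by simp
  next
    case empty
    show ?case using conf_open[OF open_empty] .
  next
    case (compl A)
    have [measurable]: "A \<in> sets borel" using meas compl(1) .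
    have one: "(\<lambda>x. indicator (UNIV - A) x + indicator A x :: ennreal) = indicator UNIV"
      by (auto simp: indicator_def)
    have "(\<integral>\<^sup>+x. nntransfer (indicator (UNIV - A)) x \<partial>\<nu>) + (\<integral>\<^sup>+x. nntransfer (indicator A) x \<partial>\<nu>)
      = ennreal lam * (\<integral>\<^sup>+x. indicator (UNIV - A) x \<partial>\<nu>) + ennreal lam * (\<integral>\<^sup>+x. indicator A x \<partial>\<nu>)"
    proof -
      have "(\<integral>\<^sup>+x. nntransfer (indicator (UNIV - A)) x \<partial>\<nu>) + (\<integral>\<^sup>+x. nntransfer (indicator A) x \<partial>\<nu>)
          = (\<integral>\<^sup>+x. nntransfer (indicator UNIV) x \<partial>\<nu>)"
        by (subst nn_integral_add[symmetric]) (auto simp: one simp flip: nntransfer_add)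
      also have "\<dots> = ennreal lam * (\<integral>\<^sup>+x. indicator UNIV x \<partial>\<nu>)"
        using conf_open[of UNIV] unfolding conf_def by simp
      also have "(\<integral>\<^sup>+x. indicator UNIV x \<partial>\<nu>) = (\<integral>\<^sup>+x. indicator (UNIV - A) x \<partial>\<nu>) + (\<integral>\<^sup>+x. indicator A x \<partial>\<nu>)"
      proof -
        have "(\<integral>\<^sup>+x. indicator (UNIV - A) x \<partial>\<nu>) + (\<integral>\<^sup>+x. indicator A x \<partial>\<nu>)
          = (\<integral>\<^sup>+x. indicator (UNIV - A) x + indicator A x \<partial>\<nu>)"
          by (rule nn_integral_add[symmetric]) auto
        then show ?thesis unfolding one by simp
      qed
      finally show ?thesis by (simp add: distrib_left)
    qed
    moreover have "(\<integral>\<^sup>+x. nntransfer (indicator A) x \<partial>\<nu>) = ennreal lam * (\<integral>\<^sup>+x. indicator A x \<partial>\<nu>)"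
      using compl unfolding conf_def by blast
    moreover have "ennreal lam * (\<integral>\<^sup>+x. indicator A x \<partial>\<nu>) \<noteq> \<top>"
      by (simp add: ennreal_mult_eq_top_iff)
    ultimately have "ennreal lam * (\<integral>\<^sup>+x. indicator A x \<partial>\<nu>) + (\<integral>\<^sup>+x. nntransfer (indicator (UNIV - A)) x \<partial>\<nu>)
      = ennreal lam * (\<integral>\<^sup>+x. indicator A x \<partial>\<nu>) + ennreal lam * (\<integral>\<^sup>+x. indicator (UNIV - A) x \<partial>\<nu>)"
      by (simp add: add.commute)
    then show ?case
      using \<open>ennreal lam * (\<integral>\<^sup>+x. indicator A x \<partial>\<nu>) \<noteq> \<top>\<close>
      unfolding conf_def ennreal_add_left_cancel by auto
  next
    case (union A)
    have part: "conf (indicator (\<Union>i<n. A i))" for n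
    proof (induction n)
      case 0
      show ?case using conf_open[OF open_empty] by (simp only: lessThan_0 image_empty Union_empty)
    next
      case (Suc n)
      have "indicator (\<Union>i<Suc n. A i) x = (indicator (\<Union>i<n. A i) x + indicator (A n) x :: ennreal)" for x
      proof -
        have "x \<notin> A n" if "x \<in> A i" "i < n" for i
          using union(1) that unfolding disjoint_family_on_def by (metis UNIV_I disjoint_iff less_irrefl)
        then show ?thesis by (auto simp: indicator_def lessThan_Suc)
      qed
      then show ?case using conf_add[OF Suc union(3)[of n]] by presburger
    qed
    show ?case
    proof (rule conf_LIMSEQ[OF part])
      show "incseq (\<lambda>n. indicator (\<Union>i<n. A i) :: 'a \<Rightarrow> ennreal)"
        by (intro incseq_SucI le_funI) (auto simp: indicator_def lessThan_Suc)
      show "(\<lambda>n. indicator (\<Union>i<n. A i) x :: ennreal) \<longlonglongrightarrow> indicator (\<Union>i. A i) x" for x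
      proof (cases "x \<in> (\<Union>i. A i)")
        case True
        then obtain i where "x \<in> A i" by blast
        then have "\<forall>\<^sub>F n in sequentially. (indicator (\<Union>i<n. A i) x :: ennreal) = indicator (\<Union>i. A i) x"
          using True by (auto simp: eventually_sequentially indicator_def intro!: exI[of _ "Suc i"])
        then show ?thesis by (rule tendsto_eventually)
      qed simp
    qed
  qed
qed

lemma nn_conformal:
  assumes "u \<in> borel_measurable borel"
  shows "(\<integral>\<^sup>+x. nntransfer u x \<partial>\<nu>) = ennreal lam * (\<integral>\<^sup>+x. u x \<partial>\<nu>)"
proof -
  have "conf u"
    using assms
  proof (induction rule: borel_measurable_induct)
    case (cong f g)
    then show ?case by (metis ext space_borel UNIV_I)
  next
    case (set A)
    then show ?case by (rule conf_indicator)
  next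
    case (mult u c)
    have eq: "nntransfer (\<lambda>a. c * u a) = (\<lambda>x. c * nntransfer u x)" by (auto simp: nntransfer_cmult)
    have [measurable]: "u \<in> borel_measurable borel" using mult unfolding conf_def by blast
    from mult show ?case unfolding conf_def eq by (simp add: nn_integral_cmult mult_ac)
  next
    case (add u v)
    then show ?case using conf_add by blast
  next
    case (seq U)
    show ?case
    proof (rule conf_LIMSEQ)
      show "conf (U i)" for i using seq by blast
      show inc: "incseq U" using seq by blast
      show "(\<lambda>n. U n x) \<longlonglongrightarrow> (SUP i. U i) x" for x
        using inc unfolding SUP_apply by (intro LIMSEQ_SUP) (auto simp: incseq_def le_fun_def)
    qed
  qed
  then show ?thesis unfolding conf_def by blast
qed

text \<open>The integral of the transfer of \<open>indicator Z\<close> is \<open>lam\<close> times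
  the measure of \<open>Z\<close>, hence zero, and all weights are positive: almost no point has a
  preimage in \<open>Z\<close>. In other words, images of null sets are null.\<close>

lemma AE_fibre:
  assumes "AE y in \<nu>. Q y"
  shows "AE x in \<nu>. \<forall>y. f y = x \<longrightarrow> Q y"
proof -
  obtain Z where Z: "{x \<in> space \<nu>. \<not> Q x} \<subseteq> Z" "Z \<in> sets borel" "emeasure \<nu> Z = 0"
    using assms by (auto elim!: AE_E simp: nu_sets)
  have "(\<integral>\<^sup>+x. nntransfer (indicator Z) x \<partial>\<nu>) = 0"
    using Z by (subst nn_conformal) (auto simp: nu_sets)
  then have "AE x in \<nu>. nntransfer (indicator Z) x = 0"
    using Z(2) by (subst (asm) nn_integral_0_iff_AE) auto
  then show ?thesis
  proof eventually_elim
    case (elim x)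
    then have "ennreal (exp (\<phi> y)) * indicator Z y = 0" if "f y = x" for y
      using that finite_fibre[of x] unfolding nntransfer_def by (subst (asm) sum_eq_0_iff) auto
    then have "y \<notin> Z" if "f y = x" for y using that by (auto simp: indicator_def split: if_splits)
    then show ?case using Z(1) by auto
  qed
qed

lemma nntransfer_comp: "nntransfer (\<lambda>y. u (f y) * v y) x = u x * nntransfer v x"
  unfolding nntransfer_def sum_distrib_left by (intro sum.cong) (auto simp: mult_ac)

text \<open>The counterpart for preimages: a function composed with \<open>f\<close> factors out of
  the transfer operator, so the transfer of the indicator of the preimage of \<open>Z\<close> is
  supported on \<open>Z\<close>.\<close>

lemma AE_f:
  assumes "AE x in \<nu>. Q x"
  shows "AE x in \<nu>. Q (f x)"
proof -
  obtain Z where Z: "{x \<in> space \<nu>. \<not> Q x} \<subseteq> Z" "Z \<in> sets borel" "emeasure \<nu> Z = 0"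
    using assms by (auto elim!: AE_E simp: nu_sets)
  have [measurable]: "Z \<in> sets borel" by (rule Z)
  have "ennreal lam * (\<integral>\<^sup>+x. indicator Z (f x) * 1 \<partial>\<nu>) = (\<integral>\<^sup>+x. nntransfer (\<lambda>x. indicator Z (f x) * 1) x \<partial>\<nu>)"
    by (rule nn_conformal[symmetric]) measurable
  also have "\<dots> = (\<integral>\<^sup>+x. indicator Z x * nntransfer (\<lambda>_. 1) x \<partial>\<nu>)"
    by (intro nn_integral_cong nntransfer_comp)
  also have "\<dots> = 0"
  proof (subst nn_integral_0_iff_AE)
    have "AE x in \<nu>. x \<notin> Z" using Z by (intro AE_not_in) (auto simp: null_sets_def nu_sets)
    then show "AE x in \<nu>. indicator Z x * nntransfer (\<lambda>_. 1) x = 0" by eventually_elim simp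
  qed simp
  finally have "(\<integral>\<^sup>+x. indicator Z (f x) \<partial>\<nu>) = 0" using lam_pos by (simp add: ennreal_eq_0_iff)
  then have "AE x in \<nu>. indicator Z (f x) = (0::ennreal)" by (subst (asm) nn_integral_0_iff_AE) auto
  then show ?thesis by eventually_elim (use Z(1) in \<open>auto simp: indicator_def split: if_splits\<close>)
qed

lemma AE_fpow: "AE x in \<nu>. Q x \<Longrightarrow> AE x in \<nu>. Q ((f ^^ n) x)"
proof (induction n)
  case (Suc n)
  then show ?case using AE_f[of "\<lambda>x. Q ((f ^^ n) x)"] by (simp add: funpow_swap1)
qed simp

lemma AE_fibre_pow: "AE x in \<nu>. Q x \<Longrightarrow> AE x in \<nu>. \<forall>y. (f ^^ n) y = x \<longrightarrow> Q y"
proof (induction n)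
  case (Suc n)
  from AE_fibre[OF Suc.IH[OF Suc.prems]] show ?case by eventually_elim simp
qed simp

lemma finite_fibre_pow: "finite ((f ^^ n) -` {x})"
proof (induction n arbitrary: x)
  case (Suc n)
  have eq: "(f ^^ Suc n) -` {x} = (\<Union>y\<in>f -` {x}. (f ^^ n) -` {y})" by auto
  show ?case unfolding eq using Suc finite_fibre by blast
qed simp

lemma sum_fibre_Suc:
  fixes v :: "'a \<Rightarrow> 'b::comm_monoid_add"
  shows "(\<Sum>z\<in>(f ^^ Suc n) -` {x}. v z) = (\<Sum>y\<in>f -` {x}. \<Sum>z\<in>(f ^^ n) -` {y}. v z)"
proof -
  have eq: "(f ^^ Suc n) -` {x} = (\<Union>y\<in>f -` {x}. (f ^^ n) -` {y})" by auto
  show ?thesis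
    unfolding eq by (rule sum.UNION_disjoint) (use finite_fibre finite_fibre_pow in auto)
qed

section \<open>Birkhoff sums and the measure of images under iterates\<close>

abbreviation S :: "nat \<Rightarrow> 'a \<Rightarrow> real" where
  "S n x \<equiv> birkhoff_sum f \<phi> n x"

lemma S_Suc: "S (Suc n) x = S n x + \<phi> ((f ^^ n) x)"
  by (simp add: birkhoff_sum_def)

lemma S_add: "S (n + k) x = S n x + S k ((f ^^ n) x)"
proof (induction k)
  case (Suc k)
  have "(f ^^ (n + k)) x = (f ^^ k) ((f ^^ n) x)" by (metis add.commute funpow_add comp_apply)
  with Suc show ?case by (simp add: S_Suc)
qed (simp add: birkhoff_sum_def)

lemma S_0: "S 0 x = 0"
  by (simp add: birkhoff_sum_def)

lemma S_meas [measurable]: "S n \<in> borel_measurable borel"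
  unfolding birkhoff_sum_def by measurable

lemma nntransfer_pow: "(nntransfer ^^ n) u x = (\<Sum>y\<in>(f ^^ n) -` {x}. ennreal (exp (S n y)) * u y)"
proof (induction n arbitrary: x)
  case (Suc n)
  have "(nntransfer ^^ Suc n) u x = (\<Sum>y\<in>f -` {x}. ennreal (exp (\<phi> y)) * (\<Sum>z\<in>(f ^^ n) -` {y}. ennreal (exp (S n z)) * u z))"
    by (simp add: nntransfer_def Suc)
  also have "\<dots> = (\<Sum>y\<in>f -` {x}. \<Sum>z\<in>(f ^^ n) -` {y}. ennreal (exp (S (Suc n) z)) * u z)"
    unfolding sum_distrib_left
    by (intro sum.cong refl) (auto simp: S_Suc exp_add ennreal_mult' mult_ac)
  finally show ?case by (simp only: sum_fibre_Suc)
qed (simp add: S_0)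

lemma nntransfer_pow_measurable [measurable]:
  "u \<in> borel_measurable borel \<Longrightarrow> (nntransfer ^^ n) u \<in> borel_measurable borel"
  by (induction n) auto

lemma nn_conformal_pow:
  assumes "u \<in> borel_measurable borel"
  shows "(\<integral>\<^sup>+x. (nntransfer ^^ n) u x \<partial>\<nu>) = ennreal (lam ^ n) * (\<integral>\<^sup>+x. u x \<partial>\<nu>)"
proof (induction n)
  case (Suc n)
  have "(\<integral>\<^sup>+x. (nntransfer ^^ Suc n) u x \<partial>\<nu>) = ennreal lam * (\<integral>\<^sup>+x. (nntransfer ^^ n) u x \<partial>\<nu>)"
    using nn_conformal[OF nntransfer_pow_measurable[OF assms]] by simp
  then show ?case using lam_pos by (simp add: Suc ennreal_mult' mult.assoc)
qed simp

lemma nntransfer_pow_comp: "(nntransfer ^^ n) (\<lambda>y. u ((f ^^ n) y) * v y) x = u x * (nntransfer ^^ n) v x"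
  unfolding nntransfer_pow sum_distrib_left by (intro sum.cong) (auto simp: mult_ac)

text \<open>The \<open>n\<close>-fold transfer of the indicator of \<open>A\<close> sums the weights
  of the preimages in \<open>A\<close>; injectivity leaves at most one of them.\<close>

lemma emeasure_cyl_le:
  assumes A: "A \<in> sets borel" "inj_on (f ^^ n) A" and w: "\<And>x. x \<in> A \<Longrightarrow> exp (S n x) \<le> w"
  shows "ennreal (lam ^ n) * emeasure \<nu> A \<le> ennreal w * emeasure \<nu> ((f ^^ n) ` A)"
proof -
  have [measurable]: "A \<in> sets borel" "(f ^^ n) ` A \<in> sets borel" using A image_fpow_measurable by auto
  have "ennreal (lam ^ n) * emeasure \<nu> A = (\<integral>\<^sup>+x. (nntransfer ^^ n) (indicator A) x \<partial>\<nu>)"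
    by (subst nn_conformal_pow) (auto simp: nu_sets)
  also have "\<dots> \<le> (\<integral>\<^sup>+x. ennreal w * indicator ((f ^^ n) ` A) x \<partial>\<nu>)"
  proof (intro nn_integral_mono)
    fix x
    have "(nntransfer ^^ n) (indicator A) x = (\<Sum>y\<in>(f ^^ n) -` {x} \<inter> A. ennreal (exp (S n y)))"
      unfolding nntransfer_pow using finite_fibre_pow by (simp add: sum.inter_restrict indicator_def if_distrib cong: if_cong)
    also have "\<dots> \<le> ennreal w * indicator ((f ^^ n) ` A) x"
    proof (cases "x \<in> (f ^^ n) ` A")
      case True
      then obtain y where y: "y \<in> A" "(f ^^ n) y = x" by blast
      then have "(f ^^ n) -` {x} \<inter> A = {y}" using A(2) by (auto dest: inj_onD)
      then show ?thesis using w[OF y(1)] True by (simp add: ennreal_leI)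
    next
      case False
      then have "(f ^^ n) -` {x} \<inter> A = {}" by auto
      then show ?thesis by simp
    qed
    finally show "(nntransfer ^^ n) (indicator A) x \<le> ennreal w * indicator ((f ^^ n) ` A) x" .
  qed
  also have "\<dots> = ennreal w * emeasure \<nu> ((f ^^ n) ` A)" by (simp add: nn_integral_cmult nu_sets)
  finally show ?thesis .
qed

lemma emeasure_cyl_ge:
  assumes A: "A \<in> sets borel" and w: "\<And>x. x \<in> A \<Longrightarrow> w \<le> exp (S n x)"
  shows "ennreal w * emeasure \<nu> ((f ^^ n) ` A) \<le> ennreal (lam ^ n) * emeasure \<nu> A"
proof -
  have [measurable]: "A \<in> sets borel" "(f ^^ n) ` A \<in> sets borel" using A image_fpow_measurable by auto
  have "ennreal w * emeasure \<nu> ((f ^^ n) ` A) = (\<integral>\<^sup>+x. ennreal w * indicator ((f ^^ n) ` A) x \<partial>\<nu>)"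
    by (simp add: nn_integral_cmult nu_sets)
  also have "\<dots> \<le> (\<integral>\<^sup>+x. (nntransfer ^^ n) (indicator A) x \<partial>\<nu>)"
  proof (intro nn_integral_mono)
    fix x
    show "ennreal w * indicator ((f ^^ n) ` A) x \<le> (nntransfer ^^ n) (indicator A) x"
    proof (cases "x \<in> (f ^^ n) ` A")
      case True
      then obtain y where y: "y \<in> A" "(f ^^ n) y = x" by blast
      have "ennreal w \<le> ennreal (exp (S n y)) * indicator A y"
        using y(1) w[OF y(1)] by (simp add: ennreal_leI)
      also have "\<dots> \<le> (nntransfer ^^ n) (indicator A) x"
        unfolding nntransfer_pow using y finite_fibre_pow
        by (intro member_le_sum[of y _ "\<lambda>y. ennreal (exp (S n y)) * indicator A y"]) auto
      finally show ?thesis using True by simp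
    qed simp
  qed
  also have "\<dots> = ennreal (lam ^ n) * emeasure \<nu> A"
    by (subst nn_conformal_pow) (auto simp: nu_sets)
  finally show ?thesis .
qed

lemma S_ge: "(\<And>x. m \<le> \<phi> x) \<Longrightarrow> real n * m \<le> S n x"
  using sum_bounded_below[of "{..<n}" m "\<lambda>j. \<phi> ((f ^^ j) x)"] by (simp add: birkhoff_sum_def)

lemma S_le: "(\<And>x. \<phi> x \<le> M) \<Longrightarrow> S n x \<le> real n * M"
  using sum_bounded_above[of "{..<n}" "\<lambda>j. \<phi> ((f ^^ j) x)" M] by (simp add: birkhoff_sum_def)

lemma emeasure_fpow_image_le:
  assumes A: "A \<in> sets borel" and m: "\<And>x. m \<le> \<phi> x"
  shows "ennreal (exp (real n * m)) * emeasure \<nu> ((f ^^ n) ` A) \<le> ennreal (lam ^ n) * emeasure \<nu> A"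
  by (rule emeasure_cyl_ge[OF A]) (simp add: S_ge[OF m])

end

section \<open>Weighted sums over cylinders\<close>

text \<open>The geometry is condensed into \<open>contraction\<close>. \<open>H n\<close> stands for
  the hyperbolic cylinders and \<open>B n\<close> for those with too many visits to the
  non-expanding region. \<open>\<rho>\<close> is a common rate: it bounds the weight of
  \<open>B n\<close> relative to \<open>lam ^ n\<close> and dominates the rate
  \<open>exp (- c * \<alpha>)\<close> at which the oscillation of Hoelder functions on
  \<open>H n\<close> decays.\<close>

locale hyperbolic_system = conformal_map f P N \<phi> d \<nu> lam
  for f :: "'a::{metric_space, second_countable_topology} \<Rightarrow> 'a" and P N \<phi> d \<nu> lam +
  fixes H B :: "nat \<Rightarrow> 'a set set" and c \<alpha> osc \<rho> :: real
  assumes H_cyl: "C \<in> H n \<Longrightarrow> C \<in> cyl n"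
    and H_0: "H 0 = {UNIV}"
    and H_join: "C \<in> H n \<Longrightarrow> C' \<in> H k \<Longrightarrow> C \<inter> (f ^^ n) -` C' \<noteq> {} \<Longrightarrow> C \<inter> (f ^^ n) -` C' \<in> H (n + k)"
    and contraction: "\<exists>K\<ge>0. \<forall>n C x y j. C \<in> H n \<longrightarrow> x \<in> C \<longrightarrow> y \<in> C \<longrightarrow> j < n \<longrightarrow>
      dist ((f ^^ j) x) ((f ^^ j) y) \<le> K * exp (- c * real (n - j))"
    and c_pos: "c > 0" and alpha_pos: "\<alpha> > 0"
    and holder: "holder_continuous \<alpha> \<phi>"
    and expanding: "AE x in \<nu>. infinite {(n, C). n \<ge> 1 \<and> C \<in> H n \<and> x \<in> closure C}"
    and B_cyl: "B n \<subseteq> cyl n"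
    and B_hyp: "n \<ge> 1 \<Longrightarrow> C \<in> cyl n \<Longrightarrow> C \<notin> B n \<Longrightarrow> \<exists>k\<in>{1..n}. \<exists>D\<in>H k. C \<subseteq> D"
    and B_sum: "\<exists>K. \<forall>n. (\<Sum>C\<in>B n. exp (SUP x\<in>C. birkhoff_sum f \<phi> n x)) \<le> K * (lam * \<rho>) ^ n"
    and osc: "\<bar>\<phi> x - \<phi> y\<bar> \<le> osc"
    and rho: "\<rho> > 0" "exp (- c * \<alpha>) \<le> \<rho>" "exp osc * \<rho> < 1"
begin

definition w :: "nat \<Rightarrow> 'a set \<Rightarrow> real" where
  "w n C = exp (SUP x\<in>C. S n x)"

lemma osc_nonneg: "osc \<ge> 0"
  using osc[of undefined undefined] by simp

lemma rho_less_1: "\<rho> < 1"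
proof -
  have "1 * \<rho> \<le> exp osc * \<rho>" using osc_nonneg rho(1) by (intro mult_right_mono) auto
  then show ?thesis using rho(3) by simp
qed

lemma bdd_S: "bdd_above (S n ` C)"
proof -
  obtain M where "\<And>x. \<bar>\<phi> x\<bar> \<le> M" using phi_bounded by blast
  then have "S n x \<le> real n * M" for x using S_le[of M] by (simp add: abs_le_iff)
  then show ?thesis by (intro bdd_aboveI2)
qed

lemma w_ge: "x \<in> C \<Longrightarrow> exp (S n x) \<le> w n C"
  unfolding w_def by (simp add: cSUP_upper bdd_S)

lemma w_pos: "w n C > 0"
  unfolding w_def by simp

lemma w_le:
  assumes "C \<noteq> {}" "\<And>x. x \<in> C \<Longrightarrow> exp (S n x) \<le> b"
  shows "w n C \<le> b"
proof -
  obtain x where "x \<in> C" using assms(1) by blast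
  then have b: "b > 0" using assms(2) by (metis exp_gt_zero order_less_le_trans)
  have "(SUP x\<in>C. S n x) \<le> ln b"
    using assms b by (intro cSUP_least) (auto simp: ln_ge_iff)
  then show ?thesis unfolding w_def using b by (simp add: ln_ge_iff)
qed

lemma w_split:
  assumes "C' \<inter> (f ^^ n) -` C'' \<noteq> {}"
  shows "w (n + k) (C' \<inter> (f ^^ n) -` C'') \<le> w n C' * w k C''"
proof (rule w_le[OF assms])
  fix x assume "x \<in> C' \<inter> (f ^^ n) -` C''"
  then have "exp (S n x) \<le> w n C'" "exp (S k ((f ^^ n) x)) \<le> w k C''" by (auto intro: w_ge)
  then show "exp (S (n + k) x) \<le> w n C' * w k C''"
    by (simp add: S_add exp_add mult_mono less_imp_le[OF w_pos])
qed

lemma powr_contraction: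
  assumes "K \<ge> 0" "0 \<le> r" "r \<le> K * exp (- c * real k)"
  shows "r powr \<alpha> \<le> K powr \<alpha> * exp (- c * \<alpha>) ^ k"
proof -
  have "r powr \<alpha> \<le> (K * exp (- c * real k)) powr \<alpha>"
    using assms alpha_pos by (intro powr_mono2) auto
  also have "\<dots> = K powr \<alpha> * exp (- c * \<alpha>) ^ k"
  proof -
    have "exp (- c * real k) powr \<alpha> = exp (- c * \<alpha>) ^ k"
      by (simp add: powr_def mult_ac flip: exp_of_nat_mult)
    then show ?thesis using assms(1) by (simp add: powr_mult)
  qed
  finally show ?thesis .
qed

lemma q_bounds: "0 < exp (- c * \<alpha>)" "exp (- c * \<alpha>) < 1"
  using c_pos alpha_pos by auto

lemma holder_const:
  assumes "holder_continuous \<alpha> g"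
  obtains K where "K \<ge> 0" "\<And>x y. \<bar>g x - g y\<bar> \<le> K * dist x y powr \<alpha>"
proof -
  obtain K where K: "\<And>x y. \<bar>g x - g y\<bar> \<le> K * dist x y powr \<alpha>"
    using assms unfolding holder_continuous_def by blast
  have "\<bar>g x - g y\<bar> \<le> max 0 K * dist x y powr \<alpha>" for x y
    by (rule order_trans[OF K mult_right_mono]) auto
  then show ?thesis using that[of "max 0 K"] by simp
qed

lemma holder_osc:
  assumes "holder_continuous \<alpha> g"
  obtains K where "K \<ge> 0"
    "\<And>k C x y. C \<in> H k \<Longrightarrow> x \<in> C \<Longrightarrow> y \<in> C \<Longrightarrow> \<bar>g x - g y\<bar> \<le> K * exp (- c * \<alpha>) ^ k"
proof -
  obtain Kg where Kg: "Kg \<ge> 0" "\<And>x y. \<bar>g x - g y\<bar> \<le> Kg * dist x y powr \<alpha>"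
    using holder_const[OF assms] by blast
  obtain K0 where K0: "K0 \<ge> 0" "\<And>n C x y j. C \<in> H n \<Longrightarrow> x \<in> C \<Longrightarrow> y \<in> C \<Longrightarrow> j < n \<Longrightarrow>
      dist ((f ^^ j) x) ((f ^^ j) y) \<le> K0 * exp (- c * real (n - j))"
    using contraction by blast
  obtain b where b: "\<And>x y::'a. dist x y \<le> b"
    using compact_imp_bounded[OF compact_space] bounded_two_points by (metis UNIV_I)
  \<comment> \<open>At order 0 the cylinder is the whole space and \<open>contraction\<close> says
    nothing; there the diameter bound \<open>b\<close> is used.\<close>
  define K1 where "K1 = max K0 b"
  have K1: "K1 \<ge> 0" using K0 by (simp add: K1_def)
  have "\<bar>g x - g y\<bar> \<le> Kg * K1 powr \<alpha> * exp (- c * \<alpha>) ^ k" if "C \<in> H k" "x \<in> C" "y \<in> C" for k C x y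
  proof -
    have "dist x y \<le> K1 * exp (- c * real k)"
    proof (cases "k = 0")
      case True
      then show ?thesis using b[of x y] by (simp add: K1_def)
    next
      case False
      then have "dist x y \<le> K0 * exp (- c * real k)" using K0(2)[OF that, of 0] by simp
      also have "\<dots> \<le> K1 * exp (- c * real k)" by (intro mult_right_mono) (auto simp: K1_def)
      finally show ?thesis .
    qed
    from powr_contraction[OF K1 zero_le_dist this]
    have "Kg * dist x y powr \<alpha> \<le> Kg * (K1 powr \<alpha> * exp (- c * \<alpha>) ^ k)"
      using Kg(1) by (rule mult_left_mono)
    then show ?thesis using Kg(2)[of x y] by (simp add: mult.assoc)
  qed
  then show ?thesis using that[of "Kg * K1 powr \<alpha>"] Kg(1) by simp
qed

text \<open>At time \<open>j\<close> two points of a hyperbolic cylinder of order \<open>n\<close>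
  are at distance of order \<open>exp (- c * (n - j))\<close>, so the difference of their Birkhoff
  sums is dominated by a geometric series whose sum does not depend on \<open>n\<close>.\<close>

lemma distortion:
  obtains K where "K \<ge> 0" "\<And>n C x y. C \<in> H n \<Longrightarrow> x \<in> C \<Longrightarrow> y \<in> C \<Longrightarrow> S n x \<le> S n y + K"
proof -
  let ?q = "exp (- c * \<alpha>)"
  obtain Kg where Kg: "Kg \<ge> 0" "\<And>x y. \<bar>\<phi> x - \<phi> y\<bar> \<le> Kg * dist x y powr \<alpha>"
    using holder_const[OF holder] by blast
  obtain K0 where K0: "K0 \<ge> 0" "\<And>n C x y j. C \<in> H n \<Longrightarrow> x \<in> C \<Longrightarrow> y \<in> C \<Longrightarrow> j < n \<Longrightarrow>
      dist ((f ^^ j) x) ((f ^^ j) y) \<le> K0 * exp (- c * real (n - j))"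
    using contraction by blast
  have "S n x \<le> S n y + Kg * K0 powr \<alpha> * (1 / (1 - ?q))" if C: "C \<in> H n" "x \<in> C" "y \<in> C" for n C x y
  proof -
    have "S n x - S n y = (\<Sum>j<n. \<phi> ((f ^^ j) x) - \<phi> ((f ^^ j) y))"
      by (simp add: birkhoff_sum_def sum_subtractf)
    \<comment> \<open>One power of the ratio is given away so that the sum reverses into
      \<open>\<Sum>j<n. ?q ^ j\<close>.\<close>
    also have "\<dots> \<le> (\<Sum>j<n. Kg * K0 powr \<alpha> * ?q ^ (n - Suc j))"
    proof (intro sum_mono)
      fix j assume "j \<in> {..<n}"
      then have j: "j < n" by simp
      have "\<phi> ((f ^^ j) x) - \<phi> ((f ^^ j) y) \<le> Kg * dist ((f ^^ j) x) ((f ^^ j) y) powr \<alpha>"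
        using Kg(2) by (meson abs_le_D1)
      also have "\<dots> \<le> Kg * (K0 powr \<alpha> * ?q ^ (n - j))"
        using Kg(1) by (intro mult_left_mono powr_contraction K0(1) K0(2)[OF C j]) auto
      also have "\<dots> \<le> Kg * (K0 powr \<alpha> * ?q ^ (n - Suc j))"
        using Kg(1) q_bounds by (intro mult_left_mono power_decreasing) auto
      finally show "\<phi> ((f ^^ j) x) - \<phi> ((f ^^ j) y) \<le> Kg * K0 powr \<alpha> * ?q ^ (n - Suc j)" by (simp add: mult.assoc)
    qed
    also have "\<dots> = Kg * K0 powr \<alpha> * (\<Sum>j<n. ?q ^ j)"
      unfolding sum_distrib_left[symmetric] sum.nat_diff_reindex[of "\<lambda>j. ?q ^ j" n] ..
    also have "\<dots> \<le> Kg * K0 powr \<alpha> * (\<Sum>j. ?q ^ j)"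
      using Kg(1) q_bounds by (intro mult_left_mono sum_le_suminf summable_geometric) auto
    also have "(\<Sum>j. ?q ^ j) = 1 / (1 - ?q)" using q_bounds by (intro suminf_geometric) auto
    finally show ?thesis by simp
  qed
  moreover have "Kg * K0 powr \<alpha> * (1 / (1 - ?q)) \<ge> 0" using Kg(1) q_bounds by simp
  ultimately show ?thesis using that by blast
qed

lemma cyl_meas [measurable]: "C \<in> cyl n \<Longrightarrow> C \<in> sets borel"
  using open_cyl borel_open by blast

lemma fpow_image_add: "(f ^^ (n + k)) ` C = (f ^^ n) ` (f ^^ k) ` C"
  by (simp add: funpow_add image_comp)

lemma measure_ge_of_image_UNIV:
  assumes "A \<in> sets borel" "(f ^^ n) ` A = UNIV" "\<And>x. m \<le> \<phi> x"
  shows "exp (real n * m) / lam ^ n \<le> measure \<nu> A"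
proof -
  have "ennreal (exp (real n * m)) \<le> ennreal (lam ^ n) * ennreal (measure \<nu> A)"
    using emeasure_fpow_image_le[OF assms(1,3), of n] assms(2) by (simp add: nu_UNIV emeasure_eq_measure)
  also have "\<dots> = ennreal (lam ^ n * measure \<nu> A)" using lam_pos by (simp add: ennreal_mult')
  finally have "exp (real n * m) \<le> lam ^ n * measure \<nu> A"
    using lam_pos by (simp add: ennreal_le_iff)
  then show ?thesis using lam_pos by (simp add: field_simps)
qed

lemma cyl_image_UNIV:
  assumes "C \<in> cyl (Suc n)"
  shows "(f ^^ (N + n)) ` C = UNIV"
proof -
  obtain E where "E \<in> P" "(f ^^ n) ` C = E" using cyl_last[OF assms] by blast
  then show ?thesis using mixing by (simp add: fpow_image_add)
qed

lemma cyl_measure_pos: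
  assumes "C \<in> cyl n"
  shows "measure \<nu> C > 0"
proof (cases n)
  case 0
  then show ?thesis using assms by (simp add: cyl_0)
next
  case (Suc k)
  obtain M where M: "\<And>x. \<bar>\<phi> x\<bar> \<le> M" using phi_bounded by blast
  have m: "- M \<le> \<phi> x" for x using M[of x] by linarith
  have "exp (real (N + k) * - M) / lam ^ (N + k) \<le> measure \<nu> C"
    using assms Suc cyl_image_UNIV by (intro measure_ge_of_image_UNIV m cyl_meas) auto
  moreover have "exp (real (N + k) * - M) / lam ^ (N + k) > 0" using lam_pos by simp
  ultimately show ?thesis by linarith
qed

text \<open>After \<open>n - 1\<close> steps \<open>C\<close> is a partition element, and that fills
  the space after \<open>N\<close> further steps; from the image under \<open>f ^^ n\<close> only
  \<open>N - 1\<close> steps remain. The measure can change in these steps by a factor independent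
  of \<open>n\<close> at most.\<close>

lemma full_image_measure:
  obtains \<eta> where "\<eta> > 0" "\<And>n C. n \<ge> 1 \<Longrightarrow> C \<in> cyl n \<Longrightarrow> \<eta> \<le> measure \<nu> ((f ^^ n) ` C)"
proof -
  obtain M where M: "\<And>x. \<bar>\<phi> x\<bar> \<le> M" using phi_bounded by blast
  have m: "- M \<le> \<phi> x" for x using M[of x] by linarith
  obtain k where k: "N = Suc k" using N_pos by (cases N) auto
  have "exp (real k * - M) / lam ^ k \<le> measure \<nu> ((f ^^ n) ` C)" if n: "n \<ge> 1" and C: "C \<in> cyl n" for n C
  proof (rule measure_ge_of_image_UNIV[OF _ _ m])
    show "(f ^^ n) ` C \<in> sets borel" using image_fpow_measurable cyl_meas[OF C] by blast
    obtain j where j: "n = Suc j" using n by (cases n) auto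
    have "(f ^^ k) ` (f ^^ n) ` C = (f ^^ (N + j)) ` C"
      unfolding fpow_image_add[symmetric] k j by simp
    then show "(f ^^ k) ` (f ^^ n) ` C = UNIV" using cyl_image_UNIV C j by simp
  qed
  moreover have "exp (real k * - M) / lam ^ k > 0" using lam_pos by simp
  ultimately show ?thesis using that by blast
qed

lemma H_finite: "finite (H n)"
  using finite_subset[of "H n" "cyl n"] H_cyl finite_cyl by blast

lemma sum_measure_le_1:
  assumes "F \<subseteq> cyl n"
  shows "(\<Sum>C\<in>F. measure \<nu> C) \<le> 1"
proof -
  have fin: "finite F" using assms finite_cyl finite_subset by blast
  have "(\<Sum>C\<in>F. measure \<nu> C) = measure \<nu> (\<Union>C\<in>F. C)"
  proof (rule finite_measure_finite_Union[symmetric, OF fin])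
    show "(\<lambda>C. C) ` F \<subseteq> sets \<nu>" using assms cyl_meas by (auto simp: nu_sets)
    show "disjoint_family_on (\<lambda>C. C) F"
      unfolding disjoint_family_on_def using assms cyl_disjoint[of _ n] by (meson disjoint_iff subsetD)
  qed
  then show ?thesis by simp
qed

text \<open>By bounded distortion, and since the image has measure at least \<open>\<eta>\<close>,
  the weight \<open>w n C\<close> is at most a constant times \<open>lam ^ n\<close> times the
  measure of \<open>C\<close>; disjointness bounds the total measure by 1.\<close>

lemma H_sum: "\<exists>K>0. \<forall>n. (\<Sum>C\<in>H n. w n C) \<le> K * lam ^ n"
proof -
  obtain Kd where Kd: "Kd \<ge> 0" "\<And>n C x y. C \<in> H n \<Longrightarrow> x \<in> C \<Longrightarrow> y \<in> C \<Longrightarrow> S n x \<le> S n y + Kd"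
    using distortion by blast
  obtain \<eta> where \<eta>: "\<eta> > 0" "\<And>n C. n \<ge> 1 \<Longrightarrow> C \<in> cyl n \<Longrightarrow> \<eta> \<le> measure \<nu> ((f ^^ n) ` C)"
    using full_image_measure by blast
  have "(\<Sum>C\<in>H n. w n C) \<le> max 1 (exp Kd / \<eta>) * lam ^ n" for n
  proof (cases "n = 0")
    case True
    then show ?thesis by (simp add: H_0 w_def S_0)
  next
    case False
    have "w n C \<le> exp Kd / \<eta> * lam ^ n * measure \<nu> C" if C: "C \<in> H n" for C
    proof -
      have cyl: "C \<in> cyl n" using H_cyl[OF C] .
      have low: "w n C * exp (- Kd) \<le> exp (S n x)" if "x \<in> C" for x
      proof -
        have "w n C \<le> exp (S n x + Kd)"
          by (rule w_le[OF cyl_ne[OF cyl]]) (use Kd(2)[OF C _ that] in simp)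
        then show ?thesis by (simp add: exp_add exp_minus field_simps)
      qed
      have "ennreal (w n C * exp (- Kd)) * emeasure \<nu> ((f ^^ n) ` C) \<le> ennreal (lam ^ n) * emeasure \<nu> C"
        by (rule emeasure_cyl_ge[OF cyl_meas[OF cyl] low])
      then have "w n C * exp (- Kd) * measure \<nu> ((f ^^ n) ` C) \<le> lam ^ n * measure \<nu> C"
        using lam_pos w_pos[of n C] by (simp add: emeasure_eq_measure flip: ennreal_mult')
      moreover have "w n C * exp (- Kd) * \<eta> \<le> w n C * exp (- Kd) * measure \<nu> ((f ^^ n) ` C)"
        using \<eta>(2)[of n C] False cyl w_pos[of n C] by (intro mult_left_mono) auto
      ultimately have "w n C * exp (- Kd) * \<eta> \<le> lam ^ n * measure \<nu> C" by linarith
      then show ?thesis using \<eta>(1) by (simp add: exp_minus field_simps)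
    qed
    then have "(\<Sum>C\<in>H n. w n C) \<le> (\<Sum>C\<in>H n. exp Kd / \<eta> * lam ^ n * measure \<nu> C)" by (rule sum_mono)
    also have "\<dots> = exp Kd / \<eta> * lam ^ n * (\<Sum>C\<in>H n. measure \<nu> C)" by (simp add: sum_distrib_left)
    also have "\<dots> \<le> exp Kd / \<eta> * lam ^ n * 1"
      using \<eta>(1) lam_pos H_cyl by (intro mult_left_mono sum_measure_le_1[of _ n]) auto
    also have "\<dots> \<le> max 1 (exp Kd / \<eta>) * lam ^ n"
      unfolding mult_1_right using lam_pos by (intro mult_right_mono) auto
    finally show ?thesis .
  qed
  then show ?thesis by (intro exI[of _ "max 1 (exp Kd / \<eta>)"]) auto
qed

subsection \<open>The boundary of the partition is a null set\<close>

lemma vimage_pow_P: "(f ^^ n) x \<in> \<Union>P \<Longrightarrow> x \<in> \<Union>P"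
proof (induction n arbitrary: x)
  case (Suc n)
  have "(f ^^ n) (f x) \<in> \<Union>P" using Suc.prems by (simp add: funpow_swap1)
  then have "f x \<in> \<Union>P" by (rule Suc.IH)
  then show ?case using vimage_P[of x] by (metis Union_iff)
qed simp

text \<open>No distortion enters an upper bound: the weight is a supremum, it bounds the Birkhoff
  sum on the closure by continuity, and the image has measure at most 1.\<close>

lemma closure_measure_le:
  assumes "C \<in> cyl n"
  shows "lam ^ n * measure \<nu> (closure C) \<le> w n C"
proof -
  have cl: "closure C \<in> sets borel" by simp
  have cont: "continuous_on (closure C) (\<lambda>x. exp (S n x))"
    unfolding birkhoff_sum_def
    by (intro continuous_intros continuous_on_compose2[OF phi_cont fpow_cont]) auto
  have "exp (S n x) \<le> w n C" if "x \<in> closure C" for x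
    by (rule continuous_le_on_closure[OF cont that]) (rule w_ge)
  from emeasure_cyl_le[OF cl inj_cyl[OF assms] this]
  have "ennreal (lam ^ n) * emeasure \<nu> (closure C) \<le> ennreal (w n C) * emeasure \<nu> ((f ^^ n) ` closure C)" .
  also have "\<dots> \<le> ennreal (w n C) * 1"
    by (intro mult_left_mono) (auto simp: emeasure_eq_measure)
  finally show ?thesis
    using lam_pos w_pos[of n C] by (simp add: emeasure_eq_measure flip: ennreal_mult')
qed

text \<open>If the boundary had positive measure, the sets of points entering it at time about \<open>n\<close> would have a measure comparable
  with that of the hyperbolic cylinders of order \<open>n\<close>, which is not summable by the Borel-Cantelli lemma.\<close>

lemma AE_P: "AE x in \<nu>. x \<in> \<Union>P"
proof -
  \<comment> \<open>The complement of the partition elements. It is forward invariant, since a point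
    mapped into an element already lies in one.\<close>
  define \<Lambda> where "\<Lambda> = - \<Union>P"
  have \<Lambda>_meas [measurable]: "\<Lambda> \<in> sets borel"
    unfolding \<Lambda>_def using open_P by (intro borel_closed) (simp add: closed_def open_Union)
  have \<Lambda>_inv: "(f ^^ (n + k)) y \<in> \<Lambda>" if "(f ^^ n) y \<in> \<Lambda>" for n k y
  proof -
    have "(f ^^ (n + k)) y = (f ^^ k) ((f ^^ n) y)" by (metis add.commute funpow_add comp_apply)
    then show ?thesis using that vimage_pow_P[of k "(f ^^ n) y"] unfolding \<Lambda>_def by auto
  qed
  obtain M where M: "\<And>x. \<bar>\<phi> x\<bar> \<le> M" using phi_bounded by blast
  have m: "- M \<le> \<phi> x" for x using M[of x] by linarith
  obtain Kd where Kd: "Kd \<ge> 0" "\<And>n C x y. C \<in> H n \<Longrightarrow> x \<in> C \<Longrightarrow> y \<in> C \<Longrightarrow> S n x \<le> S n y + Kd"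
    using distortion by blast
  define Hb where "Hb n = (if n = 0 then {} else (\<Union>C\<in>H n. closure C))" for n
  have Hb_meas [measurable]: "Hb n \<in> sets borel" for n
    unfolding Hb_def using H_finite by (auto intro!: sets.finite_UN)
  \<comment> \<open>Points that enter the boundary set after time \<open>n\<close> and not later
    than \<open>n + N\<close>. The window \<open>N\<close> is the mixing time, in which every
    partition element comes to cover the boundary set as well.\<close>
  define A where "A n = {y. (f ^^ (n + N)) y \<in> \<Lambda> \<and> (f ^^ n) y \<notin> \<Lambda>}" for n
  have A_meas [measurable]: "A n \<in> sets borel" for n
    unfolding A_def by measurable
  \<comment> \<open>By forward invariance a point enters at most once, and the entrance is seen by
    at most \<open>N\<close> consecutive values of \<open>n\<close>.\<close>
  have overlap: "(\<Sum>n<l. indicator (A n) y) \<le> (real N :: real)" for l y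
  proof (cases "\<exists>n. y \<in> A n")
    case True
    define n0 where "n0 = (LEAST n. y \<in> A n)"
    have n0: "y \<in> A n0" using True LeastI_ex[of "\<lambda>n. y \<in> A n"] by (simp add: n0_def)
    have "n \<in> {n0..<n0 + N}" if "y \<in> A n" for n
    proof -
      have "n0 \<le> n" using that by (simp add: n0_def Least_le)
      moreover have "\<not> n0 + N \<le> n"
        using \<Lambda>_inv[of "n0 + N" y "n - (n0 + N)"] n0 that by (auto simp: A_def)
      ultimately show ?thesis by simp
    qed
    then have "{n \<in> {..<l}. y \<in> A n} \<subseteq> {n0..<n0 + N}" by blast
    from card_mono[OF _ this] have "card {n \<in> {..<l}. y \<in> A n} \<le> N" by simp
    moreover have "(\<Sum>n<l. indicator (A n) y) = real (card {n \<in> {..<l}. y \<in> A n})"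
      by (simp add: indicator_def sum.If_cases Int_def)
    ultimately show ?thesis by simp
  next
    case False
    then show ?thesis by (simp add: indicator_def)
  qed
  have A_sum: "(\<Sum>n<l. measure \<nu> (A n)) \<le> real N" for l
  proof -
    have "(\<Sum>n<l. measure \<nu> (A n)) = (\<integral>x. (\<Sum>n<l. indicator (A n) x) \<partial>\<nu>)"
      by (subst Bochner_Integration.integral_sum)
        (auto intro!: integrable_real_indicator simp: nu_sets emeasure_eq_measure)
    also have "\<dots> \<le> (\<integral>x. real N \<partial>\<nu>)"
      by (intro integral_mono Bochner_Integration.integrable_sum overlap)
        (auto intro!: integrable_real_indicator simp: nu_sets emeasure_eq_measure)
    finally show ?thesis by simp
  qed
  \<comment> \<open>The factors come from a lower bound for the weight of one branch of
    \<open>f ^^ N\<close>, from the distortion, from the choice of one partition element among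
    \<open>card P\<close>, and from the normalisation of \<open>N\<close> transfers.\<close>
  define \<kappa> where "\<kappa> = exp (real N * - M) * exp (- Kd) / (real (card P) * lam ^ N)"
  have cardP: "card P > 0" using finite_P P_nonempty by (simp add: card_gt_0_iff)
  have \<kappa>: "\<kappa> > 0" using lam_pos cardP by (simp add: \<kappa>_def)
  have key: "\<kappa> * measure \<nu> \<Lambda> * measure \<nu> (Hb n) \<le> measure \<nu> (A n)" for n
  proof (cases "n = 0")
    case True
    then show ?thesis by (simp add: Hb_def)
  next
    case n: False
    define t where "t E = (\<Sum>C\<in>{C \<in> H n. E \<subseteq> (f ^^ n) ` C}. w n C)" for E
    have covers: "\<exists>E\<in>P. E \<subseteq> (f ^^ n) ` C" if C: "C \<in> H n" for C
    proof -
      obtain j where j: "n = Suc j" using n by (cases n) auto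
      obtain F where F: "F \<in> P" "(f ^^ j) ` C = F" using cyl_last[of C j] H_cyl[OF C] j by blast
      obtain E y where "E \<in> P" "y \<in> E" using P_nonempty P_ne by blast
      then obtain z where z: "z \<in> F" "(f ^^ N) z = y" using mixing[OF F(1)] by (metis UNIV_I imageE)
      obtain i where i: "N = Suc i" using N_pos by (cases N) auto
      have "(f ^^ i) (f z) \<in> \<Union>P" using z \<open>y \<in> E\<close> \<open>E \<in> P\<close> by (auto simp: i funpow_swap1)
      then obtain E' where E': "E' \<in> P" "f z \<in> E'" using vimage_pow_P by blast
      then have "E' \<subseteq> f ` F" using markov[OF F(1)] z by blast
      moreover have "(f ^^ n) ` C = f ` F" unfolding j F(2)[symmetric] by (simp add: image_comp)
      ultimately show ?thesis using E'(1) by (intro bexI[of _ E']) auto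
    qed
    have "lam ^ n * measure \<nu> (Hb n) \<le> lam ^ n * (\<Sum>C\<in>H n. measure \<nu> (closure C))"
      unfolding Hb_def using n lam_pos H_finite
      by (simp add: nu_sets) (intro mult_left_mono finite_measure_subadditive_finite, auto simp: nu_sets)
    also have "\<dots> \<le> (\<Sum>C\<in>H n. w n C)"
      unfolding sum_distrib_left by (intro sum_mono closure_measure_le H_cyl)
    also have "\<dots> \<le> (\<Sum>E\<in>P. t E)"
    proof -
      have "(\<Sum>C\<in>H n. w n C) \<le> (\<Sum>C\<in>H n. \<Sum>E\<in>P. if E \<subseteq> (f ^^ n) ` C then w n C else 0)"
      proof (rule sum_mono)
        fix C assume "C \<in> H n"
        then obtain E where E: "E \<in> P" "E \<subseteq> (f ^^ n) ` C" using covers by blast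
        have "(if E \<subseteq> (f ^^ n) ` C then w n C else 0) \<le> (\<Sum>E\<in>P. if E \<subseteq> (f ^^ n) ` C then w n C else 0)"
          using finite_P less_imp_le[OF w_pos] E(1) by (intro member_le_sum) auto
        then show "w n C \<le> (\<Sum>E\<in>P. if E \<subseteq> (f ^^ n) ` C then w n C else 0)" using E(2) by simp
      qed
      also have "\<dots> = (\<Sum>E\<in>P. t E)"
        unfolding t_def sum.inter_filter[OF H_finite] by (rule sum.swap)
      finally show ?thesis .
    qed
    finally have sum_t: "lam ^ n * measure \<nu> (Hb n) \<le> (\<Sum>E\<in>P. t E)" .
    \<comment> \<open>Pigeonhole: some \<open>E\<close> is covered by the images of hyperbolic
      cylinders whose weights make up the fraction \<open>1 / card P\<close> of the required
      total.\<close>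
    obtain E where E: "E \<in> P" "lam ^ n * measure \<nu> (Hb n) / real (card P) \<le> t E"
    proof (rule ccontr)
      assume "\<not> thesis"
      then have "\<And>E. E \<in> P \<Longrightarrow> t E < lam ^ n * measure \<nu> (Hb n) / real (card P)" using that by force
      then have "(\<Sum>E\<in>P. t E) < (\<Sum>E\<in>P. lam ^ n * measure \<nu> (Hb n) / real (card P))"
        using finite_P P_nonempty by (intro sum_strict_mono) auto
      then show False using sum_t cardP by simp
    qed
    \<comment> \<open>Each cylinder whose image covers \<open>E\<close> contributes its own preimage
      of \<open>z\<close>, and by distortion the weight there is comparable with the supremum
      \<open>w n C\<close>.\<close>
    have low: "ennreal (exp (- Kd) * t E) \<le> (nntransfer ^^ n) (\<lambda>_. 1) z" if z: "z \<in> E" for z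
    proof -
      define F where "F = {C \<in> H n. E \<subseteq> (f ^^ n) ` C}"
      have "\<exists>y. y \<in> C \<and> (f ^^ n) y = z" if "C \<in> F" for C using that z by (auto simp: F_def)
      then obtain y where y: "\<And>C. C \<in> F \<Longrightarrow> y C \<in> C \<and> (f ^^ n) (y C) = z" by metis
      have inj: "inj_on y F"
      proof (rule inj_onI)
        fix C D assume "C \<in> F" "D \<in> F" "y C = y D"
        then show "C = D" using y[of C] y[of D] cyl_disjoint[of C n D "y C"] H_cyl by (auto simp: F_def)
      qed
      have "exp (- Kd) * t E = (\<Sum>C\<in>F. exp (- Kd) * w n C)" unfolding t_def F_def by (simp add: sum_distrib_left)
      also have "\<dots> \<le> (\<Sum>C\<in>F. exp (S n (y C)))"
      proof (intro sum_mono)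
        fix C assume C: "C \<in> F"
        have "w n C \<le> exp (S n (y C) + Kd)"
        proof (rule w_le)
          show "C \<noteq> {}" using y[OF C] by blast
          show "exp (S n x) \<le> exp (S n (y C) + Kd)" if "x \<in> C" for x
            using Kd(2)[of C n x "y C"] C y[OF C] that by (simp add: F_def)
        qed
        then show "exp (- Kd) * w n C \<le> exp (S n (y C))" by (simp add: exp_add exp_minus field_simps)
      qed
      also have "\<dots> = (\<Sum>x\<in>y ` F. exp (S n x))" by (simp add: sum.reindex[OF inj])
      also have "\<dots> \<le> (\<Sum>x\<in>(f ^^ n) -` {z}. exp (S n x))"
        by (intro sum_mono2 finite_fibre_pow) (use y in auto)
      finally show ?thesis
        unfolding nntransfer_pow mult_1_right by (subst sum_ennreal) (auto intro: ennreal_leI)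
    qed
    let ?v = "\<lambda>z. indicator (- \<Lambda>) z * (nntransfer ^^ n) (\<lambda>_. 1) z :: ennreal"
    have low2: "ennreal (exp (real N * - M) * (exp (- Kd) * t E)) \<le> (nntransfer ^^ N) ?v x" for x
    proof -
      obtain z where z: "z \<in> E" "(f ^^ N) z = x" using mixing[OF E(1)] by (metis UNIV_I imageE)
      have "z \<notin> \<Lambda>" using z(1) E(1) by (auto simp: \<Lambda>_def)
      have "ennreal (exp (real N * - M) * (exp (- Kd) * t E)) = ennreal (exp (real N * - M)) * ennreal (exp (- Kd) * t E)"
        by (simp add: ennreal_mult')
      also have "\<dots> \<le> ennreal (exp (S N z)) * ?v z"
        using low[OF z(1)] \<open>z \<notin> \<Lambda>\<close> S_ge[of "- M" N z, OF m] by (intro mult_mono ennreal_leI) auto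
      also have "\<dots> \<le> (nntransfer ^^ N) ?v x"
        unfolding nntransfer_pow[of N] using z finite_fibre_pow
        by (intro member_le_sum[of z _ "\<lambda>z. ennreal (exp (S N z)) * ?v z"]) auto
      finally show ?thesis .
    qed
    \<comment> \<open>Membership in \<open>A n\<close> says that the \<open>n\<close>-th image lies
      off the boundary set and is sent into it by \<open>f ^^ N\<close>; each of the two conditions
      factors out of the transfers that precede it.\<close>
    have "(nntransfer ^^ (N + n)) (indicator (A n)) x = indicator \<Lambda> x * (nntransfer ^^ N) ?v x" for x
    proof -
      have ind: "indicator (A n) = (\<lambda>y. (indicator \<Lambda> ((f ^^ N) ((f ^^ n) y)) * indicator (- \<Lambda>) ((f ^^ n) y)) * 1 :: ennreal)"
      proof
        fix y
        have "(f ^^ (n + N)) y = (f ^^ N) ((f ^^ n) y)" by (metis add.commute funpow_add comp_apply)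
        then show "indicator (A n) y = (indicator \<Lambda> ((f ^^ N) ((f ^^ n) y)) * indicator (- \<Lambda>) ((f ^^ n) y)) * (1 :: ennreal)"
          by (auto simp: A_def indicator_def)
      qed
      have "(nntransfer ^^ n) (indicator (A n)) = (\<lambda>z. indicator \<Lambda> ((f ^^ N) z) * ?v z)"
        unfolding ind nntransfer_pow_comp[of n "\<lambda>z. indicator \<Lambda> ((f ^^ N) z) * indicator (- \<Lambda>) z" "\<lambda>_. 1", abs_def]
        by (simp add: mult.assoc)
      then show ?thesis
        using nntransfer_pow_comp[of N "indicator \<Lambda>" ?v x] by (simp add: funpow_add)
    qed
    then have "(\<integral>\<^sup>+x. indicator \<Lambda> x * (nntransfer ^^ N) ?v x \<partial>\<nu>) = ennreal (lam ^ (N + n)) * emeasure \<nu> (A n)"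
      using nn_conformal_pow[of "indicator (A n)" "N + n"] by (simp add: nu_sets)
    moreover have "(\<integral>\<^sup>+x. indicator \<Lambda> x * ennreal (exp (real N * - M) * (exp (- Kd) * t E)) \<partial>\<nu>)
        \<le> (\<integral>\<^sup>+x. indicator \<Lambda> x * (nntransfer ^^ N) ?v x \<partial>\<nu>)"
      by (intro nn_integral_mono mult_left_mono low2) auto
    moreover have "t E \<ge> 0" unfolding t_def by (intro sum_nonneg) (simp add: less_imp_le[OF w_pos])
    ultimately have "measure \<nu> \<Lambda> * (exp (real N * - M) * (exp (- Kd) * t E)) \<le> lam ^ (N + n) * measure \<nu> (A n)"
      using lam_pos by (simp add: nn_integral_multc nu_sets emeasure_eq_measure flip: ennreal_mult')
    moreover have "measure \<nu> \<Lambda> * (exp (real N * - M) * (exp (- Kd) * (lam ^ n * measure \<nu> (Hb n) / real (card P))))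
        \<le> measure \<nu> \<Lambda> * (exp (real N * - M) * (exp (- Kd) * t E))"
      by (intro mult_left_mono E(2)) auto
    ultimately have "measure \<nu> \<Lambda> * (exp (real N * - M) * (exp (- Kd) * (lam ^ n * measure \<nu> (Hb n) / real (card P))))
      \<le> lam ^ (N + n) * measure \<nu> (A n)" by linarith
    then show ?thesis using lam_pos cardP by (simp add: \<kappa>_def power_add field_simps)
  qed
  have "measure \<nu> \<Lambda> = 0"
  proof (rule ccontr)
    assume "measure \<nu> \<Lambda> \<noteq> 0"
    then have pos: "\<kappa> * measure \<nu> \<Lambda> > 0" using \<kappa> by (simp add: zero_less_measure_iff)
    have "(\<Sum>n<l. measure \<nu> (Hb n)) \<le> real N / (\<kappa> * measure \<nu> \<Lambda>)" for l
    proof -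
      have "\<kappa> * measure \<nu> \<Lambda> * (\<Sum>n<l. measure \<nu> (Hb n)) \<le> (\<Sum>n<l. measure \<nu> (A n))"
        unfolding sum_distrib_left by (intro sum_mono key)
      then show ?thesis using A_sum[of l] pos by (simp add: field_simps)
    qed
    then have "summable (\<lambda>n. measure \<nu> (Hb n))"
      by (intro summableI_nonneg_bounded) auto
    then have "AE x in \<nu>. \<forall>\<^sub>F n in sequentially. x \<in> space \<nu> - Hb n"
      by (intro borel_cantelli_AE1) (auto simp: nu_sets emeasure_eq_measure)
    with expanding have "AE x in \<nu>. False"
    proof eventually_elim
      case (elim x)
      then obtain n0 where n0: "\<And>n. n \<ge> n0 \<Longrightarrow> x \<notin> Hb n" by (auto simp: eventually_sequentially)
      have "{(n, C). n \<ge> 1 \<and> C \<in> H n \<and> x \<in> closure C} \<subseteq> (SIGMA n:{..<n0}. H n)"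
      proof
        fix p assume "p \<in> {(n, C). n \<ge> 1 \<and> C \<in> H n \<and> x \<in> closure C}"
        then obtain n C where p: "p = (n, C)" and "n \<ge> 1" "C \<in> H n" "x \<in> closure C" by blast
        then have "x \<in> Hb n" by (auto simp: Hb_def)
        then have "n < n0" using n0 by (meson not_le)
        then show "p \<in> (SIGMA n:{..<n0}. H n)" using \<open>C \<in> H n\<close> by (simp add: p)
      qed
      then have "finite {(n, C). n \<ge> 1 \<and> C \<in> H n \<and> x \<in> closure C}"
        by (rule finite_subset) (use H_finite in auto)
      then show ?case using elim by blast
    qed
    then show False by simp
  qed
  then have "\<Lambda> \<in> null_sets \<nu>" by (auto simp: null_sets_def nu_sets emeasure_eq_measure)
  from AE_not_in[OF this] show ?thesis by (simp add: \<Lambda>_def)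
qed

lemma AE_cyl: "AE x in \<nu>. \<forall>n. x \<in> \<Union>(cyl n)"
proof -
  have "AE x in \<nu>. \<forall>n. (f ^^ n) x \<in> \<Union>P"
    by (subst AE_all_countable) (use AE_fpow[OF AE_P] in blast)
  then show ?thesis
  proof eventually_elim
    case (elim x)
    have "\<forall>x. (\<forall>n. (f ^^ n) x \<in> \<Union>P) \<longrightarrow> x \<in> \<Union>(cyl n)" for n
    proof (induction n)
      case (Suc n)
      show ?case
      proof (intro allI impI)
        fix x assume x: "\<forall>n. (f ^^ n) x \<in> \<Union>P"
        then obtain E where E: "E \<in> P" "x \<in> E" by (metis Union_iff funpow_0)
        have "\<forall>n. (f ^^ n) (f x) \<in> \<Union>P" using x by (metis funpow_swap1 funpow.simps(2) comp_apply)
        then obtain C where C: "C \<in> cyl n" "f x \<in> C" using Suc by blast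
        then have "E \<inter> f -` C \<in> cyl (Suc n)" using E by (intro cyl_SucI) auto
        then show "x \<in> \<Union>(cyl (Suc n))" using E C by blast
      qed
    qed (simp add: cyl_0)
    then show ?case using elim by blast
  qed
qed

subsection \<open>Decomposition at the last hyperbolic time\<close>

definition B' :: "nat \<Rightarrow> 'a set set" where
  "B' n = (if n = 0 then {UNIV} else B n)"

lemma B'_finite: "finite (B' n)"
  unfolding B'_def using finite_subset[OF B_cyl finite_cyl] by simp

lemma B'_sum: "\<exists>K>0. \<forall>n. (\<Sum>C\<in>B' n. w n C) \<le> K * (lam * \<rho>) ^ n"
proof -
  obtain K where K: "\<And>n. (\<Sum>C\<in>B n. w n C) \<le> K * (lam * \<rho>) ^ n" using B_sum unfolding w_def by blast
  have "(\<Sum>C\<in>B' n. w n C) \<le> max 1 K * (lam * \<rho>) ^ n" for n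
  proof (cases "n = 0")
    case True
    then show ?thesis by (simp add: B'_def w_def S_0)
  next
    case False
    have "K * (lam * \<rho>) ^ n \<le> max 1 K * (lam * \<rho>) ^ n"
      using lam_pos rho by (intro mult_right_mono) auto
    then show ?thesis using K[of n] False by (simp add: B'_def)
  qed
  then show ?thesis by (intro exI[of _ "max 1 K"]) auto
qed

text \<open>At the last order \<open>k\<close> for which the cylinder lies in a hyperbolic one, the
  remainder must be in \<open>B'\<close>: otherwise it would lie in a hyperbolic cylinder of some
  order \<open>j \<ge> 1\<close>, and concatenation would give the later order
  \<open>k + j\<close>.\<close>

lemma last_hyperbolic:
  assumes C: "C \<in> cyl n"
  obtains k C' C'' where "k \<le> n" "C' \<in> H k" "C'' \<in> B' (n - k)" "C = C' \<inter> (f ^^ k) -` C''"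
proof -
  let ?T = "\<lambda>k. k \<le> n \<and> (\<exists>D\<in>H k. C \<subseteq> D)"
  have T0: "?T 0" by (simp add: H_0)
  define k where "k = (GREATEST k. ?T k)"
  have k: "?T k" unfolding k_def by (rule GreatestI_nat[of ?T 0 n]) (use T0 in auto)
  have max: "j \<le> k" if "?T j" for j unfolding k_def by (rule Greatest_le_nat[of ?T j n]) (use that in auto)
  obtain D where D: "D \<in> H k" "C \<subseteq> D" using k by blast
  have "C \<in> cyl (k + (n - k))" using C k by simp
  then obtain C' C'' where CC: "C' \<in> cyl k" "C'' \<in> cyl (n - k)" "C = C' \<inter> (f ^^ k) -` C''" by (rule cyl_splitE)
  obtain x where x: "x \<in> C" using cyl_ne[OF C] by blast
  have "C' = D" using cyl_disjoint[OF CC(1) H_cyl[OF D(1)], of x] x CC(3) D(2) by blast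
  moreover have "C'' \<in> B' (n - k)"
  proof (rule ccontr)
    assume nb: "C'' \<notin> B' (n - k)"
    then have nk: "n - k \<noteq> 0" using CC(2) by (auto simp: B'_def cyl_0)
    obtain j E where j: "j \<in> {1..n - k}" "E \<in> H j" "C'' \<subseteq> E"
      using B_hyp[OF _ CC(2)] nb nk by (auto simp: B'_def)
    have sub: "C \<subseteq> D \<inter> (f ^^ k) -` E" using CC(3) \<open>C' = D\<close> j by blast
    then have "D \<inter> (f ^^ k) -` E \<in> H (k + j)" using H_join[OF D(1) j(2)] x by blast
    then have "?T (k + j)" using sub j k by (intro conjI bexI[of _ "D \<inter> (f ^^ k) -` E"]) auto
    then show False using max[of "k + j"] j by simp
  qed
  ultimately show ?thesis using that[of k C' C''] k CC D by blast
qed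

text \<open>The decomposition turns the sum over cylinders into a convolution of the weights of
  \<open>H k\<close> and \<open>B' (n - k)\<close>, with \<open>o1\<close> controlled by the
  hyperbolic part. It is applied to the constant 1 with \<open>r = 1\<close>, and to the oscillation
  of a Hoelder function with \<open>r = exp (- c * \<alpha>)\<close>.\<close>

lemma sum_cyl_le:
  assumes o: "\<And>C. 0 \<le> o1 C"
    and le: "\<And>k C' C. C' \<in> H k \<Longrightarrow> C \<subseteq> C' \<Longrightarrow> C \<noteq> {} \<Longrightarrow> o1 C \<le> K * r ^ k" and "K \<ge> 0" "r \<ge> 0"
  obtains K' where "K' \<ge> 0" "\<And>n. (\<Sum>C\<in>cyl n. w n C * o1 C) \<le> K' * lam ^ n * (\<Sum>k\<le>n. r ^ k * \<rho> ^ (n - k))"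
proof -
  obtain KH where KH: "KH > 0" "\<And>n. (\<Sum>C\<in>H n. w n C) \<le> KH * lam ^ n" using H_sum by blast
  obtain KB where KB: "KB > 0" "\<And>n. (\<Sum>C\<in>B' n. w n C) \<le> KB * (lam * \<rho>) ^ n" using B'_sum by blast
  have "(\<Sum>C\<in>cyl n. w n C * o1 C) \<le> (KH * KB * K) * lam ^ n * (\<Sum>k\<le>n. r ^ k * \<rho> ^ (n - k))" for n
  proof -
    define I where "I = (SIGMA k:{..n}. H k \<times> B' (n - k))"
    define g where "g = (\<lambda>(k, C', C''). C' \<inter> (f ^^ k) -` C'')"
    have finI: "finite I" unfolding I_def using H_finite B'_finite by auto
    have sub: "cyl n \<subseteq> g ` {i \<in> I. g i \<noteq> {}}"
    proof
      fix C assume C: "C \<in> cyl n"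
      then obtain k C' C'' where "k \<le> n" "C' \<in> H k" "C'' \<in> B' (n - k)" "C = C' \<inter> (f ^^ k) -` C''" by (rule last_hyperbolic)
      then show "C \<in> g ` {i \<in> I. g i \<noteq> {}}" using cyl_ne[OF C] by (intro image_eqI[of _ _ "(k, C', C'')"]) (auto simp: g_def I_def)
    qed
    have "(\<Sum>C\<in>cyl n. w n C * o1 C) \<le> (\<Sum>C\<in>g ` {i \<in> I. g i \<noteq> {}}. w n C * o1 C)"
      using finI sub o less_imp_le[OF w_pos] by (intro sum_mono2) auto
    also have "\<dots> \<le> (\<Sum>i\<in>{i \<in> I. g i \<noteq> {}}. w n (g i) * o1 (g i))"
      using finI o less_imp_le[OF w_pos] sum_image_le[of "{i \<in> I. g i \<noteq> {}}" "\<lambda>C. w n C * o1 C" g] by (simp add: o_def)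
    also have "\<dots> \<le> (\<Sum>i\<in>{i \<in> I. g i \<noteq> {}}. (case i of (k, C', C'') \<Rightarrow> w k C' * w (n - k) C'' * (K * r ^ k)))"
    proof (intro sum_mono)
      fix i assume iI: "i \<in> {i \<in> I. g i \<noteq> {}}"
      obtain k C' C'' where i0: "i = (k, C', C'')" by (cases i)
      have i: "i = (k, C', C'')" "k \<le> n" "C' \<in> H k" "C'' \<in> B' (n - k)" "C' \<inter> (f ^^ k) -` C'' \<noteq> {}"
        using iI i0 by (simp_all add: I_def g_def)
      have "w n (C' \<inter> (f ^^ k) -` C'') \<le> w k C' * w (n - k) C''" using w_split[OF i(5), of "n - k"] i(2) by simp
      moreover have "o1 (C' \<inter> (f ^^ k) -` C'') \<le> K * r ^ k" using le[OF i(3) _ i(5)] by blast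
      ultimately show "w n (g i) * o1 (g i) \<le> (case i of (k, C', C'') \<Rightarrow> w k C' * w (n - k) C'' * (K * r ^ k))"
        by (auto simp: i g_def intro!: mult_mono mult_nonneg_nonneg o less_imp_le[OF w_pos])
    qed
    also have "\<dots> \<le> (\<Sum>i\<in>I. (case i of (k, C', C'') \<Rightarrow> w k C' * w (n - k) C'' * (K * r ^ k)))"
      using finI assms(3,4) less_imp_le[OF w_pos] by (intro sum_mono2) (auto split: prod.splits)
    also have "\<dots> = (\<Sum>k\<le>n. \<Sum>(C', C'')\<in>H k \<times> B' (n - k). w k C' * w (n - k) C'' * (K * r ^ k))"
      unfolding I_def using H_finite B'_finite by (subst sum.Sigma) auto
    also have "\<dots> = (\<Sum>k\<le>n. (\<Sum>C\<in>H k. w k C) * (\<Sum>C\<in>B' (n - k). w (n - k) C) * (K * r ^ k))"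
      unfolding sum.cartesian_product[symmetric]
      by (simp add: sum_distrib_right sum_distrib_left sum_product) (intro sum.cong refl sum.swap)
    also have "\<dots> \<le> (\<Sum>k\<le>n. (KH * lam ^ k) * (KB * (lam * \<rho>) ^ (n - k)) * (K * r ^ k))"
      using KH KB assms(3,4) lam_pos rho less_imp_le[OF w_pos]
      by (intro sum_mono mult_right_mono mult_mono) (auto intro!: sum_nonneg)
    also have "\<dots> = (\<Sum>k\<le>n. (KH * KB * K) * lam ^ n * (r ^ k * \<rho> ^ (n - k)))"
    proof (intro sum.cong refl)
      fix k assume "k \<in> {..n}"
      then have "lam ^ n = lam ^ k * lam ^ (n - k)" by (simp flip: power_add)
      then show "(KH * lam ^ k) * (KB * (lam * \<rho>) ^ (n - k)) * (K * r ^ k) = (KH * KB * K) * lam ^ n * (r ^ k * \<rho> ^ (n - k))"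
        by (simp add: power_mult_distrib mult_ac)
    qed
    finally show ?thesis by (simp add: sum_distrib_left)
  qed
  moreover have "KH * KB * K \<ge> 0" using KH KB assms(3) by simp
  ultimately show ?thesis using that by blast
qed

lemma cyl_sum: "\<exists>K>0. \<forall>n. (\<Sum>C\<in>cyl n. w n C) \<le> K * lam ^ n"
proof -
  obtain K' where K': "K' \<ge> 0" "\<And>n. (\<Sum>C\<in>cyl n. w n C * 1) \<le> K' * lam ^ n * (\<Sum>k\<le>n. 1 ^ k * \<rho> ^ (n - k))"
    by (rule sum_cyl_le[of "\<lambda>_. 1" 1 1]) auto
  have "(\<Sum>C\<in>cyl n. w n C) \<le> (K' * (1 / (1 - \<rho>)) + 1) * lam ^ n" for n
  proof -
    have "(\<Sum>k\<le>n. \<rho> ^ (n - k)) = (\<Sum>k\<le>n. \<rho> ^ k)"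
      by (rule sum.reindex_bij_witness[of _ "\<lambda>k. n - k" "\<lambda>k. n - k"]) auto
    also have "\<dots> \<le> (\<Sum>k. \<rho> ^ k)"
      using rho rho_less_1 by (intro sum_le_suminf summable_geometric) auto
    also have "\<dots> = 1 / (1 - \<rho>)" using rho rho_less_1 by (intro suminf_geometric) auto
    finally have g: "(\<Sum>k\<le>n. \<rho> ^ (n - k)) \<le> 1 / (1 - \<rho>)" .
    have "(\<Sum>C\<in>cyl n. w n C) \<le> K' * lam ^ n * (1 / (1 - \<rho>))"
      using K'(2)[of n] mult_left_mono[OF g, of "K' * lam ^ n"] K'(1) lam_pos by simp
    also have "\<dots> \<le> (K' * (1 / (1 - \<rho>)) + 1) * lam ^ n" using lam_pos by (simp add: algebra_simps)
    finally show ?thesis .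
  qed
  moreover have "K' * (1 / (1 - \<rho>)) + 1 > 0" using K' rho_less_1 by (simp add: add_nonneg_pos)
  ultimately show ?thesis by blast
qed

text \<open>Both factors of the convolution are at most powers of \<rho>, as
  \<open>exp (- c * \<alpha>) \<le> \<rho>\<close>; the \<open>n + 1\<close> equal bounds account
  for the polynomial factor.\<close>

lemma holder_cyl_sum:
  assumes "holder_continuous \<alpha> g"
  shows "\<exists>K\<ge>0. \<forall>n. (\<Sum>C\<in>cyl n. w n C * (SUP x\<in>C. SUP y\<in>C. \<bar>g x - g y\<bar>)) \<le> K * real (Suc n) * (lam * \<rho>) ^ n"
    and "\<exists>K. \<forall>x y. \<bar>g x - g y\<bar> \<le> K"
proof -
  obtain K where K: "K \<ge> 0" "\<And>k C x y. C \<in> H k \<Longrightarrow> x \<in> C \<Longrightarrow> y \<in> C \<Longrightarrow> \<bar>g x - g y\<bar> \<le> K * exp (- c * \<alpha>) ^ k"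
    using holder_osc[OF assms] by blast
  have bnd: "\<bar>g x - g y\<bar> \<le> K" for x y using K(2)[of UNIV 0 x y] by (simp add: H_0)
  then show "\<exists>K. \<forall>x y. \<bar>g x - g y\<bar> \<le> K" by blast
  \<comment> \<open>A real supremum over the empty set has no useful value, hence the separate
    case.\<close>
  define o1 where "o1 C = (if C = {} then 0 else (SUP x\<in>C. SUP y\<in>C. \<bar>g x - g y\<bar>))" for C
  have bdd1: "bdd_above ((\<lambda>y. \<bar>g x - g y\<bar>) ` C)" for x C using bnd by (intro bdd_aboveI2) auto
  have bdd2: "bdd_above ((\<lambda>x. SUP y\<in>C. \<bar>g x - g y\<bar>) ` C)" if "C \<noteq> {}" for C
    using bnd that by (intro bdd_aboveI2[of _ _ K] cSUP_least) auto
  have o0: "0 \<le> o1 C" for C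
  proof (cases "C = {}")
    case False
    then obtain x where x: "x \<in> C" by blast
    have "\<bar>g x - g x\<bar> \<le> (SUP y\<in>C. \<bar>g x - g y\<bar>)" by (rule cSUP_upper[OF x bdd1])
    also have "\<dots> \<le> o1 C" using False cSUP_upper[OF x bdd2[OF False]] by (simp add: o1_def)
    finally show ?thesis by simp
  qed (simp add: o1_def)
  have le: "o1 C \<le> K * exp (- c * \<alpha>) ^ k" if "C' \<in> H k" "C \<subseteq> C'" "C \<noteq> {}" for k C' C
    using K(2)[OF that(1)] that(2,3) by (auto simp: o1_def intro!: cSUP_least)
  obtain K' where K': "K' \<ge> 0" "\<And>n. (\<Sum>C\<in>cyl n. w n C * o1 C) \<le> K' * lam ^ n * (\<Sum>k\<le>n. exp (- c * \<alpha>) ^ k * \<rho> ^ (n - k))"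
    by (rule sum_cyl_le[OF o0 le K(1)]) (auto intro: less_imp_le)
  have "(\<Sum>C\<in>cyl n. w n C * (SUP x\<in>C. SUP y\<in>C. \<bar>g x - g y\<bar>)) \<le> K' * real (Suc n) * (lam * \<rho>) ^ n" for n
  proof -
    have "(\<Sum>k\<le>n. exp (- c * \<alpha>) ^ k * \<rho> ^ (n - k)) \<le> (\<Sum>k\<le>n. \<rho> ^ n)"
    proof (intro sum_mono)
      fix k assume k: "k \<in> {..n}"
      have "exp (- c * \<alpha>) ^ k * \<rho> ^ (n - k) \<le> \<rho> ^ k * \<rho> ^ (n - k)"
        using rho by (intro mult_right_mono power_mono) auto
      also have "\<dots> = \<rho> ^ n" using k by (simp flip: power_add)
      finally show "exp (- c * \<alpha>) ^ k * \<rho> ^ (n - k) \<le> \<rho> ^ n" .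
    qed
    then have "(\<Sum>k\<le>n. exp (- c * \<alpha>) ^ k * \<rho> ^ (n - k)) \<le> real (Suc n) * \<rho> ^ n" by simp
    from mult_left_mono[OF this, of "K' * lam ^ n"]
    have "(\<Sum>C\<in>cyl n. w n C * o1 C) \<le> K' * lam ^ n * (real (Suc n) * \<rho> ^ n)"
      using K'(2)[of n] K'(1) lam_pos by simp
    moreover have "(\<Sum>C\<in>cyl n. w n C * o1 C) = (\<Sum>C\<in>cyl n. w n C * (SUP x\<in>C. SUP y\<in>C. \<bar>g x - g y\<bar>))"
      using cyl_ne by (intro sum.cong) (auto simp: o1_def)
    ultimately show ?thesis by (simp add: power_mult_distrib mult_ac)
  qed
  then show "\<exists>K\<ge>0. \<forall>n. (\<Sum>C\<in>cyl n. w n C * (SUP x\<in>C. SUP y\<in>C. \<bar>g x - g y\<bar>)) \<le> K * real (Suc n) * (lam * \<rho>) ^ n"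
    using K'(1) by blast
qed

end

section \<open>Functions of bounded variation\<close>

locale theta_system = hyperbolic_system f P N \<phi> d \<nu> lam H B c \<alpha> osc \<rho>
  for f :: "'a::{metric_space, second_countable_topology} \<Rightarrow> 'a" and P N \<phi> d \<nu> lam H B c \<alpha> osc \<rho> +
  fixes \<theta> :: real
  assumes theta: "\<theta> > 0" "exp osc < \<theta> * lam" "\<theta> * lam * \<rho> < 1"
begin

abbreviation eo :: "('a \<Rightarrow> complex) \<Rightarrow> 'a set \<Rightarrow> ennreal" where
  "eo g C \<equiv> ess_osc \<nu> g C"

abbreviation sn :: "('a \<Rightarrow> complex) \<Rightarrow> ennreal" where
  "sn g \<equiv> esssup \<nu> (\<lambda>x. ennreal (cmod (g x)))"

abbreviation var :: "('a \<Rightarrow> complex) \<Rightarrow> ennreal" where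
  "var g \<equiv> var_theta f \<phi> P \<nu> \<theta> g"

abbreviation V :: "('a \<Rightarrow> complex) set" where
  "V \<equiv> V_theta f \<phi> P \<nu> \<theta>"

abbreviation Nm :: "('a \<Rightarrow> complex) \<Rightarrow> real" where
  "Nm \<equiv> norm_theta f \<phi> P \<nu> \<theta>"

abbreviation T :: "('a \<Rightarrow> complex) \<Rightarrow> 'a \<Rightarrow> complex" where
  "T \<equiv> transfer_op f \<phi>"

definition cylvar :: "nat \<Rightarrow> ('a \<Rightarrow> complex) \<Rightarrow> ennreal" where
  "cylvar n g = (\<Sum>C\<in>cyl n. ennreal (w n C) * eo g C)"

lemma var_eq: "var g = (\<Sum>k. ennreal (\<theta> ^ Suc k) * cylvar (Suc k) g)"
  unfolding var_theta_def cylvar_def w_def Let_def ..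

lemma meas_iff: "g \<in> borel_measurable \<nu> \<longleftrightarrow> g \<in> borel_measurable borel"
  by (rule measurable_cong_sets[OF nu_sets refl, THEN arg_cong[where f = "\<lambda>A. g \<in> A"]])

subsection \<open>Essential oscillation\<close>

lemma diff_measurable:
  assumes [measurable]: "g \<in> borel_measurable borel"
  shows "(\<lambda>(x, y). ennreal (cmod (g x - g y))) \<in> borel_measurable (\<nu> \<Otimes>\<^sub>M \<nu>)"
  by measurable

lemma null_setsD: "Z \<in> null_sets \<nu> \<Longrightarrow> AE x in \<nu>. x \<notin> Z"
  by (rule AE_not_in)

lemma AE_imp_null: "AE x in \<nu>. Q x \<Longrightarrow> \<exists>Z\<in>null_sets \<nu>. \<forall>x. x \<notin> Z \<longrightarrow> Q x"
  unfolding eventually_ae_filter by auto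

lemma eo_le:
  assumes g: "g \<in> borel_measurable borel" and C: "C \<in> sets borel"
    and le: "AE x in \<nu>. AE y in \<nu>. x \<in> C \<longrightarrow> y \<in> C \<longrightarrow> ennreal (cmod (g x - g y)) \<le> r"
  shows "eo g C \<le> r"
proof -
  interpret pair_sigma_finite \<nu> \<nu> by unfold_locales
  have [measurable]: "C \<in> sets borel" "g \<in> borel_measurable borel" by fact+
  have CC: "C \<times> C \<inter> space (\<nu> \<Otimes>\<^sub>M \<nu>) \<in> sets (\<nu> \<Otimes>\<^sub>M \<nu>)" by measurable
  have "AE p in \<nu> \<Otimes>\<^sub>M \<nu>. p \<in> C \<times> C \<longrightarrow> (case p of (x, y) \<Rightarrow> ennreal (cmod (g x - g y))) \<le> r"
  proof (rule AE_pair_measure)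
    show "{p \<in> space (\<nu> \<Otimes>\<^sub>M \<nu>). p \<in> C \<times> C \<longrightarrow> (case p of (x, y) \<Rightarrow> ennreal (cmod (g x - g y))) \<le> r} \<in> sets (\<nu> \<Otimes>\<^sub>M \<nu>)"
      by measurable
    show "AE x in \<nu>. AE y in \<nu>. (x, y) \<in> C \<times> C \<longrightarrow> (case (x, y) of (x, y) \<Rightarrow> ennreal (cmod (g x - g y))) \<le> r"
      using le unfolding mem_Sigma_iff imp_conjL prod.case .
  qed
  then show ?thesis
    unfolding ess_osc_def
    by (intro esssup_I measurable_restrict_space1 diff_measurable g) (simp add: AE_restrict_space_iff[OF CC])
qed

lemma eo_le_null:
  assumes g: "g \<in> borel_measurable borel" and C: "C \<in> sets borel"
    and Z: "Z \<in> null_sets \<nu>" "\<And>x y. x \<in> C - Z \<Longrightarrow> y \<in> C - Z \<Longrightarrow> ennreal (cmod (g x - g y)) \<le> r"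
  shows "eo g C \<le> r"
proof (rule eo_le[OF g C])
  show "AE x in \<nu>. AE y in \<nu>. x \<in> C \<longrightarrow> y \<in> C \<longrightarrow> ennreal (cmod (g x - g y)) \<le> r"
    using null_setsD[OF Z(1)]
  proof eventually_elim
    case (elim x)
    show ?case using null_setsD[OF Z(1)] by eventually_elim (use elim Z(2) in auto)
  qed
qed

text \<open>The exceptional set is the preimage of the complement of the essential range of \<open>g\<close> on \<open>C\<close>.\<close>

lemma eo_pointwise:
  assumes g: "g \<in> borel_measurable borel" and C: "C \<in> sets borel"
  obtains Z where "Z \<in> null_sets \<nu>" "\<And>x y. x \<in> C - Z \<Longrightarrow> y \<in> C - Z \<Longrightarrow> ennreal (cmod (g x - g y)) \<le> eo g C"
proof -
  interpret pair_sigma_finite \<nu> \<nu> by unfold_locales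
  have [measurable]: "C \<in> sets borel" "g \<in> borel_measurable borel" by fact+
  have CC: "C \<times> C \<inter> space (\<nu> \<Otimes>\<^sub>M \<nu>) \<in> sets (\<nu> \<Otimes>\<^sub>M \<nu>)" by measurable
  obtain Bs :: "complex set set" where Bs: "countable Bs" "topological_basis Bs"
    using ex_countable_basis by blast
  define Z where "Z = (\<Union>U\<in>{U \<in> Bs. C \<inter> g -` U \<in> null_sets \<nu>}. C \<inter> g -` U)"
  have Z: "Z \<in> null_sets \<nu>"
    unfolding Z_def using Bs(1) by (intro null_sets_UN') auto
  have meas: "C \<inter> g -` U \<in> sets \<nu>" if "open U" for U
    using measurable_sets[OF g, of U] that by (auto simp: nu_sets)
  have pos: "emeasure \<nu> (C \<inter> g -` U) > 0" if x: "x \<in> C - Z" and U: "open U" "g x \<in> U" for x U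
  proof -
    obtain U' where U': "U' \<in> Bs" "g x \<in> U'" "U' \<subseteq> U" using topological_basisE[OF Bs(2) U] by blast
    have "C \<inter> g -` U' \<notin> null_sets \<nu>" using x U' by (auto simp: Z_def)
    then have "emeasure \<nu> (C \<inter> g -` U') > 0"
      using meas[of U'] topological_basis_open[OF Bs(2) U'(1)] by (auto simp: null_sets_def zero_less_iff_neq_zero)
    also have "emeasure \<nu> (C \<inter> g -` U') \<le> emeasure \<nu> (C \<inter> g -` U)"
      using U'(3) meas[OF U(1)] by (intro emeasure_mono) auto
    finally show ?thesis .
  qed
  have AE: "AE p in \<nu> \<Otimes>\<^sub>M \<nu>. p \<in> C \<times> C \<longrightarrow> (case p of (x, y) \<Rightarrow> ennreal (cmod (g x - g y))) \<le> eo g C"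
    using esssup_AE[where M = "restrict_space (\<nu> \<Otimes>\<^sub>M \<nu>) (C \<times> C)" and f = "\<lambda>(x, y). ennreal (cmod (g x - g y))"]
    unfolding ess_osc_def AE_restrict_space_iff[OF CC] .
  have "ennreal (cmod (g x - g y)) \<le> eo g C" if x: "x \<in> C - Z" and y: "y \<in> C - Z" for x y
  proof (rule ccontr)
    assume "\<not> ?thesis"
    then have lt: "eo g C < ennreal (cmod (g x - g y))" by simp
    \<comment> \<open>A pair of values exceeding the essential oscillation has neighbourhoods that
      do so too; their preimages in \<open>C\<close> have positive measure, and so does the product
      of these preimages.\<close>
    define W where "W = {p :: complex \<times> complex. eo g C < ennreal (cmod (fst p - snd p))}"
    have "open W"
      unfolding W_def by (intro open_Collect_less continuous_on_const continuous_on_ennreal continuous_intros)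
    moreover have "(g x, g y) \<in> W" using lt by (simp add: W_def)
    ultimately obtain U1 U2 where U: "open U1" "open U2" "(g x, g y) \<in> U1 \<times> U2" "U1 \<times> U2 \<subseteq> W"
      by (rule open_prod_elim)
    have "emeasure (\<nu> \<Otimes>\<^sub>M \<nu>) ((C \<inter> g -` U1) \<times> (C \<inter> g -` U2)) = emeasure \<nu> (C \<inter> g -` U1) * emeasure \<nu> (C \<inter> g -` U2)"
    proof (rule sigma_finite_measure.emeasure_pair_measure_Times)
      show "sigma_finite_measure \<nu>" ..
    qed (use meas U in auto)
    also have "\<dots> > 0" using pos[OF x U(1)] pos[OF y U(2)] U(3) by (simp add: ennreal_zero_less_mult_iff)
    finally have p: "emeasure (\<nu> \<Otimes>\<^sub>M \<nu>) ((C \<inter> g -` U1) \<times> (C \<inter> g -` U2)) > 0" .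
    have "AE p in \<nu> \<Otimes>\<^sub>M \<nu>. p \<notin> (C \<inter> g -` U1) \<times> (C \<inter> g -` U2)"
      using AE
    proof eventually_elim
      case (elim p)
      show ?case
      proof
        assume p: "p \<in> (C \<inter> g -` U1) \<times> (C \<inter> g -` U2)"
        then have "(g (fst p), g (snd p)) \<in> W" using U(4) by auto
        moreover have "(case p of (x, y) \<Rightarrow> ennreal (cmod (g x - g y))) \<le> eo g C" using elim p by auto
        ultimately show False by (auto simp: W_def split: prod.splits)
      qed
    qed
    then have "(C \<inter> g -` U1) \<times> (C \<inter> g -` U2) \<in> null_sets (\<nu> \<Otimes>\<^sub>M \<nu>)"
      using AE_iff_null_sets[of "(C \<inter> g -` U1) \<times> (C \<inter> g -` U2)" "\<nu> \<Otimes>\<^sub>M \<nu>"] meas U by auto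
    then show False using p by (simp add: null_sets_def)
  qed
  then show ?thesis using that Z by blast
qed

lemma sn_AE: "AE x in \<nu>. ennreal (cmod (g x)) \<le> sn g"
  by (rule esssup_AE)

lemma sn_le:
  assumes [measurable]: "g \<in> borel_measurable borel" and "AE x in \<nu>. ennreal (cmod (g x)) \<le> r"
  shows "sn g \<le> r"
  by (rule esssup_I[OF _ assms(2)]) measurable

text \<open>The cylinders of all orders form a countable family, so one null set serves all of them;
  outside it, essential suprema and oscillations may be used pointwise.\<close>

lemma good_null:
  assumes g: "g \<in> borel_measurable borel"
  obtains Z where "Z \<in> null_sets \<nu>" "\<And>x. x \<notin> Z \<Longrightarrow> ennreal (cmod (g x)) \<le> sn g"
    "\<And>x n. x \<notin> Z \<Longrightarrow> x \<in> \<Union>(cyl n)"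
    "\<And>n C x y. C \<in> cyl n \<Longrightarrow> x \<in> C - Z \<Longrightarrow> y \<in> C - Z \<Longrightarrow> ennreal (cmod (g x - g y)) \<le> eo g C"
proof -
  obtain Z1 where Z1: "Z1 \<in> null_sets \<nu>" "\<And>x. x \<notin> Z1 \<Longrightarrow> ennreal (cmod (g x)) \<le> sn g"
    using AE_imp_null[OF sn_AE[of g]] by blast
  obtain Z2 where Z2: "Z2 \<in> null_sets \<nu>" "\<And>x. x \<notin> Z2 \<Longrightarrow> \<forall>n. x \<in> \<Union>(cyl n)"
    using AE_imp_null[OF AE_cyl] by blast
  have "\<exists>Z. Z \<in> null_sets \<nu> \<and> (\<forall>x\<in>C - Z. \<forall>y\<in>C - Z. ennreal (cmod (g x - g y)) \<le> eo g C)" if "C \<in> (\<Union>n. cyl n)" for C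
  proof -
    have "C \<in> sets borel" using that cyl_meas by blast
    then show ?thesis using eo_pointwise[OF g] by metis
  qed
  then obtain Z3 where Z3: "\<And>C. C \<in> (\<Union>n. cyl n) \<Longrightarrow> Z3 C \<in> null_sets \<nu>"
    "\<And>C x y. C \<in> (\<Union>n. cyl n) \<Longrightarrow> x \<in> C - Z3 C \<Longrightarrow> y \<in> C - Z3 C \<Longrightarrow> ennreal (cmod (g x - g y)) \<le> eo g C"
    by metis
  define Z where "Z = Z1 \<union> Z2 \<union> (\<Union>C\<in>(\<Union>n. cyl n). Z3 C)"
  have "(\<Union>C\<in>(\<Union>n. cyl n). Z3 C) \<in> null_sets \<nu>"
    by (rule null_sets_UN'[OF countable_UN[OF countableI_type countable_finite[OF finite_cyl]]])
      (use Z3(1) in auto)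
  then have "Z \<in> null_sets \<nu>" unfolding Z_def using Z1(1) Z2(1) by blast
  moreover have "ennreal (cmod (g x - g y)) \<le> eo g C" if "C \<in> cyl n" "x \<in> C - Z" "y \<in> C - Z" for n C x y
  proof (rule Z3(2))
    show C: "C \<in> (\<Union>n. cyl n)" using that(1) by blast
    show "x \<in> C - Z3 C" "y \<in> C - Z3 C" using that C unfolding Z_def by blast+
  qed
  moreover have "ennreal (cmod (g x)) \<le> sn g" "x \<in> \<Union>(cyl n)" if "x \<notin> Z" for x n
    using that Z1(2)[of x] Z2(2)[of x] by (simp_all add: Z_def)
  ultimately show ?thesis using that by blast
qed

subsection \<open>The seminorm\<close>

text \<open>One pointwise inequality off a null set yields the inequality for every level and for
  the variation. Sums, multiples, products, real and imaginary parts and positive parts are all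
  handled through it.\<close>

lemma var_combine:
  assumes u: "u \<in> borel_measurable borel" and g: "g \<in> borel_measurable borel" and k: "k \<in> borel_measurable borel"
    and ab: "0 \<le> a" "0 \<le> b" and Z0: "Z0 \<in> null_sets \<nu>"
    and le: "\<And>x y. x \<notin> Z0 \<Longrightarrow> y \<notin> Z0 \<Longrightarrow> cmod (u x - u y) \<le> a * cmod (g x - g y) + b * cmod (k x - k y)"
  shows "cylvar n u \<le> ennreal a * cylvar n g + ennreal b * cylvar n k"
    and "var u \<le> ennreal a * var g + ennreal b * var k"
proof -
  obtain Z1 where Z1: "Z1 \<in> null_sets \<nu>"
    "\<And>n C x y. C \<in> cyl n \<Longrightarrow> x \<in> C - Z1 \<Longrightarrow> y \<in> C - Z1 \<Longrightarrow> ennreal (cmod (g x - g y)) \<le> eo g C"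
    by (rule good_null[OF g]) blast
  obtain Z2 where Z2: "Z2 \<in> null_sets \<nu>"
    "\<And>n C x y. C \<in> cyl n \<Longrightarrow> x \<in> C - Z2 \<Longrightarrow> y \<in> C - Z2 \<Longrightarrow> ennreal (cmod (k x - k y)) \<le> eo k C"
    by (rule good_null[OF k]) blast
  have e: "eo u C \<le> ennreal a * eo g C + ennreal b * eo k C" if C: "C \<in> cyl n" for C n
  proof (rule eo_le_null[OF u cyl_meas[OF C], of "Z0 \<union> Z1 \<union> Z2"])
    show "Z0 \<union> Z1 \<union> Z2 \<in> null_sets \<nu>" using Z0 Z1(1) Z2(1) by blast
    fix x y assume xy: "x \<in> C - (Z0 \<union> Z1 \<union> Z2)" "y \<in> C - (Z0 \<union> Z1 \<union> Z2)"
    have "ennreal (cmod (u x - u y)) \<le> ennreal (a * cmod (g x - g y) + b * cmod (k x - k y))"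
      using le xy by (intro ennreal_leI) auto
    also have "\<dots> = ennreal a * ennreal (cmod (g x - g y)) + ennreal b * ennreal (cmod (k x - k y))"
      using ab by (simp add: ennreal_mult')
    also have "\<dots> \<le> ennreal a * eo g C + ennreal b * eo k C"
      by (intro add_mono mult_left_mono Z1(2)[OF C] Z2(2)[OF C]) (use xy in auto)
    finally show "ennreal (cmod (u x - u y)) \<le> ennreal a * eo g C + ennreal b * eo k C" .
  qed
  show cv: "cylvar n u \<le> ennreal a * cylvar n g + ennreal b * cylvar n k" for n
  proof -
    have "cylvar n u \<le> (\<Sum>C\<in>cyl n. ennreal (w n C) * (ennreal a * eo g C + ennreal b * eo k C))"
      unfolding cylvar_def by (intro sum_mono mult_left_mono e) auto
    also have "\<dots> = ennreal a * cylvar n g + ennreal b * cylvar n k"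
      unfolding cylvar_def by (simp add: distrib_left sum.distrib sum_distrib_left mult_ac)
    finally show ?thesis .
  qed
  have "var u \<le> (\<Sum>k'. ennreal (\<theta> ^ Suc k') * (ennreal a * cylvar (Suc k') g + ennreal b * cylvar (Suc k') k))"
    unfolding var_eq by (intro suminf_le mult_left_mono cv) auto
  also have "\<dots> = (\<Sum>k'. ennreal a * (ennreal (\<theta> ^ Suc k') * cylvar (Suc k') g) + ennreal b * (ennreal (\<theta> ^ Suc k') * cylvar (Suc k') k))"
    by (simp add: distrib_left mult_ac)
  also have "\<dots> = ennreal a * var g + ennreal b * var k"
    unfolding var_eq by (subst suminf_add[symmetric]) auto
  finally show "var u \<le> ennreal a * var g + ennreal b * var k" .
qed

lemma var_cong_AE:
  assumes u: "u \<in> borel_measurable borel" and g: "g \<in> borel_measurable borel" and "AE x in \<nu>. u x = g x"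
  shows "var u = var g" "sn u = sn g"
proof -
  obtain Z where Z: "Z \<in> null_sets \<nu>" "\<And>x. x \<notin> Z \<Longrightarrow> u x = g x" using AE_imp_null[OF assms(3)] by blast
  have "var u \<le> ennreal 1 * var g + ennreal 0 * var g" by (rule var_combine(2)[OF u g g _ _ Z(1)]) (auto simp: Z(2))
  moreover have "var g \<le> ennreal 1 * var u + ennreal 0 * var u" by (rule var_combine(2)[OF g u u _ _ Z(1)]) (auto simp: Z(2))
  ultimately show "var u = var g" by simp
  show "sn u = sn g"
    by (rule esssup_AE_cong) (use u g assms(3) in \<open>auto simp: meas_iff elim!: eventually_mono\<close>)
qed

lemma cylvar_le_sn:
  assumes g: "g \<in> borel_measurable borel"
  shows "cylvar n g \<le> ennreal (\<Sum>C\<in>cyl n. w n C) * (2 * sn g)"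
proof -
  obtain Z where Z: "Z \<in> null_sets \<nu>" "\<And>x. x \<notin> Z \<Longrightarrow> ennreal (cmod (g x)) \<le> sn g"
    by (rule good_null[OF g]) blast
  have "eo g C \<le> 2 * sn g" if C: "C \<in> cyl n" for C
  proof (rule eo_le_null[OF g cyl_meas[OF C] Z(1)])
    fix x y assume "x \<in> C - Z" "y \<in> C - Z"
    then have "ennreal (cmod (g x)) + ennreal (cmod (g y)) \<le> sn g + sn g" using Z(2) by (intro add_mono) auto
    moreover have "ennreal (cmod (g x - g y)) \<le> ennreal (cmod (g x)) + ennreal (cmod (g y))"
      by (simp add: norm_triangle_ineq4 flip: ennreal_plus)
    ultimately show "ennreal (cmod (g x - g y)) \<le> 2 * sn g" by (simp add: mult_2)
  qed
  then have "cylvar n g \<le> (\<Sum>C\<in>cyl n. ennreal (w n C) * (2 * sn g))"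
    unfolding cylvar_def by (intro sum_mono mult_left_mono) auto
  also have "\<dots> = ennreal (\<Sum>C\<in>cyl n. w n C) * (2 * sn g)"
    using less_imp_le[OF w_pos] by (simp add: sum_distrib_right[symmetric])
  finally show ?thesis .
qed

lemma V_iff: "g \<in> V \<longleftrightarrow> g \<in> borel_measurable borel \<and> sn g < \<top> \<and> var g < \<top>"
  unfolding V_theta_def enorm_theta_def by (auto simp: meas_iff)

lemma V_meas [measurable_dest]: "g \<in> V \<Longrightarrow> g \<in> borel_measurable borel"
  by (simp add: V_iff)

lemma Nm_eq: "g \<in> V \<Longrightarrow> ennreal (Nm g) = sn g + var g"
  unfolding norm_theta_def enorm_theta_def by (subst ennreal_enn2real) (auto simp: V_iff less_top)

lemma Nm_nonneg: "Nm g \<ge> 0"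
  unfolding norm_theta_def by simp

lemma sn_le_Nm: "g \<in> V \<Longrightarrow> sn g \<le> ennreal (Nm g)"
  and var_le_Nm: "g \<in> V \<Longrightarrow> var g \<le> ennreal (Nm g)"
  by (simp_all add: Nm_eq)

lemma Nm_leI: "g \<in> V \<Longrightarrow> sn g + var g \<le> ennreal r \<Longrightarrow> r \<ge> 0 \<Longrightarrow> Nm g \<le> r"
  using Nm_eq[of g] by (metis ennreal_le_iff)

text \<open>Values and increments get separate constants because a product is bounded by the norm of
  one factor times the other, while its increments involve the increments of both factors.\<close>

lemma V_combine:
  assumes u: "u \<in> borel_measurable borel" and g: "g \<in> V" and k: "k \<in> V"
    and ab: "0 \<le> a" "0 \<le> b" "0 \<le> a'" "0 \<le> b'" and Z0: "Z0 \<in> null_sets \<nu>"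
    and le: "\<And>x y. x \<notin> Z0 \<Longrightarrow> y \<notin> Z0 \<Longrightarrow> cmod (u x - u y) \<le> a * cmod (g x - g y) + b * cmod (k x - k y)"
    and le': "\<And>x. x \<notin> Z0 \<Longrightarrow> cmod (u x) \<le> a' * cmod (g x) + b' * cmod (k x)"
    and "a' \<le> a" "b' \<le> b"
  shows "u \<in> V" "Nm u \<le> a * Nm g + b * Nm k"
proof -
  have v: "var u \<le> ennreal a * var g + ennreal b * var k"
    by (rule var_combine(2)[OF u V_meas[OF g] V_meas[OF k] ab(1,2) Z0 le])
  have s: "sn u \<le> ennreal a * sn g + ennreal b * sn k"
  proof (rule sn_le[OF u])
    show "AE x in \<nu>. ennreal (cmod (u x)) \<le> ennreal a * sn g + ennreal b * sn k"
      using sn_AE[of g] sn_AE[of k] null_setsD[OF Z0]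
    proof eventually_elim
      case (elim x)
      have "cmod (u x) \<le> a' * cmod (g x) + b' * cmod (k x)" using le' elim by blast
      also have "\<dots> \<le> a * cmod (g x) + b * cmod (k x)" using assms by (intro add_mono mult_right_mono) auto
      finally have "ennreal (cmod (u x)) \<le> ennreal a * ennreal (cmod (g x)) + ennreal b * ennreal (cmod (k x))"
        using ab by (simp add: ennreal_leI flip: ennreal_mult' ennreal_plus)
      also have "\<dots> \<le> ennreal a * sn g + ennreal b * sn k" using elim by (intro add_mono mult_left_mono) auto
      finally show ?case .
    qed
  qed
  have fin: "ennreal a * sn g + ennreal b * sn k < \<top>" "ennreal a * var g + ennreal b * var k < \<top>"
    using g k by (auto simp: V_iff ennreal_mult_less_top)
  show V: "u \<in> V"
    unfolding V_iff using order_le_less_trans[OF s fin(1)] order_le_less_trans[OF v fin(2)] u by blast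
  have "sn u + var u \<le> (ennreal a * sn g + ennreal b * sn k) + (ennreal a * var g + ennreal b * var k)"
    by (rule add_mono[OF s v])
  also have "\<dots> = ennreal a * (sn g + var g) + ennreal b * (sn k + var k)" by (simp add: distrib_left algebra_simps)
  also have "\<dots> = ennreal (a * Nm g + b * Nm k)"
    using ab Nm_nonneg by (simp add: Nm_eq[OF g, symmetric] Nm_eq[OF k, symmetric] ennreal_mult')
  finally show "Nm u \<le> a * Nm g + b * Nm k"
    using ab Nm_nonneg by (intro Nm_leI V) auto
qed

lemma empty_null: "{} \<in> null_sets \<nu>" by simp

lemma V_contraction:
  assumes "u \<in> borel_measurable borel" "g \<in> V" "\<And>x y. cmod (u x - u y) \<le> cmod (g x - g y)" "\<And>x. cmod (u x) \<le> cmod (g x)"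
  shows "u \<in> V" "Nm u \<le> Nm g"
  using V_combine[OF assms(1,2,2) _ _ _ _ empty_null, of 1 0 1 0] assms(3,4) by auto

lemma const_V: "(\<lambda>_. z) \<in> V"
proof -
  have "eo (\<lambda>_. z) C \<le> 0" if "C \<in> cyl n" for C n
    by (rule eo_le_null[OF _ cyl_meas[OF that] empty_null]) auto
  then have "cylvar n (\<lambda>_. z) = 0" for n unfolding cylvar_def by (intro sum.neutral) auto
  then have "var (\<lambda>_. z) = 0" unfolding var_eq by simp
  moreover have "sn (\<lambda>_. z) \<le> ennreal (cmod z)" by (rule sn_le) auto
  then have "sn (\<lambda>_. z) < \<top>" by (rule order_le_less_trans) simp
  ultimately show ?thesis by (simp add: V_iff)
qed

sublocale seminormed_functions V Nm
proof
  show "(\<lambda>_. 0) \<in> V" by (rule const_V)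
  show "Nm g \<ge> 0" for g by (rule Nm_nonneg)
  show "(\<lambda>x. a * g x + b * h x) \<in> V" if g: "g \<in> V" and h: "h \<in> V" for g h a b
  proof (rule V_combine(1)[OF _ g h _ _ _ _ empty_null, of _ "cmod a" "cmod b" "cmod a" "cmod b"])
    have [measurable]: "g \<in> borel_measurable borel" "h \<in> borel_measurable borel" using g h by (auto simp: V_iff)
    show "(\<lambda>x. a * g x + b * h x) \<in> borel_measurable borel" by measurable
    show "cmod (a * g x + b * h x - (a * g y + b * h y)) \<le> cmod a * cmod (g x - g y) + cmod b * cmod (h x - h y)" for x y
    proof -
      have "a * g x + b * h x - (a * g y + b * h y) = a * (g x - g y) + b * (h x - h y)" by (simp add: algebra_simps)
      then show ?thesis by (metis norm_mult norm_triangle_ineq)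
    qed
    show "cmod (a * g x + b * h x) \<le> cmod a * cmod (g x) + cmod b * cmod (h x)" for x
      by (metis norm_mult norm_triangle_ineq)
  qed auto
  show "Nm (\<lambda>x. g x + h x) \<le> Nm g + Nm h" if g: "g \<in> V" and h: "h \<in> V" for g h
  proof -
    have [measurable]: "g \<in> borel_measurable borel" "h \<in> borel_measurable borel" using g h by (auto simp: V_iff)
    have "Nm (\<lambda>x. g x + h x) \<le> 1 * Nm g + 1 * Nm h"
    proof (rule V_combine(2)[OF _ g h _ _ _ _ empty_null, of _ 1 1 1 1])
      show "cmod (g x + h x - (g y + h y)) \<le> 1 * cmod (g x - g y) + 1 * cmod (h x - h y)" for x y
        using norm_triangle_ineq[of "g x - g y" "h x - h y"] by (simp add: algebra_simps)
    qed (auto intro: norm_triangle_ineq)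
    then show ?thesis by simp
  qed
  have scale: "Nm (\<lambda>x. a * g x) \<le> cmod a * Nm g" "(\<lambda>x. a * g x) \<in> V" if g: "g \<in> V" for g a
  proof -
    have [measurable]: "g \<in> borel_measurable borel" using g by (auto simp: V_iff)
    have *: "cmod (a * g x - a * g y) \<le> cmod a * cmod (g x - g y) + 0 * cmod (g x - g y)" for x y
      by (simp add: norm_mult flip: right_diff_distrib)
    have "Nm (\<lambda>x. a * g x) \<le> cmod a * Nm g + 0 * Nm g"
      by (rule V_combine(2)[OF _ g g _ _ _ _ empty_null *, where a' = "cmod a" and b' = 0]) (auto simp: norm_mult)
    then show "Nm (\<lambda>x. a * g x) \<le> cmod a * Nm g" by simp
    show "(\<lambda>x. a * g x) \<in> V"
      by (rule V_combine(1)[OF _ g g _ _ _ _ empty_null *, where a' = "cmod a" and b' = 0]) (auto simp: norm_mult)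
  qed
  show "Nm (\<lambda>x. a * g x) = cmod a * Nm g" if g: "g \<in> V" for g a
  proof (cases "a = 0")
    case True
    then show ?thesis using scale(1)[OF g, of 0] Nm_nonneg[of "\<lambda>_. 0"] by simp
  next
    case False
    have "Nm g = Nm (\<lambda>x. (1 / a) * (a * g x))" using False by simp
    also have "\<dots> \<le> cmod (1 / a) * Nm (\<lambda>x. a * g x)" by (rule scale(1)[OF scale(2)[OF g]])
    finally have "cmod a * Nm g \<le> Nm (\<lambda>x. a * g x)" using False by (simp add: norm_divide field_simps)
    then show ?thesis using scale(1)[OF g, of a] by simp
  qed
qed

lemma Nm_AE:
  assumes u: "u \<in> borel_measurable borel" and g: "g \<in> V" and ae: "AE x in \<nu>. u x = g x"
  shows "u \<in> V" "Nm (\<lambda>x. u x - g x) = 0"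
proof -
  note [measurable] = u V_meas[OF g]
  show V: "u \<in> V" using var_cong_AE[OF u V_meas[OF g] ae] g u by (simp add: V_iff)
  have 0: "AE x in \<nu>. u x - g x = 0" using ae by eventually_elim simp
  have "var (\<lambda>x. u x - g x) = var (\<lambda>_. 0)" "sn (\<lambda>x. u x - g x) = sn (\<lambda>_. 0)"
    using var_cong_AE[OF _ _ 0] by auto
  then have "Nm (\<lambda>x. u x - g x) = Nm (\<lambda>_. 0)" unfolding norm_theta_def enorm_theta_def by simp
  then show "Nm (\<lambda>x. u x - g x) = 0" by (simp add: N_zero)
qed

lemma AE_le_Nm: "g \<in> V \<Longrightarrow> AE x in \<nu>. cmod (g x) \<le> Nm g"
proof -
  assume g: "g \<in> V"
  have "AE x in \<nu>. ennreal (cmod (g x)) \<le> ennreal (Nm g)"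
    using sn_AE[of g] by eventually_elim (use sn_le_Nm[OF g] in auto)
  then show ?thesis by eventually_elim (simp add: ennreal_le_iff Nm_nonneg)
qed

lemma V_integrable: "g \<in> V \<Longrightarrow> integrable \<nu> g"
  by (rule integrable_const_bound[of _ "Nm g"]) (auto simp: AE_le_Nm meas_iff V_meas)

lemma L1_le_Nm:
  assumes "g \<in> V"
  shows "(\<integral>x. cmod (g x) \<partial>\<nu>) \<le> Nm g"
proof -
  have "(\<integral>x. cmod (g x) \<partial>\<nu>) \<le> (\<integral>x. Nm g \<partial>\<nu>)"
    using V_integrable[OF assms] AE_le_Nm[OF assms] by (intro integral_mono_AE) auto
  then show ?thesis by simp
qed

lemma mult_V:
  assumes g: "g \<in> V" and h: "h \<in> V"
  shows "(\<lambda>x. g x * h x) \<in> V" "Nm (\<lambda>x. g x * h x) \<le> 2 * Nm h * Nm g"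
proof -
  note [measurable] = V_meas[OF g] V_meas[OF h]
  obtain Z1 where Z1: "Z1 \<in> null_sets \<nu>" "\<And>x. x \<notin> Z1 \<Longrightarrow> cmod (g x) \<le> Nm g" using AE_imp_null[OF AE_le_Nm[OF g]] by blast
  obtain Z2 where Z2: "Z2 \<in> null_sets \<nu>" "\<And>x. x \<notin> Z2 \<Longrightarrow> cmod (h x) \<le> Nm h" using AE_imp_null[OF AE_le_Nm[OF h]] by blast
  have Z: "Z1 \<union> Z2 \<in> null_sets \<nu>" using Z1 Z2 by blast
  have 1: "cmod (g x * h x - g y * h y) \<le> Nm h * cmod (g x - g y) + Nm g * cmod (h x - h y)"
    if "x \<notin> Z1 \<union> Z2" "y \<notin> Z1 \<union> Z2" for x y
  proof -
    have "g x * h x - g y * h y = h x * (g x - g y) + g y * (h x - h y)" by (simp add: algebra_simps)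
    then have "cmod (g x * h x - g y * h y) \<le> cmod (h x) * cmod (g x - g y) + cmod (g y) * cmod (h x - h y)"
      by (metis norm_mult norm_triangle_ineq)
    also have "\<dots> \<le> Nm h * cmod (g x - g y) + Nm g * cmod (h x - h y)"
      using Z1 Z2 that by (intro add_mono mult_right_mono) auto
    finally show ?thesis .
  qed
  have 2: "cmod (g x * h x) \<le> Nm h * cmod (g x) + 0 * cmod (h x)" if "x \<notin> Z1 \<union> Z2" for x
    using Z2 that mult_right_mono[of "cmod (h x)" "Nm h" "cmod (g x)"] by (simp add: norm_mult mult.commute)
  show "(\<lambda>x. g x * h x) \<in> V"
    by (rule V_combine(1)[OF _ g h _ _ _ _ Z 1 2]) (auto simp: Nm_nonneg)
  have "Nm (\<lambda>x. g x * h x) \<le> Nm h * Nm g + Nm g * Nm h"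
    by (rule V_combine(2)[OF _ g h _ _ _ _ Z 1 2]) (auto simp: Nm_nonneg)
  then show "Nm (\<lambda>x. g x * h x) \<le> 2 * Nm h * Nm g" by (simp add: mult_ac)
qed

text \<open>The sup part of the norm gives uniform convergence off a null set and thereby the limit.
  The variation of the difference to the limit is bounded through finite partial sums, each of which
  is continuous in the sup norm, and then by their supremum.\<close>

lemma complete: "complete_seminormed V Nm"
  unfolding complete_seminormed_def
proof (intro allI impI)
  fix g :: "nat \<Rightarrow> 'a \<Rightarrow> complex"
  assume "(\<forall>i. g i \<in> V) \<and> (\<forall>e>0. \<exists>M. \<forall>i\<ge>M. \<forall>j\<ge>M. Nm (\<lambda>x. g i x - g j x) < e)"
  then have gV: "\<And>i. g i \<in> V" and cauchy: "\<And>e. e > 0 \<Longrightarrow> \<exists>M. \<forall>i\<ge>M. \<forall>j\<ge>M. Nm (\<lambda>x. g i x - g j x) < e" by blast+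
  have [measurable]: "g i \<in> borel_measurable borel" for i using gV V_meas by blast
  have ae: "AE x in \<nu>. \<forall>i j. cmod (g i x - g j x) \<le> Nm (\<lambda>x. g i x - g j x)"
    unfolding AE_all_countable using AE_le_Nm[OF V_diff[OF gV gV]] by blast
  obtain Z where Z: "Z \<in> null_sets \<nu>" "\<And>x i j. x \<notin> Z \<Longrightarrow> cmod (g i x - g j x) \<le> Nm (\<lambda>x. g i x - g j x)"
    using AE_imp_null[OF ae] by blast
  have Z_meas [measurable]: "Z \<in> sets borel" using Z(1) by (auto simp: null_sets_def nu_sets)
  \<comment> \<open>Zero on the exceptional set, so that the sequence converges everywhere.\<close>
  define h where "h x = lim (\<lambda>i. if x \<in> Z then 0 else g i x)" for x
  have h_meas [measurable]: "h \<in> borel_measurable borel" unfolding h_def by measurable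
  have conv: "(\<lambda>i. g i x) \<longlonglongrightarrow> h x" if "x \<notin> Z" for x
  proof -
    have "Cauchy (\<lambda>i. g i x)"
    proof (rule metric_CauchyI)
      fix e :: real assume "e > 0"
      then obtain M where "\<forall>i\<ge>M. \<forall>j\<ge>M. Nm (\<lambda>x. g i x - g j x) < e" using cauchy by blast
      then show "\<exists>M. \<forall>m\<ge>M. \<forall>n\<ge>M. dist (g m x) (g n x) < e"
        using Z(2)[OF that] unfolding dist_norm by (meson order_le_less_trans)
    qed
    then have "convergent (\<lambda>i. g i x)" by (rule Cauchy_convergent)
    then show ?thesis using that by (simp add: h_def convergent_LIMSEQ_iff)
  qed
  have close: "(\<lambda>x. g i x - h x) \<in> V \<and> Nm (\<lambda>x. g i x - h x) \<le> 2 * e"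
    if e: "e > 0" and M: "\<forall>i\<ge>M. \<forall>j\<ge>M. Nm (\<lambda>x. g i x - g j x) < e" and i: "i \<ge> M" for e M i
  proof -
    have sn_gen: "sn (\<lambda>x. g j x - h x) \<le> ennreal e'"
      if e': "e' > 0" and M': "\<forall>i\<ge>M'. \<forall>j\<ge>M'. Nm (\<lambda>x. g i x - g j x) < e'" and j: "j \<ge> M'" for e' M' j
    proof (rule sn_le)
      have "cmod (g j x - h x) \<le> e'" if x: "x \<notin> Z" for x
      proof (rule LIMSEQ_le_const2)
        show "(\<lambda>k. cmod (g j x - g k x)) \<longlonglongrightarrow> cmod (g j x - h x)"
          by (intro tendsto_intros conv x)
        show "\<exists>N. \<forall>n\<ge>N. cmod (g j x - g n x) \<le> e'"
          using Z(2)[OF x] M' j by (meson less_imp_le order_trans)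
      qed
      then show "AE x in \<nu>. ennreal (cmod (g j x - h x)) \<le> ennreal e'"
        using null_setsD[OF Z(1)] by (auto elim!: eventually_mono intro: ennreal_leI)
    qed measurable
    have part: "(\<Sum>k<n. ennreal (\<theta> ^ Suc k) * cylvar (Suc k) (\<lambda>x. g i x - h x)) \<le> ennreal e" for n
    proof (rule ennreal_le_epsilon)
      fix e0 :: real assume e0: "e0 > 0"
      \<comment> \<open>The factor with which the sup norm controls the first \<open>n\<close>
        terms; a late index \<open>j\<close> then makes their contribution at most
        \<open>e0\<close>.\<close>
      define c0 where "c0 = (\<Sum>k<n. \<theta> ^ Suc k * ((\<Sum>C\<in>cyl (Suc k). w (Suc k) C) * 2))"
      have c0: "c0 \<ge> 0" unfolding c0_def
        using theta(1) less_imp_le[OF w_pos] by (intro sum_nonneg mult_nonneg_nonneg) auto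
      define e' where "e' = e0 / (c0 + 1)"
      have e': "e' > 0" "c0 * e' \<le> e0" using e0 c0 by (auto simp: e'_def field_simps)
      obtain M' where M': "\<forall>i\<ge>M'. \<forall>j\<ge>M'. Nm (\<lambda>x. g i x - g j x) < e'" using cauchy[OF e'(1)] by blast
      define j where "j = max M M'"
      have split: "cylvar k (\<lambda>x. g i x - h x) \<le> cylvar k (\<lambda>x. g i x - g j x) + cylvar k (\<lambda>x. g j x - h x)" for k
      proof -
        have "cylvar k (\<lambda>x. g i x - h x) \<le> ennreal 1 * cylvar k (\<lambda>x. g i x - g j x) + ennreal 1 * cylvar k (\<lambda>x. g j x - h x)"
        proof (rule var_combine(1)[OF _ _ _ _ _ empty_null])
          show "cmod (g i x - h x - (g i y - h y)) \<le> 1 * cmod (g i x - g j x - (g i y - g j y)) + 1 * cmod (g j x - h x - (g j y - h y))" for x y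
            using norm_triangle_ineq[of "g i x - g j x - (g i y - g j y)" "g j x - h x - (g j y - h y)"] by (simp add: algebra_simps)
        qed auto
        then show ?thesis by simp
      qed
      have "(\<Sum>k<n. ennreal (\<theta> ^ Suc k) * cylvar (Suc k) (\<lambda>x. g i x - h x))
        \<le> (\<Sum>k<n. ennreal (\<theta> ^ Suc k) * cylvar (Suc k) (\<lambda>x. g i x - g j x) + ennreal (\<theta> ^ Suc k) * cylvar (Suc k) (\<lambda>x. g j x - h x))"
        unfolding distrib_left[symmetric] by (intro sum_mono mult_left_mono split) auto
      also have "\<dots> = (\<Sum>k<n. ennreal (\<theta> ^ Suc k) * cylvar (Suc k) (\<lambda>x. g i x - g j x)) + (\<Sum>k<n. ennreal (\<theta> ^ Suc k) * cylvar (Suc k) (\<lambda>x. g j x - h x))"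
        by (rule sum.distrib)
      also have "\<dots> \<le> ennreal e + ennreal e0"
      proof (rule add_mono)
        have "(\<Sum>k<n. ennreal (\<theta> ^ Suc k) * cylvar (Suc k) (\<lambda>x. g i x - g j x)) \<le> var (\<lambda>x. g i x - g j x)"
          unfolding var_eq by (rule sum_le_suminf) auto
        also have "\<dots> \<le> ennreal (Nm (\<lambda>x. g i x - g j x))" by (intro var_le_Nm V_diff gV)
        also have "\<dots> \<le> ennreal e" using M i by (intro ennreal_leI less_imp_le) (auto simp: j_def)
        finally show "(\<Sum>k<n. ennreal (\<theta> ^ Suc k) * cylvar (Suc k) (\<lambda>x. g i x - g j x)) \<le> ennreal e" .
        have "(\<Sum>k<n. ennreal (\<theta> ^ Suc k) * cylvar (Suc k) (\<lambda>x. g j x - h x))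
          \<le> (\<Sum>k<n. ennreal (\<theta> ^ Suc k) * (ennreal (\<Sum>C\<in>cyl (Suc k). w (Suc k) C) * (2 * ennreal e')))"
        proof (intro sum_mono mult_left_mono order_trans[OF cylvar_le_sn])
          show "sn (\<lambda>x. g j x - h x) \<le> ennreal e'" by (rule sn_gen[OF e'(1) M']) (simp add: j_def)
        qed auto
        also have "\<dots> = ennreal (c0 * e')"
        proof -
          have term_eq: "ennreal (\<theta> ^ Suc k) * (ennreal s * (2 * ennreal e')) = ennreal (\<theta> ^ Suc k * (s * 2) * e')" if "s \<ge> 0" for k s
          proof -
            have "2 * ennreal e' = ennreal (2 * e')" using e' by (simp add: ennreal_mult')
            then show ?thesis using that theta(1) e' by (simp add: mult_ac flip: ennreal_mult')
          qed
          have "(\<Sum>k<n. ennreal (\<theta> ^ Suc k) * (ennreal (\<Sum>C\<in>cyl (Suc k). w (Suc k) C) * (2 * ennreal e')))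
             = (\<Sum>k<n. ennreal (\<theta> ^ Suc k * ((\<Sum>C\<in>cyl (Suc k). w (Suc k) C) * 2) * e'))"
            by (intro sum.cong refl term_eq sum_nonneg less_imp_le[OF w_pos])
          also have "\<dots> = ennreal (c0 * e')"
            unfolding c0_def sum_distrib_right
            using theta(1) e' less_imp_le[OF w_pos] by (intro sum_ennreal mult_nonneg_nonneg sum_nonneg) auto
          finally show ?thesis .
        qed
        also have "\<dots> \<le> ennreal e0" using e' by (intro ennreal_leI)
        finally show "(\<Sum>k<n. ennreal (\<theta> ^ Suc k) * cylvar (Suc k) (\<lambda>x. g j x - h x)) \<le> ennreal e0" .
      qed
      finally show "(\<Sum>k<n. ennreal (\<theta> ^ Suc k) * cylvar (Suc k) (\<lambda>x. g i x - h x)) \<le> ennreal e + ennreal e0" .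
    qed
    have v: "var (\<lambda>x. g i x - h x) \<le> ennreal e"
      unfolding var_eq by (rule suminf_le_const[OF summableI part])
    have s: "sn (\<lambda>x. g i x - h x) \<le> ennreal e" by (rule sn_gen[OF e M i])
    have V: "(\<lambda>x. g i x - h x) \<in> V"
      using v s unfolding V_iff by (auto intro: order_le_less_trans)
    moreover have "Nm (\<lambda>x. g i x - h x) \<le> 2 * e"
    proof (rule Nm_leI[OF V])
      show "sn (\<lambda>x. g i x - h x) + var (\<lambda>x. g i x - h x) \<le> ennreal (2 * e)"
        using add_mono[OF s v] e by (simp flip: ennreal_plus)
    qed (use e in simp)
    ultimately show ?thesis by blast
  qed
  obtain M1 where M1: "\<forall>i\<ge>M1. \<forall>j\<ge>M1. Nm (\<lambda>x. g i x - g j x) < 1" using cauchy[of 1] by auto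
  have "(\<lambda>x. g M1 x - h x) \<in> V" using close[OF _ M1, of M1] by simp
  from V_diff[OF gV[of M1] this] have hV: "h \<in> V" by simp
  moreover have "(\<lambda>i. Nm (\<lambda>x. g i x - h x)) \<longlonglongrightarrow> 0"
  proof (rule LIMSEQ_I)
    fix r :: real assume r: "r > 0"
    then have r3: "r / 3 > 0" by simp
    then obtain M where "\<forall>i\<ge>M. \<forall>j\<ge>M. Nm (\<lambda>x. g i x - g j x) < r / 3" using cauchy by blast
    from close[OF r3 this] have "Nm (\<lambda>x. g i x - h x) < r" if "i \<ge> M" for i using that r by force
    then show "\<exists>no. \<forall>n\<ge>no. norm (Nm (\<lambda>x. g n x - h x) - 0) < r" by (auto simp: Nm_nonneg)
  qed
  ultimately show "\<exists>h\<in>V. (\<lambda>i. Nm (\<lambda>x. g i x - h x)) \<longlonglongrightarrow> 0" by blast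
qed

end

section \<open>The transfer operator on functions of bounded variation\<close>

context theta_system
begin

lemma T_measurable [measurable]:
  assumes [measurable]: "g \<in> borel_measurable borel"
  shows "T g \<in> borel_measurable borel"
  unfolding transfer_op_def by (rule fibre_sum_measurable) measurable

lemma T_linear: "T (\<lambda>x. a * g x + b * h x) = (\<lambda>x. a * T g x + b * T h x)"
  unfolding transfer_op_def
  by (auto simp: distrib_left sum.distrib sum_distrib_left mult_ac)

lemma Tpow_eq: "(T ^^ n) g x = (\<Sum>y\<in>(f ^^ n) -` {x}. complex_of_real (exp (S n y)) * g y)"
proof (induction n arbitrary: x)
  case (Suc n)
  have "(T ^^ Suc n) g x = (\<Sum>y\<in>f -` {x}. complex_of_real (exp (\<phi> y)) * (\<Sum>z\<in>(f ^^ n) -` {y}. complex_of_real (exp (S n z)) * g z))"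
    by (simp add: transfer_op_def Suc)
  also have "\<dots> = (\<Sum>y\<in>f -` {x}. \<Sum>z\<in>(f ^^ n) -` {y}. complex_of_real (exp (S (Suc n) z)) * g z)"
    unfolding sum_distrib_left
    by (intro sum.cong refl) (auto simp: S_Suc exp_add mult_ac)
  finally show ?case by (simp only: sum_fibre_Suc)
qed (simp add: S_0)

lemma Tpow_measurable [measurable]:
  "g \<in> borel_measurable borel \<Longrightarrow> (T ^^ n) g \<in> borel_measurable borel"
  by (induction n) auto

lemma T_integral:
  assumes g: "integrable \<nu> g"
  shows "integrable \<nu> (T g)" "(\<integral>x. T g x \<partial>\<nu>) = of_real lam * (\<integral>x. g x \<partial>\<nu>)"
    "(\<integral>x. cmod (T g x) \<partial>\<nu>) \<le> lam * (\<integral>x. cmod (g x) \<partial>\<nu>)"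
proof -
  have [measurable]: "g \<in> borel_measurable borel" using g by (simp add: meas_iff[symmetric])
  define Tr where "Tr u x = (\<Sum>y\<in>f -` {x}. exp (\<phi> y) * u y)" for u :: "'a \<Rightarrow> real" and x
  have nn: "integrable \<nu> (Tr u) \<and> (\<integral>x. Tr u x \<partial>\<nu>) = lam * (\<integral>x. u x \<partial>\<nu>)"
    if u: "integrable \<nu> u" "\<And>x. u x \<ge> 0" for u
  proof -
    have [measurable]: "u \<in> borel_measurable borel"
      using borel_measurable_integrable[OF u(1)] by (simp cong: measurable_cong_sets add: nu_sets)
    have m [measurable]: "Tr u \<in> borel_measurable borel"
      unfolding Tr_def by (rule fibre_sum_measurable) measurable
    have Tr0: "Tr u x \<ge> 0" for x unfolding Tr_def using u(2) by (intro sum_nonneg) auto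
    have eq: "ennreal (Tr u x) = nntransfer (\<lambda>x. ennreal (u x)) x" for x
      unfolding nntransfer_def Tr_def using u(2) by (subst sum_ennreal[symmetric]) (auto simp: ennreal_mult')
    have "(\<integral>\<^sup>+x. ennreal (Tr u x) \<partial>\<nu>) = ennreal lam * (\<integral>\<^sup>+x. ennreal (u x) \<partial>\<nu>)"
      unfolding eq by (rule nn_conformal) measurable
    also have "\<dots> = ennreal (lam * (\<integral>x. u x \<partial>\<nu>))"
      using u lam_pos by (simp add: nn_integral_eq_integral ennreal_mult')
    finally have e: "(\<integral>\<^sup>+x. ennreal (Tr u x) \<partial>\<nu>) = ennreal (lam * (\<integral>x. u x \<partial>\<nu>))" .
    have int: "integrable \<nu> (Tr u)"
      by (rule integrableI_nonneg) (use Tr0 e in auto)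
    have "ennreal (\<integral>x. Tr u x \<partial>\<nu>) = ennreal (lam * (\<integral>x. u x \<partial>\<nu>))"
      using e int Tr0 by (simp add: nn_integral_eq_integral)
    then have "(\<integral>x. Tr u x \<partial>\<nu>) = lam * (\<integral>x. u x \<partial>\<nu>)"
      using Tr0 u(2) lam_pos by (subst (asm) ennreal_inj) (auto intro!: integral_nonneg mult_nonneg_nonneg)
    then show ?thesis using int by blast
  qed
  have real: "integrable \<nu> (Tr u) \<and> (\<integral>x. Tr u x \<partial>\<nu>) = lam * (\<integral>x. u x \<partial>\<nu>)"
    if u: "integrable \<nu> u" for u
  proof -
    have 1: "integrable \<nu> (\<lambda>x. max 0 (u x))" "integrable \<nu> (\<lambda>x. max 0 (- u x))" using u by auto
    have Tr_eq: "Tr u = (\<lambda>x. Tr (\<lambda>x. max 0 (u x)) x - Tr (\<lambda>x. max 0 (- u x)) x)"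
      unfolding Tr_def sum_subtractf[symmetric] by (intro ext sum.cong refl) (auto simp: max_def)
    have u_eq: "(\<integral>x. u x \<partial>\<nu>) = (\<integral>x. max 0 (u x) \<partial>\<nu>) - (\<integral>x. max 0 (- u x) \<partial>\<nu>)"
    proof -
      have "(\<integral>x. u x \<partial>\<nu>) = (\<integral>x. max 0 (u x) - max 0 (- u x) \<partial>\<nu>)"
        by (intro Bochner_Integration.integral_cong refl) (auto simp: max_def)
      then show ?thesis unfolding Bochner_Integration.integral_diff[OF 1] .
    qed
    show ?thesis
      unfolding Tr_eq u_eq using nn[OF 1(1)] nn[OF 1(2)] by (simp add: right_diff_distrib)
  qed
  have T_eq: "T g = (\<lambda>x. complex_of_real (Tr (\<lambda>x. Re (g x)) x) + \<i> * complex_of_real (Tr (\<lambda>x. Im (g x)) x))"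
    unfolding transfer_op_def Tr_def
    by (intro ext) (auto simp: complex_eq_iff)
  have re: "integrable \<nu> (\<lambda>x. Re (g x))" "integrable \<nu> (\<lambda>x. Im (g x))" using g by auto
  note r = real[OF re(1)] real[OF re(2)]
  show "integrable \<nu> (T g)" unfolding T_eq using r by auto
  have "(\<integral>x. T g x \<partial>\<nu>) = of_real (\<integral>x. Tr (\<lambda>x. Re (g x)) x \<partial>\<nu>) + \<i> * of_real (\<integral>x. Tr (\<lambda>x. Im (g x)) x \<partial>\<nu>)"
    unfolding T_eq using r by simp
  also have "\<dots> = of_real lam * (of_real (\<integral>x. Re (g x) \<partial>\<nu>) + \<i> * of_real (\<integral>x. Im (g x) \<partial>\<nu>))"
    using r by (simp add: algebra_simps)
  also have "of_real (\<integral>x. Re (g x) \<partial>\<nu>) + \<i> * of_real (\<integral>x. Im (g x) \<partial>\<nu>) = (\<integral>x. g x \<partial>\<nu>)"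
    using g by (simp add: complex_eq_iff)
  finally show "(\<integral>x. T g x \<partial>\<nu>) = of_real lam * (\<integral>x. g x \<partial>\<nu>)" .
  have "(\<integral>x. cmod (T g x) \<partial>\<nu>) \<le> (\<integral>x. Tr (\<lambda>x. cmod (g x)) x \<partial>\<nu>)"
  proof (rule integral_mono)
    show "integrable \<nu> (\<lambda>x. cmod (T g x))" unfolding T_eq using r by auto
    show "integrable \<nu> (Tr (\<lambda>x. cmod (g x)))" using nn[of "\<lambda>x. cmod (g x)"] g by auto
    show "cmod (T g x) \<le> Tr (\<lambda>x. cmod (g x)) x" for x
      unfolding transfer_op_def Tr_def by (rule order_trans[OF norm_sum]) (simp add: norm_mult)
  qed
  then show "(\<integral>x. cmod (T g x) \<partial>\<nu>) \<le> lam * (\<integral>x. cmod (g x) \<partial>\<nu>)"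
    using nn[of "\<lambda>x. cmod (g x)"] g by auto
qed

lemma Tpow_integral:
  assumes g: "integrable \<nu> g"
  shows "integrable \<nu> ((T ^^ n) g)" "(\<integral>x. (T ^^ n) g x \<partial>\<nu>) = of_real (lam ^ n) * (\<integral>x. g x \<partial>\<nu>)"
    "(\<integral>x. cmod ((T ^^ n) g x) \<partial>\<nu>) \<le> lam ^ n * (\<integral>x. cmod (g x) \<partial>\<nu>)"
proof (induction n)
  case (Suc n)
  { case 1 show ?case using T_integral(1)[OF Suc(1)] by simp }
  { case 2 show ?case using T_integral(2)[OF Suc(1)] Suc(2) by simp }
  { case 3
    have "(\<integral>x. cmod (T ((T ^^ n) g) x) \<partial>\<nu>) \<le> lam * (lam ^ n * (\<integral>x. cmod (g x) \<partial>\<nu>))"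
      using T_integral(3)[OF Suc(1)] mult_left_mono[OF Suc(3), of lam] lam_pos by linarith
    then show ?case by (simp add: mult.assoc) }
qed (use g in auto)

lemma Tpow_comp: "(T ^^ n) (\<lambda>y. u ((f ^^ n) y) * v y) x = u x * (T ^^ n) v x"
  unfolding Tpow_eq sum_distrib_left by (intro sum.cong) (auto simp: mult_ac)

definition Dp :: "'a set \<Rightarrow> real" where
  "Dp C = (SUP x\<in>C. SUP y\<in>C. \<bar>\<phi> x - \<phi> y\<bar>)"

lemma Dp_ge: "x \<in> C \<Longrightarrow> y \<in> C \<Longrightarrow> \<bar>\<phi> x - \<phi> y\<bar> \<le> Dp C"
proof -
  assume x: "x \<in> C" and y: "y \<in> C"
  have bdd1: "bdd_above ((\<lambda>y. \<bar>\<phi> x - \<phi> y\<bar>) ` C)" for x using osc by (intro bdd_aboveI2) auto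
  have bdd2: "bdd_above ((\<lambda>x. SUP y\<in>C. \<bar>\<phi> x - \<phi> y\<bar>) ` C)"
    using osc x by (intro bdd_aboveI2[of _ _ osc] cSUP_least) auto
  have "\<bar>\<phi> x - \<phi> y\<bar> \<le> (SUP y\<in>C. \<bar>\<phi> x - \<phi> y\<bar>)" by (rule cSUP_upper[OF y bdd1])
  also have "\<dots> \<le> Dp C" unfolding Dp_def by (rule cSUP_upper[OF x bdd2])
  finally show ?thesis .
qed

lemma Dp_nonneg: "C \<noteq> {} \<Longrightarrow> Dp C \<ge> 0"
  using Dp_ge[of _ C] by (metis abs_ge_zero ex_in_conv order_trans)

lemma exp_diff_le:
  fixes a b M :: real
  assumes "a \<le> M" "b \<le> M"
  shows "\<bar>exp a - exp b\<bar> \<le> exp M * \<bar>a - b\<bar>"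
proof -
  have *: "exp a - exp b \<le> exp M * (a - b)" if "b \<le> a" "a \<le> M" for a b :: real
  proof -
    have "exp a - exp b = exp a * (1 - exp (b - a))" by (simp add: exp_diff right_diff_distrib)
    also have "\<dots> \<le> exp a * (a - b)"
      by (rule mult_left_mono) (use exp_ge_add_one_self[of "b - a"] in linarith, simp)
    also have "\<dots> \<le> exp M * (a - b)" using that by (intro mult_right_mono) auto
    finally show ?thesis .
  qed
  show ?thesis
  proof (cases "b \<le> a")
    case True
    then show ?thesis using *[OF True assms(1)] by simp
  next
    case False
    then show ?thesis using *[of a b] assms(2) by simp
  qed
qed

text \<open>Points of \<open>C\<close> at which the supremum \<open>w n C\<close> is approached have
  preimages in \<open>E\<close> other than \<open>y\<close>; exchanging the value of \<phi> at one
  preimage for that at the other costs \<open>exp osc\<close>. This loss is the source of the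
  requirement \<open>exp osc < \<theta> * lam\<close>.\<close>

lemma weight_le:
  assumes E: "E \<in> P" and C: "C \<in> cyl n" "n \<ge> 1" and ne: "E \<inter> f -` C \<noteq> {}" and y: "y \<in> E \<inter> f -` C"
  shows "w n C * exp (\<phi> y) \<le> exp osc * w (Suc n) (E \<inter> f -` C)"
proof -
  have "w n C \<le> exp osc * w (Suc n) (E \<inter> f -` C) / exp (\<phi> y)"
  proof (rule w_le[OF cyl_ne[OF C(1)]])
    fix z assume "z \<in> C"
    then obtain y' where y': "y' \<in> E \<inter> f -` C" "f y' = z" using image_branch[OF E C(1,2) ne] by (metis imageE)
    have "S (Suc n) y' = \<phi> y' + S n z"
      using S_add[of 1 n y'] y'(2) by (simp add: birkhoff_sum_def)
    then have "exp (S n z) * exp (\<phi> y) = exp (S (Suc n) y') * exp (\<phi> y - \<phi> y')"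
      by (simp flip: exp_add)
    also have "\<dots> \<le> w (Suc n) (E \<inter> f -` C) * exp osc"
      using osc[of y y'] w_ge[OF y'(1)] by (intro mult_mono) (auto simp: abs_le_iff less_imp_le[OF w_pos])
    finally show "exp (S n z) \<le> exp osc * w (Suc n) (E \<inter> f -` C) / exp (\<phi> y)"
      by (simp add: field_simps)
  qed
  then show ?thesis by (simp add: field_simps)
qed

lemma fibre_branches:
  assumes C: "C \<in> cyl n" "n \<ge> 1" and x: "x \<in> C"
  shows "inj_on (\<lambda>E. inv_into E f x) {E \<in> P. E \<inter> f -` C \<noteq> {}}"
    "(\<lambda>E. inv_into E f x) ` {E \<in> P. E \<inter> f -` C \<noteq> {}} = f -` {x}"
    "\<And>E. E \<in> P \<Longrightarrow> E \<inter> f -` C \<noteq> {} \<Longrightarrow> inv_into E f x \<in> E \<inter> f -` C \<and> f (inv_into E f x) = x"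
proof -
  show inE: "inv_into E f x \<in> E \<inter> f -` C \<and> f (inv_into E f x) = x" if "E \<in> P" "E \<inter> f -` C \<noteq> {}" for E
  proof -
    have "x \<in> f ` E" using image_branch[OF that(1) C that(2)] x by blast
    then show ?thesis using inv_into_into[of x f E] f_inv_into_f[of x f E] x by simp
  qed
  show "inj_on (\<lambda>E. inv_into E f x) {E \<in> P. E \<inter> f -` C \<noteq> {}}"
  proof (rule inj_onI)
    fix E E' assume E: "E \<in> {E \<in> P. E \<inter> f -` C \<noteq> {}}" "E' \<in> {E \<in> P. E \<inter> f -` C \<noteq> {}}"
      and eq: "inv_into E f x = inv_into E' f x"
    have "inv_into E f x \<in> E" "inv_into E f x \<in> E'" using inE[of E] inE[of E'] E eq by auto
    then show "E = E'" using disjoint_P[of E E'] E by auto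
  qed
  obtain F where F: "F \<in> P" "C \<subseteq> F" using ex_cyl_of_le[OF C(1), of 1] C(2) by (auto simp: cyl_1)
  show "(\<lambda>E. inv_into E f x) ` {E \<in> P. E \<inter> f -` C \<noteq> {}} = f -` {x}"
  proof
    show "(\<lambda>E. inv_into E f x) ` {E \<in> P. E \<inter> f -` C \<noteq> {}} \<subseteq> f -` {x}" using inE by auto
    show "f -` {x} \<subseteq> (\<lambda>E. inv_into E f x) ` {E \<in> P. E \<inter> f -` C \<noteq> {}}"
    proof
      fix y assume "y \<in> f -` {x}"
      then have y: "f y = x" by simp
      then obtain E where E: "E \<in> P" "y \<in> E" using vimage_P[of y F] F x by blast
      have "E \<inter> f -` C \<noteq> {}" using E y x by blast
      moreover have "inv_into E f x = y"
        using inv_into_f_f[OF inj_on_subset[OF inj_P[OF E(1)] closure_subset] E(2)] y by simp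
      ultimately show "y \<in> (\<lambda>E. inv_into E f x) ` {E \<in> P. E \<inter> f -` C \<noteq> {}}" using E(1) by force
    qed
  qed
qed

text \<open>On each inverse branch the product of \<open>exp \<circ> \<phi>\<close> and
  \<open>g\<close> oscillates either through \<open>g\<close>, weighted by the exponential, or
  through the exponential, weighted by the size of \<open>g\<close>. The first part belongs to the
  variation one level deeper, the second is the sup norm times an oscillation of \<phi>.\<close>

lemma eo_T:
  assumes g: "g \<in> borel_measurable borel" and C: "C \<in> cyl n" "n \<ge> 1" and M: "\<And>x. \<bar>\<phi> x\<bar> \<le> M"
  shows "ennreal (w n C) * eo (T g) C \<le>
    (\<Sum>E\<in>{E \<in> P. E \<inter> f -` C \<noteq> {}}. ennreal (exp osc) * (ennreal (w (Suc n) (E \<inter> f -` C)) * eo g (E \<inter> f -` C))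
      + ennreal (exp (osc + 2 * M)) * (ennreal (w (Suc n) (E \<inter> f -` C) * Dp (E \<inter> f -` C)) * sn g))"
    (is "_ \<le> (\<Sum>E\<in>?I. ?t E)")
proof -
  obtain Z where Z: "Z \<in> null_sets \<nu>" "\<And>x. x \<notin> Z \<Longrightarrow> ennreal (cmod (g x)) \<le> sn g"
    "\<And>n C x y. C \<in> cyl n \<Longrightarrow> x \<in> C - Z \<Longrightarrow> y \<in> C - Z \<Longrightarrow> ennreal (cmod (g x - g y)) \<le> eo g C"
    by (rule good_null[OF g]) blast
  obtain Z' where Z': "Z' \<in> null_sets \<nu>" "\<And>x y. x \<notin> Z' \<Longrightarrow> f y = x \<Longrightarrow> y \<notin> Z"
    using AE_imp_null[OF AE_fibre[OF null_setsD[OF Z(1)]]] by blast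
  have bound: "ennreal (w n C) * ennreal (cmod (T g x - T g x')) \<le> (\<Sum>E\<in>?I. ?t E)"
    if x: "x \<in> C - Z'" and x': "x' \<in> C - Z'" for x x'
  proof -
    define y where "y E = inv_into E f x" for E
    define y' where "y' E = inv_into E f x'" for E
    have T_eq: "T g x = (\<Sum>E\<in>?I. complex_of_real (exp (\<phi> (y E))) * g (y E))"
      unfolding transfer_op_def y_def using fibre_branches(1,2)[OF C, of x] x
      by (metis (no_types, lifting) DiffD1 sum.reindex_cong)
    have T_eq': "T g x' = (\<Sum>E\<in>?I. complex_of_real (exp (\<phi> (y' E))) * g (y' E))"
      unfolding transfer_op_def y'_def using fibre_branches(1,2)[OF C, of x'] x'
      by (metis (no_types, lifting) DiffD1 sum.reindex_cong)
    have each: "ennreal (w n C) * ennreal (cmod (complex_of_real (exp (\<phi> (y E))) * g (y E) - complex_of_real (exp (\<phi> (y' E))) * g (y' E))) \<le> ?t E"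
      if E: "E \<in> ?I" for E
    proof -
      have EP: "E \<in> P" "E \<inter> f -` C \<noteq> {}" using E by auto
      have yE: "y E \<in> E \<inter> f -` C" "f (y E) = x" "y' E \<in> E \<inter> f -` C" "f (y' E) = x'"
        unfolding y_def y'_def using fibre_branches(3)[OF C _ EP] x x' by auto
      have nZ: "y E \<notin> Z" "y' E \<notin> Z" using Z'(2) x x' yE by blast+
      have CE: "E \<inter> f -` C \<in> cyl (Suc n)" using cyl_SucI[OF EP(1) C(1) EP(2)] .
      have o: "ennreal (cmod (g (y E) - g (y' E))) \<le> eo g (E \<inter> f -` C)"
        by (rule Z(3)[OF CE]) (use yE nZ in auto)
      have s: "ennreal (cmod (g (y' E))) \<le> sn g" by (rule Z(2)[OF nZ(2)])
      have "cmod (complex_of_real (exp (\<phi> (y E))) * g (y E) - complex_of_real (exp (\<phi> (y' E))) * g (y' E))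
        = cmod (complex_of_real (exp (\<phi> (y E))) * (g (y E) - g (y' E)) + complex_of_real (exp (\<phi> (y E)) - exp (\<phi> (y' E))) * g (y' E))"
        by (simp add: algebra_simps)
      also have "\<dots> \<le> exp (\<phi> (y E)) * cmod (g (y E) - g (y' E)) + \<bar>exp (\<phi> (y E)) - exp (\<phi> (y' E))\<bar> * cmod (g (y' E))"
        by (rule order_trans[OF norm_triangle_ineq]) (simp only: norm_mult norm_of_real abs_exp_cancel order_refl)
      finally have 1: "w n C * cmod (complex_of_real (exp (\<phi> (y E))) * g (y E) - complex_of_real (exp (\<phi> (y' E))) * g (y' E))
         \<le> w n C * (exp (\<phi> (y E)) * cmod (g (y E) - g (y' E)) + \<bar>exp (\<phi> (y E)) - exp (\<phi> (y' E))\<bar> * cmod (g (y' E)))"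
        using less_imp_le[OF w_pos] by (rule mult_left_mono)
      have wl: "w n C * exp (\<phi> (y E)) \<le> exp osc * w (Suc n) (E \<inter> f -` C)"
        by (rule weight_le[OF EP(1) C EP(2) yE(1)])
      have 2: "w n C * exp (\<phi> (y E)) * cmod (g (y E) - g (y' E)) \<le> exp osc * w (Suc n) (E \<inter> f -` C) * cmod (g (y E) - g (y' E))"
        using wl by (rule mult_right_mono) simp
      have "w n C * \<bar>exp (\<phi> (y E)) - exp (\<phi> (y' E))\<bar> \<le> w n C * (exp M * Dp (E \<inter> f -` C))"
      proof (intro mult_left_mono less_imp_le[OF w_pos])
        have "\<bar>exp (\<phi> (y E)) - exp (\<phi> (y' E))\<bar> \<le> exp M * \<bar>\<phi> (y E) - \<phi> (y' E)\<bar>"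
          using M by (intro exp_diff_le) (auto simp: abs_le_iff)
        also have "\<dots> \<le> exp M * Dp (E \<inter> f -` C)" by (intro mult_left_mono Dp_ge yE) auto
        finally show "\<bar>exp (\<phi> (y E)) - exp (\<phi> (y' E))\<bar> \<le> exp M * Dp (E \<inter> f -` C)" .
      qed
      \<comment> \<open>The bound \<open>exp M\<close> is traded for \<open>exp (- M)\<close>, which
        lies below the weight of the branch, so that the comparison \<open>wl\<close> applies here
        too.\<close>
      also have "\<dots> = (w n C * exp (- M)) * (exp (2 * M) * Dp (E \<inter> f -` C))"
        by (simp add: exp_minus exp_add[symmetric] mult_2 exp_add field_simps)
      also have "\<dots> \<le> (exp osc * w (Suc n) (E \<inter> f -` C)) * (exp (2 * M) * Dp (E \<inter> f -` C))"
      proof (rule mult_right_mono)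
        have "w n C * exp (- M) \<le> w n C * exp (\<phi> (y E))"
          using M[of "y E"] less_imp_le[OF w_pos] by (intro mult_left_mono) (auto simp: abs_le_iff)
        then show "w n C * exp (- M) \<le> exp osc * w (Suc n) (E \<inter> f -` C)" using wl by linarith
        show "0 \<le> exp (2 * M) * Dp (E \<inter> f -` C)" using Dp_nonneg[OF EP(2)] by simp
      qed
      also have "\<dots> = exp (osc + 2 * M) * (w (Suc n) (E \<inter> f -` C) * Dp (E \<inter> f -` C))"
        by (simp add: exp_add mult_ac)
      finally have 3: "w n C * \<bar>exp (\<phi> (y E)) - exp (\<phi> (y' E))\<bar> * cmod (g (y' E))
          \<le> exp (osc + 2 * M) * (w (Suc n) (E \<inter> f -` C) * Dp (E \<inter> f -` C)) * cmod (g (y' E))"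
        by (rule mult_right_mono) simp
      have "w n C * cmod (complex_of_real (exp (\<phi> (y E))) * g (y E) - complex_of_real (exp (\<phi> (y' E))) * g (y' E))
        \<le> exp osc * w (Suc n) (E \<inter> f -` C) * cmod (g (y E) - g (y' E))
          + exp (osc + 2 * M) * (w (Suc n) (E \<inter> f -` C) * Dp (E \<inter> f -` C)) * cmod (g (y' E))"
        using 1 2 3 by (simp add: distrib_left mult.assoc)
      then have "ennreal (w n C * cmod (complex_of_real (exp (\<phi> (y E))) * g (y E) - complex_of_real (exp (\<phi> (y' E))) * g (y' E)))
        \<le> ennreal (exp osc * w (Suc n) (E \<inter> f -` C) * cmod (g (y E) - g (y' E))
          + exp (osc + 2 * M) * (w (Suc n) (E \<inter> f -` C) * Dp (E \<inter> f -` C)) * cmod (g (y' E)))"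
        by (rule ennreal_leI)
      also have "\<dots> = ennreal (exp osc) * (ennreal (w (Suc n) (E \<inter> f -` C)) * ennreal (cmod (g (y E) - g (y' E))))
          + ennreal (exp (osc + 2 * M)) * (ennreal (w (Suc n) (E \<inter> f -` C) * Dp (E \<inter> f -` C)) * ennreal (cmod (g (y' E))))"
        using less_imp_le[OF w_pos] Dp_nonneg[OF EP(2)] by (simp add: ennreal_mult' ennreal_plus mult.assoc)
      also have "\<dots> \<le> ?t E" by (intro add_mono mult_left_mono o s) auto
      finally show ?thesis using less_imp_le[OF w_pos] by (simp add: ennreal_mult')
    qed
    have "cmod (T g x - T g x') \<le> (\<Sum>E\<in>?I. cmod (complex_of_real (exp (\<phi> (y E))) * g (y E) - complex_of_real (exp (\<phi> (y' E))) * g (y' E)))"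
      unfolding T_eq T_eq' sum_subtractf[symmetric] by (rule norm_sum)
    then have "ennreal (w n C) * ennreal (cmod (T g x - T g x'))
      \<le> ennreal (w n C) * (\<Sum>E\<in>?I. ennreal (cmod (complex_of_real (exp (\<phi> (y E))) * g (y E) - complex_of_real (exp (\<phi> (y' E))) * g (y' E))))"
      by (intro mult_left_mono) (simp_all add: ennreal_leI)
    also have "\<dots> \<le> (\<Sum>E\<in>?I. ?t E)"
      unfolding sum_distrib_left by (intro sum_mono each)
    finally show ?thesis .
  qed
  have inv: "ennreal (1 / w n C) * (ennreal (w n C) * r) = r" for r
    using w_pos[of n C] by (simp add: mult.assoc[symmetric] ennreal_mult'[symmetric])
  have "eo (T g) C \<le> ennreal (1 / w n C) * (\<Sum>E\<in>?I. ?t E)"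
  proof (rule eo_le_null[OF _ cyl_meas[OF C(1)] Z'(1)])
    show "T g \<in> borel_measurable borel" using g by measurable
    fix x x' assume "x \<in> C - Z'" "x' \<in> C - Z'"
    from mult_left_mono[OF bound[OF this], of "ennreal (1 / w n C)"]
    show "ennreal (cmod (T g x - T g x')) \<le> ennreal (1 / w n C) * (\<Sum>E\<in>?I. ?t E)" unfolding inv by simp
  qed
  then have "ennreal (w n C) * eo (T g) C \<le> ennreal (w n C) * (ennreal (1 / w n C) * (\<Sum>E\<in>?I. ?t E))"
    by (rule mult_left_mono) simp
  also have "\<dots> = (\<Sum>E\<in>?I. ?t E)"
    using w_pos[of n C] by (simp add: mult.assoc[symmetric] ennreal_mult'[symmetric])
  finally show ?thesis .
qed

text \<open>\<open>E\<close> and \<open>C\<close> are recovered from a nonempty intersection of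
  \<open>E\<close> with the preimage of \<open>C\<close>, by disjointness; so no cylinder of order
  \<open>n + 1\<close> is counted twice.\<close>

lemma sum_branches_le:
  fixes F :: "'a set \<Rightarrow> ennreal"
  shows "(\<Sum>C\<in>cyl n. \<Sum>E\<in>{E \<in> P. E \<inter> f -` C \<noteq> {}}. F (E \<inter> f -` C)) \<le> (\<Sum>C\<in>cyl (Suc n). F C)"
proof -
  let ?I = "SIGMA C:cyl n. {E \<in> P. E \<inter> f -` C \<noteq> {}}"
  let ?g = "\<lambda>(C, E). E \<inter> f -` C"
  have "(\<Sum>C\<in>cyl n. \<Sum>E\<in>{E \<in> P. E \<inter> f -` C \<noteq> {}}. F (E \<inter> f -` C)) = (\<Sum>p\<in>?I. F (?g p))"
    using finite_cyl finite_P by (subst sum.Sigma) (auto intro!: sum.cong)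
  also have "\<dots> = (\<Sum>C\<in>?g ` ?I. F C)"
  proof (rule sum.reindex[symmetric, unfolded o_def])
    show "inj_on ?g ?I"
    proof (rule inj_onI)
      fix p p' assume p: "p \<in> ?I" "p' \<in> ?I" "?g p = ?g p'"
      obtain C E C' E' where pp: "p = (C, E)" "p' = (C', E')" by (cases p, cases p')
      have *: "C \<in> cyl n" "E \<in> P" "C' \<in> cyl n" "E' \<in> P" "E \<inter> f -` C = E' \<inter> f -` C'" "E \<inter> f -` C \<noteq> {}"
        using p by (simp_all add: pp)
      then obtain y where y: "y \<in> E" "f y \<in> C" by blast
      then have y': "y \<in> E'" "f y \<in> C'" using *(5) by blast+
      have "E = E'" using disjoint_P[OF *(2,4)] y(1) y'(1) by blast
      moreover have "C = C'" using cyl_disjoint[OF *(1,3) y(2) y'(2)] .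
      ultimately show "p = p'" by (simp add: pp)
    qed
  qed
  also have "\<dots> \<le> (\<Sum>C\<in>cyl (Suc n). F C)"
  proof (rule sum_mono2[OF finite_cyl])
    show "?g ` ?I \<subseteq> cyl (Suc n)"
    proof (rule image_subsetI)
      fix p assume "p \<in> ?I"
      moreover obtain C E where "p = (C, E)" by (cases p)
      ultimately show "?g p \<in> cyl (Suc n)" using cyl_SucI by simp
    qed
  qed simp
  finally show ?thesis .
qed

lemma summable_theta_lam_rho: "summable (\<lambda>n. real (Suc n) * (\<theta> * lam * \<rho>) ^ n)"
proof -
  have "summable (\<lambda>n. diffs (\<lambda>_. 1) n * (\<theta> * lam * \<rho>) ^ n)"
    by (rule termdiff_converges[of _ 1]) (use theta lam_pos rho(1) in \<open>auto intro!: summable_geometric\<close>)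
  then show ?thesis by (simp add: diffs_def)
qed

text \<open>Level \<open>n\<close> of \<open>T g\<close> is bounded by level \<open>n + 1\<close> of
  \<open>g\<close>, and the missing power of \<theta> produces the factor
  \<open>exp osc / \<theta>\<close>. The oscillations of \<phi> contribute terms of size
  \<open>(\<theta> * lam * \<rho>) ^ n\<close> up to a linear factor, and these are
  summable.\<close>

lemma var_T: "\<exists>K\<ge>0. \<forall>g\<in>borel_measurable borel. var (T g) \<le> ennreal (exp osc / \<theta>) * var g + ennreal K * sn g"
proof -
  obtain M where M: "\<And>x. \<bar>\<phi> x\<bar> \<le> M" using phi_bounded by blast
  obtain K0 where K0: "K0 \<ge> 0" "\<And>n. (\<Sum>C\<in>cyl n. w n C * Dp C) \<le> K0 * real (Suc n) * (lam * \<rho>) ^ n"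
    using holder_cyl_sum(1)[OF holder] unfolding Dp_def by blast
  let ?k = "exp (osc + 2 * M)"
  have step: "cylvar n (T g) \<le> ennreal (exp osc) * cylvar (Suc n) g + ennreal (?k * (K0 * real (Suc (Suc n)) * (lam * \<rho>) ^ Suc n)) * sn g"
    if g: "g \<in> borel_measurable borel" and n: "n \<ge> 1" for g n
  proof -
    have "cylvar n (T g) \<le> (\<Sum>C\<in>cyl n. \<Sum>E\<in>{E \<in> P. E \<inter> f -` C \<noteq> {}}.
        ennreal (exp osc) * (ennreal (w (Suc n) (E \<inter> f -` C)) * eo g (E \<inter> f -` C))
      + ennreal ?k * (ennreal (w (Suc n) (E \<inter> f -` C) * Dp (E \<inter> f -` C)) * sn g))"
      unfolding cylvar_def by (intro sum_mono eo_T[OF g _ n M])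
    also have "\<dots> \<le> (\<Sum>C\<in>cyl (Suc n). ennreal (exp osc) * (ennreal (w (Suc n) C) * eo g C)
      + ennreal ?k * (ennreal (w (Suc n) C * Dp C) * sn g))"
      by (rule sum_branches_le)
    also have "\<dots> = ennreal (exp osc) * cylvar (Suc n) g + ennreal ?k * ((\<Sum>C\<in>cyl (Suc n). ennreal (w (Suc n) C * Dp C)) * sn g)"
      by (simp add: sum.distrib cylvar_def sum_distrib_left sum_distrib_right)
    also have "(\<Sum>C\<in>cyl (Suc n). ennreal (w (Suc n) C * Dp C)) = ennreal (\<Sum>C\<in>cyl (Suc n). w (Suc n) C * Dp C)"
      using less_imp_le[OF w_pos] Dp_nonneg cyl_ne by (intro sum_ennreal mult_nonneg_nonneg) auto
    also have "ennreal ?k * (ennreal (\<Sum>C\<in>cyl (Suc n). w (Suc n) C * Dp C) * sn g)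
      \<le> ennreal ?k * (ennreal (K0 * real (Suc (Suc n)) * (lam * \<rho>) ^ Suc n) * sn g)"
      by (intro mult_left_mono mult_right_mono ennreal_leI K0) auto
    also have "\<dots> = ennreal (?k * (K0 * real (Suc (Suc n)) * (lam * \<rho>) ^ Suc n)) * sn g"
      by (simp add: ennreal_mult' mult.assoc)
    finally show ?thesis by simp
  qed
  define b where "b k = \<theta> ^ Suc k * (?k * (K0 * real (Suc (Suc (Suc k))) * (lam * \<rho>) ^ Suc (Suc k)))" for k
  have b0: "b k \<ge> 0" for k unfolding b_def using theta(1) K0(1) lam_pos rho(1) by simp
  let ?x = "\<theta> * lam * \<rho>"
  have b_eq: "b k = (?k * K0 / \<theta>) * (real (k + 3) * ?x ^ (k + 2))" for k
    unfolding b_def using theta(1) by (simp add: power_mult_distrib field_simps)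
  have "summable (\<lambda>n. real (Suc (n + 2)) * ?x ^ (n + 2))"
    using summable_theta_lam_rho by (subst summable_iff_shift)
  then have summ: "summable b" unfolding b_eq[abs_def] by (intro summable_mult) (simp add: add.commute)
  define K where "K = (\<Sum>k. b k)"
  have K: "K \<ge> 0" unfolding K_def using summ b0 by (rule suminf_nonneg)
  have "var (T g) \<le> ennreal (exp osc / \<theta>) * var g + ennreal K * sn g" if g: "g \<in> borel_measurable borel" for g
  proof -
    have "var (T g) \<le> (\<Sum>k. ennreal (\<theta> ^ Suc k) * (ennreal (exp osc) * cylvar (Suc (Suc k)) g
        + ennreal (?k * (K0 * real (Suc (Suc (Suc k))) * (lam * \<rho>) ^ Suc (Suc k))) * sn g))"
      unfolding var_eq by (intro suminf_le mult_left_mono step g) auto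
    also have "\<dots> = (\<Sum>k. ennreal (exp osc / \<theta>) * (ennreal (\<theta> ^ Suc (Suc k)) * cylvar (Suc (Suc k)) g) + ennreal (b k) * sn g)"
    proof (intro suminf_cong)
      fix k
      have "ennreal (\<theta> ^ Suc k) * ennreal (exp osc) = ennreal (exp osc / \<theta>) * ennreal (\<theta> ^ Suc (Suc k))"
        using theta(1) by (simp add: field_simps flip: ennreal_mult')
      moreover have "ennreal (\<theta> ^ Suc k) * ennreal (?k * (K0 * real (Suc (Suc (Suc k))) * (lam * \<rho>) ^ Suc (Suc k))) = ennreal (b k)"
        using theta(1) unfolding b_def by (subst ennreal_mult') auto
      ultimately show "ennreal (\<theta> ^ Suc k) * (ennreal (exp osc) * cylvar (Suc (Suc k)) g
          + ennreal (?k * (K0 * real (Suc (Suc (Suc k))) * (lam * \<rho>) ^ Suc (Suc k))) * sn g)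
        = ennreal (exp osc / \<theta>) * (ennreal (\<theta> ^ Suc (Suc k)) * cylvar (Suc (Suc k)) g) + ennreal (b k) * sn g"
        unfolding distrib_left mult.assoc[symmetric] by simp
    qed
    also have "\<dots> = ennreal (exp osc / \<theta>) * (\<Sum>k. ennreal (\<theta> ^ Suc (Suc k)) * cylvar (Suc (Suc k)) g) + (\<Sum>k. ennreal (b k)) * sn g"
      by (subst suminf_add[symmetric]) auto
    also have "(\<Sum>k. ennreal (b k)) = ennreal K"
      unfolding K_def using b0 summ by (rule suminf_ennreal2)
    \<comment> \<open>The shifted series starts at level 2, so level 1 of the variation is left
      over.\<close>
    also have "(\<Sum>k. ennreal (\<theta> ^ Suc (Suc k)) * cylvar (Suc (Suc k)) g) \<le> var g"
    proof -
      have "var g = (\<Sum>k. ennreal (\<theta> ^ Suc (k + 1)) * cylvar (Suc (k + 1)) g) + (\<Sum>k<1. ennreal (\<theta> ^ Suc k) * cylvar (Suc k) g)"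
        unfolding var_eq by (rule suminf_offset) simp
      then show ?thesis by simp
    qed
    finally show ?thesis by (simp add: mult_left_mono add_right_mono)
  qed
  then show ?thesis using K by blast
qed

text \<open>Different points of a fibre of \<open>f ^^ n\<close> lie in different
  \<open>n\<close>-cylinders, so a sum over the fibre is at most a sum over all cylinders. The bound
  on \<open>g\<close> may vary from cylinder to cylinder.\<close>

lemma Tpow_AE_le:
  assumes b: "\<And>C. C \<in> cyl n \<Longrightarrow> 0 \<le> b C"
    and le: "AE y in \<nu>. \<forall>C\<in>cyl n. y \<in> C \<longrightarrow> cmod (g y) \<le> b C"
  shows "AE x in \<nu>. cmod ((T ^^ n) g x) \<le> (\<Sum>C\<in>cyl n. w n C * b C)"
  using AE_fibre_pow[OF AE_conjI[OF le AE_cyl], of n]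
proof eventually_elim
  case (elim x)
  have "\<exists>C. C \<in> cyl n \<and> y \<in> C" if "(f ^^ n) y = x" for y using elim that by blast
  then obtain Cy where Cy: "\<And>y. (f ^^ n) y = x \<Longrightarrow> Cy y \<in> cyl n \<and> y \<in> Cy y" by metis
  have inj: "inj_on Cy ((f ^^ n) -` {x})"
  proof (rule inj_onI)
    fix y y' assume y: "y \<in> (f ^^ n) -` {x}" "y' \<in> (f ^^ n) -` {x}" and e: "Cy y = Cy y'"
    have "y \<in> closure (Cy y)" "y' \<in> closure (Cy y)" using Cy y e closure_subset[of "Cy y"] by auto
    then show "y = y'" using inj_onD[OF inj_cyl[of "Cy y" n], of y y'] Cy y by auto
  qed
  have "cmod ((T ^^ n) g x) \<le> (\<Sum>y\<in>(f ^^ n) -` {x}. exp (S n y) * cmod (g y))"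
    unfolding Tpow_eq by (rule order_trans[OF norm_sum]) (simp add: norm_mult)
  also have "\<dots> \<le> (\<Sum>y\<in>(f ^^ n) -` {x}. w n (Cy y) * b (Cy y))"
  proof (intro sum_mono mult_mono)
    fix y assume "y \<in> (f ^^ n) -` {x}"
    then have y: "(f ^^ n) y = x" "Cy y \<in> cyl n" "y \<in> Cy y" using Cy by auto
    show "exp (S n y) \<le> w n (Cy y)" by (rule w_ge[OF y(3)])
    show "cmod (g y) \<le> b (Cy y)" using elim y by blast
  qed (auto simp: less_imp_le[OF w_pos])
  also have "\<dots> = (\<Sum>C\<in>Cy ` ((f ^^ n) -` {x}). w n C * b C)" by (simp add: sum.reindex[OF inj])
  also have "\<dots> \<le> (\<Sum>C\<in>cyl n. w n C * b C)"
    using Cy b less_imp_le[OF w_pos] by (intro sum_mono2 finite_cyl) auto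
  finally show ?case .
qed

lemma sn_Tpow:
  obtains K where "K > 0" "\<And>n g. g \<in> V \<Longrightarrow> sn ((T ^^ n) g) \<le> ennreal (K * lam ^ n) * sn g"
proof -
  obtain K where K: "K > 0" "\<And>n. (\<Sum>C\<in>cyl n. w n C) \<le> K * lam ^ n" using cyl_sum by blast
  have "sn ((T ^^ n) g) \<le> ennreal (K * lam ^ n) * sn g" if g: "g \<in> V" for n g
  proof -
    have [measurable]: "g \<in> borel_measurable borel" using g by (rule V_meas)
    define s where "s = enn2real (sn g)"
    have s: "sn g = ennreal s" "s \<ge> 0" using g by (auto simp: s_def V_iff)
    have "AE y in \<nu>. \<forall>C\<in>cyl n. y \<in> C \<longrightarrow> cmod (g y) \<le> s"
      using sn_AE[of g] by eventually_elim (simp add: s ennreal_le_iff)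
    from Tpow_AE_le[OF _ this] have "AE x in \<nu>. cmod ((T ^^ n) g x) \<le> (\<Sum>C\<in>cyl n. w n C * s)" using s(2) by simp
    then have "AE x in \<nu>. ennreal (cmod ((T ^^ n) g x)) \<le> ennreal (K * lam ^ n) * sn g"
    proof eventually_elim
      case (elim x)
      have "(\<Sum>C\<in>cyl n. w n C * s) \<le> K * lam ^ n * s"
        unfolding sum_distrib_right[symmetric] using K(2) s(2) by (rule mult_right_mono)
      then have "ennreal (cmod ((T ^^ n) g x)) \<le> ennreal (K * lam ^ n * s)" using elim by (intro ennreal_leI) simp
      then show ?case using s(2) by (simp add: s(1) ennreal_mult'')
    qed
    then show ?thesis by (intro sn_le) measurable
  qed
  then show ?thesis using that K(1) by blast
qed

lemma cyl_oscillation: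
  assumes g: "g \<in> V" and n: "n \<ge> 1"
  shows "(\<Sum>C\<in>cyl n. w n C * enn2real (eo g C)) \<le> Nm g / \<theta> ^ n" "\<And>C. C \<in> cyl n \<Longrightarrow> eo g C < \<top>"
proof -
  have "ennreal (\<theta> ^ n) * cylvar n g \<le> var g"
  proof -
    obtain k where k: "n = Suc k" using n by (cases n) auto
    have "(\<Sum>j\<in>{k}. ennreal (\<theta> ^ Suc j) * cylvar (Suc j) g) \<le> var g"
      unfolding var_eq by (rule sum_le_suminf) auto
    then show ?thesis by (simp add: k)
  qed
  also have "\<dots> \<le> ennreal (Nm g)" by (rule var_le_Nm[OF g])
  finally have le: "ennreal (\<theta> ^ n) * cylvar n g \<le> ennreal (Nm g)" .
  then have "ennreal (\<theta> ^ n) * cylvar n g < \<top>" by (rule order_le_less_trans) simp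
  then have fin: "cylvar n g < \<top>" using theta(1) by (auto simp: ennreal_mult_less_top)
  show eo_fin: "eo g C < \<top>" if C: "C \<in> cyl n" for C
  proof -
    have "ennreal (w n C) * eo g C \<le> cylvar n g"
      unfolding cylvar_def using C finite_cyl by (intro member_le_sum) auto
    then have "ennreal (w n C) * eo g C < \<top>" using fin by (rule order_le_less_trans)
    then show ?thesis using w_pos[of n C] by (auto simp: ennreal_mult_less_top)
  qed
  have "cylvar n g = ennreal (\<Sum>C\<in>cyl n. w n C * enn2real (eo g C))"
    unfolding cylvar_def using eo_fin less_imp_le[OF w_pos]
    by (subst sum_ennreal[symmetric]) (auto intro!: sum.cong simp: ennreal_mult')
  then have "ennreal (\<theta> ^ n * (\<Sum>C\<in>cyl n. w n C * enn2real (eo g C))) \<le> ennreal (Nm g)"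
    using le theta(1) by (simp add: ennreal_mult')
  then have "\<theta> ^ n * (\<Sum>C\<in>cyl n. w n C * enn2real (eo g C)) \<le> Nm g"
    by (simp add: ennreal_le_iff Nm_nonneg)
  then show "(\<Sum>C\<in>cyl n. w n C * enn2real (eo g C)) \<le> Nm g / \<theta> ^ n" using theta(1) by (simp add: field_simps)
qed

text \<open>On a cylinder \<open>g\<close> is bounded by its mean there plus its oscillation, and
  the weighted oscillations of order \<open>n\<close> form one term of the variation, whence
  \<open>Nm g / \<theta> ^ n\<close>. The constant \<open>K\<close> depends on \<open>n\<close>
  through the weights and measures of the cylinders; that is harmless once \<open>n\<close> is
  fixed.\<close>

lemma sn_Tpow_L1:
  assumes n: "n \<ge> 1"
  obtains K where "K \<ge> 0" "\<And>g. g \<in> V \<Longrightarrow> sn ((T ^^ n) g) \<le> ennreal (Nm g / \<theta> ^ n + K * (\<integral>x. cmod (g x) \<partial>\<nu>))"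
proof -
  define K where "K = (\<Sum>C\<in>cyl n. w n C / measure \<nu> C)"
  have K: "K \<ge> 0" unfolding K_def by (intro sum_nonneg divide_nonneg_nonneg less_imp_le[OF w_pos]) auto
  have "sn ((T ^^ n) g) \<le> ennreal (Nm g / \<theta> ^ n + K * (\<integral>x. cmod (g x) \<partial>\<nu>))" if g: "g \<in> V" for g
  proof -
    have [measurable]: "g \<in> borel_measurable borel" using g by (rule V_meas)
    define I where "I = (\<integral>x. cmod (g x) \<partial>\<nu>)"
    have I0: "I \<ge> 0" unfolding I_def by simp
    have int: "integrable \<nu> (\<lambda>x. cmod (g x))" using V_integrable[OF g] by auto
    obtain Z where Z: "Z \<in> null_sets \<nu>"
      "\<And>n C x y. C \<in> cyl n \<Longrightarrow> x \<in> C - Z \<Longrightarrow> y \<in> C - Z \<Longrightarrow> ennreal (cmod (g x - g y)) \<le> eo g C"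
      by (rule good_null[OF V_meas[OF g]]) blast
    have pt: "cmod (g y) \<le> I / measure \<nu> C + enn2real (eo g C)" if C: "C \<in> cyl n" and y: "y \<in> C - Z" for C y
    proof -
      have [measurable]: "C \<in> sets borel" using cyl_meas[OF C] .
      have pos: "measure \<nu> C > 0" by (rule cyl_measure_pos[OF C])
      have "measure \<nu> C * cmod (g y) = (\<integral>x. indicator C x * cmod (g y) \<partial>\<nu>)"
        by (simp add: nu_sets)
      also have "\<dots> \<le> (\<integral>x. cmod (g x) + indicator C x * enn2real (eo g C) \<partial>\<nu>)"
      proof (rule integral_mono_AE)
        show "AE x in \<nu>. indicator C x * cmod (g y) \<le> cmod (g x) + indicator C x * enn2real (eo g C)"
          using null_setsD[OF Z(1)]
        proof eventually_elim
          case (elim x)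
          show ?case
          proof (cases "x \<in> C")
            case True
            have "ennreal (cmod (g y - g x)) \<le> eo g C" using Z(2)[OF C y] True elim by blast
            then have "cmod (g y - g x) \<le> enn2real (eo g C)"
              using cyl_oscillation(2)[OF g n C] by (metis enn2real_ennreal enn2real_mono norm_ge_zero)
            then show ?thesis using True norm_triangle_ineq2[of "g y" "g x"] by simp
          qed simp
        qed
      qed (use int in \<open>auto intro!: integrable_real_mult_indicator simp: nu_sets emeasure_eq_measure\<close>)
      also have "\<dots> = I + measure \<nu> C * enn2real (eo g C)"
        using int by (subst Bochner_Integration.integral_add) (auto simp: I_def nu_sets emeasure_eq_measure)
      finally show ?thesis using pos by (simp add: field_simps)
    qed
    have "AE y in \<nu>. \<forall>C\<in>cyl n. y \<in> C \<longrightarrow> cmod (g y) \<le> I / measure \<nu> C + enn2real (eo g C)"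
      using null_setsD[OF Z(1)] by eventually_elim (use pt in auto)
    from Tpow_AE_le[OF _ this]
    have "AE x in \<nu>. cmod ((T ^^ n) g x) \<le> (\<Sum>C\<in>cyl n. w n C * (I / measure \<nu> C + enn2real (eo g C)))"
      using I0 by (simp add: divide_nonneg_nonneg)
    moreover have "(\<Sum>C\<in>cyl n. w n C * (I / measure \<nu> C + enn2real (eo g C))) \<le> Nm g / \<theta> ^ n + K * I"
    proof -
      have "(\<Sum>C\<in>cyl n. w n C * (I / measure \<nu> C + enn2real (eo g C))) = K * I + (\<Sum>C\<in>cyl n. w n C * enn2real (eo g C))"
        unfolding K_def by (simp add: distrib_left sum.distrib sum_distrib_right)
      then show ?thesis using cyl_oscillation(1)[OF g n] by simp
    qed
    ultimately have "AE x in \<nu>. ennreal (cmod ((T ^^ n) g x)) \<le> ennreal (Nm g / \<theta> ^ n + K * I)"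
      by (auto elim!: eventually_mono intro!: ennreal_leI)
    then show ?thesis unfolding I_def by (intro sn_le) measurable
  qed
  then show ?thesis using that K by blast
qed

end

section \<open>Exponential decay\<close>

text \<open>The norm \<open>Nf + A * Lf\<close> is contracted for large \<open>A\<close>: either \<open>Nf\<close> dominates and decreases, or \<open>Lf\<close> decreases.\<close>

lemma two_norm_decay:
  fixes Nf Lf :: "'b \<Rightarrow> real" and M :: "'b \<Rightarrow> 'b"
  assumes M: "\<And>g. g \<in> X \<Longrightarrow> M g \<in> X"
    and Lf: "\<And>g. g \<in> X \<Longrightarrow> 0 \<le> Lf g" "\<And>g. g \<in> X \<Longrightarrow> Lf g \<le> Nf g"
    and LY: "\<And>g. g \<in> X \<Longrightarrow> Nf (M g) \<le> 1/2 * Nf g + K * Lf g" and K: "K > 0"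
    and L_M: "\<And>g. g \<in> X \<Longrightarrow> Lf (M g) \<le> Lf g"
    and drop: "\<And>b. b > 0 \<Longrightarrow> \<exists>j\<ge>1. \<exists>\<epsilon>>0. \<epsilon> \<le> 1 \<and> (\<forall>g\<in>X. Nf g \<le> b * Lf g \<longrightarrow> Lf ((M ^^ j) g) \<le> (1 - \<epsilon>) * Lf g)"
  shows "\<exists>j\<ge>1. \<exists>C r. 0 < C \<and> 0 < r \<and> r < 1 \<and> (\<forall>g\<in>X. \<forall>n. Nf ((M ^^ (j * n)) g) \<le> C * r ^ n * Nf g)"
proof -
  have Mpow: "(M ^^ n) g \<in> X" if "g \<in> X" for n g using that by (induction n) (auto intro: M)
  have L_Mpow: "Lf ((M ^^ n) g) \<le> Lf g" if "g \<in> X" for n g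
    using that by (induction n) (auto intro: order_trans[OF L_M[OF Mpow]])
  have LYpow: "Nf ((M ^^ Suc n) g) \<le> 1/2 * Nf g + 2 * K * Lf g" if g: "g \<in> X" for n g
  proof (induction n)
    case 0
    have "K * Lf g \<le> (2 * K) * Lf g" using K Lf(1)[OF g] by (intro mult_right_mono) auto
    then show ?case using LY[OF g] by simp
  next
    case (Suc n)
    have "Nf ((M ^^ Suc (Suc n)) g) \<le> 1/2 * Nf ((M ^^ Suc n) g) + K * Lf ((M ^^ Suc n) g)"
      using LY[OF Mpow[OF g, of "Suc n"]] by simp
    also have "\<dots> \<le> 1/2 * (1/2 * Nf g + 2 * K * Lf g) + K * Lf g"
      using Suc L_Mpow[OF g, of "Suc n"] K by (intro add_mono mult_left_mono) auto
    also have "\<dots> \<le> 1/2 * Nf g + 2 * K * Lf g" using Lf[OF g] by simp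
    finally show ?case .
  qed
  \<comment> \<open>If \<open>Nf g\<close> exceeds \<open>b * Lf g\<close>, this value makes
    \<open>2 * K * Lf g\<close> at most a quarter of \<open>Nf g\<close>.\<close>
  define b where "b = 8 * K"
  obtain j \<epsilon> where j: "j \<ge> 1" and \<epsilon>: "\<epsilon> > 0" "\<epsilon> \<le> 1"
    and dr: "\<And>g. g \<in> X \<Longrightarrow> Nf g \<le> b * Lf g \<Longrightarrow> Lf ((M ^^ j) g) \<le> (1 - \<epsilon>) * Lf g"
    using drop[of b] K by (auto simp: b_def)
  \<comment> \<open>Then \<open>A * \<epsilon> = 4 * K\<close>: half of the drop in
    \<open>A * Lf\<close> pays for \<open>2 * K * Lf\<close>, and the other half is the
    gain.\<close>
  define A where "A = 4 * K / \<epsilon>"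
  have A: "A > 0" "A * \<epsilon> = 4 * K" using K \<epsilon> by (auto simp: A_def)
  define star where "star g = Nf g + A * Lf g" for g
  \<comment> \<open>The first rate belongs to the case of a dominating \<open>Lf\<close>, the second
    to that of a dominating \<open>Nf\<close>.\<close>
  define r where "r = max (1 - \<epsilon> / 2) (1 - 1 / (4 * (1 + A / b)))"
  have b0: "b > 0" using K by (simp add: b_def)
  have AB: "A / b > 0" using A b0 by simp
  have "1 - \<epsilon> / 2 \<le> r" by (simp add: r_def)
  then have "1/2 \<le> r" using \<epsilon> by simp
  moreover have "r < 1" using \<epsilon> AB by (auto simp: r_def)
  ultimately have r: "0 < r" "r < 1" "1/2 \<le> r" by auto
  obtain j' where j': "j = Suc j'" using j by (cases j) auto
  have step: "star ((M ^^ j) g) \<le> r * star g" if g: "g \<in> X" for g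
  proof -
    have N1: "Nf ((M ^^ j) g) \<le> 1/2 * Nf g + 2 * K * Lf g" using LYpow[OF g, of j'] by (simp add: j')
    show ?thesis
    proof (cases "Nf g \<le> b * Lf g")
      case True
      have "A * Lf ((M ^^ j) g) \<le> A * ((1 - \<epsilon>) * Lf g)" using dr[OF g True] A by (intro mult_left_mono) auto
      then have "star ((M ^^ j) g) \<le> 1/2 * Nf g + (2 * K + A - A * \<epsilon>) * Lf g"
        unfolding star_def using N1 by (simp add: algebra_simps)
      also have "2 * K + A - A * \<epsilon> = (1 - \<epsilon> / 2) * A" using A(2) by (simp add: algebra_simps)
      also have "1/2 * Nf g + (1 - \<epsilon> / 2) * A * Lf g \<le> r * Nf g + r * A * Lf g"
        using r A Lf[OF g] by (intro add_mono mult_right_mono) (auto simp: r_def)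
      finally show ?thesis by (simp add: star_def algebra_simps)
    next
      case False
      then have L: "Lf g \<le> Nf g / b" using b0 by (simp add: field_simps)
      have N0: "Nf g \<ge> 0" using Lf[OF g] by simp
      have "2 * K * Lf g \<le> 1/4 * Nf g" using L b0 by (simp add: b_def field_simps)
      moreover have "A * Lf ((M ^^ j) g) \<le> A * Lf g" using L_Mpow[OF g] A by (intro mult_left_mono) auto
      ultimately have 1: "star ((M ^^ j) g) \<le> star g - 1/4 * Nf g" unfolding star_def using N1 by simp
      have "A * Lf g \<le> A * (Nf g / b)" using L A by (intro mult_left_mono) auto
      then have "star g \<le> (1 + A / b) * Nf g" by (simp add: star_def algebra_simps)
      then have "1 / (4 * (1 + A / b)) * star g \<le> 1 / (4 * (1 + A / b)) * ((1 + A / b) * Nf g)"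
        using AB by (intro mult_left_mono) auto
      also have "\<dots> = 1/4 * Nf g"
      proof -
        have "1 / (4 * s) * (s * y) = 1/4 * y" if "s > 0" for s y :: real using that by simp
        then show ?thesis using AB by (metis add_pos_pos zero_less_one)
      qed
      finally have "1 / (4 * (1 + A / b)) * star g \<le> 1/4 * Nf g" .
      moreover have "x \<le> (1 - t) * s" if "t * s \<le> 1/4 * y" "x \<le> s - 1/4 * y" for x y s t :: real
        using that by (simp add: algebra_simps)
      ultimately have "star ((M ^^ j) g) \<le> (1 - 1 / (4 * (1 + A / b))) * star g" using 1 by blast
      also have "\<dots> \<le> r * star g"
        unfolding star_def using N0 Lf[OF g] A by (intro mult_right_mono) (auto simp: r_def)
      finally show ?thesis .
    qed
  qed
  have pow: "star ((M ^^ (j * n)) g) \<le> r ^ n * star g" if g: "g \<in> X" for g n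
  proof (induction n)
    case (Suc n)
    have "(M ^^ (j * Suc n)) g = (M ^^ j) ((M ^^ (j * n)) g)" by (simp add: funpow_add)
    then have "star ((M ^^ (j * Suc n)) g) \<le> r * star ((M ^^ (j * n)) g)" using step[OF Mpow[OF g]] by simp
    also have "\<dots> \<le> r * (r ^ n * star g)" using Suc r by (intro mult_left_mono) auto
    finally show ?case by (simp add: mult.assoc)
  qed simp
  have "Nf ((M ^^ (j * n)) g) \<le> (1 + A) * r ^ n * Nf g" if g: "g \<in> X" for g n
  proof -
    have "Nf ((M ^^ (j * n)) g) \<le> star ((M ^^ (j * n)) g)"
      unfolding star_def using Lf(1)[OF Mpow[OF g]] A by simp
    also have "\<dots> \<le> r ^ n * star g" by (rule pow[OF g])
    also have "\<dots> \<le> r ^ n * ((1 + A) * Nf g)"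
      unfolding star_def using Lf[OF g] A r by (intro mult_left_mono) (auto simp: algebra_simps)
    finally show ?thesis by (simp add: mult_ac)
  qed
  then show ?thesis using j r A by (intro exI[of _ j] conjI exI[of _ "1 + A"] exI[of _ r]) auto
qed

section \<open>The Lasota-Yorke inequality\<close>

context theta_system
begin

abbreviation cplx :: "('a \<Rightarrow> real) \<Rightarrow> 'a \<Rightarrow> complex" where
  "cplx u \<equiv> (\<lambda>x. complex_of_real (u x))"

definition vr :: "('a \<Rightarrow> complex) \<Rightarrow> real" where "vr g = enn2real (var g)"
definition sr :: "('a \<Rightarrow> complex) \<Rightarrow> real" where "sr g = enn2real (sn g)"
definition L1 :: "('a \<Rightarrow> complex) \<Rightarrow> real" where "L1 g = (\<integral>x. cmod (g x) \<partial>\<nu>)"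

lemma vr: "g \<in> V \<Longrightarrow> var g = ennreal (vr g)" "vr g \<ge> 0"
  and sr: "g \<in> V \<Longrightarrow> sn g = ennreal (sr g)" "sr g \<ge> 0"
  by (auto simp: vr_def sr_def V_iff)

lemma Nm_vr_sr: "g \<in> V \<Longrightarrow> Nm g = sr g + vr g"
  using Nm_eq[of g] vr sr by (metis add_nonneg_nonneg ennreal_inj ennreal_plus Nm_nonneg)

lemma L1_nonneg: "L1 g \<ge> 0"
  unfolding L1_def by simp

lemma T_V:
  assumes g: "g \<in> V"
  shows "T g \<in> V"
proof -
  note [measurable] = V_meas[OF g]
  obtain K where K: "\<forall>g\<in>borel_measurable borel. var (T g) \<le> ennreal (exp osc / \<theta>) * var g + ennreal K * sn g"
    using var_T by blast
  have "var (T g) \<le> ennreal (exp osc / \<theta>) * var g + ennreal K * sn g" using K V_meas[OF g] by blast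
  also have "\<dots> < \<top>" using g by (simp add: V_iff ennreal_mult_less_top)
  finally have 1: "var (T g) < \<top>" .
  obtain K' where K': "\<And>n g. g \<in> V \<Longrightarrow> sn ((T ^^ n) g) \<le> ennreal (K' * lam ^ n) * sn g"
    using sn_Tpow by blast
  have "sn (T g) \<le> ennreal (K' * lam ^ 1) * sn g" using K'[OF g, of 1] by simp
  also have "\<dots> < \<top>" using g by (simp add: V_iff ennreal_mult_less_top)
  finally show ?thesis using 1 by (simp add: V_iff)
qed

lemma vr_T: "\<exists>K\<ge>0. \<forall>g\<in>V. vr (T g) \<le> exp osc / \<theta> * vr g + K * sr g"
proof -
  obtain K where K: "K \<ge> 0" "\<forall>g\<in>borel_measurable borel. var (T g) \<le> ennreal (exp osc / \<theta>) * var g + ennreal K * sn g"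
    using var_T by blast
  have "vr (T g) \<le> exp osc / \<theta> * vr g + K * sr g" if g: "g \<in> V" for g
  proof -
    have "ennreal (vr (T g)) \<le> ennreal (exp osc / \<theta>) * ennreal (vr g) + ennreal K * ennreal (sr g)"
      using K(2) V_meas[OF g] vr(1)[OF g] vr(1)[OF T_V[OF g]] sr(1)[OF g] by metis
    also have "\<dots> = ennreal (exp osc / \<theta> * vr g + K * sr g)"
      using K(1) vr(2)[of g] sr(2)[of g] theta(1)
      by (simp only: ennreal_plus ennreal_mult mult_nonneg_nonneg divide_nonneg_pos exp_ge_zero)
    finally show ?thesis
      by (subst (asm) ennreal_le_iff) (use K(1) vr(2)[of g] sr(2)[of g] theta(1) in auto)
  qed
  then show ?thesis using K(1) by blast
qed

lemma Tpow_V': "g \<in> V \<Longrightarrow> (T ^^ n) g \<in> V"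
  by (induction n) (auto intro: T_V)

lemma sr_Tpow: "\<exists>K>0. \<forall>g\<in>V. \<forall>n. sr ((T ^^ n) g) \<le> K * lam ^ n * sr g"
proof -
  obtain K where K: "K > 0" "\<And>n g. g \<in> V \<Longrightarrow> sn ((T ^^ n) g) \<le> ennreal (K * lam ^ n) * sn g"
    using sn_Tpow by blast
  have "sr ((T ^^ n) g) \<le> K * lam ^ n * sr g" if g: "g \<in> V" for g n
  proof -
    have "ennreal (sr ((T ^^ n) g)) \<le> ennreal (K * lam ^ n * sr g)"
      using K(2)[OF g, of n] sr(1)[OF Tpow_V'[OF g, of n]] sr(1)[OF g] K(1) lam_pos sr(2)[of g]
      by (simp add: ennreal_mult')
    then show ?thesis using K(1) lam_pos sr(2)[of g] by (simp add: ennreal_le_iff)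
  qed
  then show ?thesis using K(1) by blast
qed

lemma sr_Tpow_L1:
  assumes "n \<ge> 1"
  shows "\<exists>K\<ge>0. \<forall>g\<in>V. sr ((T ^^ n) g) \<le> Nm g / \<theta> ^ n + K * L1 g"
proof -
  obtain K where K: "K \<ge> 0" "\<And>g. g \<in> V \<Longrightarrow> sn ((T ^^ n) g) \<le> ennreal (Nm g / \<theta> ^ n + K * (\<integral>x. cmod (g x) \<partial>\<nu>))"
    using sn_Tpow_L1[OF assms] by blast
  have "sr ((T ^^ n) g) \<le> Nm g / \<theta> ^ n + K * L1 g" if g: "g \<in> V" for g
  proof -
    have "ennreal (sr ((T ^^ n) g)) \<le> ennreal (Nm g / \<theta> ^ n + K * L1 g)"
      using K(2)[OF g] sr(1)[OF Tpow_V'[OF g, of n]] by (simp add: L1_def)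
    moreover have "Nm g / \<theta> ^ n + K * L1 g \<ge> 0" using K(1) L1_nonneg[of g] Nm_nonneg[of g] theta(1) by simp
    ultimately show ?thesis by (simp add: ennreal_le_iff)
  qed
  then show ?thesis using K(1) by blast
qed

lemma vr_Tpow: "\<exists>K\<ge>0. \<forall>g\<in>V. \<forall>n. vr ((T ^^ n) g) \<le> (exp osc / \<theta>) ^ n * vr g + K * lam ^ n * sr g"
proof -
  obtain K1 where K1: "K1 \<ge> 0" "\<forall>g\<in>V. vr (T g) \<le> exp osc / \<theta> * vr g + K1 * sr g" using vr_T by blast
  obtain K2 where K2: "K2 > 0" "\<forall>g\<in>V. \<forall>n. sr ((T ^^ n) g) \<le> K2 * lam ^ n * sr g" using sr_Tpow by blast
  define e where "e = exp osc / \<theta>"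
  have e: "0 < e" "e < lam" using theta by (auto simp: e_def field_simps)
  \<comment> \<open>The fixed point of the recursion, \<open>e * K + K1 * K2 = lam * K\<close>; it
    is positive enough to start the induction because \<open>e < lam\<close>.\<close>
  define K where "K = K1 * K2 / (lam - e)"
  have K: "K \<ge> 0" "e * K + K1 * K2 = lam * K" using K1 K2 e by (auto simp: K_def field_simps)
  have "vr ((T ^^ n) g) \<le> e ^ n * vr g + K * lam ^ n * sr g" if g: "g \<in> V" for g n
  proof (induction n)
    case 0
    then show ?case using K(1) sr(2)[of g] by simp
  next
    case (Suc n)
    have "vr ((T ^^ Suc n) g) \<le> e * vr ((T ^^ n) g) + K1 * sr ((T ^^ n) g)"
      using K1(2) Tpow_V'[OF g, of n] by (simp add: e_def)
    also have "\<dots> \<le> e * (e ^ n * vr g + K * lam ^ n * sr g) + K1 * (K2 * lam ^ n * sr g)"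
      using Suc K1(1) K2(2) g e by (intro add_mono mult_left_mono) auto
    also have "\<dots> = e ^ Suc n * vr g + (e * K + K1 * K2) * lam ^ n * sr g" by (simp add: algebra_simps)
    also have "\<dots> = e ^ Suc n * vr g + K * lam ^ Suc n * sr g" unfolding K(2) by (simp add: mult_ac)
    finally show ?case .
  qed
  then show ?thesis unfolding e_def using K(1) by blast
qed

lemma Nm_Tpow: "\<exists>K>0. \<forall>g\<in>V. \<forall>n. Nm ((T ^^ n) g) \<le> K * lam ^ n * Nm g"
proof -
  obtain K1 where K1: "K1 \<ge> 0" "\<forall>g\<in>V. \<forall>n. vr ((T ^^ n) g) \<le> (exp osc / \<theta>) ^ n * vr g + K1 * lam ^ n * sr g" using vr_Tpow by blast
  obtain K2 where K2: "K2 > 0" "\<forall>g\<in>V. \<forall>n. sr ((T ^^ n) g) \<le> K2 * lam ^ n * sr g" using sr_Tpow by blast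
  have e: "0 < exp osc / \<theta>" "exp osc / \<theta> \<le> lam" using theta by (auto simp: field_simps)
  have "Nm ((T ^^ n) g) \<le> (1 + K1 + K2) * lam ^ n * Nm g" if g: "g \<in> V" for g n
  proof -
    have "Nm ((T ^^ n) g) = sr ((T ^^ n) g) + vr ((T ^^ n) g)" by (rule Nm_vr_sr[OF Tpow_V'[OF g]])
    also have "\<dots> \<le> K2 * lam ^ n * sr g + ((exp osc / \<theta>) ^ n * vr g + K1 * lam ^ n * sr g)"
      using K1(2) K2(2) g by (intro add_mono) auto
    also have "\<dots> \<le> K2 * lam ^ n * sr g + (lam ^ n * vr g + K1 * lam ^ n * sr g)"
      using e vr(2)[of g] by (intro add_mono mult_right_mono power_mono order_refl) auto
    also have "\<dots> \<le> (1 + K1 + K2) * lam ^ n * (sr g + vr g)"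
      using K1(1) K2(1) lam_pos vr(2)[of g] sr(2)[of g] by (simp add: algebra_simps)
    finally show ?thesis by (simp add: Nm_vr_sr[OF g])
  qed
  then show ?thesis using K1(1) K2(1) by (intro exI[of _ "1 + K1 + K2"]) auto
qed

sublocale linear_operator V Nm T
proof
  show "T g \<in> V" if "g \<in> V" for g using T_V that .
  show "T (\<lambda>x. a * g x + b * h x) = (\<lambda>x. a * T g x + b * T h x)" for g h a b by (rule T_linear)
  obtain K where "\<forall>g\<in>V. \<forall>n. Nm ((T ^^ n) g) \<le> K * lam ^ n * Nm g" using Nm_Tpow by blast
  then have "\<forall>g\<in>V. Nm ((T ^^ 1) g) \<le> K * lam ^ 1 * Nm g" by blast
  then show "\<exists>K. \<forall>g\<in>V. Nm (T g) \<le> K * Nm g" by auto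
qed

text \<open>A block of \<open>n\<close> steps contracts the variation but brings back the sup norm
  with a constant that need not be small. A preceding block of \<open>n\<close> steps makes the sup
  norm small up to a multiple of the weak norm, so two blocks are composed.\<close>

lemma Lasota_Yorke: "\<exists>m\<ge>1. \<exists>K>0. \<forall>g\<in>V. Nm ((T ^^ m) g) / lam ^ m \<le> 1/2 * Nm g + K * L1 g"
proof -
  obtain K1 where K1: "K1 \<ge> 0" "\<forall>g\<in>V. \<forall>n. vr ((T ^^ n) g) \<le> (exp osc / \<theta>) ^ n * vr g + K1 * lam ^ n * sr g" using vr_Tpow by blast
  obtain K2 where K2: "K2 > 0" "\<forall>g\<in>V. \<forall>n. sr ((T ^^ n) g) \<le> K2 * lam ^ n * sr g" using sr_Tpow by blast
  \<comment> \<open>Rates relative to \<open>lam\<close>: \<open>k1\<close> is that of the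
    variation, and \<open>k2\<close> that of the factor \<open>1 / \<theta> ^ n\<close> in the
    estimate of the sup norm.\<close>
  define k1 where "k1 = exp osc / (\<theta> * lam)"
  define k2 where "k2 = 1 / (\<theta> * lam)"
  have tl: "\<theta> * lam > 1" using theta(2) osc_nonneg by (meson order_le_less_trans one_le_exp_iff)
  have k: "0 < k1" "k1 < 1" "0 < k2" "k2 < 1" using theta tl by (auto simp: k1_def k2_def)
  have "(\<lambda>n. k1 ^ n * (1 + K1) + (K1 + K2) * k2 ^ n) \<longlonglongrightarrow> 0 * (1 + K1) + (K1 + K2) * 0"
    by (intro tendsto_intros LIMSEQ_power_zero) (use k in auto)
  then have "\<forall>\<^sub>F n in sequentially. k1 ^ n * (1 + K1) + (K1 + K2) * k2 ^ n < 1/2"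
    by (rule order_tendstoD) simp
  then obtain n where n: "n \<ge> 1" "k1 ^ n * (1 + K1) + (K1 + K2) * k2 ^ n < 1/2"
    by (auto simp: eventually_sequentially) (metis linorder_linear)
  obtain K3 where K3: "K3 \<ge> 0" "\<forall>g\<in>V. sr ((T ^^ n) g) \<le> Nm g / \<theta> ^ n + K3 * L1 g" using sr_Tpow_L1[OF n(1)] by blast
  define K where "K = (K1 + K2) * K3 / lam ^ n + 1"
  have K: "K > 0" unfolding K_def using K1 K2 K3 lam_pos by (intro add_nonneg_pos) auto
  have "Nm ((T ^^ (n + n)) g) / lam ^ (n + n) \<le> 1/2 * Nm g + K * L1 g" if g: "g \<in> V" for g
  proof -
    define u where "u = (T ^^ n) g"
    have u: "u \<in> V" unfolding u_def by (rule Tpow_V'[OF g])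
    have eq: "(T ^^ (n + n)) g = (T ^^ n) u" by (simp add: u_def funpow_add)
    have pw: "(exp osc / \<theta>) ^ n = k1 ^ n * lam ^ n"
      unfolding power_mult_distrib[symmetric] k1_def using lam_pos by simp
    have pw2: "1 / \<theta> ^ n = k2 ^ n * lam ^ n"
      unfolding power_mult_distrib[symmetric] k2_def using lam_pos by (simp add: power_divide)
    have a: "vr ((T ^^ n) u) \<le> k1 ^ n * lam ^ n * vr u + K1 * lam ^ n * sr u"
      using K1(2) u by (metis pw)
    have b: "vr u \<le> k1 ^ n * lam ^ n * vr g + K1 * lam ^ n * sr g"
      using K1(2) g unfolding u_def by (metis pw)
    have c: "sr ((T ^^ n) u) \<le> K2 * lam ^ n * sr u" using K2(2) u by blast
    have d: "sr u \<le> k2 ^ n * lam ^ n * Nm g + K3 * L1 g"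
      using K3(2) g unfolding u_def by (simp flip: pw2)
    have b': "vr u \<le> lam ^ n * (1 + K1) * Nm g"
    proof -
      have "k1 ^ n * lam ^ n * vr g \<le> 1 * lam ^ n * vr g"
        using k lam_pos vr(2)[of g] by (intro mult_right_mono) (auto simp: power_le_one)
      then have "vr u \<le> lam ^ n * vr g + K1 * lam ^ n * sr g" using b by simp
      also have "\<dots> \<le> lam ^ n * (1 + K1) * (sr g + vr g)"
        using K1(1) lam_pos vr(2)[of g] sr(2)[of g] by (simp add: algebra_simps)
      finally show ?thesis by (simp add: Nm_vr_sr[OF g])
    qed
    have "Nm ((T ^^ n) u) = sr ((T ^^ n) u) + vr ((T ^^ n) u)" by (rule Nm_vr_sr[OF Tpow_V'[OF u]])
    also have "\<dots> \<le> k1 ^ n * lam ^ n * vr u + (K1 + K2) * lam ^ n * sr u" using a c by (simp add: algebra_simps)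
    also have "\<dots> \<le> k1 ^ n * lam ^ n * (lam ^ n * (1 + K1) * Nm g) + (K1 + K2) * lam ^ n * (k2 ^ n * lam ^ n * Nm g + K3 * L1 g)"
      using k lam_pos K1(1) K2(1) by (intro add_mono mult_left_mono b' d) auto
    also have "\<dots> = lam ^ (n + n) * ((k1 ^ n * (1 + K1) + (K1 + K2) * k2 ^ n) * Nm g + (K1 + K2) * K3 / lam ^ n * L1 g)"
      using lam_pos by (simp add: power_add field_simps)
    also have "\<dots> \<le> lam ^ (n + n) * (1/2 * Nm g + K * L1 g)"
      using lam_pos n(2) Nm_nonneg[of g] L1_nonneg[of g] unfolding K_def
      by (intro mult_left_mono add_mono mult_right_mono) auto
    finally show ?thesis unfolding eq using lam_pos by (simp add: field_simps)
  qed
  then show ?thesis using n(1) K by (intro exI[of _ "n + n"]) auto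
qed

section \<open>The normalised operator on functions of mean zero\<close>

definition U :: "('a \<Rightarrow> complex) \<Rightarrow> 'a \<Rightarrow> complex" where
  "U g x = T g x / of_real lam"

lemma Upow_eq: "(U ^^ n) g = (\<lambda>x. (T ^^ n) g x / of_real (lam ^ n))"
proof (induction n)
  case (Suc n)
  have "(U ^^ Suc n) g = U (\<lambda>x. (T ^^ n) g x / of_real (lam ^ n))" by (simp add: Suc)
  also have "\<dots> = (\<lambda>x. (T ^^ Suc n) g x / of_real (lam ^ Suc n))"
    unfolding U_def transfer_op_def by (auto simp: sum_divide_distrib field_simps)
  finally show ?case .
qed simp

lemma Upow_V: "g \<in> V \<Longrightarrow> (U ^^ n) g \<in> V"
  unfolding Upow_eq using V_scale[OF Tpow_V', of g "1 / of_real (lam ^ n)" n] by simp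

lemma Nm_Upow: "g \<in> V \<Longrightarrow> Nm ((U ^^ n) g) = Nm ((T ^^ n) g) / lam ^ n"
  unfolding Upow_eq using N_scale[OF Tpow_V', of g "1 / of_real (lam ^ n)" n] lam_pos
  by (simp add: norm_divide norm_power)

lemma Nm_Upow_le: "\<exists>K>0. \<forall>g\<in>V. \<forall>n. Nm ((U ^^ n) g) \<le> K * Nm g"
proof -
  obtain K where K: "K > 0" "\<And>g n. g \<in> V \<Longrightarrow> Nm ((T ^^ n) g) \<le> K * lam ^ n * Nm g" using Nm_Tpow by blast
  have "Nm ((U ^^ n) g) \<le> K * Nm g" if "g \<in> V" for g n
    using K(2)[OF that, of n] lam_pos by (simp add: Nm_Upow[OF that] field_simps)
  then show ?thesis using K(1) by blast
qed

lemma Upow_lin: "(U ^^ n) (\<lambda>x. a * g x + b * h x) x = a * (U ^^ n) g x + b * (U ^^ n) h x"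
  unfolding Upow_eq Tpow_eq by (simp add: sum_divide_distrib sum_distrib_left distrib_left sum.distrib mult_ac add_divide_distrib)

lemma Upow_integral:
  assumes "integrable \<nu> g"
  shows "integrable \<nu> ((U ^^ n) g)" "(\<integral>x. (U ^^ n) g x \<partial>\<nu>) = (\<integral>x. g x \<partial>\<nu>)" "L1 ((U ^^ n) g) \<le> L1 g"
proof -
  have l: "lam ^ n > 0" using lam_pos by simp
  show "integrable \<nu> ((U ^^ n) g)" unfolding Upow_eq using Tpow_integral(1)[OF assms, of n] by simp
  show "(\<integral>x. (U ^^ n) g x \<partial>\<nu>) = (\<integral>x. g x \<partial>\<nu>)"
    unfolding Upow_eq using Tpow_integral(2)[OF assms, of n] lam_pos by simp
  have "L1 ((U ^^ n) g) = (\<integral>x. cmod ((T ^^ n) g x) \<partial>\<nu>) / lam ^ n"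
    unfolding Upow_eq L1_def using l lam_pos by (simp add: norm_divide norm_power)
  also have "\<dots> \<le> L1 g" using Tpow_integral(3)[OF assms, of n] l by (simp add: L1_def field_simps)
  finally show "L1 ((U ^^ n) g) \<le> L1 g" .
qed

lemma L1_le: "g \<in> V \<Longrightarrow> L1 g \<le> Nm g"
  unfolding L1_def by (rule L1_le_Nm)

text \<open>A nonnegative density of controlled variation is bounded below on some cylinder of a fixed order, and
  cylinders expand to the whole space.\<close>

lemma doeblin:
  assumes b: "b > 0"
  obtains n \<epsilon> where "\<epsilon> > 0" "\<And>u. cplx u \<in> V \<Longrightarrow> (\<And>x. 0 \<le> u x) \<Longrightarrow>
    Nm (cplx u) \<le> b * (\<integral>x. u x \<partial>\<nu>) \<Longrightarrow>
    AE x in \<nu>. \<epsilon> * (\<integral>x. u x \<partial>\<nu>) \<le> Re ((U ^^ n) (cplx u) x)"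
proof -
  have tl: "\<theta> * lam > 1" using theta(2) osc_nonneg by (meson order_le_less_trans one_le_exp_iff)
  \<comment> \<open>An order at which the oscillations, summed against the measure, use up at most
    half of the integral.\<close>
  obtain j where j: "(1 / (\<theta> * lam)) ^ j < 1 / (2 * b)"
    using real_arch_pow_inv[of "1 / (2 * b)" "1 / (\<theta> * lam)"] b tl by auto
  \<comment> \<open>The variation starts with cylinders of order 1, hence the successor; a cylinder
    of order \<open>j + 1\<close> fills the space after \<open>N + j\<close> steps.\<close>
  define k where "k = Suc j"
  have "(1 / (\<theta> * lam)) ^ k \<le> (1 / (\<theta> * lam)) ^ j"
    using tl by (intro power_decreasing) (auto simp: k_def)
  then have "b * (1 / (\<theta> * lam)) ^ k \<le> b * (1 / (2 * b))" using j b by (intro mult_left_mono) auto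
  then have kb: "b * (1 / (\<theta> * lam)) ^ k \<le> 1/2" using b by simp
  obtain M where M: "M \<ge> 0" "\<And>x. \<bar>\<phi> x\<bar> \<le> M" using phi_bounded by blast
  have m: "- M \<le> \<phi> x" for x using M(2)[of x] by linarith
  define n where "n = N + j"
  define q where "q = real (card (cyl k))"
  have "cyl k \<noteq> {}"
  proof -
    have "\<exists>x. x \<in> \<Union>(cyl k)"
      using AE_cyl by (metis (mono_tags, lifting) AE_E_prob ae_filter_eq_bot_iff emeasure_space_1 eventually_happens zero_neq_one)
    then show ?thesis by auto
  qed
  then have q: "q > 0" unfolding q_def using finite_cyl by (simp add: card_gt_0_iff)
  define \<epsilon> where "\<epsilon> = exp (real n * - M) / (2 * q * lam ^ n)"
  have \<epsilon>: "\<epsilon> > 0" unfolding \<epsilon>_def using q lam_pos by simp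
  have "AE x in \<nu>. \<epsilon> * (\<integral>x. u x \<partial>\<nu>) \<le> Re ((U ^^ n) (cplx u) x)"
    if g: "cplx u \<in> V" and u0: "\<And>x. 0 \<le> u x"
      and le: "Nm (cplx u) \<le> b * (\<integral>x. u x \<partial>\<nu>)" for u
  proof -
    define g where "g = cplx u"
    have gV: "g \<in> V" using g by (simp add: g_def)
    have int: "integrable \<nu> u" using V_integrable[OF g] by (simp add: complex_of_real_integrable_eq)
    define I where "I = (\<integral>x. u x \<partial>\<nu>)"
    have I0: "I \<ge> 0" unfolding I_def using u0 by simp
    obtain Z where Z: "Z \<in> null_sets \<nu>" "\<And>x n. x \<notin> Z \<Longrightarrow> x \<in> \<Union>(cyl n)"
      "\<And>n C x y. C \<in> cyl n \<Longrightarrow> x \<in> C - Z \<Longrightarrow> y \<in> C - Z \<Longrightarrow> ennreal (cmod (g x - g y)) \<le> eo g C"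
      by (rule good_null[OF V_meas[OF gV]]) blast
    define o1 where "o1 C = enn2real (eo g C)" for C
    have osc_u: "\<bar>u x - u y\<bar> \<le> o1 C" if C: "C \<in> cyl k" and xy: "x \<in> C - Z" "y \<in> C - Z" for C x y
    proof -
      have "ennreal (cmod (g x - g y)) \<le> eo g C" using Z(3)[OF C xy] .
      then have "cmod (g x - g y) \<le> o1 C"
        unfolding o1_def using cyl_oscillation(2)[OF gV _ C] by (metis enn2real_ennreal enn2real_mono norm_ge_zero k_def le_add1 plus_1_eq_Suc)
      then show ?thesis by (simp add: g_def flip: of_real_diff)
    qed
    have int_ind: "integrable \<nu> (\<lambda>x. indicator C x * u x)" if "C \<in> cyl k" for C
      using integrable_mult_indicator[OF _ int, of C] cyl_meas[OF that] by (simp add: nu_sets)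
    have "I = (\<integral>x. (\<Sum>C\<in>cyl k. indicator C x * u x) \<partial>\<nu>)"
      unfolding I_def
    proof (rule integral_cong_AE)
      show "AE x in \<nu>. u x = (\<Sum>C\<in>cyl k. indicator C x * u x)"
        using null_setsD[OF Z(1)]
      proof eventually_elim
        case (elim x)
        obtain C0 where C0: "C0 \<in> cyl k" "x \<in> C0" using Z(2)[OF elim] by blast
        have "(\<Sum>C\<in>cyl k. indicator C x * u x) = (\<Sum>C\<in>cyl k. if C = C0 then u x else 0)"
          using cyl_disjoint C0 by (intro sum.cong refl) (auto simp: indicator_def)
        then show ?case using C0(1) finite_cyl by simp
      qed
    qed (use int int_ind in \<open>auto intro!: borel_measurable_integrable\<close>)
    also have "\<dots> = (\<Sum>C\<in>cyl k. \<integral>x. indicator C x * u x \<partial>\<nu>)"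
      using int_ind by (rule Bochner_Integration.integral_sum)
    finally have I_sum: "I = (\<Sum>C\<in>cyl k. \<integral>x. indicator C x * u x \<partial>\<nu>)" .
    have "(\<Sum>C\<in>cyl k. measure \<nu> C * o1 C) \<le> (\<Sum>C\<in>cyl k. w k C * o1 C) / lam ^ k"
      unfolding sum_divide_distrib
    proof (intro sum_mono)
      fix C assume C: "C \<in> cyl k"
      have "measure \<nu> C \<le> measure \<nu> (closure C)" by (intro finite_measure_mono closure_subset) (simp add: nu_sets)
      then have "lam ^ k * measure \<nu> C \<le> w k C"
        using closure_measure_le[OF C] lam_pos by (meson mult_left_mono order_trans zero_le_power less_imp_le)
      then have "measure \<nu> C \<le> w k C / lam ^ k" using lam_pos by (simp add: field_simps)
      from mult_right_mono[OF this, of "o1 C"] show "measure \<nu> C * o1 C \<le> w k C * o1 C / lam ^ k" by (simp add: o1_def)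
    qed
    also have "\<dots> \<le> Nm g / \<theta> ^ k / lam ^ k"
      unfolding o1_def using lam_pos by (intro divide_right_mono cyl_oscillation(1)[OF gV]) (auto simp: k_def)
    also have "\<dots> = (1 / (\<theta> * lam)) ^ k * Nm g" by (simp add: power_divide power_mult_distrib)
    also have "\<dots> \<le> (1 / (\<theta> * lam)) ^ k * (b * I)"
      using le tl unfolding g_def I_def by (intro mult_left_mono) auto
    also have "\<dots> = (b * (1 / (\<theta> * lam)) ^ k) * I" by simp
    also have "\<dots> \<le> 1/2 * I" using kb I0 by (rule mult_right_mono)
    finally have o_sum: "(\<Sum>C\<in>cyl k. measure \<nu> C * o1 C) \<le> 1/2 * I" .
    \<comment> \<open>The mass of \<open>u\<close> on \<open>C\<close> minus what oscillation can
      account for. These numbers add up to at least half the integral, so some cylinder has at least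
      the average share.\<close>
    define mc where "mc C = (\<integral>x. indicator C x * u x \<partial>\<nu>) - measure \<nu> C * o1 C" for C
    have mc_sum: "(\<Sum>C\<in>cyl k. mc C) \<ge> 1/2 * I"
      unfolding mc_def sum_subtractf using I_sum o_sum by linarith
    obtain C where C: "C \<in> cyl k" "mc C \<ge> I / (2 * q)"
    proof (rule ccontr)
      assume "\<not> thesis"
      then have "\<And>C. C \<in> cyl k \<Longrightarrow> mc C < I / (2 * q)" using that by force
      then have "(\<Sum>C\<in>cyl k. mc C) < (\<Sum>C\<in>cyl k. I / (2 * q))"
        using finite_cyl \<open>cyl k \<noteq> {}\<close> by (intro sum_strict_mono) auto
      also have "\<dots> = 1/2 * I" using q by (simp add: q_def)
      finally show False using mc_sum by simp
    qed
    have C_meas: "C \<in> sets borel" using cyl_meas[OF C(1)] .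
    have low: "I / (2 * q) \<le> u y" if y: "y \<in> C - Z" for y
    proof -
      have "(\<integral>x. indicator C x * u x \<partial>\<nu>) \<le> (\<integral>x. indicator C x * (u y + o1 C) \<partial>\<nu>)"
      proof (rule integral_mono_AE)
        show "AE x in \<nu>. indicator C x * u x \<le> indicator C x * (u y + o1 C)"
          using null_setsD[OF Z(1)]
        proof eventually_elim
          case (elim x)
          show ?case
          proof (cases "x \<in> C")
            case True
            then have "\<bar>u x - u y\<bar> \<le> o1 C" using osc_u[OF C(1) _ y, of x] elim by blast
            then show ?thesis using True by (simp add: abs_le_iff)
          qed simp
        qed
      qed (use int_ind[OF C(1)] C_meas in \<open>auto intro!: integrable_mult_left integrable_real_indicator simp: nu_sets emeasure_eq_measure\<close>)
      also have "\<dots> = measure \<nu> C * (u y + o1 C)" using C_meas by (simp add: nu_sets)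
      finally have "mc C \<le> measure \<nu> C * u y" by (simp add: mc_def distrib_left)
      also have "\<dots> \<le> 1 * u y" using u0[of y] by (intro mult_right_mono) auto
      finally show ?thesis using C(2) by simp
    qed
    have img: "(f ^^ n) ` C = UNIV" using cyl_image_UNIV[of C j] C(1) by (simp add: n_def k_def)
    have "AE x in \<nu>. \<forall>y. (f ^^ n) y = x \<longrightarrow> y \<notin> Z" by (rule AE_fibre_pow[OF null_setsD[OF Z(1)]])
    then show ?thesis
    proof eventually_elim
      case (elim x)
      \<comment> \<open>One preimage in the favourable cylinder is enough, since all terms of the
        fibre sum are nonnegative.\<close>
      obtain y where y: "y \<in> C" "(f ^^ n) y = x" using img by (metis UNIV_I imageE)
      have "Re ((T ^^ n) g x) = (\<Sum>y\<in>(f ^^ n) -` {x}. exp (S n y) * u y)"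
        unfolding Tpow_eq g_def by simp
      also have "\<dots> \<ge> exp (S n y) * u y"
        using y(2) u0 finite_fibre_pow by (intro member_le_sum) auto
      finally have "exp (S n y) * u y \<le> Re ((T ^^ n) g x)" .
      moreover have "exp (real n * - M) * (I / (2 * q)) \<le> exp (S n y) * u y"
        using S_ge[OF m, of n y] low[of y] y elim I0 q by (intro mult_mono) auto
      ultimately have "exp (real n * - M) * (I / (2 * q)) \<le> Re ((T ^^ n) g x)" by linarith
      then have "exp (real n * - M) * (I / (2 * q)) / lam ^ n \<le> Re ((T ^^ n) g x) / lam ^ n"
        using lam_pos by (intro divide_right_mono) auto
      then show ?case
        unfolding Upow_eq by (simp add: g_def I_def \<epsilon>_def mult_ac flip: of_real_power)
    qed
  qed
  then show ?thesis using that \<epsilon> by blast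
qed

text \<open>Real functions, so that positive and negative parts can be separated; complex ones are
  treated through their real and imaginary parts in \<open>decay\<close>.\<close>

definition V0 :: "('a \<Rightarrow> complex) set" where
  "V0 = {g \<in> V. (\<forall>x. Im (g x) = 0) \<and> (\<integral>x. g x \<partial>\<nu>) = 0}"

text \<open>Positive and negative part have the same integral \<open>s\<close>, half the
  \<open>L1\<close> norm. Their images are both at least \<open>\<epsilon> * s\<close> almost
  everywhere, and this common part cancels in the difference. The lower bound is invoked with
  \<open>2 * b\<close> because norms are now compared with \<open>s\<close> instead of the
  \<open>L1\<close> norm.\<close>

lemma L1_contraction:
  assumes b: "b > 0"
  shows "\<exists>n \<epsilon>. 0 < \<epsilon> \<and> \<epsilon> \<le> 1 \<and> (\<forall>g\<in>V0. Nm g \<le> b * L1 g \<longrightarrow> L1 ((U ^^ n) g) \<le> (1 - \<epsilon>) * L1 g)"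
proof -
  obtain n \<epsilon> where \<epsilon>: "\<epsilon> > 0" and D: "\<And>u. cplx u \<in> V \<Longrightarrow> (\<And>x. 0 \<le> u x) \<Longrightarrow>
    Nm (cplx u) \<le> (2 * b) * (\<integral>x. u x \<partial>\<nu>) \<Longrightarrow>
    AE x in \<nu>. \<epsilon> * (\<integral>x. u x \<partial>\<nu>) \<le> Re ((U ^^ n) (cplx u) x)"
    by (rule doeblin[of "2 * b"]) (use b in simp, blast)
  have "L1 ((U ^^ n) g) \<le> (1 - \<epsilon>) * L1 g" if g: "g \<in> V0" and le: "Nm g \<le> b * L1 g" for g
  proof -
    have gV: "g \<in> V" and re: "\<And>x. Im (g x) = 0" and zero: "(\<integral>x. g x \<partial>\<nu>) = 0" using g by (auto simp: V0_def)
    note [measurable] = V_meas[OF gV]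
    define u where "u x = max 0 (Re (g x))" for x
    define v where "v x = max 0 (- Re (g x))" for x
    have uv: "u x \<ge> 0" "v x \<ge> 0" for x by (auto simp: u_def v_def)
    have g_uv: "g x = complex_of_real (u x) - complex_of_real (v x)" for x
      using re[of x] by (auto simp: u_def v_def complex_eq_iff max_def)
    have re_diff: "\<bar>Re (g x) - Re (g y)\<bar> \<le> cmod (g x - g y)" for x y using abs_Re_le_cmod[of "g x - g y"] by simp
    have uV: "cplx u \<in> V" "Nm (cplx u) \<le> Nm g"
    proof (atomize (full), intro conjI V_contraction[OF _ gV])
      show "cplx u \<in> borel_measurable borel" unfolding u_def by measurable
      then show "cplx u \<in> borel_measurable borel" .
      have 1: "cmod (complex_of_real (u x) - complex_of_real (u y)) \<le> cmod (g x - g y)" for x y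
        using re_diff[of x y] by (auto simp: u_def max_def simp flip: of_real_diff)
      have 2: "cmod (complex_of_real (u x)) \<le> cmod (g x)" for x
        using abs_Re_le_cmod[of "g x"] by (auto simp: u_def max_def)
      show "cmod (complex_of_real (u x) - complex_of_real (u y)) \<le> cmod (g x - g y)" for x y by (rule 1)
      show "cmod (complex_of_real (u x)) \<le> cmod (g x)" for x by (rule 2)
      show "cmod (complex_of_real (u x) - complex_of_real (u y)) \<le> cmod (g x - g y)" for x y by (rule 1)
      show "cmod (complex_of_real (u x)) \<le> cmod (g x)" for x by (rule 2)
    qed
    have vV: "cplx v \<in> V" "Nm (cplx v) \<le> Nm g"
    proof (atomize (full), intro conjI V_contraction[OF _ gV])
      show "cplx v \<in> borel_measurable borel" unfolding v_def by measurable
      then show "cplx v \<in> borel_measurable borel" .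
      have 1: "cmod (complex_of_real (v x) - complex_of_real (v y)) \<le> cmod (g x - g y)" for x y
        using re_diff[of x y] by (auto simp: v_def max_def simp flip: of_real_diff)
      have 2: "cmod (complex_of_real (v x)) \<le> cmod (g x)" for x
        using abs_Re_le_cmod[of "g x"] by (auto simp: v_def max_def)
      show "cmod (complex_of_real (v x) - complex_of_real (v y)) \<le> cmod (g x - g y)" for x y by (rule 1)
      show "cmod (complex_of_real (v x)) \<le> cmod (g x)" for x by (rule 2)
      show "cmod (complex_of_real (v x) - complex_of_real (v y)) \<le> cmod (g x - g y)" for x y by (rule 1)
      show "cmod (complex_of_real (v x)) \<le> cmod (g x)" for x by (rule 2)
    qed
    have int: "integrable \<nu> u" "integrable \<nu> v"
      using V_integrable[OF uV(1)] V_integrable[OF vV(1)] by (simp_all add: complex_of_real_integrable_eq)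
    define s where "s = (\<integral>x. u x \<partial>\<nu>)"
    have "(\<integral>x. g x \<partial>\<nu>) = complex_of_real ((\<integral>x. u x \<partial>\<nu>) - (\<integral>x. v x \<partial>\<nu>))"
      unfolding g_uv using int by simp
    then have sv: "(\<integral>x. v x \<partial>\<nu>) = s" using zero unfolding s_def by (simp flip: of_real_diff)
    have "cmod (g x) = u x + v x" for x using re[of x] by (auto simp: u_def v_def cmod_def max_def)
    then have L1_s: "L1 g = 2 * s" unfolding L1_def using int sv by (simp add: s_def)
    have Du: "AE x in \<nu>. \<epsilon> * s \<le> Re ((U ^^ n) (cplx u) x)"
      unfolding s_def by (rule D[OF uV(1) uv(1)]) (use uV(2) le L1_s in \<open>simp add: s_def mult_ac\<close>)
    have Dv: "AE x in \<nu>. \<epsilon> * s \<le> Re ((U ^^ n) (cplx v) x)"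
      unfolding sv[symmetric] by (rule D[OF vV(1) uv(2)]) (use vV(2) le L1_s in \<open>simp add: sv mult_ac\<close>)
    let ?a = "\<lambda>x. Re ((U ^^ n) (cplx u) x)" and ?b = "\<lambda>x. Re ((U ^^ n) (cplx v) x)"
    have Ug: "cmod ((U ^^ n) g x) = \<bar>?a x - ?b x\<bar>" for x
    proof -
      have "(U ^^ n) g x = complex_of_real (?a x - ?b x)"
        unfolding Upow_eq Tpow_eq g_uv
        by (simp add: complex_eq_iff right_diff_distrib sum_subtractf diff_divide_distrib flip: of_real_power)
      then show ?thesis by (simp only: norm_of_real)
    qed
    have ia: "integrable \<nu> ?a" "(\<integral>x. ?a x \<partial>\<nu>) = s"
    proof -
      note * = Upow_integral[OF V_integrable[OF uV(1)], of n]
      show "integrable \<nu> ?a" using *(1) by auto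
      have "(\<integral>x. ?a x \<partial>\<nu>) = Re (\<integral>x. (U ^^ n) (cplx u) x \<partial>\<nu>)" using *(1) by simp
      then show "(\<integral>x. ?a x \<partial>\<nu>) = s" using *(2) by (simp add: s_def)
    qed
    have ib: "integrable \<nu> ?b" "(\<integral>x. ?b x \<partial>\<nu>) = s"
    proof -
      note * = Upow_integral[OF V_integrable[OF vV(1)], of n]
      show "integrable \<nu> ?b" using *(1) by auto
      have "(\<integral>x. ?b x \<partial>\<nu>) = Re (\<integral>x. (U ^^ n) (cplx v) x \<partial>\<nu>)" using *(1) by simp
      then show "(\<integral>x. ?b x \<partial>\<nu>) = s" using *(2) by (simp add: sv)
    qed
    have "L1 ((U ^^ n) g) \<le> (\<integral>x. ?a x + ?b x - 2 * (\<epsilon> * s) \<partial>\<nu>)"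
      unfolding L1_def Ug
    proof (rule integral_mono_AE)
      show "AE x in \<nu>. \<bar>?a x - ?b x\<bar> \<le> ?a x + ?b x - 2 * (\<epsilon> * s)"
        using Du Dv by eventually_elim linarith
    qed (use ia ib in auto)
    also have "\<dots> = 2 * s - 2 * (\<epsilon> * s)" using ia ib by simp
    finally show ?thesis by (simp add: L1_s algebra_simps)
  qed
  \<comment> \<open>Capping \<open>\<epsilon>\<close> at 1 keeps the contraction factor
    nonnegative.\<close>
  moreover have "(1 - \<epsilon>) * L1 g \<le> (1 - min \<epsilon> 1) * L1 g" for g
    using L1_nonneg[of g] by (intro mult_right_mono) auto
  ultimately have "\<forall>g\<in>V0. Nm g \<le> b * L1 g \<longrightarrow> L1 ((U ^^ n) g) \<le> (1 - min \<epsilon> 1) * L1 g"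
    by (meson order_trans)
  moreover have "0 < min \<epsilon> 1" "min \<epsilon> 1 \<le> 1" using \<epsilon> by auto
  ultimately show ?thesis by blast
qed

lemma Im_Upow: "(\<And>x. Im (g x) = 0) \<Longrightarrow> Im ((U ^^ n) g x) = 0"
  unfolding Upow_eq Tpow_eq by (simp flip: of_real_power)

lemma V0_Upow: "g \<in> V0 \<Longrightarrow> (U ^^ n) g \<in> V0"
  unfolding V0_def using Upow_V Im_Upow Upow_integral(2)[OF V_integrable] by simp

lemma decay_V0: "\<exists>C>0. \<exists>\<xi>. 0 < \<xi> \<and> \<xi> < 1 \<and> (\<forall>g\<in>V0. \<forall>n. Nm ((U ^^ n) g) \<le> C * \<xi> ^ n * Nm g)"
proof -
  obtain m K where m: "m \<ge> 1" and K: "K > 0" and LY: "\<And>g. g \<in> V \<Longrightarrow> Nm ((T ^^ m) g) / lam ^ m \<le> 1/2 * Nm g + K * L1 g"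
    using Lasota_Yorke by blast
  obtain K5 where K5: "K5 > 0" and N5: "\<And>g n. g \<in> V \<Longrightarrow> Nm ((U ^^ n) g) \<le> K5 * Nm g" using Nm_Upow_le by blast
  define M where "M = U ^^ m"
  have Mpow: "(M ^^ j) = U ^^ (m * j)" for j unfolding M_def by (simp add: funpow_mult mult.commute)
  have V0V: "g \<in> V" if "g \<in> V0" for g using that by (simp add: V0_def)
  have "\<exists>j\<ge>1. \<exists>C r. 0 < C \<and> 0 < r \<and> r < 1 \<and> (\<forall>g\<in>V0. \<forall>n. Nm ((M ^^ (j * n)) g) \<le> C * r ^ n * Nm g)"
  proof (rule two_norm_decay[where Lf = L1 and K = K])
    show "M g \<in> V0" if "g \<in> V0" for g unfolding M_def by (rule V0_Upow[OF that])
    show "0 \<le> L1 g" for g by (rule L1_nonneg)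
    show "L1 g \<le> Nm g" if "g \<in> V0" for g by (rule L1_le[OF V0V[OF that]])
    show "Nm (M g) \<le> 1/2 * Nm g + K * L1 g" if "g \<in> V0" for g
      unfolding M_def Nm_Upow[OF V0V[OF that]] by (rule LY[OF V0V[OF that]])
    show "L1 (M g) \<le> L1 g" if "g \<in> V0" for g
      unfolding M_def by (rule Upow_integral(3)[OF V_integrable[OF V0V[OF that]]])
    show "\<exists>j\<ge>1. \<exists>\<epsilon>>0. \<epsilon> \<le> 1 \<and> (\<forall>g\<in>V0. Nm g \<le> b * L1 g \<longrightarrow> L1 ((M ^^ j) g) \<le> (1 - \<epsilon>) * L1 g)"
      if b: "b > 0" for b
    proof -
      obtain n \<epsilon> where \<epsilon>: "0 < \<epsilon>" "\<epsilon> \<le> 1" "\<And>g. g \<in> V0 \<Longrightarrow> Nm g \<le> b * L1 g \<Longrightarrow> L1 ((U ^^ n) g) \<le> (1 - \<epsilon>) * L1 g"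
        using L1_contraction[OF b] by blast
      \<comment> \<open>\<open>M\<close> is a block of \<open>m \<ge> 1\<close> steps, so
        \<open>n + 1\<close> blocks contain at least \<open>n\<close> single steps, and further
        steps do not increase the \<open>L1\<close> norm. The successor guarantees a positive number
        of blocks.\<close>
      have "L1 ((M ^^ Suc n) g) \<le> (1 - \<epsilon>) * L1 g" if g: "g \<in> V0" and le: "Nm g \<le> b * L1 g" for g
      proof -
        have "n \<le> m * Suc n" using m by (metis Suc_leD le_refl mult_le_mono nat_mult_1 One_nat_def)
        then have eq: "(M ^^ Suc n) g = (U ^^ (m * Suc n - n)) ((U ^^ n) g)"
          unfolding Mpow by (metis funpow_add comp_apply le_add_diff_inverse2)
        have "L1 ((M ^^ Suc n) g) \<le> L1 ((U ^^ n) g)"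
          unfolding eq by (rule Upow_integral(3)[OF V_integrable[OF Upow_V[OF V0V[OF g]]]])
        also have "\<dots> \<le> (1 - \<epsilon>) * L1 g" by (rule \<epsilon>(3)[OF g le])
        finally show ?thesis .
      qed
      then show ?thesis using \<epsilon>(1,2) by (intro exI[of _ "Suc n"] conjI exI[of _ \<epsilon>]) auto
    qed
  qed (rule K)
  then obtain j C r where j: "j \<ge> 1" and C: "0 < C" and r: "0 < r" "r < 1"
    and dec: "\<And>g n. g \<in> V0 \<Longrightarrow> Nm ((U ^^ (m * (j * n))) g) \<le> C * r ^ n * Nm g"
    unfolding Mpow by blast
  define l where "l = m * j"
  have l: "l \<ge> 1" unfolding l_def using m j by simp
  \<comment> \<open>Decay by \<open>r\<close> over \<open>l\<close> steps becomes a rate per step;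
    the incomplete block costs the constants \<open>K5\<close> and \<open>1 / r\<close>.\<close>
  define \<xi> where "\<xi> = root l r"
  have \<xi>: "0 < \<xi>" "\<xi> < 1" "\<xi> ^ l = r" unfolding \<xi>_def using r l by (auto simp: real_root_lt_1_iff)
  have "Nm ((U ^^ n) g) \<le> (K5 * C / r) * \<xi> ^ n * Nm g" if g: "g \<in> V0" for g n
  proof -
    define q where "q = n div l"
    have n: "n = n mod l + l * q" by (simp add: q_def)
    have "Nm ((U ^^ n) g) = Nm ((U ^^ (n mod l)) ((U ^^ (l * q)) g))"
      using n by (metis funpow_add comp_apply)
    also have "\<dots> \<le> K5 * Nm ((U ^^ (l * q)) g)" by (rule N5[OF Upow_V[OF V0V[OF g]]])
    also have "\<dots> \<le> K5 * (C * r ^ q * Nm g)"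
      using dec[OF g, of q] K5 by (intro mult_left_mono) (auto simp: l_def mult.assoc)
    also have "r ^ q = \<xi> ^ (l * q)" by (simp add: power_mult \<xi>(3))
    finally have 1: "Nm ((U ^^ n) g) \<le> K5 * (C * \<xi> ^ (l * q) * Nm g)" .
    have "\<xi> ^ (l * q) \<le> \<xi> ^ n / r"
    proof -
      have "r * \<xi> ^ (l * q) = \<xi> ^ (l + l * q)" by (simp add: power_add \<xi>(3))
      also have "\<dots> \<le> \<xi> ^ n"
      proof (rule power_decreasing)
        show "n \<le> l + l * q" using n l mod_less_divisor[of l n] by linarith
      qed (use \<xi> in auto)
      finally show ?thesis using r by (simp add: field_simps)
    qed
    then have "K5 * (C * \<xi> ^ (l * q) * Nm g) \<le> K5 * (C * (\<xi> ^ n / r) * Nm g)"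
      using K5 C Nm_nonneg[of g] by (intro mult_left_mono mult_right_mono) auto
    with 1 show ?thesis by (simp add: mult_ac)
  qed
  moreover have "K5 * C / r > 0" using K5 C r by simp
  ultimately show ?thesis using \<xi> by blast
qed

lemma decay: "\<exists>C>0. \<exists>\<xi>. 0 < \<xi> \<and> \<xi> < 1 \<and>
  (\<forall>g\<in>V. (\<integral>x. g x \<partial>\<nu>) = 0 \<longrightarrow> (\<forall>n. Nm ((U ^^ n) g) \<le> C * \<xi> ^ n * Nm g))"
proof -
  obtain C \<xi> where C: "C > 0" and \<xi>: "0 < \<xi>" "\<xi> < 1" and dec: "\<And>g n. g \<in> V0 \<Longrightarrow> Nm ((U ^^ n) g) \<le> C * \<xi> ^ n * Nm g"
    using decay_V0 by blast
  have "Nm ((U ^^ n) g) \<le> (2 * C) * \<xi> ^ n * Nm g" if g: "g \<in> V" and zero: "(\<integral>x. g x \<partial>\<nu>) = 0" for g n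
  proof -
    note [measurable] = V_meas[OF g]
    define a where "a x = complex_of_real (Re (g x))" for x
    define b where "b x = complex_of_real (Im (g x))" for x
    have meas: "a \<in> borel_measurable borel" "b \<in> borel_measurable borel" unfolding a_def b_def by measurable
    have a1: "cmod (a x - a y) \<le> cmod (g x - g y)" "cmod (a x) \<le> cmod (g x)" for x y
      using abs_Re_le_cmod[of "g x - g y"] abs_Re_le_cmod[of "g x"] by (auto simp: a_def simp flip: of_real_diff)
    have b1: "cmod (b x - b y) \<le> cmod (g x - g y)" "cmod (b x) \<le> cmod (g x)" for x y
      using abs_Im_le_cmod[of "g x - g y"] abs_Im_le_cmod[of "g x"] by (auto simp: b_def simp flip: of_real_diff)
    note aV = V_contraction[OF meas(1) g a1] and bV = V_contraction[OF meas(2) g b1]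
    have int: "integrable \<nu> g" by (rule V_integrable[OF g])
    have "(\<integral>x. a x \<partial>\<nu>) = of_real (Re (\<integral>x. g x \<partial>\<nu>))" "(\<integral>x. b x \<partial>\<nu>) = of_real (Im (\<integral>x. g x \<partial>\<nu>))"
      unfolding a_def b_def using int by simp_all
    then have int0: "(\<integral>x. a x \<partial>\<nu>) = 0" "(\<integral>x. b x \<partial>\<nu>) = 0" using zero by simp_all
    have "Im (a x) = 0" "Im (b x) = 0" for x by (simp_all add: a_def b_def)
    then have V0: "a \<in> V0" "b \<in> V0" using aV(1) bV(1) int0 by (simp_all add: V0_def)
    have "g = (\<lambda>x. 1 * a x + \<i> * b x)" by (auto simp: a_def b_def complex_eq_iff)
    then have "(U ^^ n) g = (\<lambda>x. (U ^^ n) a x + \<i> * (U ^^ n) b x)"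
      using Upow_lin[of n 1 a \<i> b] by auto
    then have "Nm ((U ^^ n) g) \<le> Nm ((U ^^ n) a) + Nm ((U ^^ n) b)"
      using N_add[OF Upow_V[OF aV(1)] V_scale[OF Upow_V[OF bV(1)]], of n \<i> n] N_scale[OF Upow_V[OF bV(1)], of \<i> n] by simp
    also have "\<dots> \<le> C * \<xi> ^ n * Nm g + C * \<xi> ^ n * Nm g"
    proof (rule add_mono)
      have p: "0 \<le> C * \<xi> ^ n" using C \<xi> by simp
      show "Nm ((U ^^ n) a) \<le> C * \<xi> ^ n * Nm g" using dec[OF V0(1), of n] mult_left_mono[OF aV(2) p] by linarith
      show "Nm ((U ^^ n) b) \<le> C * \<xi> ^ n * Nm g" using dec[OF V0(2), of n] mult_left_mono[OF bV(2) p] by linarith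
    qed
    finally show ?thesis by simp
  qed
  then show ?thesis using C \<xi> by (intro exI[of _ "2 * C"]) auto
qed

lemma integral_diff_V: "g \<in> V \<Longrightarrow> k \<in> V \<Longrightarrow> (\<integral>x. g x - k x \<partial>\<nu>) = (\<integral>x. g x \<partial>\<nu>) - (\<integral>x. k x \<partial>\<nu>)"
  using V_integrable by (intro Bochner_Integration.integral_diff) auto

text \<open>The images of the constant 1 under \<open>U ^^ n\<close> form a Cauchy sequence: the
  difference of the members \<open>n + k\<close> and \<open>n\<close> is the \<open>n\<close>-th
  image of a function of mean zero whose norm is bounded independently of \<open>k\<close>. The
  limit is fixed since \<open>U\<close> is bounded.\<close>

lemma invariant_density: "\<exists>h\<in>V. Nm (\<lambda>x. U h x - h x) = 0 \<and> (\<integral>x. h x \<partial>\<nu>) = 1"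
proof -
  obtain C \<xi> where C: "C > 0" and \<xi>: "0 < \<xi>" "\<xi> < 1"
    and dec: "\<And>g n. g \<in> V \<Longrightarrow> (\<integral>x. g x \<partial>\<nu>) = 0 \<Longrightarrow> Nm ((U ^^ n) g) \<le> C * \<xi> ^ n * Nm g" using decay by blast
  obtain K5 where K5: "K5 > 0" and N5: "\<And>g n. g \<in> V \<Longrightarrow> Nm ((U ^^ n) g) \<le> K5 * Nm g" using Nm_Upow_le by blast
  define one where "one = (\<lambda>_::'a. 1 :: complex)"
  define s where "s n = (U ^^ n) one" for n
  have oneV: "one \<in> V" unfolding one_def by (rule const_V)
  have sV: "s n \<in> V" for n unfolding s_def by (rule Upow_V[OF oneV])
  have s_int: "(\<integral>x. s n x \<partial>\<nu>) = 1" for n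
    unfolding s_def using Upow_integral(2)[OF V_integrable[OF oneV], of n] by (simp add: one_def)
  define K where "K = C * (K5 * Nm one + Nm one)"
  have K: "K \<ge> 0" unfolding K_def using C K5 Nm_nonneg[of one] by simp
  have diff: "Nm (\<lambda>x. s (n + k) x - s n x) \<le> K * \<xi> ^ n" for n k
  proof -
    define z where "z = (\<lambda>x. s k x - one x)"
    have zV: "z \<in> V" unfolding z_def by (rule V_diff[OF sV oneV])
    have z0: "(\<integral>x. z x \<partial>\<nu>) = 0" unfolding z_def using integral_diff_V[OF sV oneV] s_int by (simp add: one_def)
    have "(U ^^ n) z x = s (n + k) x - s n x" for x
      using Upow_lin[of n 1 "s k" "-1" one x] by (simp add: z_def s_def funpow_add)
    then have "(\<lambda>x. s (n + k) x - s n x) = (U ^^ n) z" by auto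
    then have "Nm (\<lambda>x. s (n + k) x - s n x) \<le> C * \<xi> ^ n * Nm z" using dec[OF zV z0] by simp
    also have "\<dots> \<le> C * \<xi> ^ n * (K5 * Nm one + Nm one)"
    proof (rule mult_left_mono)
      show "Nm z \<le> K5 * Nm one + Nm one"
        unfolding z_def using N_diff[OF sV oneV, of k] N5[OF oneV, of k] by (simp add: s_def)
    qed (use C \<xi> in simp)
    finally show ?thesis by (simp add: K_def mult_ac)
  qed
  have lim: "(\<lambda>n. K * \<xi> ^ n) \<longlonglongrightarrow> K * 0" by (intro tendsto_intros LIMSEQ_power_zero) (use \<xi> in auto)
  have "\<exists>M. \<forall>i\<ge>M. \<forall>j\<ge>M. Nm (\<lambda>x. s i x - s j x) < e" if e: "e > 0" for e
  proof -
    obtain M where M: "\<And>n. n \<ge> M \<Longrightarrow> K * \<xi> ^ n < e"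
      using order_tendstoD(2)[OF lim, of e] e by (auto simp: eventually_sequentially)
    have "Nm (\<lambda>x. s i x - s j x) < e" if "i \<ge> M" "j \<ge> M" for i j
    proof (cases "j \<le> i")
      case True
      then show ?thesis using diff[of j "i - j"] M[OF that(2)] by simp
    next
      case False
      then show ?thesis using diff[of i "j - i"] M[OF that(1)] N_minus_commute[OF sV sV, of i j] by simp
    qed
    then show ?thesis by blast
  qed
  then obtain h where h: "h \<in> V" "(\<lambda>i. Nm (\<lambda>x. s i x - h x)) \<longlonglongrightarrow> 0"
    using complete[unfolded complete_seminormed_def, THEN spec, of s] sV by blast
  have "(\<integral>x. h x \<partial>\<nu>) = 1"
  proof -
    have "cmod (1 - (\<integral>x. h x \<partial>\<nu>)) \<le> Nm (\<lambda>x. s i x - h x)" for i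
    proof -
      have "cmod (1 - (\<integral>x. h x \<partial>\<nu>)) = cmod (\<integral>x. s i x - h x \<partial>\<nu>)" using integral_diff_V[OF sV h(1)] s_int by simp
      also have "\<dots> \<le> (\<integral>x. cmod (s i x - h x) \<partial>\<nu>)" by (rule integral_norm_bound)
      also have "\<dots> \<le> Nm (\<lambda>x. s i x - h x)" by (rule L1_le_Nm[OF V_diff[OF sV h(1)]])
      finally show ?thesis .
    qed
    then have "cmod (1 - (\<integral>x. h x \<partial>\<nu>)) \<le> 0" using h(2) by (intro LIMSEQ_le_const) auto
    then show ?thesis by simp
  qed
  moreover have "Nm (\<lambda>x. U h x - h x) = 0"
  proof (rule limit_unique[of "\<lambda>n. s (Suc n)"])
    show "s (Suc n) \<in> V" for n by (rule sV)
    show "U h \<in> V" using Upow_V[OF h(1), of 1] by simp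
    show "h \<in> V" by (rule h)
    show "(\<lambda>n. Nm (\<lambda>x. s (Suc n) x - h x)) \<longlonglongrightarrow> 0" using LIMSEQ_Suc[OF h(2)] .
    have "Nm (\<lambda>x. s (Suc n) x - U h x) \<le> K5 * Nm (\<lambda>x. s n x - h x)" for n
    proof -
      have "(\<lambda>x. s (Suc n) x - U h x) = (U ^^ 1) (\<lambda>x. s n x - h x)"
        using Upow_lin[of 1 1 "s n" "-1" h] by (auto simp: s_def)
      then show ?thesis using N5[OF V_diff[OF sV h(1)], of 1 n] by simp
    qed
    moreover have "(\<lambda>n. K5 * Nm (\<lambda>x. s n x - h x)) \<longlonglongrightarrow> 0" using tendsto_mult_left[OF h(2), of K5] by simp
    ultimately show "(\<lambda>n. Nm (\<lambda>x. s (Suc n) x - U h x)) \<longlonglongrightarrow> 0"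
      by (intro null_seq_le[of "\<lambda>n. Nm (\<lambda>x. s (Suc n) x - U h x)"] Nm_nonneg)
  qed
  ultimately show ?thesis using h(1) by blast
qed

end

section \<open>The invariant density and decay of correlations\<close>

context theta_system
begin

text \<open>The functional of the abstract criterion is integration against \<nu>, which the
  operator multiplies by \<open>lam\<close>; its kernel is the space on which exponential decay was
  proved.\<close>

theorem quasi_compact_T: "\<exists>B0 B1. quasi_compact_decomposition V Nm T B0 B1 \<and> has_dimension B0 Nm 1"
proof -
  obtain C \<xi> where C: "C > 0" and \<xi>: "0 < \<xi>" "\<xi> < 1"
    and dec: "\<And>g n. g \<in> V \<Longrightarrow> (\<integral>x. g x \<partial>\<nu>) = 0 \<Longrightarrow> Nm ((U ^^ n) g) \<le> C * \<xi> ^ n * Nm g" using decay by blast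
  obtain K where K: "K > 0" "\<And>g n. g \<in> V \<Longrightarrow> Nm ((T ^^ n) g) \<le> K * lam ^ n * Nm g" using Nm_Tpow by blast
  obtain h where h: "h \<in> V" "Nm (\<lambda>x. U h x - h x) = 0" "(\<integral>x. h x \<partial>\<nu>) = 1" using invariant_density by blast
  show ?thesis
  proof (rule spectral_gap[where J = "\<lambda>g. \<integral>x. g x \<partial>\<nu>" and l = lam and \<xi> = \<xi> and h = h and C = "C + K"])
    show "complete_seminormed V Nm" by (rule complete)
    show "(\<integral>x. a * g x + b * k x \<partial>\<nu>) = a * (\<integral>x. g x \<partial>\<nu>) + b * (\<integral>x. k x \<partial>\<nu>)" if "g \<in> V" "k \<in> V" for g k a b
      using V_integrable[OF that(1)] V_integrable[OF that(2)] by simp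
    show "cmod (\<integral>x. g x \<partial>\<nu>) \<le> Nm g" if "g \<in> V" for g
      by (rule order_trans[OF integral_norm_bound L1_le_Nm[OF that]])
    show "(\<integral>x. T g x \<partial>\<nu>) = complex_of_real lam * (\<integral>x. g x \<partial>\<nu>)" if "g \<in> V" for g
      by (rule T_integral(2)[OF V_integrable[OF that]])
    have UV: "U h \<in> V" using Upow_V[OF h(1), of 1] by simp
    have "(\<lambda>x. T h x - complex_of_real lam * h x) = (\<lambda>x. complex_of_real lam * (U h x - h x))"
      using lam_pos by (auto simp: U_def right_diff_distrib)
    then show "Nm (\<lambda>x. T h x - complex_of_real lam * h x) = 0"
      using N_scale[OF V_diff[OF UV h(1)], of "complex_of_real lam"] h(2) by simp
    show "Nm ((T ^^ n) g) \<le> (C + K) * (lam * \<xi>) ^ n * Nm g" if g: "g \<in> V" and "(\<integral>x. g x \<partial>\<nu>) = 0" for n g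
    proof -
      have "Nm ((T ^^ n) g) = lam ^ n * Nm ((U ^^ n) g)" using lam_pos by (simp add: Nm_Upow[OF g])
      also have "\<dots> \<le> lam ^ n * (C * \<xi> ^ n * Nm g)" using dec[OF that] lam_pos by (intro mult_left_mono) auto
      also have "\<dots> = C * ((lam * \<xi>) ^ n * Nm g)" by (simp add: power_mult_distrib mult_ac)
      also have "\<dots> \<le> (C + K) * ((lam * \<xi>) ^ n * Nm g)"
        using K(1) lam_pos \<xi> Nm_nonneg[of g] by (intro mult_right_mono) auto
      finally show ?thesis by (simp add: mult.assoc)
    qed
    show "Nm ((T ^^ n) g) \<le> (C + K) * lam ^ n * Nm g" if g: "g \<in> V" for n g
    proof -
      have "K * (lam ^ n * Nm g) \<le> (C + K) * (lam ^ n * Nm g)"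
        using C lam_pos Nm_nonneg[of g] by (intro mult_right_mono) auto
      then show ?thesis using K(2)[OF g, of n] by (simp add: mult.assoc)
    qed
  qed (use lam_pos \<xi> h in auto)
qed

text \<open>Splitting off the multiple of \<open>h\<close> with the same integral leaves a function
  of mean zero, to which the decay applies; \<open>h\<close> is fixed by all powers up to seminorm
  zero.\<close>

lemma Upow_convergence:
  assumes h: "h \<in> V" "Nm (\<lambda>x. U h x - h x) = 0" "(\<integral>x. h x \<partial>\<nu>) = 1"
  shows "\<exists>C>0. \<exists>\<xi>. 0 < \<xi> \<and> \<xi> < 1 \<and>
    (\<forall>g\<in>V. \<forall>n. Nm (\<lambda>x. (U ^^ n) g x - (\<integral>y. g y \<partial>\<nu>) * h x) \<le> C * \<xi> ^ n * Nm g)"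
proof -
  obtain C \<xi> where C: "C > 0" and \<xi>: "0 < \<xi>" "\<xi> < 1"
    and dec: "\<And>g n. g \<in> V \<Longrightarrow> (\<integral>x. g x \<partial>\<nu>) = 0 \<Longrightarrow> Nm ((U ^^ n) g) \<le> C * \<xi> ^ n * Nm g" using decay by blast
  obtain K5 where K5: "K5 > 0" and N5: "\<And>g n. g \<in> V \<Longrightarrow> Nm ((U ^^ n) g) \<le> K5 * Nm g" using Nm_Upow_le by blast
  have UV: "U h \<in> V" using Upow_V[OF h(1), of 1] by simp
  have Uh: "Nm (\<lambda>x. (U ^^ n) h x - h x) = 0" for n
  proof (induction n)
    case (Suc n)
    have eq: "(U ^^ Suc n) h x - (U ^^ n) h x = (U ^^ n) (\<lambda>x. U h x - h x) x" for x
      using Upow_lin[of n 1 "U h" "-1" h x] by (simp add: funpow_swap1)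
    have "Nm (\<lambda>x. (U ^^ Suc n) h x - (U ^^ n) h x) \<le> 0"
      unfolding eq using N5[OF V_diff[OF UV h(1)], of n] h(2) by simp
    then show ?case
      using N_triangle[OF Upow_V[OF h(1), of "Suc n"] Upow_V[OF h(1), of n] h(1)] Suc
        Nm_nonneg[of "\<lambda>x. (U ^^ Suc n) h x - h x"] by linarith
  qed (simp add: N_zero)
  have "Nm (\<lambda>x. (U ^^ n) g x - (\<integral>y. g y \<partial>\<nu>) * h x) \<le> (C * (1 + Nm h)) * \<xi> ^ n * Nm g" if g: "g \<in> V" for g n
  proof -
    define I where "I = (\<integral>y. g y \<partial>\<nu>)"
    define z where "z = (\<lambda>x. g x - I * h x)"
    have IhV: "(\<lambda>x. I * k x) \<in> V" if "k \<in> V" for k by (rule V_scale[OF that])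
    have zV: "z \<in> V" unfolding z_def by (rule V_diff[OF g IhV[OF h(1)]])
    have "(\<integral>x. z x \<partial>\<nu>) = 0"
      unfolding z_def using V_integrable[OF g] V_integrable[OF h(1)] h(3) by (simp add: I_def)
    note dec[OF zV this, of n]
    moreover have "Nm z \<le> (1 + Nm h) * Nm g"
    proof -
      have "cmod I \<le> Nm g" unfolding I_def by (rule order_trans[OF integral_norm_bound L1_le_Nm[OF g]])
      then have "cmod I * Nm h \<le> Nm g * Nm h" by (rule mult_right_mono) (rule Nm_nonneg)
      then show ?thesis unfolding z_def using N_diff[OF g IhV[OF h(1)]] N_scale[OF h(1), of I] by (simp add: algebra_simps)
    qed
    then have "C * \<xi> ^ n * Nm z \<le> C * \<xi> ^ n * ((1 + Nm h) * Nm g)" using C \<xi> by (intro mult_left_mono) auto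
    moreover have Uz: "(U ^^ n) z x = (U ^^ n) g x - I * (U ^^ n) h x" for x
      using Upow_lin[of n 1 g "- I" h x] by (simp add: z_def)
    moreover have "Nm (\<lambda>x. I * (U ^^ n) h x - I * h x) = 0"
      using N_scale[OF V_diff[OF Upow_V[OF h(1)] h(1)], of I n] Uh[of n] by (simp add: right_diff_distrib)
    moreover have "(\<lambda>x. (U ^^ n) g x - I * (U ^^ n) h x) = (U ^^ n) z" using Uz by auto
    ultimately have "Nm (\<lambda>x. (U ^^ n) g x - I * h x) \<le> C * \<xi> ^ n * ((1 + Nm h) * Nm g)"
      using N_triangle[OF Upow_V[OF g] IhV[OF Upow_V[OF h(1)]] IhV[OF h(1)], of n n] by simp
    then show ?thesis by (simp add: I_def mult_ac)
  qed
  moreover have "C * (1 + Nm h) > 0" using C Nm_nonneg[of h] by simp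
  ultimately show ?thesis using \<xi> by blast
qed

text \<open>The weighted oscillations of order \<open>n\<close> are at most a constant times
  \<open>(n + 1) * (lam * \<rho>) ^ n\<close>, and \<open>\<theta> * lam * \<rho> < 1\<close> makes
  the variation converge. This supplies the elements of the space from which every integrable
  function is reached.\<close>

lemma holder_V:
  assumes g: "holder_continuous \<alpha> g" and meas: "g \<in> borel_measurable borel"
  shows "cplx g \<in> V"
proof -
  let ?u = "\<lambda>x. complex_of_real (g x)"
  have [measurable]: "?u \<in> borel_measurable borel" using meas by measurable
  obtain K where K: "\<And>x y. \<bar>g x - g y\<bar> \<le> K" using holder_cyl_sum(2)[OF g] by blast
  define D where "D C = (SUP x\<in>C. SUP y\<in>C. \<bar>g x - g y\<bar>)" for C
  have D: "\<bar>g x - g y\<bar> \<le> D C" if "x \<in> C" "y \<in> C" for x y C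
  proof -
    have "bdd_above ((\<lambda>y. \<bar>g x - g y\<bar>) ` C)" for x using K by (intro bdd_aboveI2) auto
    moreover have "bdd_above ((\<lambda>x. SUP y\<in>C. \<bar>g x - g y\<bar>) ` C)"
      using K that by (intro bdd_aboveI2[of _ _ K] cSUP_least) auto
    ultimately show ?thesis unfolding D_def using that by (meson cSUP_upper order_trans)
  qed
  have D0: "0 \<le> D C" if "C \<in> cyl n" for n C using D cyl_ne[OF that] by (metis abs_ge_zero ex_in_conv order_trans)
  obtain K0 where K0: "K0 \<ge> 0" "\<And>n. (\<Sum>C\<in>cyl n. w n C * D C) \<le> K0 * real (Suc n) * (lam * \<rho>) ^ n"
    using holder_cyl_sum(1)[OF g] unfolding D_def by blast
  have cv: "cylvar n ?u \<le> ennreal (K0 * real (Suc n) * (lam * \<rho>) ^ n)" for n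
  proof -
    have "cylvar n ?u \<le> (\<Sum>C\<in>cyl n. ennreal (w n C) * ennreal (D C))"
      unfolding cylvar_def
    proof (intro sum_mono mult_left_mono)
      fix C assume C: "C \<in> cyl n"
      show "eo ?u C \<le> ennreal (D C)"
        by (rule eo_le_null[OF _ cyl_meas[OF C] empty_null]) (auto intro!: ennreal_leI D simp flip: of_real_diff)
    qed auto
    also have "\<dots> = (\<Sum>C\<in>cyl n. ennreal (w n C * D C))"
      using D0 w_pos[of n] by (intro sum.cong ennreal_mult[symmetric]) (auto intro: less_imp_le)
    also have "\<dots> = ennreal (\<Sum>C\<in>cyl n. w n C * D C)"
      using D0 w_pos[of n] by (intro sum_ennreal mult_nonneg_nonneg) (auto intro: less_imp_le)
    also have "\<dots> \<le> ennreal (K0 * real (Suc n) * (lam * \<rho>) ^ n)" by (rule ennreal_leI[OF K0(2)])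
    finally show ?thesis .
  qed
  let ?x = "\<theta> * lam * \<rho>"
  have x: "0 \<le> ?x" using theta(1) lam_pos rho(1) by simp
  have "summable (\<lambda>n. real (Suc (Suc n)) * ?x ^ Suc n)"
    using summable_theta_lam_rho by (subst (asm) summable_Suc_iff[symmetric])
  then have summ: "summable (\<lambda>n. K0 * (real (Suc (Suc n)) * ?x ^ Suc n))" by (rule summable_mult)
  have "var ?u \<le> (\<Sum>k. ennreal (K0 * (real (Suc (Suc k)) * ?x ^ Suc k)))"
    unfolding var_eq
  proof (intro suminf_le)
    fix k
    have "ennreal (\<theta> ^ Suc k) * cylvar (Suc k) ?u \<le> ennreal (\<theta> ^ Suc k) * ennreal (K0 * real (Suc (Suc k)) * (lam * \<rho>) ^ Suc k)"
      by (rule mult_left_mono[OF cv]) simp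
    also have "\<dots> = ennreal (\<theta> ^ Suc k * (K0 * real (Suc (Suc k)) * (lam * \<rho>) ^ Suc k))"
      using theta(1) by (intro ennreal_mult'[symmetric]) simp
    also have "\<theta> ^ Suc k * (K0 * real (Suc (Suc k)) * (lam * \<rho>) ^ Suc k) = K0 * (real (Suc (Suc k)) * ?x ^ Suc k)"
      by (simp only: power_mult_distrib mult_ac)
    finally show "ennreal (\<theta> ^ Suc k) * cylvar (Suc k) ?u \<le> ennreal (K0 * (real (Suc (Suc k)) * ?x ^ Suc k))" .
  qed auto
  also have "\<dots> = ennreal (\<Sum>k. K0 * (real (Suc (Suc k)) * ?x ^ Suc k))"
    by (rule suminf_ennreal2[OF _ summ]) (intro mult_nonneg_nonneg zero_le_power K0(1) x of_nat_0_le_iff)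
  also have "\<dots> < \<top>" by (rule ennreal_less_top)
  finally have "var ?u < \<top>" .
  moreover have "sn ?u \<le> ennreal (\<bar>g undefined\<bar> + K)"
  proof (rule sn_le)
    have "\<bar>g x\<bar> \<le> \<bar>g undefined\<bar> + K" for x using K[of x undefined] by linarith
    then show "AE x in \<nu>. ennreal (cmod (?u x)) \<le> ennreal (\<bar>g undefined\<bar> + K)" by (auto intro: ennreal_leI)
  qed auto
  then have "sn ?u < \<top>" by (rule order_le_less_trans) simp
  ultimately show ?thesis by (simp add: V_iff)
qed

section \<open>Convergence in \<open>L1\<close> and uniqueness of the fixed density\<close>

context
  fixes h :: "'a \<Rightarrow> complex"
  assumes h: "h \<in> V" "Nm (\<lambda>x. U h x - h x) = 0" "(\<integral>x. h x \<partial>\<nu>) = 1"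
begin

text \<open>The asymptotics of \<open>Upow_convergence\<close> in the weak norm, for functions that
  need not belong to the space. The class turns out to contain every integrable function when
  \<open>\<alpha> \<le> 1\<close>.\<close>

definition converges :: "('a \<Rightarrow> complex) \<Rightarrow> bool" where
  "converges u \<longleftrightarrow> integrable \<nu> u \<and> (\<lambda>n. L1 (\<lambda>x. (U ^^ n) u x - (\<integral>y. u y \<partial>\<nu>) * h x)) \<longlonglongrightarrow> 0"

lemma L1_triangle:
  assumes "integrable \<nu> u" "integrable \<nu> v"
  shows "L1 (\<lambda>x. u x + v x) \<le> L1 u + L1 v"
proof -
  have "L1 (\<lambda>x. u x + v x) \<le> (\<integral>x. cmod (u x) + cmod (v x) \<partial>\<nu>)"
    unfolding L1_def using assms by (intro integral_mono norm_triangle_ineq) auto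
  then show ?thesis using assms by (simp add: L1_def)
qed

lemma L1_scale: "L1 (\<lambda>x. a * u x) = cmod a * L1 u"
  unfolding L1_def by (simp add: norm_mult)

lemma V_converges:
  assumes g: "g \<in> V"
  shows "converges g"
proof -
  obtain C \<xi> where \<xi>: "0 < \<xi>" "\<xi> < 1"
    and conv: "\<And>n. Nm (\<lambda>x. (U ^^ n) g x - (\<integral>y. g y \<partial>\<nu>) * h x) \<le> C * \<xi> ^ n * Nm g"
    using Upow_convergence[OF h] g by blast
  have V: "(\<lambda>x. (U ^^ n) g x - (\<integral>y. g y \<partial>\<nu>) * h x) \<in> V" for n by (intro V_diff Upow_V V_scale g h)
  have "(\<lambda>n. C * \<xi> ^ n * Nm g) \<longlonglongrightarrow> C * 0 * Nm g"
    by (intro tendsto_intros LIMSEQ_power_zero) (use \<xi> in auto)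
  moreover have "L1 (\<lambda>x. (U ^^ n) g x - (\<integral>y. g y \<partial>\<nu>) * h x) \<le> C * \<xi> ^ n * Nm g" for n
    using L1_le[OF V[of n]] conv[of n] by linarith
  ultimately have "(\<lambda>n. L1 (\<lambda>x. (U ^^ n) g x - (\<integral>y. g y \<partial>\<nu>) * h x)) \<longlonglongrightarrow> 0"
    by (intro null_seq_le[of "\<lambda>n. L1 (\<lambda>x. (U ^^ n) g x - (\<integral>y. g y \<partial>\<nu>) * h x)"] L1_nonneg) auto
  then show ?thesis unfolding converges_def using V_integrable[OF g] by simp
qed

lemma defect_integrable: "integrable \<nu> u \<Longrightarrow> integrable \<nu> (\<lambda>x. (U ^^ n) u x - a * h x)"
  using Upow_integral(1) V_integrable[OF h(1)] by auto

lemma converges_lin: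
  assumes u: "converges u" and v: "converges v"
  shows "converges (\<lambda>x. a * u x + b * v x)"
proof -
  let ?d = "\<lambda>u n x. (U ^^ n) u x - (\<integral>y. u y \<partial>\<nu>) * h x"
  have i: "integrable \<nu> u" "integrable \<nu> v" using assms by (auto simp: converges_def)
  have "L1 (?d (\<lambda>x. a * u x + b * v x) n) \<le> cmod a * L1 (?d u n) + cmod b * L1 (?d v n)" for n
  proof -
    have "?d (\<lambda>x. a * u x + b * v x) n = (\<lambda>x. a * ?d u n x + b * ?d v n x)"
      using i by (auto simp: Upow_lin algebra_simps)
    then show ?thesis
      using L1_triangle[of "\<lambda>x. a * ?d u n x" "\<lambda>x. b * ?d v n x"] defect_integrable i
      by (simp add: L1_scale)
  qed
  moreover have "(\<lambda>n. cmod a * L1 (?d u n) + cmod b * L1 (?d v n)) \<longlonglongrightarrow> cmod a * 0 + cmod b * 0"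
    using u v unfolding converges_def by (intro tendsto_intros) auto
  ultimately have "(\<lambda>n. L1 (?d (\<lambda>x. a * u x + b * v x) n)) \<longlonglongrightarrow> 0"
    by (intro null_seq_le[of "\<lambda>n. L1 (?d (\<lambda>x. a * u x + b * v x) n)"] L1_nonneg) auto
  then show ?thesis unfolding converges_def using i by simp
qed

text \<open>All powers of \<open>U\<close> are contractions in \<open>L1\<close>, so the error of
  approximating by members of the class is uniform in \<open>n\<close>.\<close>

lemma converges_closed:
  assumes u: "integrable \<nu> u" and s: "\<And>k. converges (s k)" "(\<lambda>k. L1 (\<lambda>x. u x - s k x)) \<longlonglongrightarrow> 0"
  shows "converges u"
  unfolding converges_def
proof (intro conjI u LIMSEQ_I)
  fix e :: real assume e: "e > 0"
  let ?d = "\<lambda>u n x. (U ^^ n) u x - (\<integral>y. u y \<partial>\<nu>) * h x"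
  have si: "integrable \<nu> (s k)" for k using s(1) by (auto simp: converges_def)
  obtain k where k: "(1 + L1 h) * L1 (\<lambda>x. u x - s k x) < e / 2"
  proof -
    have "(\<lambda>k. (1 + L1 h) * L1 (\<lambda>x. u x - s k x)) \<longlonglongrightarrow> (1 + L1 h) * 0" by (intro tendsto_intros s)
    from order_tendstoD(2)[OF this, of "e / 2"] e
    have "\<forall>\<^sub>F k in sequentially. (1 + L1 h) * L1 (\<lambda>x. u x - s k x) < e / 2" by simp
    then show ?thesis using that eventually_happens[of _ sequentially] by auto
  qed
  have "(\<lambda>n. L1 (?d (s k) n)) \<longlonglongrightarrow> 0" using s(1)[of k] unfolding converges_def by blast
  from order_tendstoD(2)[OF this, of "e / 2"] e
  obtain M where M: "\<And>n. n \<ge> M \<Longrightarrow> L1 (?d (s k) n) < e / 2" by (auto simp: eventually_sequentially)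
  define z where "z = (\<lambda>x. u x - s k x)"
  have z: "integrable \<nu> z" unfolding z_def using u si by auto
  have "L1 (?d u n) < e" if "n \<ge> M" for n
  proof -
    have "?d u n = (\<lambda>x. ?d (s k) n x + ((U ^^ n) z x + (- (\<integral>y. z y \<partial>\<nu>)) * h x))"
      using Upow_lin[of n 1 u "-1" "s k"] u si by (auto simp: z_def algebra_simps)
    moreover have i: "integrable \<nu> ((U ^^ n) z)" "integrable \<nu> (\<lambda>x. (- (\<integral>y. z y \<partial>\<nu>)) * h x)"
      using Upow_integral(1)[OF z] V_integrable[OF h(1)] by auto
    ultimately have "L1 (?d u n) \<le> L1 (?d (s k) n) + (L1 ((U ^^ n) z) + cmod (\<integral>y. z y \<partial>\<nu>) * L1 h)"
      using L1_triangle[OF defect_integrable[OF si] Bochner_Integration.integrable_add[OF i], of n k "\<integral>y. s k y \<partial>\<nu>"]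
        L1_triangle[OF i] L1_scale[of "- (\<integral>y. z y \<partial>\<nu>)" h] by simp
    moreover have "cmod (\<integral>y. z y \<partial>\<nu>) * L1 h \<le> L1 z * L1 h"
      using integral_norm_bound[of \<nu> z] L1_nonneg by (intro mult_right_mono) (auto simp: L1_def)
    ultimately show ?thesis using Upow_integral(3)[OF z, of n] M[OF that] k
      by (simp add: z_def[symmetric] algebra_simps)
  qed
  then show "\<exists>M. \<forall>n\<ge>M. norm (L1 (?d u n) - 0) < e" using L1_nonneg by (auto intro!: exI[of _ M])
qed

lemma converges_dominated:
  assumes s: "\<And>k. converges (s k)" and lim: "\<And>x. (\<lambda>k. s k x) \<longlonglongrightarrow> u x"
    and b: "integrable \<nu> b" "\<And>k x. cmod (s k x) \<le> b x"
  shows "converges u"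
proof (rule converges_closed[OF _ s])
  have si: "integrable \<nu> (s k)" for k using s by (auto simp: converges_def)
  then have [measurable]: "s k \<in> borel_measurable borel" for k by (auto simp: meas_iff[symmetric])
  have [measurable]: "u \<in> borel_measurable borel" by (rule borel_measurable_LIMSEQ_metric[of s]) (use lim in auto)
  show ui: "integrable \<nu> u"
    by (rule integrable_dominated_convergence[OF _ _ b(1), of u s]) (use lim b(2) in \<open>auto simp: meas_iff\<close>)
  have ub: "cmod (u x) \<le> b x" for x by (rule LIMSEQ_le_const2[OF tendsto_norm[OF lim]]) (use b(2) in auto)
  have "(\<lambda>k. \<integral>x. cmod (u x - s k x) \<partial>\<nu>) \<longlonglongrightarrow> (\<integral>x. 0 \<partial>\<nu>)"
  proof (rule integral_dominated_convergence[where w = "\<lambda>x. 2 * b x"])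
    show "AE x in \<nu>. (\<lambda>k. cmod (u x - s k x)) \<longlonglongrightarrow> 0"
    proof (rule AE_I2)
      fix x show "(\<lambda>k. cmod (u x - s k x)) \<longlonglongrightarrow> 0"
        using tendsto_norm[OF tendsto_diff[OF tendsto_const[of "u x"] lim[of x]]] by simp
    qed
    show "AE x in \<nu>. norm (cmod (u x - s k x)) \<le> 2 * b x" for k
    proof (rule AE_I2)
      fix x show "norm (cmod (u x - s k x)) \<le> 2 * b x"
        using norm_triangle_ineq4[of "u x" "s k x"] ub[of x] b(2)[of k x] by simp
    qed
  qed (use b in \<open>auto simp: meas_iff\<close>)
  then show "(\<lambda>k. L1 (\<lambda>x. u x - s k x)) \<longlonglongrightarrow> 0" by (simp add: L1_def)
qed

text \<open>Cutoffs linear in the distance to \<open>F\<close> tend to the indicator. They are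
  Lipschitz and bounded, hence \<alpha>-Hoelder because \<open>\<alpha> \<le> 1\<close>, and so
  belong to the space.\<close>

lemma closed_converges:
  assumes a1: "\<alpha> \<le> 1" and F: "closed F"
  shows "converges (indicator F)"
\<comment> \<open>The distance to the empty set is 0 by convention, which would produce the constant
  1 in place of 0.\<close>
proof (cases "F = {}")
  case True
  then show ?thesis using V_converges[OF const_V[of 0]] by (simp add: indicator_def[abs_def])
next
  case False
  define s where "s k x = max 0 (1 - real k * infdist x F)" for k x
  have s01: "0 \<le> s k x" "s k x \<le> 1" for k x unfolding s_def using infdist_nonneg[of x F] by auto
  have "converges (\<lambda>x. complex_of_real (s k x))" for k
  proof (rule V_converges[OF holder_V])
    have "continuous_on UNIV (s k)" unfolding s_def by (intro continuous_intros)
    then show "s k \<in> borel_measurable borel" by (rule borel_measurable_continuous_onI)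
    have "\<bar>s k x - s k y\<bar> \<le> (1 + real k) * dist x y powr \<alpha>" for x y
    proof (cases "dist x y \<le> 1")
      case True
      have "\<bar>infdist x F - infdist y F\<bar> \<le> dist x y"
        using infdist_triangle[of x F y] infdist_triangle[of y F x] by (simp add: dist_commute abs_le_iff)
      then have "real k * \<bar>infdist x F - infdist y F\<bar> \<le> real k * dist x y" by (intro mult_left_mono) auto
      moreover have "\<bar>s k x - s k y\<bar> \<le> \<bar>real k * infdist x F - real k * infdist y F\<bar>"
        unfolding s_def by (auto simp: max_def abs_if)
      then have "\<bar>s k x - s k y\<bar> \<le> real k * \<bar>infdist x F - infdist y F\<bar>"
        by (simp add: abs_mult flip: right_diff_distrib)
      ultimately have "\<bar>s k x - s k y\<bar> \<le> real k * dist x y" by linarith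
      also have "\<dots> \<le> (1 + real k) * dist x y powr \<alpha>"
      proof (rule mult_mono)
        show "dist x y \<le> dist x y powr \<alpha>"
          using powr_mono'[of \<alpha> 1 "dist x y"] a1 True by (cases "x = y") auto
      qed auto
      finally show ?thesis .
    next
      case False
      then have "1 \<le> dist x y powr \<alpha>" using alpha_pos by (intro ge_one_powr_ge_zero) auto
      then have "1 * 1 \<le> (1 + real k) * dist x y powr \<alpha>" by (intro mult_mono) auto
      then show ?thesis using s01[of k x] s01[of k y] by linarith
    qed
    then show "holder_continuous \<alpha> (s k)" unfolding holder_continuous_def by blast
  qed
  moreover have "(\<lambda>k. complex_of_real (s k x)) \<longlonglongrightarrow> indicator F x" for x
  proof (cases "x \<in> F")
    case True
    then show ?thesis by (simp add: s_def)
  next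
    case xF: False
    then have pos: "infdist x F > 0" using infdist_pos_not_in_closed[OF F False] by simp
    obtain m where m: "1 / infdist x F < real m" using reals_Archimedean2 by blast
    have "s k x = 0" if "k \<ge> m" for k
    proof -
      have "1 / infdist x F \<le> real k" using m that by simp
      then show ?thesis using pos by (simp add: s_def field_simps)
    qed
    then have "\<forall>\<^sub>F k in sequentially. complex_of_real (s k x) = indicator F x"
      using xF by (auto simp: eventually_sequentially)
    then show ?thesis by (rule tendsto_eventually)
  qed
  ultimately show ?thesis
    by (rule converges_dominated[where b = "\<lambda>_. 1"]) (use s01 in auto)
qed

lemma borel_converges:
  assumes a1: "\<alpha> \<le> 1" and A: "A \<in> sets borel"
  shows "converges (indicator A)"
proof -
  have gen: "sets (borel :: 'a measure) = sigma_sets UNIV (Collect closed)"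
    unfolding borel_eq_closed by simp
  have "Int_stable (Collect closed :: 'a set set)" by (auto simp: Int_stable_def)
  moreover have "(Collect closed :: 'a set set) \<subseteq> Pow UNIV" by simp
  moreover note A[unfolded gen]
  ultimately show ?thesis
  proof (induction rule: sigma_sets_induct_disjoint)
    case (basic F)
    then show ?case using closed_converges[OF a1] by simp
  next
    case empty
    then show ?case using V_converges[OF const_V[of 0]] by simp
  next
    case (compl F)
    have "indicator (UNIV - F) = (\<lambda>x. 1 * 1 + (-1) * indicator F x :: complex)" by (auto simp: indicator_def)
    then show ?case using converges_lin[OF V_converges[OF const_V[of 1]] compl(2), of 1 "-1"] by simp
  next
    case (union F)
    have fin: "converges (indicator (\<Union>i<n. F i))" for n
    proof (induction n)
      case 0
      then show ?case using V_converges[OF const_V[of 0]] by simp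
    next
      case (Suc n)
      have "F i \<inter> F n = {}" if "i < n" for i using union(1) that by (auto simp: disjoint_family_on_def)
      then have "(\<Union>i<n. F i) \<inter> F n = {}" by blast
      then have "indicator (\<Union>i<Suc n. F i) = (\<lambda>x. 1 * indicator (\<Union>i<n. F i) x + 1 * indicator (F n) x :: complex)"
        by (auto simp: lessThan_Suc indicator_def fun_eq_iff)
      then show ?case using converges_lin[OF Suc union(3)[of n], of 1 1] by simp
    qed
    show ?case
    proof (rule converges_dominated[OF fin, where b = "\<lambda>_. 1"])
      fix x
      show "(\<lambda>n. indicator (\<Union>i<n. F i) x :: complex) \<longlonglongrightarrow> indicator (\<Union>(range F)) x"
        by (rule LIMSEQ_indicator_UN)
    qed (auto simp: indicator_def)
  qed
qed

lemma integrable_converges: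
  assumes a1: "\<alpha> \<le> 1" and u: "integrable \<nu> u"
  shows "converges u"
  using u
proof (induction rule: integrable_induct)
  case (base A c)
  then have "converges (indicator A)" using borel_converges[OF a1] nu_sets by simp
  from converges_lin[OF this this, of c 0] show ?case
    by (rule arg_cong[where f = converges, THEN iffD1, rotated]) (auto simp: indicator_def)
next
  case (add u v)
  then show ?case using converges_lin[of u v 1 1] by simp
next
  case (lim u s)
  show ?case
    by (rule converges_dominated[OF lim(5), where b = "\<lambda>x. 2 * cmod (u x)"]) (use lim in auto)
qed

text \<open>A fixed function agrees with all its images, and these converge in \<open>L1\<close> to
  \<open>(\<integral>y. u y \<partial>\<nu>) * h\<close>.\<close>

lemma fixed_density_unique:
  assumes a1: "\<alpha> \<le> 1" and u: "integrable \<nu> u" and fixed: "AE x in \<nu>. U u x = u x"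
  shows "AE x in \<nu>. u x = (\<integral>y. u y \<partial>\<nu>) * h x"
proof -
  let ?I = "\<integral>y. u y \<partial>\<nu>"
  have Uu: "integrable \<nu> (U u)" using Upow_integral(1)[OF u, of 1] by simp
  have L1_0: "L1 (\<lambda>x. (U ^^ n) u x - u x) = 0" for n
  proof (induction n)
    case (Suc n)
    let ?z = "\<lambda>x. U u x - u x"
    have z: "integrable \<nu> ?z" using Uu u by simp
    have "L1 ?z = 0" unfolding L1_def using fixed by (intro integral_eq_zero_AE) (auto elim: eventually_mono)
    then have z0: "L1 ((U ^^ n) ?z) \<le> 0" using Upow_integral(3)[OF z, of n] by simp
    have eq: "(U ^^ Suc n) u x - u x = (U ^^ n) ?z x + ((U ^^ n) u x - u x)" for x
      using Upow_lin[of n 1 "U u" "-1" u x] by (simp add: funpow_swap1)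
    have "L1 (\<lambda>x. (U ^^ Suc n) u x - u x) \<le> L1 ((U ^^ n) ?z) + L1 (\<lambda>x. (U ^^ n) u x - u x)"
      unfolding eq using Upow_integral(1)[OF u] u by (intro L1_triangle[OF Upow_integral(1)[OF z, of n]]) auto
    then show ?case using Suc z0 L1_nonneg[of "\<lambda>x. (U ^^ Suc n) u x - u x"] by simp
  qed (simp add: L1_def)
  have le: "L1 (\<lambda>x. u x - ?I * h x) \<le> L1 (\<lambda>x. (U ^^ n) u x - ?I * h x)" for n
  proof -
    have "L1 (\<lambda>x. u x - (U ^^ n) u x) = 0" using L1_0[of n] by (simp add: L1_def norm_minus_commute)
    then show ?thesis
      using L1_triangle[of "\<lambda>x. u x - (U ^^ n) u x" "\<lambda>x. (U ^^ n) u x - ?I * h x"] u Upow_integral(1)[OF u]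
        defect_integrable[OF u, of n ?I] by simp
  qed
  have "(\<lambda>n. L1 (\<lambda>x. (U ^^ n) u x - ?I * h x)) \<longlonglongrightarrow> 0"
    using integrable_converges[OF a1 u] by (simp add: converges_def)
  then have "L1 (\<lambda>x. u x - ?I * h x) \<le> 0" by (rule LIMSEQ_le_const) (use le in auto)
  then have "(\<integral>x. cmod (u x - ?I * h x) \<partial>\<nu>) = 0" by (intro antisym) (simp_all add: L1_def)
  moreover have "integrable \<nu> (\<lambda>x. cmod (u x - ?I * h x))" using u V_integrable[OF h(1)] by auto
  ultimately have "AE x in \<nu>. cmod (u x - ?I * h x) = 0" by (subst (asm) integral_nonneg_eq_0_iff_AE) auto
  then show ?thesis by eventually_elim simp
qed

end

lemma integrable_mult_V:
  assumes \<Psi>: "integrable \<nu> \<Psi>" and g: "g \<in> V"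
  shows "integrable \<nu> (\<lambda>x. \<Psi> x * g x)" "cmod (\<integral>x. \<Psi> x * g x \<partial>\<nu>) \<le> Nm g * (\<integral>x. cmod (\<Psi> x) \<partial>\<nu>)"
proof -
  note [measurable] = V_meas[OF g]
  have [measurable]: "\<Psi> \<in> borel_measurable borel" using \<Psi> by (simp add: meas_iff[symmetric])
  have le: "AE x in \<nu>. cmod (\<Psi> x * g x) \<le> Nm g * cmod (\<Psi> x)"
    using AE_le_Nm[OF g] by eventually_elim (simp add: norm_mult mult.commute mult_left_mono)
  show int: "integrable \<nu> (\<lambda>x. \<Psi> x * g x)"
  proof (rule Bochner_Integration.integrable_bound[of \<nu> "\<lambda>x. Nm g * cmod (\<Psi> x)"])
    show "AE x in \<nu>. cmod (\<Psi> x * g x) \<le> norm (Nm g * cmod (\<Psi> x))" using le Nm_nonneg[of g] by simp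
  qed (use \<Psi> in \<open>auto simp: meas_iff\<close>)
  have "cmod (\<integral>x. \<Psi> x * g x \<partial>\<nu>) \<le> (\<integral>x. cmod (\<Psi> x * g x) \<partial>\<nu>)" by (rule integral_norm_bound)
  also have "\<dots> \<le> (\<integral>x. Nm g * cmod (\<Psi> x) \<partial>\<nu>)" using int \<Psi> le by (intro integral_mono_AE) auto
  finally show "cmod (\<integral>x. \<Psi> x * g x \<partial>\<nu>) \<le> Nm g * (\<integral>x. cmod (\<Psi> x) \<partial>\<nu>)" by simp
qed

text \<open>Invariance of \<mu> says that its density \<open>k\<close> is fixed by \<open>U\<close>,
  so uniqueness identifies it with the density found in the space. Duality then moves the iterates
  from \<Psi> to the product of \<Phi> and \<open>k\<close>, and the correlation becomes the
  integral of \<Psi> against the deviation of the \<open>n\<close>-th image of this product from its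
  limit.\<close>

theorem decay_of_correlations:
  assumes a1: "\<alpha> \<le> 1" and prob: "prob_space \<mu>" and sets_mu: "sets \<mu> = sets borel"
    and inv: "distr \<mu> borel f = \<mu>" and ac: "absolutely_continuous \<nu> \<mu>"
  shows "(\<lambda>x. complex_of_real (enn2real (RN_deriv \<nu> \<mu> x))) \<in> V"
    and "\<exists>C>0. \<exists>\<xi>. 0 < \<xi> \<and> \<xi> < 1 \<and> (\<forall>n\<ge>1. \<forall>\<Phi>\<in>V. \<forall>\<Psi>. integrable \<nu> \<Psi> \<longrightarrow>
      cmod ((\<integral>x. \<Phi> x * \<Psi> ((f ^^ n) x) \<partial>\<mu>) - (\<integral>x. \<Phi> x \<partial>\<mu>) * (\<integral>x. \<Psi> x \<partial>\<mu>))
        \<le> C * \<xi> ^ n * Nm \<Phi> * (\<integral>x. cmod (\<Psi> x) \<partial>\<nu>))"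
proof -
  interpret mu: prob_space \<mu> by (rule prob)
  define r where "r x = enn2real (RN_deriv \<nu> \<mu> x)" for x
  define k where "k x = complex_of_real (r x)" for x
  have sets: "sets \<mu> = sets \<nu>" using sets_mu nu_sets by simp
  note [measurable_cong] = sets_mu
  have [measurable]: "r \<in> borel_measurable borel" unfolding r_def meas_iff[symmetric] by measurable
  have [measurable]: "k \<in> borel_measurable borel" unfolding k_def by measurable
  have r0: "r x \<ge> 0" for x by (simp add: r_def)
  have rn: "AE x in \<nu>. RN_deriv \<nu> \<mu> x = ennreal (r x)"
    using RN_deriv_finite[OF mu.sigma_finite_measure_axioms ac sets] by eventually_elim (simp add: r_def less_top)
  have mu_eq: "\<mu> = density \<nu> (\<lambda>x. ennreal (r x))"
    using density_RN_deriv[OF ac sets] density_cong[OF _ _ rn] by (simp add: meas_iff)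
  have int_mu: "(\<integral>x. g x \<partial>\<mu>) = (\<integral>x. k x * g x \<partial>\<nu>)" "integrable \<mu> g \<longleftrightarrow> integrable \<nu> (\<lambda>x. k x * g x)"
    if "g \<in> borel_measurable borel" for g :: "'a \<Rightarrow> complex"
    unfolding mu_eq k_def using that r0
    by (simp_all add: integral_density integrable_density meas_iff scaleR_conv_of_real)
  have f_mu: "integrable \<mu> (\<lambda>x. g (f x))" "(\<integral>x. g (f x) \<partial>\<mu>) = (\<integral>x. g x \<partial>\<mu>)"
    if "integrable \<mu> g" for g :: "'a \<Rightarrow> complex"
  proof -
    have f: "f \<in> measurable \<mu> borel" by measurable
    have g: "g \<in> borel_measurable borel"
      using borel_measurable_integrable[OF that] by (simp add: measurable_cong_sets[OF sets_mu refl])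
    show "integrable \<mu> (\<lambda>x. g (f x))" using integrable_distr[OF f, of g] that inv by simp
    show "(\<integral>x. g (f x) \<partial>\<mu>) = (\<integral>x. g x \<partial>\<mu>)" using integral_distr[OF f g] inv by simp
  qed
  have k_int: "integrable \<nu> k" "(\<integral>x. k x \<partial>\<nu>) = 1"
    using int_mu[of "\<lambda>_. 1"] by (simp_all add: mu.prob_space)
  \<comment> \<open>Tested on indicators: \<open>U\<close> is dual to composition with
    \<open>f\<close>, which preserves \<mu>.\<close>
  have Uk: "AE x in \<nu>. U k x = k x"
  proof (rule density_unique_banach)
    show Uki: "integrable \<nu> (U k)" using Upow_integral(1)[OF k_int(1), of 1] by simp
    fix A assume "A \<in> sets \<nu>"
    then have [measurable]: "A \<in> sets borel" by (simp add: nu_sets)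
    let ?i = "\<lambda>x. complex_of_real (indicator A x)"
    have "integrable \<mu> ?i" by (rule mu.integrable_const_bound[of _ 1]) (auto simp: indicator_def)
    note fi = f_mu[OF this]
    have int: "integrable \<nu> (\<lambda>y. ?i ((f ^^ 1) y) * k y)"
      using fi(1) int_mu(2)[of "\<lambda>x. ?i (f x)"] by (simp add: mult.commute)
    have eq: "(U ^^ 1) (\<lambda>y. ?i ((f ^^ 1) y) * k y) x = ?i x * U k x" for x
      unfolding Upow_eq Tpow_comp[of 1 ?i k x] by (simp add: U_def)
    have "(\<integral>x. ?i x * U k x \<partial>\<nu>) = (\<integral>x. k x * ?i (f x) \<partial>\<nu>)"
      using Upow_integral(2)[OF int, of 1] unfolding eq by (simp add: mult.commute)
    also have "\<dots> = (\<integral>x. k x * ?i x \<partial>\<nu>)"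
      using fi(2) int_mu(1)[of "\<lambda>x. ?i (f x)"] int_mu(1)[of ?i] by simp
    finally show "set_lebesgue_integral \<nu> A (U k) = set_lebesgue_integral \<nu> A k"
      unfolding set_lebesgue_integral_def by (simp add: scaleR_conv_of_real mult.commute)
  qed (rule k_int(1))
  obtain h where h: "h \<in> V" "Nm (\<lambda>x. U h x - h x) = 0" "(\<integral>x. h x \<partial>\<nu>) = 1" using invariant_density by blast
  have kh: "AE x in \<nu>. k x = h x" using fixed_density_unique[OF h a1 k_int(1) Uk] k_int(2) by simp
  have kV: "k \<in> V" by (rule Nm_AE(1)[OF _ h(1) kh]) measurable
  then show "(\<lambda>x. complex_of_real (enn2real (RN_deriv \<nu> \<mu> x))) \<in> V" by (simp add: k_def[abs_def] r_def)
  have UkV: "U k \<in> V" using Upow_V[OF kV, of 1] by simp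
  have "Nm (\<lambda>x. U k x - k x) = 0" by (rule Nm_AE(2)[OF V_meas[OF UkV] kV Uk])
  from Upow_convergence[OF kV this k_int(2)] obtain C \<xi> where C: "C > 0" and \<xi>: "0 < \<xi>" "\<xi> < 1"
    and conv: "\<And>g n. g \<in> V \<Longrightarrow> Nm (\<lambda>x. (U ^^ n) g x - (\<integral>y. g y \<partial>\<nu>) * k x) \<le> C * \<xi> ^ n * Nm g" by blast
  \<comment> \<open>\<open>2 * Nm k\<close> bounds the multiplication by \<open>k\<close>; the
    summand 1 keeps the constant positive.\<close>
  define C' where "C' = C * (2 * Nm k + 1)"
  have "cmod ((\<integral>x. \<Phi> x * \<Psi> ((f ^^ n) x) \<partial>\<mu>) - (\<integral>x. \<Phi> x \<partial>\<mu>) * (\<integral>x. \<Psi> x \<partial>\<mu>))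
      \<le> C' * \<xi> ^ n * Nm \<Phi> * (\<integral>x. cmod (\<Psi> x) \<partial>\<nu>)"
    if \<Phi>: "\<Phi> \<in> V" and \<Psi>: "integrable \<nu> \<Psi>" for \<Phi> \<Psi> n
  proof -
    note [measurable] = V_meas[OF \<Phi>]
    have [measurable]: "\<Psi> \<in> borel_measurable borel" using \<Psi> by (simp add: meas_iff[symmetric])
    define g where "g = (\<lambda>x. \<Phi> x * k x)"
    have gV: "g \<in> V" and Ng: "Nm g \<le> 2 * Nm k * Nm \<Phi>" unfolding g_def using mult_V[OF \<Phi> kV] by auto
    have "integrable \<mu> \<Psi>" using int_mu(2)[of \<Psi>] integrable_mult_V(1)[OF \<Psi> kV] by (simp add: mult.commute)
    then have fn: "integrable \<mu> (\<lambda>x. \<Psi> ((f ^^ n) x))"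
      by (induction n) (use f_mu(1) in \<open>auto simp: funpow_swap1\<close>)
    have \<Phi>_le: "AE x in \<mu>. cmod (\<Phi> x) \<le> Nm \<Phi>" by (rule absolutely_continuous_AE[OF sets ac AE_le_Nm[OF \<Phi>]])
    have "integrable \<mu> (\<lambda>x. \<Phi> x * \<Psi> ((f ^^ n) x))"
    proof (rule Bochner_Integration.integrable_bound[of \<mu> "\<lambda>x. Nm \<Phi> * cmod (\<Psi> ((f ^^ n) x))"])
      show "AE x in \<mu>. cmod (\<Phi> x * \<Psi> ((f ^^ n) x)) \<le> norm (Nm \<Phi> * cmod (\<Psi> ((f ^^ n) x)))"
        using \<Phi>_le by eventually_elim (simp add: norm_mult Nm_nonneg mult_right_mono)
      show "integrable \<mu> (\<lambda>x. Nm \<Phi> * cmod (\<Psi> ((f ^^ n) x)))" using fn by simp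
      show "(\<lambda>x. \<Phi> x * \<Psi> ((f ^^ n) x)) \<in> borel_measurable \<mu>" by measurable
    qed
    then have int: "integrable \<nu> (\<lambda>x. \<Psi> ((f ^^ n) x) * g x)"
      using int_mu(2)[of "\<lambda>x. \<Phi> x * \<Psi> ((f ^^ n) x)"] by (simp add: g_def mult_ac)
    have eq: "(U ^^ n) (\<lambda>x. \<Psi> ((f ^^ n) x) * g x) x = \<Psi> x * (U ^^ n) g x" for x
      unfolding Upow_eq Tpow_comp by simp
    have 1: "(\<integral>x. \<Phi> x * \<Psi> ((f ^^ n) x) \<partial>\<mu>) = (\<integral>x. \<Psi> x * (U ^^ n) g x \<partial>\<nu>)"
      using Upow_integral(2)[OF int, of n] int_mu(1)[of "\<lambda>x. \<Phi> x * \<Psi> ((f ^^ n) x)"] unfolding eq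
      by (simp add: g_def mult_ac)
    have 2: "(\<integral>x. \<Phi> x \<partial>\<mu>) = (\<integral>x. g x \<partial>\<nu>)" using int_mu(1)[of \<Phi>] by (simp add: g_def mult.commute)
    have 3: "(\<integral>x. \<Psi> x \<partial>\<mu>) = (\<integral>x. \<Psi> x * k x \<partial>\<nu>)" using int_mu(1)[of \<Psi>] by (simp add: mult.commute)
    let ?z = "\<lambda>x. (U ^^ n) g x - (\<integral>y. g y \<partial>\<nu>) * k x"
    have zV: "?z \<in> V" by (intro V_diff Upow_V V_scale gV kV)
    have "(\<integral>x. \<Phi> x * \<Psi> ((f ^^ n) x) \<partial>\<mu>) - (\<integral>x. \<Phi> x \<partial>\<mu>) * (\<integral>x. \<Psi> x \<partial>\<mu>)
      = (\<integral>x. \<Psi> x * (U ^^ n) g x \<partial>\<nu>) - (\<integral>x. (\<integral>y. g y \<partial>\<nu>) * (\<Psi> x * k x) \<partial>\<nu>)"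
      unfolding 1 2 3 by simp
    also have "\<dots> = (\<integral>x. \<Psi> x * (U ^^ n) g x - (\<integral>y. g y \<partial>\<nu>) * (\<Psi> x * k x) \<partial>\<nu>)"
      using integrable_mult_V(1)[OF \<Psi> Upow_V[OF gV], of n] integrable_mult_V(1)[OF \<Psi> kV] by simp
    also have "\<dots> = (\<integral>x. \<Psi> x * ?z x \<partial>\<nu>)" by (simp add: algebra_simps)
    finally have "cmod ((\<integral>x. \<Phi> x * \<Psi> ((f ^^ n) x) \<partial>\<mu>) - (\<integral>x. \<Phi> x \<partial>\<mu>) * (\<integral>x. \<Psi> x \<partial>\<mu>))
      \<le> Nm ?z * (\<integral>x. cmod (\<Psi> x) \<partial>\<nu>)" using integrable_mult_V(2)[OF \<Psi> zV] by simp
    also have "\<dots> \<le> (C' * \<xi> ^ n * Nm \<Phi>) * (\<integral>x. cmod (\<Psi> x) \<partial>\<nu>)"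
    proof (rule mult_right_mono)
      have "Nm g \<le> (2 * Nm k + 1) * Nm \<Phi>" using Ng Nm_nonneg[of \<Phi>] by (simp add: algebra_simps)
      then have "C * \<xi> ^ n * Nm g \<le> C * \<xi> ^ n * ((2 * Nm k + 1) * Nm \<Phi>)" using C \<xi> by (intro mult_left_mono) auto
      then show "Nm ?z \<le> C' * \<xi> ^ n * Nm \<Phi>" using conv[OF gV, of n] by (simp add: C'_def mult_ac)
    qed simp
    finally show ?thesis .
  qed
  moreover have "C' > 0" unfolding C'_def using C Nm_nonneg[of k] by (simp add: add_nonneg_pos)
  ultimately show "\<exists>C>0. \<exists>\<xi>. 0 < \<xi> \<and> \<xi> < 1 \<and> (\<forall>n\<ge>1. \<forall>\<Phi>\<in>V. \<forall>\<Psi>. integrable \<nu> \<Psi> \<longrightarrow>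
      cmod ((\<integral>x. \<Phi> x * \<Psi> ((f ^^ n) x) \<partial>\<mu>) - (\<integral>x. \<Phi> x \<partial>\<mu>) * (\<integral>x. \<Psi> x \<partial>\<mu>))
        \<le> C * \<xi> ^ n * Nm \<Phi> * (\<integral>x. cmod (\<Psi> x) \<partial>\<nu>))"
    using \<xi> by blast
qed

end

section \<open>Derivation from the standing assumptions\<close>

lemma holder_continuous_imp_continuous:
  fixes \<phi> :: "'a::metric_space \<Rightarrow> real"
  assumes "holder_continuous \<alpha> \<phi>" "\<alpha> > 0"
  shows "continuous_on UNIV \<phi>"
proof (rule continuous_at_imp_continuous_on, rule ballI)
  fix x :: 'a
  obtain K where K: "\<And>x y. \<bar>\<phi> x - \<phi> y\<bar> \<le> K * dist x y powr \<alpha>" using assms(1) unfolding holder_continuous_def by blast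
  have "((\<lambda>y. dist y x) \<longlongrightarrow> dist x x) (at x)" by (intro tendsto_intros)
  then have "((\<lambda>y. dist y x powr \<alpha>) \<longlongrightarrow> dist x x powr \<alpha>) (at x)"
    by (rule tendsto_powr') (use assms(2) in auto)
  then have lim: "((\<lambda>y. K * dist y x powr \<alpha>) \<longlongrightarrow> 0) (at x)" using tendsto_mult_left[of _ _ _ K] by fastforce
  have "((\<lambda>y. \<phi> y - \<phi> x) \<longlongrightarrow> 0) (at x)"
    by (rule Lim_null_comparison[OF _ lim]) (use K in auto)
  then show "isCont \<phi> x" unfolding isCont_def by (rule LIM_zero_cancel)
qed

lemma exp_log_nat_le:
  assumes "log_nat q + ereal a + ereal b < ereal (ln (real d))" "a + b > 0"
  shows "real q * exp a * exp b \<le> real d"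
proof (cases "q = 0")
  case False
  then have lt: "ln (real q) + a + b < ln (real d)" using assms(1) by (simp add: log_nat_def)
  \<comment> \<open>\<open>ln 0\<close> has the value 0, so \<open>d = 0\<close> is excluded by the
    sign of the left-hand side.\<close>
  have "ln (real q) \<ge> 0" using False by simp
  then have d: "d > 0" using lt assms(2) by (cases "d = 0") auto
  have "real q * exp a * exp b = exp (ln (real q) + a + b)" using False by (simp add: exp_add)
  also have "\<dots> \<le> exp (ln (real d))" using lt by simp
  finally show ?thesis using d by simp
qed simp

theorem theorem1:
  fixes A :: "('a::{metric_space, second_countable_topology}, 'e::euclidean_space) chart set"
    and R :: "('a, 'e) metric_tensor"
    and f :: "'a \<Rightarrow> 'a" and \<phi> :: "'a \<Rightarrow> real" and \<alpha> :: real
    and d p q :: nat and Q :: "nat \<Rightarrow> 'a set" and P :: "'a set set" and W :: "'a set"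
    and \<sigma> L \<epsilon>0 \<gamma> c \<tau> osc lam :: real
    and \<nu> \<mu> :: "'a measure"
  assumes compact_M: "compact (UNIV :: 'a set)"
    and riemannian: "riemannian_manifold A R"
    and local_diffeo: "C1_local_diffeo A f"
    and degree: "\<forall>x. finite (f -` {x}) \<and> card (f -` {x}) = d"
    and alpha: "0 < \<alpha>" "\<alpha> \<le> 1"
    and holder: "holder_continuous \<alpha> \<phi>"
    and osc: "osc = (SUP x. \<phi> x) - (INF x. \<phi> x)"
    and A1: "markov_family A R f p q Q"
    and P: "P = Q ` {1..q+p}"
    and W: "W = (\<Union>i\<in>{1..q}. Q i)"
    and sigma_L: "\<sigma> > 1" "L > 1"
    and A2_expanding: "\<forall>x\<in>(\<Union>i\<in>{q+1..q+p}. Q i). inv_deriv_norm A R f x \<le> 1 / \<sigma>"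
    and A2_contracting: "\<forall>x\<in>W. inv_deriv_norm A R f x \<le> L"
    and A3: "ereal osc < ereal (ln (real d)) - log_nat q"
    and A4: "osc < 1/2 * (c * \<tau> - ln L) * \<alpha>"
    and eps: "\<epsilon>0 > 0" "ereal osc < ereal (ln (real d)) - log_nat q - ereal \<epsilon>0"
    and gamma: "0 < \<gamma>" "\<gamma> < 1"
    and gamma_count: "\<forall>\<^sub>F n in sequentially.
      real (card (frequent_cylinders f P W \<gamma> n)) \<le> (real q * exp \<epsilon>0) ^ n"
    and gamma_measure: "\<exists>K \<rho>. 0 < \<rho> \<and> \<rho> < 1 \<and>
      (\<forall>n\<ge>1. measure \<nu> (\<Union>(frequent_cylinders f P W \<gamma> n)) \<le> K * \<rho> ^ n)"
    and c: "c > 0" "\<sigma> powr (- (1 - \<gamma>)) < exp (- 2 * c)"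
      "log_nat q + ereal (c * \<alpha>) + ereal \<epsilon>0 < ereal (ln (real d))"
    and L_small: "(ln L)^2 \<le> 2 * c^2" "\<sigma> powr (- (1 - \<gamma>)) * L powr \<gamma> < exp (- 2 * c)"
      "ereal osc < ereal (ln (real d)) - log_nat q - ereal (real DIM('e) * ln L)"
    and tau: "0 < \<tau>" "\<tau> < 1"
    and tau_hyperbolic: "\<forall>n\<ge>1. \<forall>x. x \<notin> \<Union>(frequent_cylinders f P W \<gamma> n) \<longrightarrow>
      (\<exists>ns. real (length ns) > \<tau> * real n \<and> sorted_wrt (<) ns \<and> set ns \<subseteq> {1..n} \<and>
        (\<forall>k\<in>set ns. \<exists>C\<in>hyperbolic_cylinders A R f P c k. x \<in> closure C))"
    and lam: "lam = op_spectral_radius continuous_functions sup_norm (transfer_op f \<phi>)"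
    and nu: "conformal_measure f \<phi> lam \<nu>"
    and nu_expanding: "expanding_measure A R f P c \<nu>"
    and mu: "equilibrium_state f \<phi> \<mu>"
    and mu_unique: "\<forall>\<eta>. equilibrium_state f \<phi> \<eta> \<longrightarrow> \<eta> = \<mu>"
    and mu_nu: "absolutely_continuous \<nu> \<mu>"
  shows "\<exists>\<theta>>0.
     quasi_compact (V_theta f \<phi> P \<nu> \<theta>) (norm_theta f \<phi> P \<nu> \<theta>) (transfer_op f \<phi>) \<and>
     has_spectral_gap (V_theta f \<phi> P \<nu> \<theta>) (norm_theta f \<phi> P \<nu> \<theta>) (transfer_op f \<phi>) \<and>
     (\<exists>C>0. \<exists>\<xi>. 0 < \<xi> \<and> \<xi> < 1 \<and>
        (\<forall>n\<ge>1. \<forall>\<Phi>\<in>V_theta f \<phi> P \<nu> \<theta>. \<forall>\<Psi>. integrable \<nu> \<Psi> \<longrightarrow>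
           cmod ((\<integral>x. \<Phi> x * \<Psi> ((f ^^ n) x) \<partial>\<mu>) - (\<integral>x. \<Phi> x \<partial>\<mu>) * (\<integral>x. \<Psi> x \<partial>\<mu>))
             \<le> C * \<xi> ^ n * norm_theta f \<phi> P \<nu> \<theta> \<Phi> * (\<integral>x. cmod (\<Psi> x) \<partial>\<nu>))) \<and>
     (\<lambda>x. complex_of_real (enn2real (RN_deriv \<nu> \<mu> x))) \<in> V_theta f \<phi> P \<nu> \<theta>"
proof -
  obtain D N where N: "N \<ge> 1" "\<And>i. i \<in> {1..q+p} \<Longrightarrow> (f ^^ N) ` Q i = UNIV"
    and D: "\<And>i x y. i \<in> {1..q+p} \<Longrightarrow> x \<in> closure (Q i) \<Longrightarrow> y \<in> closure (Q i) \<Longrightarrow> \<exists>\<gamma>.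
        pw_C1_curve A \<gamma> \<and> path_image \<gamma> \<subseteq> closure (Q i) \<and> pathstart \<gamma> = x \<and> pathfinish \<gamma> = y \<and>
        curve_length A R \<gamma> < ennreal D"
    using A1 unfolding markov_family_def by metis
  have Q: "\<And>i. i \<in> {1..q+p} \<Longrightarrow> open (Q i)" "disjoint_family_on Q {1..q+p}"
    "(\<Union>i\<in>{1..q+p}. closure (Q i)) = UNIV"
    "\<And>i. i \<in> {1..q+p} \<Longrightarrow> \<exists>g. homeomorphism (closure (Q i)) (f ` closure (Q i)) f g"
    "\<And>i j. i \<in> {1..q+p} \<Longrightarrow> j \<in> {1..q+p} \<Longrightarrow> f ` Q i \<inter> Q j \<noteq> {} \<Longrightarrow> Q j \<subseteq> f ` Q i"
    using A1 unfolding markov_family_def by blast+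
  interpret RD: riemannian_local_diffeo A R f
    by unfold_locales (rule riemannian local_diffeo)+
  interpret RM: riemannian_markov_map A R f P N D
  proof unfold_locales
    show "compact (UNIV :: 'a set)" by (rule compact_M)
    show "continuous_on UNIV f" by (rule RD.f_continuous)
    show "E \<inter> F = {}" if "E \<in> P" "F \<in> P" "E \<noteq> F" for E F
      using that disjoint_family_onD[OF Q(2)] unfolding P by blast
    show "\<exists>\<gamma>. pw_C1_curve A \<gamma> \<and> path_image \<gamma> \<subseteq> closure E \<and> pathstart \<gamma> = x \<and> pathfinish \<gamma> = y \<and>
        curve_length A R \<gamma> < ennreal D" if "E \<in> P" "x \<in> closure E" "y \<in> closure E" for E x y
      using that D unfolding P by blast
    show "F \<subseteq> f ` E" if "E \<in> P" "F \<in> P" "f ` E \<inter> F \<noteq> {}" for E F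
      using that Q(5) unfolding P by blast
    show "\<exists>g. homeomorphism (closure E) (f ` closure E) f g" if "E \<in> P" for E
      using that Q(4) unfolding P by blast
    show "(\<Union>E\<in>P. closure E) = UNIV" using Q(3) unfolding P by simp
  qed (use N Q(1) in \<open>auto simp: P\<close>)
  interpret CM: conformal_map f P N \<phi> d \<nu> lam
    by unfold_locales (use degree nu holder_continuous_imp_continuous[OF holder alpha(1)] in auto)

  obtain M where M: "\<And>x. \<bar>\<phi> x\<bar> \<le> M" using CM.phi_bounded by blast
  have m: "- M \<le> \<phi> x" "\<phi> x \<le> M" for x using M[of x] by auto
  have bdd: "bdd_above (range \<phi>)" "bdd_below (range \<phi>)"
    using m by (meson bdd_aboveI2, meson bdd_belowI2)
  have sup: "\<phi> x \<le> (SUP x. \<phi> x)" and inf: "(INF x. \<phi> x) \<le> \<phi> x" for x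
    using bdd by (auto intro: cSUP_upper cINF_lower)
  have osc_bound: "\<bar>\<phi> x - \<phi> y\<bar> \<le> osc" for x y
    using sup[of x] sup[of y] inf[of x] inf[of y] unfolding osc by linarith
  then have osc0: "osc \<ge> 0" by (meson abs_ge_zero order_trans)
  \<comment> \<open>\<open>\<tau> < 1\<close> and \<open>L > 1\<close> turn the standing bound on
    \<open>osc\<close> into \<open>osc < c * \<alpha> / 2\<close>.\<close>
  have gap: "2 * osc < c * \<alpha>"
  proof -
    have "c * \<tau> \<le> c * 1" using c(1) tau(2) by (intro mult_left_mono) auto
    moreover have "ln L > 0" using sigma_L(2) by simp
    ultimately have "(c * \<tau> - ln L) * \<alpha> \<le> c * \<alpha>" using alpha(1) by (intro mult_right_mono) auto
    then show ?thesis using A4 by simp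
  qed
  \<comment> \<open>The relative growth rate of the bad weight: the number of bad cylinders loses
    \<open>exp (- c * \<alpha>)\<close> per step against the degree, and the passage from the
    infimum of \<phi>, which bounds \<open>lam\<close>, to the supremum, which bounds the weights,
    costs \<open>exp osc\<close>.\<close>
  define \<rho> where "\<rho> = exp (osc - c * \<alpha>)"
  define \<theta> where "\<theta> = exp (c * \<alpha> / 2) / lam"
  have lam_pos: "lam > 0" by (rule CM.lam_pos)
  have \<theta>_lam: "\<theta> * lam = exp (c * \<alpha> / 2)" using lam_pos by (simp add: \<theta>_def)
  \<comment> \<open>The bound on the number of bad cylinders times the largest possible weight, per
    step.\<close>
  define \<kappa> where "\<kappa> = real q * exp \<epsilon>0 * exp (SUP x. \<phi> x)"
  have \<kappa>_le: "\<kappa> \<le> lam * \<rho>"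
  proof -
    have "real q * exp (c * \<alpha>) * exp \<epsilon>0 \<le> real d"
      using exp_log_nat_le[OF c(3)] c(1) alpha(1) eps(1) by (simp add: add_pos_pos)
    then have "real q * exp (c * \<alpha>) * exp \<epsilon>0 * exp (INF x. \<phi> x) \<le> real d * exp (INF x. \<phi> x)"
      by (rule mult_right_mono) simp
    also have "\<dots> \<le> lam" using CM.lam_ge inf by blast
    finally have "real q * exp (c * \<alpha>) * exp \<epsilon>0 * exp (INF x. \<phi> x) * \<rho> \<le> lam * \<rho>"
      by (rule mult_right_mono) (simp add: \<rho>_def)
    moreover have eq: "exp (SUP x. \<phi> x) = exp (c * \<alpha>) * exp (INF x. \<phi> x) * \<rho>"
      unfolding \<rho>_def osc by (simp flip: exp_add)
    ultimately show ?thesis unfolding \<kappa>_def eq by (simp add: mult_ac)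
  qed
  let ?B = "frequent_cylinders f P W \<gamma>"
  have B_cyl: "?B n \<subseteq> cylinders f P n" for n unfolding frequent_cylinders_def by blast
  have B_sum: "\<exists>K. \<forall>n. (\<Sum>C\<in>?B n. exp (SUP x\<in>C. birkhoff_sum f \<phi> n x)) \<le> K * (lam * \<rho>) ^ n"
  proof -
    define s where "s n = (\<Sum>C\<in>?B n. exp (SUP x\<in>C. birkhoff_sum f \<phi> n x))" for n
    have s0: "s n \<ge> 0" for n unfolding s_def by (intro sum_nonneg) simp
    have lr: "lam * \<rho> > 0" using lam_pos by (simp add: \<rho>_def)
    obtain M where M: "\<And>n. n \<ge> M \<Longrightarrow> real (card (?B n)) \<le> (real q * exp \<epsilon>0) ^ n"
      using gamma_count by (auto simp: eventually_sequentially)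
    have big: "s n \<le> (lam * \<rho>) ^ n" if "n \<ge> M" for n
    proof -
      have "exp (SUP x\<in>C. birkhoff_sum f \<phi> n x) \<le> exp (SUP x. \<phi> x) ^ n" if "C \<in> ?B n" for C
      proof -
        have "C \<noteq> {}" using that B_cyl RM.cyl_ne by blast
        moreover have "birkhoff_sum f \<phi> n x \<le> real n * (SUP x. \<phi> x)" for x
          unfolding birkhoff_sum_def using sum_mono[of "{..<n}" "\<lambda>j. \<phi> ((f ^^ j) x)" "\<lambda>_. SUP x. \<phi> x"] sup by simp
        ultimately have "(SUP x\<in>C. birkhoff_sum f \<phi> n x) \<le> real n * (SUP x. \<phi> x)" by (intro cSUP_least) auto
        then show ?thesis by (simp flip: exp_of_nat_mult)
      qed
      then have "s n \<le> (\<Sum>C\<in>?B n. exp (SUP x. \<phi> x) ^ n)" unfolding s_def by (intro sum_mono)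
      also have "\<dots> \<le> (real q * exp \<epsilon>0) ^ n * exp (SUP x. \<phi> x) ^ n"
        using mult_right_mono[OF M[OF that], of "exp (SUP x. \<phi> x) ^ n"] by simp
      also have "\<dots> = \<kappa> ^ n" by (simp add: \<kappa>_def power_mult_distrib)
      also have "\<dots> \<le> (lam * \<rho>) ^ n" using \<kappa>_le by (intro power_mono) (simp_all add: \<kappa>_def)
      finally show ?thesis .
    qed
    \<comment> \<open>The finitely many orders for which the count is not yet valid are absorbed by
      adding their normalised weights to the constant.\<close>
    have "s n \<le> (1 + (\<Sum>k<M. s k / (lam * \<rho>) ^ k)) * (lam * \<rho>) ^ n" for n
    proof (cases "n < M")
      case True
      then have "s n / (lam * \<rho>) ^ n \<le> (\<Sum>k<M. s k / (lam * \<rho>) ^ k)"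
        using lr s0 by (intro member_le_sum[where f = "\<lambda>k. s k / (lam * \<rho>) ^ k"]) (auto intro!: divide_nonneg_nonneg)
      then have "s n / (lam * \<rho>) ^ n \<le> 1 + (\<Sum>k<M. s k / (lam * \<rho>) ^ k)" by simp
      then show ?thesis using lr by (simp add: pos_divide_le_eq)
    next
      case False
      have "1 \<le> 1 + (\<Sum>k<M. s k / (lam * \<rho>) ^ k)"
        using lr s0 by (simp add: sum_nonneg)
      then have "1 * (lam * \<rho>) ^ n \<le> (1 + (\<Sum>k<M. s k / (lam * \<rho>) ^ k)) * (lam * \<rho>) ^ n"
        using lr by (intro mult_right_mono) auto
      then show ?thesis using big[of n] False by simp
    qed
    then show ?thesis unfolding s_def by blast
  qed
  have B_hyp: "\<exists>k\<in>{1..n}. \<exists>E\<in>hyperbolic_cylinders A R f P c k. C \<subseteq> E"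
    if n: "n \<ge> 1" and C: "C \<in> cylinders f P n" and CB: "C \<notin> ?B n" for n C
  proof -
    obtain x where x: "x \<in> C" using RM.cyl_ne[OF C] by blast
    \<comment> \<open>Cylinders of one order are disjoint, so a point of \<open>C\<close> lies in no
      bad cylinder and has hyperbolic cylinders at its disposal.\<close>
    have "x \<notin> \<Union>(?B n)" using RM.cyl_disjoint[OF C _ x] B_cyl CB by blast
    then obtain ns where ns: "real (length ns) > \<tau> * real n" "set ns \<subseteq> {1..n}"
      "\<forall>k\<in>set ns. \<exists>E\<in>hyperbolic_cylinders A R f P c k. x \<in> closure E" using tau_hyperbolic n by blast
    have "ns \<noteq> []" using ns(1) tau(1) by (auto simp: mult_less_0_iff)
    then obtain k where k: "k \<in> set ns" by (meson list.set_sel(1))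
    then obtain E where E: "E \<in> hyperbolic_cylinders A R f P c k" "x \<in> closure E" using ns(3) by blast
    \<comment> \<open>\<open>C\<close> is open and meets the closure of \<open>E\<close>, hence
      \<open>E\<close> itself; cylinders that meet are nested, and the order of \<open>E\<close> is
      at most \<open>n\<close>.\<close>
    have "C \<inter> E \<noteq> {}" using open_Int_closure_eq_empty[OF RM.open_cyl[OF C], of E] x E(2) by blast
    then have "C \<subseteq> E" using RM.cyl_subset[OF C RM.hyp_cyl[OF E(1)]] k ns(2) by fastforce
    then show ?thesis using E(1) k ns(2) by blast
  qed
  interpret TS: theta_system f P N \<phi> d \<nu> lam "hyperbolic_cylinders A R f P c" ?B c \<alpha> osc \<rho> \<theta>
  proof unfold_locales
    show "AE x in \<nu>. infinite {(n, C). n \<ge> 1 \<and> C \<in> hyperbolic_cylinders A R f P c n \<and> x \<in> closure C}"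
      using nu_expanding unfolding expanding_measure_def .
    show "\<theta> > 0" using lam_pos by (simp add: \<theta>_def)
    show "exp osc < \<theta> * lam" unfolding \<theta>_lam using gap by simp
    show "\<theta> * lam * \<rho> < 1" unfolding \<theta>_lam \<rho>_def using gap by (simp add: mult_ac flip: exp_add)
    show "\<rho> > 0" "exp (- c * \<alpha>) \<le> \<rho>" using osc0 by (simp_all add: \<rho>_def)
    show "exp osc * \<rho> < 1" unfolding \<rho>_def using gap by (simp add: mult_ac flip: exp_add)
  qed (fact RM.hyp_cyl RM.hyp_0 RM.hyp_join RM.hyp_contraction c(1) alpha(1) holder B_cyl B_hyp B_sum osc_bound)+
  have inv: "prob_space \<mu>" "sets \<mu> = sets borel" "distr \<mu> borel f = \<mu>"
    using mu unfolding equilibrium_state_def invariant_prob_def by auto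
  note corr = TS.decay_of_correlations[OF alpha(2) inv mu_nu]
  show ?thesis
  proof (rule exI[of _ \<theta>], intro conjI)
    show "\<theta> > 0" by (rule TS.theta(1))
    show "quasi_compact (V_theta f \<phi> P \<nu> \<theta>) (norm_theta f \<phi> P \<nu> \<theta>) (transfer_op f \<phi>)"
      unfolding quasi_compact_def using TS.complete TS.bounded_operator_T TS.quasi_compact_T by blast
    show "has_spectral_gap (V_theta f \<phi> P \<nu> \<theta>) (norm_theta f \<phi> P \<nu> \<theta>) (transfer_op f \<phi>)"
      unfolding has_spectral_gap_def using TS.complete TS.bounded_operator_T TS.quasi_compact_T by blast
  qed (fact corr)+
qed

end
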